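(* Assume the Exponential Time Hypothesis. Then the minimum number of clauses and the minimum number of literals of pure Horn functions in $n$ variables cannot be approximated in time $\exp(n^{\delta})$, for some $\delta\in(0,1)$, to within factors of $O(\log^{\vartheta} n)$ for some $\vartheta>0$, even when the input is restricted to pure Horn 3-CNFs with $O(n^{1+\varepsilon})$ clauses, where $\varepsilon>0$ is some small constant.
   Context: Exponential Time Hypothesis (ETH): for $k\ge 3$ let $s_k$ be the infimum of all $\delta$ such that there is an $O(2^{\delta n})$-time algorithm deciding satisfiability of $k$-CNF formulas on $n$ variables (every clause has at most $k$ literals); ETH states $s_k>0$ for all $k\geq 3$. A clause is pure (definite) Horn if it contains exactly one positive literal; a pure Horn CNF is a conjunction of such clauses, a 3-CNF if every clause has at most three literals; a Boolean function is pure Horn if some pure Horn CNF represents it. The number of literals of a CNF is the total number of literal occurrences. The problems: given a pure Horn 3-CNF representing a pure Horn function $h$, determine the minimum number of clauses, resp. literals, of a pure Horn (3-)CNF representation of $h$. *)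

theory Defs
  imports Complex_Main "HOL-Library.Landau_Symbols"
begin

section \<open>Deterministic multi-tape Turing machines\<close>

datatype head_move = Move_Left | Stay | Move_Right

text \<open>
  States and tape symbols are initial segments of the naturals. State 0 is initial, state 1 is
  the halting state, symbol 0 is the blank, and the symbols 1 to 5 form the input alphabet.
  Tapes are infinite in both directions; the first one carries the input and the output.
\<close>

record tm =
  tapes :: nat
  symbols :: nat
  states :: nat
  trans :: "nat \<Rightarrow> nat list \<Rightarrow> nat \<times> (nat \<times> head_move) list"

definition turing_machine :: "tm \<Rightarrow> bool" where
  "turing_machine M \<longleftrightarrow>
     1 \<le> tapes M \<and> 5 < symbols M \<and> 1 < states M \<and>
     (\<forall>q < states M. \<forall>ss. length ss = tapes M \<and> set ss \<subseteq> {..<symbols M} \<longrightarrow>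
        (case trans M q ss of (q', as) \<Rightarrow>
           q' < states M \<and> length as = tapes M \<and> fst ` set as \<subseteq> {..<symbols M}))"

type_synonym tape = "(int \<Rightarrow> nat) \<times> int"
type_synonym config = "nat \<times> tape list"

fun read_head :: "tape \<Rightarrow> nat" where
  "read_head (t, p) = t p"

fun shift :: "head_move \<Rightarrow> int" where
  "shift Move_Left = -1"
| "shift Stay = 0"
| "shift Move_Right = 1"

fun act :: "nat \<times> head_move \<Rightarrow> tape \<Rightarrow> tape" where
  "act (s, d) (t, p) = (t(p := s), p + shift d)"

definition step :: "tm \<Rightarrow> config \<Rightarrow> config" where
  "step M = (\<lambda>(q, ts).
     if q = 1 then (q, ts)
     else case trans M q (map read_head ts) of (q', as) \<Rightarrow> (q', map2 act as ts))"

definition word_tape :: "nat list \<Rightarrow> tape" where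
  "word_tape w = (\<lambda>i. if 0 \<le> i \<and> nat i < length w then w ! nat i else 0, 0)"

definition init_config :: "tm \<Rightarrow> nat list \<Rightarrow> config" where
  "init_config M w = (0, word_tape w # replicate (tapes M - 1) (word_tape []))"

text \<open>The output is the word between cell 0 and the first blank to its right.\<close>

definition tape_output :: "tape \<Rightarrow> nat list \<Rightarrow> bool" where
  "tape_output tp w \<longleftrightarrow>
     0 \<notin> set w \<and> (\<forall>i < length w. fst tp (int i) = w ! i) \<and> fst tp (int (length w)) = 0"

definition outputs_within :: "tm \<Rightarrow> nat list \<Rightarrow> nat list \<Rightarrow> nat \<Rightarrow> bool" where
  "outputs_within M x y t \<longleftrightarrow>
     (case (step M ^^ t) (init_config M x) of (q, ts) \<Rightarrow> q = 1 \<and> tape_output (hd ts) y)"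


section \<open>CNF formulas\<close>

datatype lit = Pos (var: nat) | Neg (var: nat)

type_synonym clause = "lit set"
type_synonym cnf = "clause set"
type_synonym boolfun = "(nat \<Rightarrow> bool) \<Rightarrow> bool"

fun lit_true :: "(nat \<Rightarrow> bool) \<Rightarrow> lit \<Rightarrow> bool" where
  "lit_true a (Pos v) = a v"
| "lit_true a (Neg v) = (\<not> a v)"

definition cnf_fun :: "cnf \<Rightarrow> boolfun" where
  "cnf_fun \<Phi> = (\<lambda>a. \<forall>c\<in>\<Phi>. \<exists>l\<in>c. lit_true a l)"

definition satisfiable :: "cnf \<Rightarrow> bool" where
  "satisfiable \<Phi> \<longleftrightarrow> (\<exists>a. cnf_fun \<Phi> a)"

definition vars :: "cnf \<Rightarrow> nat set" where
  "vars \<Phi> = var ` (\<Union>\<Phi>)"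

definition is_cnf :: "cnf \<Rightarrow> bool" where
  "is_cnf \<Phi> \<longleftrightarrow> finite \<Phi> \<and> (\<forall>c\<in>\<Phi>. finite c)"

definition k_cnf :: "nat \<Rightarrow> cnf \<Rightarrow> bool" where
  "k_cnf k \<Phi> \<longleftrightarrow> is_cnf \<Phi> \<and> (\<forall>c\<in>\<Phi>. card c \<le> k)"

definition num_literals :: "cnf \<Rightarrow> nat" where
  "num_literals \<Phi> = (\<Sum>c\<in>\<Phi>. card c)"

text \<open>As usual, clauses containing a complementary pair of literals are not admitted.\<close>

definition pure_horn_clause :: "clause \<Rightarrow> bool" where
  "pure_horn_clause c \<longleftrightarrow> (\<exists>!v. Pos v \<in> c) \<and> (\<nexists>v. Pos v \<in> c \<and> Neg v \<in> c)"

definition pure_horn_cnf :: "cnf \<Rightarrow> bool" where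
  "pure_horn_cnf \<Phi> \<longleftrightarrow> is_cnf \<Phi> \<and> (\<forall>c\<in>\<Phi>. pure_horn_clause c)"

definition pure_horn_3cnf :: "cnf \<Rightarrow> bool" where
  "pure_horn_3cnf \<Phi> \<longleftrightarrow> pure_horn_cnf \<Phi> \<and> k_cnf 3 \<Phi>"

definition represents :: "nat \<Rightarrow> cnf \<Rightarrow> boolfun \<Rightarrow> bool" where
  "represents n \<Phi> h \<longleftrightarrow> vars \<Phi> \<subseteq> {..<n} \<and> cnf_fun \<Phi> = h"

text \<open>
  The first argument is the class of CNFs over which the minimum is taken; \<^term>\<open>h\<close> is regarded
  as a function of the variables below \<^term>\<open>n\<close>.
\<close>

definition min_clauses :: "(cnf \<Rightarrow> bool) \<Rightarrow> nat \<Rightarrow> boolfun \<Rightarrow> nat" where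
  "min_clauses P n h = (LEAST m. \<exists>\<Psi>. P \<Psi> \<and> represents n \<Psi> h \<and> card \<Psi> = m)"

definition min_literals :: "(cnf \<Rightarrow> bool) \<Rightarrow> nat \<Rightarrow> boolfun \<Rightarrow> nat" where
  "min_literals P n h = (LEAST m. \<exists>\<Psi>. P \<Psi> \<and> represents n \<Psi> h \<and> num_literals \<Psi> = m)"


section \<open>Encoding of inputs and outputs as words\<close>

text \<open>
  Least significant digit first; the symbols 1 and 2 stand for the binary digits 0 and 1.
\<close>

fun binary :: "nat \<Rightarrow> nat list" where
  "binary n = (if n = 0 then [] else (1 + n mod 2) # binary (n div 2))"

declare binary.simps [simp del]

fun encode_lit :: "lit \<Rightarrow> nat list" where
  "encode_lit (Pos v) = 3 # binary v"
| "encode_lit (Neg v) = 4 # binary v"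

definition encode_clause :: "lit list \<Rightarrow> nat list" where
  "encode_clause ls = concat (map encode_lit ls) @ [5]"

definition encode_cnf :: "lit list list \<Rightarrow> nat list" where
  "encode_cnf cs = concat (map encode_clause cs)"

definition lists_cnf :: "lit list list \<Rightarrow> cnf \<Rightarrow> bool" where
  "lists_cnf cs \<Phi> \<longleftrightarrow>
     (\<forall>ls\<in>set cs. distinct ls) \<and> distinct (map set cs) \<and> set (map set cs) = \<Phi>"

text \<open>
  A formula on \<open>n\<close> variables is given over exactly the variables \<open>0, \<dots>, n - 1\<close>, each of which
  occurs. This bounds the length of the encoding in terms of \<open>n\<close> and the number of clauses, and
  rules out lowering the density of a formula by means of unused variables.
\<close>

definition encodes :: "nat list \<Rightarrow> nat \<Rightarrow> cnf \<Rightarrow> bool" where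
  "encodes x n \<Phi> \<longleftrightarrow> vars \<Phi> = {..<n} \<and> (\<exists>cs. lists_cnf cs \<Phi> \<and> x = encode_cnf cs)"


section \<open>The Exponential Time Hypothesis\<close>

definition k_sat_in_time :: "nat \<Rightarrow> (nat \<Rightarrow> real) \<Rightarrow> bool" where
  "k_sat_in_time k g \<longleftrightarrow>
     (\<exists>M T. turing_machine M \<and> (\<lambda>n. real (T n)) \<in> O(g) \<and>
        (\<forall>n \<Phi> x. k_cnf k \<Phi> \<and> encodes x n \<Phi> \<longrightarrow>
           outputs_within M x (binary (of_bool (satisfiable \<Phi>))) (T n)))"

definition sat_exponent :: "nat \<Rightarrow> real" where
  "sat_exponent k = Inf {\<delta>. 0 \<le> \<delta> \<and> k_sat_in_time k (\<lambda>n. 2 powr (\<delta> * real n))}"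

definition ETH :: bool where
  "ETH \<longleftrightarrow> (\<forall>k\<ge>3. 0 < sat_exponent k)"


section \<open>Approximating minimum representations\<close>

definition horn_inputs :: "real \<Rightarrow> real \<Rightarrow> nat \<Rightarrow> cnf \<Rightarrow> bool" where
  "horn_inputs C \<epsilon> n \<Phi> \<longleftrightarrow>
     pure_horn_3cnf \<Phi> \<and> real (card \<Phi>) \<le> C * real n powr (1 + \<epsilon>)"

text \<open>
  Some machine, in time \<open>O(g(n))\<close>, outputs for every admissible CNF on \<open>n\<close> variables a number
  between the optimum of the function it represents and \<open>f(n)\<close> times this optimum.
\<close>

definition approximable ::
  "(nat \<Rightarrow> boolfun \<Rightarrow> nat) \<Rightarrow> (nat \<Rightarrow> cnf \<Rightarrow> bool) \<Rightarrow> (nat \<Rightarrow> real) \<Rightarrow> (nat \<Rightarrow> real) \<Rightarrow> bool" where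
  "approximable opt I f g \<longleftrightarrow>
     (\<exists>M T. turing_machine M \<and> (\<lambda>n. real (T n)) \<in> O(g) \<and>
        (\<forall>n \<Phi> x. I n \<Phi> \<and> encodes x n \<Phi> \<longrightarrow>
           (\<exists>v. opt n (cnf_fun \<Phi>) \<le> v \<and> real v \<le> f n * real (opt n (cnf_fun \<Phi>)) \<and>
                outputs_within M x (binary v) (T n))))"

end

theory Submission
  imports Defs "HOL-Computational_Algebra.Computational_Algebra" "HOL-Number_Theory.Cong"
begin

text \<open>
  3SAT is reduced to Horn minimisation with a polylogarithmic gap, and no PCP theorem is needed
  because a Horn formula can verify every point of a table instead of a random one.

  An assignment to the variables of an input of length at most \<open>s\<^sup>s\<close> is a function on \<open>{..<s}\<^sup>s\<close>; it
  extends to a function of degree below \<open>s\<close> in each of \<open>s\<close> coordinates over the field with \<open>q > s\<^sup>9\<close>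
  elements, whose table has \<open>B = q\<^sup>s\<close> entries ``value \<open>v\<close> at point \<open>a\<close>''. The entries are Horn
  variables. Horn rules propagate values along lines, from any point to any other, one coordinate
  at a time, check the clauses of the input on the values so obtained, and derive all entries once
  every point has passed. A satisfying assignment thus yields \<open>B\<close> entries that generate all others.
  Conversely, if at most \<open>10 s B\<close> entries do so, then most points carry short lists of values. Two
  distinct functions of degree below \<open>s\<close> on a line agree in fewer than \<open>s\<close> places, hence the value
  of a generic point determines the values reached from it, and these are a satisfying assignment.

  Further variables \<open>z\<^sub>1, \<dots>, z\<^sub>t\<close>, each implying all entries, make every representation pay for a
  generating set \<open>t\<close> times, where \<open>t\<close> exceeds the number of rules. The optimum is at most \<open>3 t B\<close> for
  satisfiable and more than \<open>10 s t B\<close> for unsatisfiable inputs. All sizes are polynomial in the input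
  and \<open>ln n = O(s\<^sup>2)\<close>, so the gap exceeds every multiple of \<open>ln\<^sup>1\<^sup>/\<^sup>4 n\<close>, and for small \<open>\<delta>\<close> an algorithm
  running in time \<open>exp (n\<^sup>\<delta>)\<close> would decide 3SAT in subexponential time.
\<close>

section \<open>Structured programs and their Turing machines\<close>

text \<open>A derivation may be helped by assuming any atom, not just table entries, for instance
  the last atom of the verification. Hence the verification has one copy of its inner atoms for each
  of the \<open>R * R\<close> table variables, and a copy concludes only its own variable: an
  assumed inner atom is worth no more than the entry it yields. With up to \<open>10 * s\<close>
  entries per point on average, a value need not be unique anywhere; what holds is that, for each
  target, the walk is ambiguous from fewer than half of the points. Lists longer than
  \<open>s ^ 3\<close> occur at few points, and \<open>s ^ 9 < q\<close> keeps the collisions of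
  shorter ones rare even when summed over \<open>s\<close> coordinates. Apart from a constant lower
  bound, \<open>s\<close> is least with \<open>s ^ s\<close> at least the input length, and
  \<open>q \<le> s ^ 18\<close>, so \<open>q ^ s\<close> is polynomial in that length. The reduction
  raises the number of variables to a large fixed power; this is harmless, since \<delta> may be
  half the reciprocal of that exponent, and the resulting time \<open>exp (sqrt (N + E))\<close> is
  subexponential.\<close>

type_synonym store = "nat \<Rightarrow> tape"
type_synonym instr = "(nat \<Rightarrow> nat) \<Rightarrow> nat \<times> (nat \<Rightarrow> nat \<times> head_move)"

datatype prog =
  Do "(nat \<Rightarrow> nat) \<Rightarrow> nat \<Rightarrow> nat \<times> head_move"
| Seq prog prog
| Cond "(nat \<Rightarrow> nat) \<Rightarrow> bool" prog prog
| While "(nat \<Rightarrow> nat) \<Rightarrow> bool" prog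

definition rd :: "store \<Rightarrow> nat \<Rightarrow> nat" where
  "rd \<sigma> i = read_head (\<sigma> i)"

definition app :: "(nat \<Rightarrow> nat \<times> head_move) \<Rightarrow> store \<Rightarrow> store" where
  "app d \<sigma> = (\<lambda>i. act (d i) (\<sigma> i))"

text \<open>The step count is exact and not an upper bound: a test and an elementary action cost one
  machine step each, so the count carries over unchanged to the compiled machine.\<close>

inductive exec :: "prog \<Rightarrow> store \<Rightarrow> nat \<Rightarrow> store \<Rightarrow> bool" where
  Do: "exec (Do d) \<sigma> 1 (app (d (rd \<sigma>)) \<sigma>)"
| Seq: "exec p \<sigma> t \<sigma>1 \<Longrightarrow> exec p' \<sigma>1 t' \<sigma>2 \<Longrightarrow> exec (Seq p p') \<sigma> (t + t') \<sigma>2"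
| CondT: "c (rd \<sigma>) \<Longrightarrow> exec p \<sigma> t \<sigma>' \<Longrightarrow> exec (Cond c p p') \<sigma> (Suc t) \<sigma>'"
| CondF: "\<not> c (rd \<sigma>) \<Longrightarrow> exec p' \<sigma> t \<sigma>' \<Longrightarrow> exec (Cond c p p') \<sigma> (Suc t) \<sigma>'"
| WhileF: "\<not> c (rd \<sigma>) \<Longrightarrow> exec (While c p) \<sigma> 1 \<sigma>"
| WhileT: "c (rd \<sigma>) \<Longrightarrow> exec p \<sigma> t \<sigma>1 \<Longrightarrow> exec (While c p) \<sigma>1 t' \<sigma>2 \<Longrightarrow>
    exec (While c p) \<sigma> (Suc (t + t')) \<sigma>2"

definition agree :: "nat \<Rightarrow> (nat \<Rightarrow> nat) \<Rightarrow> (nat \<Rightarrow> nat) \<Rightarrow> bool" where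
  "agree K r r' \<longleftrightarrow> (\<forall>i<K. r i = r' i)"

text \<open>Actions and tests are functions of the symbols on all tapes. Here they are confined to
  the first \<open>K\<close> tapes and to symbols below \<open>g\<close>, which is what a machine
  with finitely many tapes and symbols can carry out.\<close>

fun wf_prog :: "nat \<Rightarrow> nat \<Rightarrow> prog \<Rightarrow> bool" where
  "wf_prog K g (Do d) \<longleftrightarrow>
     (\<forall>r. (\<forall>i<K. r i < g) \<longrightarrow> (\<forall>i<K. fst (d r i) < g)) \<and>
     (\<forall>r r'. agree K r r' \<longrightarrow> (\<forall>i<K. d r i = d r' i))"
| "wf_prog K g (Seq p p') \<longleftrightarrow> wf_prog K g p \<and> wf_prog K g p'"
| "wf_prog K g (Cond c p p') \<longleftrightarrow>
     (\<forall>r r'. agree K r r' \<longrightarrow> c r = c r') \<and> wf_prog K g p \<and> wf_prog K g p'"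
| "wf_prog K g (While c p) \<longleftrightarrow> (\<forall>r r'. agree K r r' \<longrightarrow> c r = c r') \<and> wf_prog K g p"

fun fresh :: "prog \<Rightarrow> nat" where
  "fresh (Do d) = 0"
| "fresh (Seq p p') = Suc (fresh p + fresh p')"
| "fresh (Cond c p p') = Suc (Suc (fresh p + fresh p'))"
| "fresh (While c p) = Suc (fresh p)"

definition idle :: "(nat \<Rightarrow> nat) \<Rightarrow> nat \<Rightarrow> nat \<times> head_move" where
  "idle r i = (r i, Stay)"

text \<open>Code with entry state \<open>e\<close>, exit state \<open>x\<close> and internal states from \<open>f\<close> on.\<close>

fun code :: "prog \<Rightarrow> nat \<Rightarrow> nat \<Rightarrow> nat \<Rightarrow> (nat \<times> instr) list" where
  "code (Do d) e x f = [(e, \<lambda>r. (x, d r))]"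
| "code (Seq p p') e x f = code p e f (Suc f) @ code p' f x (Suc f + fresh p)"
| "code (Cond c p p') e x f = (e, \<lambda>r. (if c r then f else Suc f, idle r)) #
     code p f x (Suc (Suc f)) @ code p' (Suc f) x (Suc (Suc f) + fresh p)"
| "code (While c p) e x f = (e, \<lambda>r. (if c r then f else x, idle r)) # code p f e (Suc f)"

lemma code_keys: "fst ` set (code p e x f) \<subseteq> insert e {f..<f + fresh p}"
proof (induction p arbitrary: e x f)
  case (Seq p p')
  from Seq.IH(1)[of e f "Suc f"] Seq.IH(2)[of f x "Suc f + fresh p"] show ?case
    by (fastforce simp: image_Un)
next
  case (Cond c p p')
  from Cond.IH(1)[of f x "Suc (Suc f)"] Cond.IH(2)[of "Suc f" x "Suc (Suc f) + fresh p"]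
  show ?case by (fastforce simp: image_Un)
next
  case (While c p)
  from While.IH[of f e "Suc f"] show ?case by fastforce
qed auto

text \<open>Distinct keys let \<open>map_of\<close> find every instruction, also those of nested
  parts.\<close>

lemma code_distinct: "e < f \<Longrightarrow> distinct (map fst (code p e x f))"
proof (induction p arbitrary: e x f)
  case (Seq p p')
  have "fst ` set (code p e f (Suc f)) \<inter> fst ` set (code p' f x (Suc f + fresh p)) = {}"
    using code_keys[of p e f "Suc f"] code_keys[of p' f x "Suc f + fresh p"] Seq.prems
    by fastforce
  then show ?case using Seq by (simp add: Seq.IH)
next
  case (Cond c p p')
  have "fst ` set (code p f x (Suc (Suc f))) \<inter>
      fst ` set (code p' (Suc f) x (Suc (Suc f) + fresh p)) = {}"
    "e \<notin> fst ` set (code p f x (Suc (Suc f)))"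
    "e \<notin> fst ` set (code p' (Suc f) x (Suc (Suc f) + fresh p))"
    using code_keys[of p f x "Suc (Suc f)"] code_keys[of p' "Suc f" x "Suc (Suc f) + fresh p"]
      Cond.prems by fastforce+
  then show ?case using Cond by (simp add: Cond.IH)
next
  case (While c p)
  have "e \<notin> fst ` set (code p f e (Suc f))"
    using code_keys[of p f e "Suc f"] While.prems by fastforce
  then show ?case by (simp add: While.IH)
qed auto

definition wf_instr :: "nat \<Rightarrow> nat \<Rightarrow> nat \<Rightarrow> instr \<Rightarrow> bool" where
  "wf_instr K g S i \<longleftrightarrow> (\<forall>r. (\<forall>j<K. r j < g) \<longrightarrow> (\<forall>j<K. fst (snd (i r) j) < g)) \<and>
     (\<forall>r. fst (i r) < S) \<and>
     (\<forall>r r'. agree K r r' \<longrightarrow> fst (i r) = fst (i r') \<and> (\<forall>j<K. snd (i r) j = snd (i r') j))"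

lemma code_wf:
  assumes "wf_prog K g p" "e < S" "x < S" "f + fresh p \<le> S" "(k, i) \<in> set (code p e x f)"
  shows "wf_instr K g S i"
  using assms
proof (induction p arbitrary: e x f)
  case (Do d)
  then show ?case by (auto simp: wf_instr_def)
next
  case (Seq p p')
  then consider "(k, i) \<in> set (code p e f (Suc f))" | "(k, i) \<in> set (code p' f x (Suc f + fresh p))"
    by auto
  then show ?case
  proof cases
    case 1
    show ?thesis by (rule Seq.IH(1)[OF _ _ _ _ 1]) (use Seq.prems in auto)
  next
    case 2
    show ?thesis by (rule Seq.IH(2)[OF _ _ _ _ 2]) (use Seq.prems in auto)
  qed
next
  case (Cond c p p')
  then consider "i = (\<lambda>r. (if c r then f else Suc f, idle r))" |
      "(k, i) \<in> set (code p f x (Suc (Suc f)))" |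
      "(k, i) \<in> set (code p' (Suc f) x (Suc (Suc f) + fresh p))"
    by auto
  then show ?case
  proof cases
    case 1
    have "c r = c r'" if "agree K r r'" for r r' using that Cond.prems(1) by auto
    then show ?thesis using Cond.prems unfolding 1
      by (auto simp: wf_instr_def idle_def agree_def)
  next
    case 2
    show ?thesis by (rule Cond.IH(1)[OF _ _ _ _ 2]) (use Cond.prems in auto)
  next
    case 3
    show ?thesis by (rule Cond.IH(2)[OF _ _ _ _ 3]) (use Cond.prems in auto)
  qed
next
  case (While c p)
  then consider "i = (\<lambda>r. (if c r then f else x, idle r))" |
      "(k, i) \<in> set (code p f e (Suc f))"
    by auto
  then show ?case
  proof cases
    case 1
    have "c r = c r'" if "agree K r r'" for r r' using that While.prems(1) by auto
    then show ?thesis using While.prems unfolding 1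
      by (auto simp: wf_instr_def idle_def agree_def)
  next
    case 2
    show ?thesis by (rule While.IH[OF _ _ _ _ 2]) (use While.prems in auto)
  qed
qed

text \<open>States without an instruction lead to the halting state; this makes the machine total
  without any demand on the code.\<close>

definition mach :: "nat \<Rightarrow> nat \<Rightarrow> nat \<Rightarrow> (nat \<times> instr) list \<Rightarrow> tm" where
  "mach K g S C = \<lparr>tapes = K, symbols = g, states = S,
     trans = (\<lambda>q ss. case map_of C q of None \<Rightarrow> (1, map (\<lambda>s. (s, Stay)) ss)
       | Some i \<Rightarrow> let r = (\<lambda>j. if j < K then ss ! j else 0) in (fst (i r), map (snd (i r)) [0..<K]))\<rparr>"

lemma mach_turing:
  assumes "1 \<le> K" "5 < g" "1 < S" "\<And>k i. (k, i) \<in> set C \<Longrightarrow> wf_instr K g S i"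
  shows "turing_machine (mach K g S C)"
proof -
  have "case trans (mach K g S C) q ss of (q', as) \<Rightarrow>
      q' < S \<and> length as = K \<and> fst ` set as \<subseteq> {..<g}"
    if ss: "length ss = K" "set ss \<subseteq> {..<g}" for q ss
  proof (cases "map_of C q")
    case None
    then show ?thesis using ss assms by (auto simp: mach_def)
  next
    case (Some i)
    then have "wf_instr K g S i" using assms(4) map_of_SomeD by metis
    moreover have "\<forall>j<K. ss ! j < g" using ss by (metis lessThan_iff nth_mem subsetD)
    ultimately show ?thesis using Some by (auto simp: mach_def wf_instr_def Let_def)
  qed
  then show ?thesis using assms(1-3) by (auto simp: turing_machine_def mach_def)
qed

definition tps :: "nat \<Rightarrow> store \<Rightarrow> tape list" where
  "tps K \<sigma> = map \<sigma> [0..<K]"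

lemma mach_step:
  assumes "map_of C q = Some i" "q \<noteq> 1" "wf_instr K g S i"
  shows "step (mach K g S C) (q, tps K \<sigma>) =
    (fst (i (rd \<sigma>)), tps K (app (snd (i (rd \<sigma>))) \<sigma>))"
proof -
  let ?r = "\<lambda>j. if j < K then map read_head (tps K \<sigma>) ! j else 0"
  have "agree K ?r (rd \<sigma>)" by (auto simp: agree_def tps_def rd_def)
  then have "fst (i ?r) = fst (i (rd \<sigma>))" "\<And>j. j < K \<Longrightarrow> snd (i ?r) j = snd (i (rd \<sigma>)) j"
    using assms(3) unfolding wf_instr_def by blast+
  then show ?thesis using assms(1,2) unfolding tps_def
    by (auto simp: step_def mach_def Let_def app_def intro!: nth_equalityI)
qed

lemma app_idle [simp]: "app (idle (rd \<sigma>)) \<sigma> = \<sigma>"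
proof
  fix i
  show "app (idle (rd \<sigma>)) \<sigma> i = \<sigma> i"
    by (cases "\<sigma> i") (auto simp: app_def idle_def rd_def)
qed

lemma exec_mach:
  assumes "exec p \<sigma> t \<sigma>'" "\<forall>(k, i) \<in> set (code p e x f). map_of C k = Some i"
    "\<And>k i. map_of C k = Some i \<Longrightarrow> wf_instr K g S i \<and> k \<noteq> 1"
  shows "(step (mach K g S C) ^^ t) (e, tps K \<sigma>) = (x, tps K \<sigma>')"
  using assms(1,2)
proof (induction arbitrary: e x f rule: exec.induct)
  case (Do d \<sigma>)
  then have "map_of C e = Some (\<lambda>r. (x, d r))" by simp
  then show ?case using mach_step assms(3) by fastforce
next
  case (Seq p \<sigma> t \<sigma>1 p' t' \<sigma>2)
  have "(step (mach K g S C) ^^ t) (e, tps K \<sigma>) = (f, tps K \<sigma>1)"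
    by (rule Seq.IH(1)) (use Seq.prems in auto)
  moreover have "(step (mach K g S C) ^^ t') (f, tps K \<sigma>1) = (x, tps K \<sigma>2)"
    by (rule Seq.IH(2)) (use Seq.prems in auto)
  ultimately show ?case by (subst add.commute) (simp add: funpow_add)
next
  case (CondT c \<sigma> p t \<sigma>' p')
  then have "map_of C e = Some (\<lambda>r. (if c r then f else Suc f, idle r))" by simp
  then have "step (mach K g S C) (e, tps K \<sigma>) = (f, tps K \<sigma>)"
    using mach_step assms(3) CondT.hyps(1) by fastforce
  moreover have "(step (mach K g S C) ^^ t) (f, tps K \<sigma>) = (x, tps K \<sigma>')"
    by (rule CondT.IH) (use CondT.prems in auto)
  ultimately show ?case by (simp add: funpow_Suc_right del: funpow.simps)
next
  case (CondF c \<sigma> p' t \<sigma>' p)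
  then have "map_of C e = Some (\<lambda>r. (if c r then f else Suc f, idle r))" by simp
  then have "step (mach K g S C) (e, tps K \<sigma>) = (Suc f, tps K \<sigma>)"
    using mach_step assms(3) CondF.hyps(1) by fastforce
  moreover have "(step (mach K g S C) ^^ t) (Suc f, tps K \<sigma>) = (x, tps K \<sigma>')"
    by (rule CondF.IH) (use CondF.prems in auto)
  ultimately show ?case by (simp add: funpow_Suc_right del: funpow.simps)
next
  case (WhileF c \<sigma> p)
  then have "map_of C e = Some (\<lambda>r. (if c r then f else x, idle r))" by simp
  then show ?case using mach_step assms(3) WhileF.hyps(1) by fastforce
next
  case (WhileT c \<sigma> p t \<sigma>1 t' \<sigma>2)
  then have "map_of C e = Some (\<lambda>r. (if c r then f else x, idle r))" by simp
  then have "step (mach K g S C) (e, tps K \<sigma>) = (f, tps K \<sigma>)"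
    using mach_step assms(3) WhileT.hyps(1) by fastforce
  moreover have "(step (mach K g S C) ^^ t) (f, tps K \<sigma>) = (e, tps K \<sigma>1)"
    by (rule WhileT.IH(1)) (use WhileT.prems in auto)
  moreover have "(step (mach K g S C) ^^ t') (e, tps K \<sigma>1) = (x, tps K \<sigma>2)"
    by (rule WhileT.IH(2)) (use WhileT.prems in auto)
  ultimately have "(step (mach K g S C) ^^ (t' + (t + 1))) (e, tps K \<sigma>) = (x, tps K \<sigma>2)"
    by (simp only: funpow_add) simp
  then show ?case by (simp add: add_ac)
qed

definition init_store :: "nat list \<Rightarrow> store" where
  "init_store x i = (if i = 0 then word_tape x else word_tape [])"

lemma prog_machine:
  assumes "wf_prog K g p" "1 \<le> K" "5 < g"
  obtains M where "turing_machine M"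
    "\<And>x t \<sigma>. exec p (init_store x) t \<sigma> \<Longrightarrow> (step M ^^ t) (init_config M x) = (1, tps K \<sigma>)"
proof
  \<comment> \<open>Entry 0 and exit 1 are the initial and the halting state of the machine model,
    so fresh states start at 2.\<close>
  let ?S = "2 + fresh p" and ?C = "code p 0 1 2"
  let ?M = "mach K g ?S ?C"
  have wf: "wf_instr K g ?S i" if "(k, i) \<in> set ?C" for k i
    by (rule code_wf[OF assms(1) _ _ _ that]) auto
  show "turing_machine ?M" by (rule mach_turing) (use assms wf in auto)
  fix x t \<sigma>
  assume ex: "exec p (init_store x) t \<sigma>"
  have init: "init_config ?M x = (0, tps K (init_store x))"
    using assms(2) by (auto simp: init_config_def tps_def mach_def init_store_def nth_Cons'
      intro!: nth_equalityI)
  show "(step ?M ^^ t) (init_config ?M x) = (1, tps K \<sigma>)"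
    unfolding init
  proof (rule exec_mach[OF ex])
    show "\<forall>(k, i)\<in>set ?C. map_of ?C k = Some i"
      using code_distinct[of 0 2 p 1] by auto
    show "wf_instr K g ?S i \<and> k \<noteq> 1" if "map_of ?C k = Some i" for k i
    proof -
      have "(k, i) \<in> set ?C" using that by (rule map_of_SomeD)
      moreover from this have "k \<in> insert 0 {2..<2 + fresh p}"
        using code_keys[of p 0 1 2] by force
      ultimately show ?thesis using wf by auto
    qed
  qed
qed

section \<open>Counter programs\<close>

text \<open>The value is the head position. The mark in cell 0 reduces the test for zero to reading
  one symbol, and counting never changes the tape.\<close>

definition cnt :: "nat \<Rightarrow> tape" where
  "cnt v = (\<lambda>i. if i = 0 then 1 else 0, int v)"

text \<open>Tape 0 carries the input with its head at \<open>h\<close>, the tapes from 1 to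
  \<open>b - 1\<close> are reserved for the output and for a simulated machine, and register
  \<open>j\<close> is the counter on tape \<open>b + j\<close>. There are infinitely many registers;
  each program uses finitely many.\<close>

definition lay :: "nat \<Rightarrow> nat list \<Rightarrow> int \<Rightarrow> store \<Rightarrow> (nat \<Rightarrow> nat) \<Rightarrow> store" where
  "lay b x h \<tau> e i =
     (if i = 0 then (fst (word_tape x), h) else if i < b then \<tau> i else cnt (e (i - b)))"

definition on :: "nat \<Rightarrow> (nat \<Rightarrow> nat \<times> head_move) \<Rightarrow> (nat \<Rightarrow> nat) \<Rightarrow> nat \<Rightarrow> nat \<times> head_move" where
  "on j f r i = (if i = j then f (r i) else (r i, Stay))"

text \<open>Quantifying over all large numbers of tapes lets programs be composed without keeping
  count of their registers. An alphabet of size 6 holds the blank and the input symbols.\<close>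

definition okp :: "prog \<Rightarrow> bool" where
  "okp p \<longleftrightarrow> (\<exists>K0. \<forall>K\<ge>K0. \<forall>g\<ge>6. wf_prog K g p)"

lemma okp_Seq:
  assumes "okp p" "okp p'"
  shows "okp (Seq p p')"
proof -
  obtain K1 where 1: "\<forall>K\<ge>K1. \<forall>g\<ge>6. wf_prog K g p" using assms(1) by (auto simp: okp_def)
  obtain K2 where 2: "\<forall>K\<ge>K2. \<forall>g\<ge>6. wf_prog K g p'" using assms(2) by (auto simp: okp_def)
  show ?thesis unfolding okp_def by (rule exI[of _ "K1 + K2"]) (use 1 2 in auto)
qed

definition finc :: "((nat \<Rightarrow> nat) \<Rightarrow> bool) \<Rightarrow> bool" where
  "finc c \<longleftrightarrow> (\<exists>K0. \<forall>r r'. agree K0 r r' \<longrightarrow> c r = c r')"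

lemma agree_mono: "agree K r r' \<Longrightarrow> K0 \<le> K \<Longrightarrow> agree K0 r r'"
  by (auto simp: agree_def)

lemma okp_Cond:
  assumes "finc c" "okp p" "okp p'"
  shows "okp (Cond c p p')"
proof -
  obtain K0 where 0: "\<forall>r r'. agree K0 r r' \<longrightarrow> c r = c r'" using assms(1) by (auto simp: finc_def)
  obtain K1 where 1: "\<forall>K\<ge>K1. \<forall>g\<ge>6. wf_prog K g p" using assms(2) by (auto simp: okp_def)
  obtain K2 where 2: "\<forall>K\<ge>K2. \<forall>g\<ge>6. wf_prog K g p'" using assms(3) by (auto simp: okp_def)
  show ?thesis unfolding okp_def
    by (rule exI[of _ "K0 + K1 + K2"]) (use 0 1 2 agree_mono in auto)
qed

lemma okp_While:
  assumes "finc c" "okp p"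
  shows "okp (While c p)"
proof -
  obtain K0 where 0: "\<forall>r r'. agree K0 r r' \<longrightarrow> c r = c r'" using assms(1) by (auto simp: finc_def)
  obtain K1 where 1: "\<forall>K\<ge>K1. \<forall>g\<ge>6. wf_prog K g p" using assms(2) by (auto simp: okp_def)
  show ?thesis unfolding okp_def
    by (rule exI[of _ "K0 + K1"]) (use 0 1 agree_mono in auto)
qed

text \<open>Such an action treats each tape by its own symbol alone and writes no symbol above 5
  except the one just read; hence it suits every number of tapes and every alphabet of size at least
  6.\<close>

definition plain :: "((nat \<Rightarrow> nat) \<Rightarrow> nat \<Rightarrow> nat \<times> head_move) \<Rightarrow> bool" where
  "plain d \<longleftrightarrow> (\<forall>r i. fst (d r i) \<in> insert (r i) {..5}) \<and> (\<forall>r r' i. r i = r' i \<longrightarrow> d r i = d r' i)"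

lemma okp_Do:
  assumes "plain d"
  shows "okp (Do d)"
proof -
  have "fst (d r i) < g" if "r i < g" "6 \<le> g" for r i g
  proof -
    have "fst (d r i) = r i \<or> fst (d r i) \<le> 5" using assms unfolding plain_def by blast
    then show ?thesis using that by linarith
  qed
  moreover have "d r i = d r' i" if "r i = r' i" for r r' i
    using assms that unfolding plain_def by blast
  ultimately have "wf_prog K g (Do d)" if "6 \<le> g" for K g
    using that unfolding wf_prog.simps agree_def by blast
  then show ?thesis unfolding okp_def by blast
qed

definition nz :: "nat \<Rightarrow> nat \<Rightarrow> (nat \<Rightarrow> nat) \<Rightarrow> bool" where
  "nz b j r \<longleftrightarrow> r (b + j) \<noteq> 1"

lemma finc_nz: "finc (nz b j)"
  unfolding finc_def nz_def agree_def by (rule exI[of _ "Suc (b + j)"]) auto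

definition inc :: "nat \<Rightarrow> nat \<Rightarrow> prog" where
  "inc b j = Do (on (b + j) (\<lambda>s. (s, Move_Right)))"

definition dec :: "nat \<Rightarrow> nat \<Rightarrow> prog" where
  "dec b j = Do (on (b + j) (\<lambda>s. (s, Move_Left)))"

lemma okp_inc: "okp (inc b j)" and okp_dec: "okp (dec b j)"
  unfolding inc_def dec_def by (rule okp_Do, auto simp: plain_def on_def)+

lemmas okp_intros = okp_Seq okp_Cond okp_While finc_nz okp_inc okp_dec

lemma rd_lay:
  "1 \<le> b \<Longrightarrow> rd (lay b x h \<tau> e) (b + j) = (if e j = 0 then 1 else 0)"
  "rd (lay b x h \<tau> e) 0 = fst (word_tape x) h"
  "1 \<le> i \<Longrightarrow> i < b \<Longrightarrow> rd (lay b x h \<tau> e) i = rd \<tau> i"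
  by (auto simp: rd_def lay_def cnt_def)

lemma nz_lay [simp]: "1 \<le> b \<Longrightarrow> nz b j (rd (lay b x h \<tau> e)) \<longleftrightarrow> e j \<noteq> 0"
  by (simp add: nz_def rd_lay)

lemma act_same [simp]: "act (rd \<sigma> i, Stay) (\<sigma> i) = \<sigma> i"
  by (cases "\<sigma> i") (simp add: rd_def)

lemma act_move: "act (rd \<sigma> i, m) (\<sigma> i) = (fst (\<sigma> i), snd (\<sigma> i) + shift m)"
  by (cases "\<sigma> i") (simp add: rd_def)

lemma app_on: "app (on j f (rd \<sigma>)) \<sigma> = \<sigma>(j := act (f (rd \<sigma> j)) (\<sigma> j))"
  by (auto simp: app_def on_def)

lemma lay_upd: "1 \<le> b \<Longrightarrow> (lay b x h \<tau> e)(b + j := cnt v) = lay b x h \<tau> (e(j := v))"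
  by (auto simp: lay_def fun_eq_iff)

lemma exec_inc:
  assumes "1 \<le> b"
  shows "exec (inc b j) (lay b x h \<tau> e) 1 (lay b x h \<tau> (e(j := Suc (e j))))"
proof -
  have "app (on (b + j) (\<lambda>s. (s, Move_Right)) (rd (lay b x h \<tau> e))) (lay b x h \<tau> e) =
      lay b x h \<tau> (e(j := Suc (e j)))"
    using assms by (simp add: app_on act_move lay_upd[symmetric]) (simp add: lay_def cnt_def add.commute)
  then show ?thesis unfolding inc_def by (metis exec.Do)
qed

lemma exec_dec:
  assumes "1 \<le> b" "e j \<noteq> 0"
  shows "exec (dec b j) (lay b x h \<tau> e) 1 (lay b x h \<tau> (e(j := e j - 1)))"
proof -
  have "app (on (b + j) (\<lambda>s. (s, Move_Left)) (rd (lay b x h \<tau> e))) (lay b x h \<tau> e) =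
      lay b x h \<tau> (e(j := e j - 1))"
    using assms by (simp add: app_on act_move lay_upd[symmetric]) (simp add: lay_def cnt_def of_nat_diff)
  then show ?thesis unfolding dec_def by (metis exec.Do)
qed

section \<open>Polynomial bounds on time and register contents\<close>

definition pb :: "(nat \<Rightarrow> nat) \<Rightarrow> bool" where
  "pb P \<longleftrightarrow> (\<exists>c. \<forall>n. P n \<le> (n + c) ^ c)"

lemma pb_E:
  assumes "pb P"
  obtains c where "1 \<le> c" "\<And>n. P n \<le> (n + c) ^ c"
proof -
  obtain c where c: "\<And>n. P n \<le> (n + c) ^ c" using assms by (auto simp: pb_def)
  have "P n \<le> (n + Suc c) ^ Suc c" for n
  proof -
    have "P n \<le> (n + c) ^ c" by (rule c)
    also have "\<dots> \<le> (n + Suc c) ^ c" by (rule power_mono) auto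
    also have "\<dots> \<le> (n + Suc c) ^ Suc c" by (rule power_increasing) auto
    finally show ?thesis .
  qed
  then show ?thesis using that[of "Suc c"] by simp
qed

lemma pb_mono: "pb P \<Longrightarrow> (\<And>n. Q n \<le> P n) \<Longrightarrow> pb Q"
  unfolding pb_def by (meson order_trans)

lemma pb_const [simp, intro]: "pb (\<lambda>n. c)"
proof (unfold pb_def, rule exI[of _ "Suc c"], intro allI)
  fix n
  have "c \<le> n + Suc c" by simp
  also have "\<dots> \<le> (n + Suc c) ^ Suc c" by (rule self_le_power) auto
  finally show "c \<le> (n + Suc c) ^ Suc c" .
qed

lemma pb_id [simp, intro]: "pb (\<lambda>n. n)"
  unfolding pb_def by (rule exI[of _ 1]) auto

lemma pb_mult [intro]:
  assumes "pb P" "pb Q"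
  shows "pb (\<lambda>n. P n * Q n)"
proof -
  obtain c where c: "1 \<le> c" "\<And>n. P n \<le> (n + c) ^ c" using pb_E[OF assms(1)] by auto
  obtain d where d: "1 \<le> d" "\<And>n. Q n \<le> (n + d) ^ d" using pb_E[OF assms(2)] by auto
  have "P n * Q n \<le> (n + (c + d)) ^ (c + d)" for n
  proof -
    have "P n * Q n \<le> (n + c) ^ c * (n + d) ^ d" using c d by (intro mult_mono) auto
    also have "\<dots> \<le> (n + (c + d)) ^ c * (n + (c + d)) ^ d" by (intro mult_mono power_mono) auto
    finally show ?thesis by (simp add: power_add)
  qed
  then show ?thesis unfolding pb_def by blast
qed

lemma pb_add [intro]:
  assumes "pb P" "pb Q"
  shows "pb (\<lambda>n. P n + Q n)"
proof -
  obtain c where c: "1 \<le> c" "\<And>n. P n \<le> (n + c) ^ c" using pb_E[OF assms(1)] by auto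
  obtain d where d: "1 \<le> d" "\<And>n. Q n \<le> (n + d) ^ d" using pb_E[OF assms(2)] by auto
  have "P n + Q n \<le> (n + c) ^ c * (n + d) ^ d + (n + c) ^ c * (n + d) ^ d" for n
  proof (rule add_mono)
    have "P n \<le> (n + c) ^ c * 1" using c by simp
    also have "\<dots> \<le> (n + c) ^ c * (n + d) ^ d" using d by (intro mult_mono) auto
    finally show "P n \<le> \<dots>" .
    have "Q n \<le> 1 * (n + d) ^ d" using d by simp
    also have "\<dots> \<le> (n + c) ^ c * (n + d) ^ d" using c by (intro mult_mono) auto
    finally show "Q n \<le> \<dots>" .
  qed
  moreover have "pb (\<lambda>n. 2 * ((n + c) ^ c * (n + d) ^ d))"
    by (intro pb_mult pb_const) (auto simp: pb_def)
  ultimately show ?thesis by (rule_tac pb_mono) (auto simp: mult_2)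
qed

lemma pb_Suc [intro]: "pb P \<Longrightarrow> pb (\<lambda>n. Suc (P n))"
  using pb_add[of P "\<lambda>_. 1"] by simp

lemma pb_power [intro]: "pb P \<Longrightarrow> pb (\<lambda>n. P n ^ k)"
  by (induction k) (auto intro: pb_mult)

lemma pb_comp:
  assumes "pb P" "pb Q"
  shows "pb (\<lambda>n. P (Q n))"
proof -
  obtain c where c: "1 \<le> c" "\<And>n. P n \<le> (n + c) ^ c" using pb_E[OF assms(1)] by auto
  have "pb (\<lambda>n. (Q n + c) ^ c)" using assms by (intro pb_power pb_add pb_const)
  then show ?thesis by (rule pb_mono) (rule c)
qed

definition bd :: "nat \<Rightarrow> nat list \<Rightarrow> (nat \<Rightarrow> nat) \<Rightarrow> bool" where
  "bd N x e \<longleftrightarrow> length x \<le> N \<and> set x \<subseteq> {1..5} \<and> (\<forall>i. e i \<le> N)"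

lemma bd_le: "bd N x e \<Longrightarrow> e i \<le> N"
  by (simp add: bd_def)

lemma bd_arith: "bd N x e \<Longrightarrow> e i - j \<le> N" "bd N x e \<Longrightarrow> j \<le> e i \<Longrightarrow> j \<le> N"
    "bd N x e \<Longrightarrow> e i - j \<le> N + N" "bd N x e \<Longrightarrow> j \<le> e i \<Longrightarrow> e i' + j \<le> N + N"
    "bd N x e \<Longrightarrow> e i \<le> N + N"
  using bd_le[of N x e i] bd_le[of N x e i'] by linarith+

text \<open>Time and resulting registers are bounded together, since the bound on the registers is
  what the time bound of the next program is applied to. The head on the input starts and ends at
  cell 0. The function \<open>g\<close> is the effect on the reserved tapes.\<close>

definition runsg :: "nat \<Rightarrow> prog \<Rightarrow> (nat list \<Rightarrow> (nat \<Rightarrow> nat) \<Rightarrow> bool) \<Rightarrow>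
    (nat list \<Rightarrow> (nat \<Rightarrow> nat) \<Rightarrow> (nat \<Rightarrow> nat)) \<Rightarrow> (nat list \<Rightarrow> (nat \<Rightarrow> nat) \<Rightarrow> store \<Rightarrow> store) \<Rightarrow> bool"
  where
  "runsg b p A f g \<longleftrightarrow> (\<exists>P. pb P \<and> (\<forall>N x \<tau> e. bd N x e \<and> A x e \<longrightarrow>
     (\<exists>t \<le> P N. exec p (lay b x 0 \<tau> e) t (lay b x 0 (g x e \<tau>) (f x e))) \<and> (\<forall>i. f x e i \<le> P N)))"

abbreviation "runs b p A f \<equiv> runsg b p A f (\<lambda>_ _ \<tau>. \<tau>)"

lemma runsI:
  assumes "pb P" "pb Q"
    "\<And>N x \<tau> e. bd N x e \<Longrightarrow> A x e \<Longrightarrow>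
       \<exists>t \<le> P N. exec p (lay b x 0 \<tau> e) t (lay b x 0 (g x e \<tau>) (f x e))"
    "\<And>N x e i. bd N x e \<Longrightarrow> A x e \<Longrightarrow> f x e i \<le> Q N"
  shows "runsg b p A f g"
proof -
  have "(\<exists>t \<le> P N + Q N. exec p (lay b x 0 \<tau> e) t (lay b x 0 (g x e \<tau>) (f x e))) \<and>
      (\<forall>i. f x e i \<le> P N + Q N)"
    if "bd N x e" "A x e" for N x \<tau> e
    using assms(3)[OF that, of \<tau>] assms(4)[OF that] by (meson trans_le_add1 trans_le_add2)
  then show ?thesis unfolding runsg_def using pb_add[OF assms(1,2)] by blast
qed

lemma runsE:
  assumes "runsg b p A f g"
  obtains c where "1 \<le> c"
    "\<And>N x \<tau> e. bd N x e \<Longrightarrow> A x e \<Longrightarrow>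
       \<exists>t \<le> (N + c) ^ c. exec p (lay b x 0 \<tau> e) t (lay b x 0 (g x e \<tau>) (f x e))"
    "\<And>N x e i. bd N x e \<Longrightarrow> A x e \<Longrightarrow> f x e i \<le> (N + c) ^ c"
proof -
  obtain P where P: "pb P" "\<And>N x \<tau> e. bd N x e \<and> A x e \<Longrightarrow>
     (\<exists>t \<le> P N. exec p (lay b x 0 \<tau> e) t (lay b x 0 (g x e \<tau>) (f x e))) \<and> (\<forall>i. f x e i \<le> P N)"
    using assms unfolding runsg_def by blast
  obtain c where c: "1 \<le> c" "\<And>n. P n \<le> (n + c) ^ c" using pb_E[OF P(1)] by auto
  show ?thesis
    by (rule that[of c]) (use c P(2) in \<open>meson order_trans\<close>)+
qed

lemma runs_conseq:
  assumes "runsg b p A f g" "\<And>x e. A' x e \<Longrightarrow> A x e" "\<And>x e. A' x e \<Longrightarrow> f x e = f' x e"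
  shows "runsg b p A' f' g"
  using assms unfolding runsg_def by (metis (no_types, lifting))

lemma runs_conseq_out:
  assumes "runsg b p A f g" "\<And>x e \<tau>. A x e \<Longrightarrow> g x e \<tau> = g' x e \<tau>"
  shows "runsg b p A f g'"
  using assms unfolding runsg_def by (metis (no_types, lifting))

lemma pb_pow [simp, intro]: "pb (\<lambda>n. (n + c) ^ c)"
  by (auto simp: pb_def)

lemma runsg_seq:
  assumes "runsg b p A f g" "runsg b p' A' f' g'"
  shows "runsg b (Seq p p') (\<lambda>x e. A x e \<and> A' x (f x e)) (\<lambda>x e. f' x (f x e))
    (\<lambda>x e \<tau>. g' x (f x e) (g x e \<tau>))"
proof -
  obtain c where c: "1 \<le> c"
    "\<And>N x \<tau> e. bd N x e \<Longrightarrow> A x e \<Longrightarrow>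
       \<exists>t \<le> (N + c) ^ c. exec p (lay b x 0 \<tau> e) t (lay b x 0 (g x e \<tau>) (f x e))"
    "\<And>N x e i. bd N x e \<Longrightarrow> A x e \<Longrightarrow> f x e i \<le> (N + c) ^ c" using runsE[OF assms(1)] by metis
  obtain d where d: "1 \<le> d"
    "\<And>N x \<tau> e. bd N x e \<Longrightarrow> A' x e \<Longrightarrow>
       \<exists>t \<le> (N + d) ^ d. exec p' (lay b x 0 \<tau> e) t (lay b x 0 (g' x e \<tau>) (f' x e))"
    "\<And>N x e i. bd N x e \<Longrightarrow> A' x e \<Longrightarrow> f' x e i \<le> (N + d) ^ d" using runsE[OF assms(2)] by metis
  let ?Q = "\<lambda>N. N + (N + c) ^ c"
  have bd: "bd (?Q N) x (f x e)" if "bd N x e" "A x e" for N x e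
    using that c(3)[OF that] by (auto simp: bd_def intro: trans_le_add2)
  show ?thesis
  proof (rule runsI[where P = "\<lambda>N. (N + c) ^ c + (?Q N + d) ^ d" and Q = "\<lambda>N. (?Q N + d) ^ d"])
    show "pb (\<lambda>N. (N + c) ^ c + (?Q N + d) ^ d)" "pb (\<lambda>N. (?Q N + d) ^ d)"
      by (intro pb_add pb_power pb_id pb_const)+
    fix N x e assume a: "bd N x e" "A x e \<and> A' x (f x e)"
    then have a1: "A x e" and a2: "A' x (f x e)" by auto
    show "\<exists>t \<le> (N + c) ^ c + (?Q N + d) ^ d.
        exec (Seq p p') (lay b x 0 \<tau> e) t (lay b x 0 (g' x (f x e) (g x e \<tau>)) (f' x (f x e)))" for \<tau>
      using c(2)[OF a(1) a1, of \<tau>] d(2)[OF bd[OF a(1) a1] a2, of "g x e \<tau>"]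
      by (meson add_mono exec.Seq)
    show "f' x (f x e) i \<le> (?Q N + d) ^ d" for i by (rule d(3)[OF bd[OF a(1) a1] a2])
  qed
qed

lemmas runs_seq = runsg_seq[where g = "\<lambda>_ _ \<tau>. \<tau>" and g' = "\<lambda>_ _ \<tau>. \<tau>"]

lemma exec_loop:
  assumes "1 \<le> b"
    "\<And>j. j < n \<Longrightarrow> \<exists>t \<le> T. exec p (lay b x h (ts j) (st j)) t (lay b x h (ts (Suc j)) (st (Suc j)))"
    "\<And>j. j \<le> n \<Longrightarrow> st j r = 0 \<longleftrightarrow> j = n"
  shows "\<exists>t \<le> n * Suc T + 1. exec (While (nz b r) p) (lay b x h (ts 0) (st 0)) t (lay b x h (ts n) (st n))"
proof -
  have "\<exists>t \<le> k * Suc T + 1. exec (While (nz b r) p) (lay b x h (ts (n - k)) (st (n - k))) t (lay b x h (ts n) (st n))"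
    if "k \<le> n" for k
    using that
  proof (induction k)
    case 0
    show ?case by (rule exI[of _ 1]) (use assms(1) assms(3)[of n] in \<open>simp add: exec.WhileF[simplified]\<close>)
  next
    case (Suc k)
    then obtain t where t: "t \<le> k * Suc T + 1"
      "exec (While (nz b r) p) (lay b x h (ts (n - k)) (st (n - k))) t (lay b x h (ts n) (st n))" by auto
    have n: "n - Suc k < n" "Suc (n - Suc k) = n - k" using Suc.prems by auto
    then obtain t' where t': "t' \<le> T"
      "exec p (lay b x h (ts (n - Suc k)) (st (n - Suc k))) t' (lay b x h (ts (n - k)) (st (n - k)))"
      using assms(2)[of "n - Suc k"] by auto
    have "nz b r (rd (lay b x h (ts (n - Suc k)) (st (n - Suc k))))"
      using assms(1) assms(3)[of "n - Suc k"] n(1) by auto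
    from exec.WhileT[OF this t'(2) t(2)] show ?case
      by (intro exI[of _ "Suc (t' + t)"] conjI) (use t(1) t'(1) in auto)
  qed
  from this[of n] show ?thesis by simp
qed

text \<open>The trajectory \<open>st\<close> is supplied in closed form together with a polynomial
  bound on all of it: a polynomial bound for a single pass would not survive iteration.\<close>

lemma runsg_While:
  assumes "1 \<le> b" "runsg b p A f g"
    "\<And>x e. I x e \<Longrightarrow> st x e 0 = e" "\<And>x e \<tau>. I x e \<Longrightarrow> ts x e \<tau> 0 = \<tau>"
    "\<And>x e j. I x e \<Longrightarrow> j < n x e \<Longrightarrow> A x (st x e j) \<and> f x (st x e j) = st x e (Suc j)"
    "\<And>x e j \<tau>. I x e \<Longrightarrow> j < n x e \<Longrightarrow> g x (st x e j) (ts x e \<tau> j) = ts x e \<tau> (Suc j)"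
    "\<And>x e j. I x e \<Longrightarrow> j \<le> n x e \<Longrightarrow> st x e j r = 0 \<longleftrightarrow> j = n x e"
    "pb Q" "\<And>N x e j i. bd N x e \<Longrightarrow> I x e \<Longrightarrow> j \<le> n x e \<Longrightarrow> st x e j i \<le> Q N"
    "\<And>N x e. bd N x e \<Longrightarrow> I x e \<Longrightarrow> n x e \<le> N"
  shows "runsg b (While (nz b r) p) I (\<lambda>x e. st x e (n x e)) (\<lambda>x e \<tau>. ts x e \<tau> (n x e))"
proof -
  obtain c where c: "1 \<le> c"
    "\<And>N x \<tau> e. bd N x e \<Longrightarrow> A x e \<Longrightarrow>
      \<exists>t \<le> (N + c) ^ c. exec p (lay b x 0 \<tau> e) t (lay b x 0 (g x e \<tau>) (f x e))"
    using runsE[OF assms(2)] by metis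
  let ?T = "\<lambda>N. (N + Q N + c) ^ c"
  show ?thesis
  proof (rule runsI[where P = "\<lambda>N. N * Suc (?T N) + 1" and Q = Q])
    show "pb (\<lambda>N. N * Suc (?T N) + 1)"
      by (intro pb_add pb_mult pb_Suc pb_power pb_id pb_const assms)
    show "pb Q" by fact
    fix N x e assume a: "bd N x e" "I x e"
    show "st x e (n x e) i \<le> Q N" for i using assms(9)[OF a] by simp
    show "\<exists>t \<le> N * Suc (?T N) + 1. exec (While (nz b r) p) (lay b x 0 \<tau> e) t
        (lay b x 0 (ts x e \<tau> (n x e)) (st x e (n x e)))" for \<tau>
    proof -
      have "\<exists>t \<le> ?T N. exec p (lay b x 0 (ts x e \<tau> j) (st x e j)) t
          (lay b x 0 (ts x e \<tau> (Suc j)) (st x e (Suc j)))" if "j < n x e" for j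
      proof -
        have "bd (N + Q N) x (st x e j)"
          using a(1) assms(9)[OF a, of j] that by (auto simp: bd_def intro: trans_le_add2)
        then show ?thesis using c(2)[of "N + Q N" x "st x e j" "ts x e \<tau> j"] assms(5,6)[OF a(2) that] by auto
      qed
      from exec_loop[where st = "st x e" and ts = "ts x e \<tau>", OF assms(1) this assms(7)[OF a(2)]]
      obtain t where "t \<le> n x e * Suc (?T N) + 1"
        "exec (While (nz b r) p) (lay b x 0 (ts x e \<tau> 0) (st x e 0)) t
          (lay b x 0 (ts x e \<tau> (n x e)) (st x e (n x e)))" by blast
      moreover have "n x e * Suc (?T N) \<le> N * Suc (?T N)" using assms(10)[OF a] by (intro mult_le_mono1)
      ultimately show ?thesis using assms(3,4)[OF a(2)]
        by (metis add_le_mono1 order_trans)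
    qed
  qed
qed

lemma runs_While:
  assumes "1 \<le> b" "runs b p A g"
    "\<And>x e. I x e \<Longrightarrow> st x e 0 = e"
    "\<And>x e j. I x e \<Longrightarrow> j < e r \<Longrightarrow> A x (st x e j) \<and> g x (st x e j) = st x e (Suc j)"
    "\<And>x e j. I x e \<Longrightarrow> j \<le> e r \<Longrightarrow> st x e j r = e r - j"
    "pb Q" "\<And>N x e j i. bd N x e \<Longrightarrow> I x e \<Longrightarrow> j \<le> e r \<Longrightarrow> st x e j i \<le> Q N"
  shows "runs b (While (nz b r) p) I (\<lambda>x e. st x e (e r))"
  by (rule runsg_While[where ts = "\<lambda>x e \<tau> j. \<tau>" and n = "\<lambda>x e. e r", OF assms(1,2,3) refl assms(4) refl _ assms(6,7)])
    (simp_all add: assms(5) bd_le, linarith)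

lemma runs_Seq:
  assumes "runs b p A f" "runs b p' A' f'" "\<And>x e. A x e \<Longrightarrow> A' x (f x e)"
  shows "runs b (Seq p p') A (\<lambda>x e. f' x (f x e))"
  by (rule runs_conseq[OF runs_seq[OF assms(1,2)]]) (use assms(3) in auto)

lemma runs_inc: "1 \<le> b \<Longrightarrow> runs b (inc b j) (\<lambda>_ _. True) (\<lambda>x e. e(j := Suc (e j)))"
  by (rule runsI[where P = "\<lambda>_. 1" and Q = "\<lambda>N. Suc N"])
    (use exec_inc in \<open>auto simp: bd_def intro: le_SucI\<close>)

lemma runs_dec: "1 \<le> b \<Longrightarrow> runs b (dec b j) (\<lambda>x e. e j \<noteq> 0) (\<lambda>x e. e(j := e j - 1))"
  by (rule runsI[where P = "\<lambda>_. 1" and Q = "\<lambda>N. N"])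
    (use exec_dec in \<open>auto simp: bd_def intro: order_trans[OF diff_le_self]\<close>)

definition clear :: "nat \<Rightarrow> nat \<Rightarrow> prog" where
  "clear b r = While (nz b r) (dec b r)"

lemma okp_clear: "okp (clear b r)"
  unfolding clear_def by (intro okp_intros)

lemma runs_clear:
  assumes "1 \<le> b"
  shows "runs b (clear b r) (\<lambda>_ _. True) (\<lambda>x e. e(r := 0))"
proof -
  have "runs b (clear b r) (\<lambda>_ _. True) (\<lambda>x e. e(r := e r - e r))"
    unfolding clear_def
    by (rule runs_While[OF assms runs_dec[OF assms], where Q = "\<lambda>N. N" and st = "\<lambda>x e j. e(r := e r - j)"])
      (auto simp: bd_def intro: order_trans[OF diff_le_self])
  then show ?thesis by simp
qed

definition move :: "nat \<Rightarrow> nat \<Rightarrow> nat \<Rightarrow> prog" where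
  "move b r r' = While (nz b r) (Seq (dec b r) (inc b r'))"

lemma okp_move: "okp (move b r r')"
  unfolding move_def by (intro okp_intros)

lemma runs_move:
  assumes "1 \<le> b" "r \<noteq> r'"
  shows "runs b (move b r r') (\<lambda>_ _. True) (\<lambda>x e. e(r := 0, r' := e r' + e r))"
proof -
  have "runs b (move b r r') (\<lambda>_ _. True) (\<lambda>x e. e(r := e r - e r, r' := e r' + e r))"
    unfolding move_def
    by (rule runs_While[OF assms(1) runs_Seq[OF runs_dec runs_inc],
          where Q = "\<lambda>N. N + N" and st = "\<lambda>x e j. e(r := e r - j, r' := e r' + j)"])
      (use assms in \<open>auto simp: fun_eq_iff bd_arith\<close>)
  then show ?thesis by simp
qed

text \<open>A register can only be read by counting it down. The value is therefore transferred to
  two registers at once, and the second one refills the source.\<close>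

definition copy :: "nat \<Rightarrow> nat \<Rightarrow> nat \<Rightarrow> prog" where
  "copy b i k = Seq (While (nz b i) (Seq (dec b i) (Seq (inc b k) (inc b (Suc k))))) (move b (Suc k) i)"

lemma okp_copy: "okp (copy b r r')"
  unfolding copy_def by (intro okp_intros okp_move)

lemma runs_copy:
  assumes "1 \<le> b" "i < k"
  shows "runs b (copy b i k) (\<lambda>x e. \<forall>j\<ge>k. e j = 0) (\<lambda>x e. e(k := e i))"
proof -
  have 0: "runs b (Seq (dec b i) (Seq (inc b k) (inc b (Suc k)))) (\<lambda>x e. e i \<noteq> 0)
      (\<lambda>x e. e(i := e i - 1, k := Suc (e k), Suc k := Suc (e (Suc k))))"
    by (rule runs_conseq[OF runs_Seq[OF runs_dec runs_Seq[OF runs_inc runs_inc]]])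
      (use assms in auto)
  have 1: "runs b (While (nz b i) (Seq (dec b i) (Seq (inc b k) (inc b (Suc k)))))
      (\<lambda>x e. e k = 0 \<and> e (Suc k) = 0) (\<lambda>x e. e(i := e i - e i, k := e i, Suc k := e i))"
  proof (rule runs_While[OF assms(1) 0, where Q = "\<lambda>N. N" and st = "\<lambda>x e j. e(i := e i - j, k := j, Suc k := j)"])
    show "pb (\<lambda>N. N)" by simp
  qed (use assms in \<open>auto simp: bd_arith bd_le\<close>)
  show ?thesis unfolding copy_def
    by (rule runs_conseq[OF runs_Seq[OF 1 runs_move]]) (use assms in auto)
qed

section \<open>Functions computable in polynomial time\<close>

text \<open>
  \<open>pc d F\<close>: the value of \<open>F\<close> on the input word and the registers below \<open>d\<close> can be computed in
  polynomial time into any register from \<open>d\<close> on, all registers above being free.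
\<close>

definition pc :: "nat \<Rightarrow> (nat list \<Rightarrow> (nat \<Rightarrow> nat) \<Rightarrow> nat) \<Rightarrow> bool" where
  "pc d F \<longleftrightarrow> (\<forall>x e e'. (\<forall>i<d. e i = e' i) \<longrightarrow> F x e = F x e') \<and>
     (\<forall>b\<ge>1. \<forall>k\<ge>d. \<exists>p. okp p \<and> runs b p (\<lambda>x e. \<forall>i\<ge>k. e i = 0) (\<lambda>x e. e(k := F x e)))"

lemma pc_local: "pc d F \<Longrightarrow> (\<And>i. i < d \<Longrightarrow> e i = e' i) \<Longrightarrow> F x e = F x e'"
  unfolding pc_def by blast

lemma pc_upd: "pc d F \<Longrightarrow> d \<le> k \<Longrightarrow> F x (e(k := v)) = F x e"
  by (erule pc_local) simp

lemma pc_prog: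
  assumes "pc d F" "1 \<le> b" "d \<le> k"
  obtains p where "okp p" "runs b p (\<lambda>x e. \<forall>i\<ge>k. e i = 0) (\<lambda>x e. e(k := F x e))"
  using assms unfolding pc_def by blast

lemma pc_mono:
  assumes "pc d F" "d \<le> d'"
  shows "pc d' F"
  unfolding pc_def
proof (intro conjI allI impI)
  show "F x e = F x e'" if "\<forall>i<d'. e i = e' i" for x e e'
    by (rule pc_local[OF assms(1)]) (use that assms(2) in auto)
  show "\<exists>p. okp p \<and> runs b p (\<lambda>x e. \<forall>i\<ge>k. e i = 0) (\<lambda>x e. e(k := F x e))"
    if b: "1 \<le> b" and k: "d' \<le> k" for b k
  proof -
    have "d \<le> k" using k assms(2) by simp
    then obtain p where "okp p" "runs b p (\<lambda>x e. \<forall>i\<ge>k. e i = 0) (\<lambda>x e. e(k := F x e))"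
      by (rule pc_prog[OF assms(1) b])
    then show ?thesis by (intro exI conjI)
  qed
qed

text \<open>The value ends up in a register, and registers are bounded after a run. The registers
  from \<open>d\<close> on do not influence \<open>F\<close> and are set to 0 to meet the
  precondition of the program.\<close>

lemma pc_bound:
  assumes "pc d F"
  obtains P where "pb P" "\<And>N x e. bd N x e \<Longrightarrow> F x e \<le> P N"
proof -
  obtain p where "runs 1 p (\<lambda>x e. \<forall>i\<ge>d. e i = 0) (\<lambda>x e. e(d := F x e))"
    by (rule pc_prog[OF assms le_refl le_refl])
  then obtain c where c: "\<And>N x e i. bd N x e \<Longrightarrow> \<forall>i\<ge>d. e i = 0 \<Longrightarrow> (e(d := F x e)) i \<le> (N + c) ^ c"
    by (rule runsE) blast
  have "F x e \<le> (N + c) ^ c" if "bd N x e" for N x e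
  proof -
    let ?e = "\<lambda>i. if i < d then e i else 0"
    have "bd N x ?e" using that by (auto simp: bd_def)
    from c[OF this, of d] have "F x ?e \<le> (N + c) ^ c" by simp
    moreover have "F x ?e = F x e" by (rule pc_local[OF assms]) auto
    ultimately show ?thesis by simp
  qed
  then show ?thesis using that pb_pow by blast
qed

lemma pc_var:
  assumes "i < d"
  shows "pc d (\<lambda>x e. e i)"
  unfolding pc_def
proof (intro conjI allI impI)
  show "\<exists>p. okp p \<and> runs b p (\<lambda>x e. \<forall>i\<ge>k. e i = 0) (\<lambda>x e. e(k := e i))"
    if "1 \<le> b" "d \<le> k" for b k
  proof -
    have "i < k" using that(2) assms by simp
    from runs_copy[OF that(1) this] okp_copy show ?thesis by (intro exI conjI)
  qed
qed (use assms in auto)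

lemma exec_skip: "exec (Do idle) \<sigma> 1 \<sigma>"
  using exec.Do[of idle \<sigma>] by simp

lemma okp_skip: "okp (Do idle)"
  by (rule okp_Do) (auto simp: plain_def idle_def)

lemma pc_zero: "pc d (\<lambda>x e. 0)"
proof -
  have "runs b (Do idle) (\<lambda>x e. \<forall>i\<ge>k. e i = 0) (\<lambda>x e. e(k := 0))" for b k
  proof (rule runsI[where P = "\<lambda>_. 1" and Q = "\<lambda>N. N"])
    fix N x e \<tau> assume "bd N x e" "\<forall>i\<ge>k. e i = (0::nat)"
    then have "e(k := 0) = e" by auto
    then show "\<exists>t\<le>1. exec (Do idle) (lay b x 0 \<tau> e) t (lay b x 0 \<tau> (e(k := 0)))"
      using exec_skip by (metis order_refl)
  qed (auto simp: bd_def)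
  then show ?thesis unfolding pc_def by (intro conjI allI impI exI[of _ "Do idle"] okp_skip) auto
qed

lemma pc_Suc:
  assumes "pc d F"
  shows "pc d (\<lambda>x e. Suc (F x e))"
  unfolding pc_def
proof (intro conjI allI impI)
  show "Suc (F x e) = Suc (F x e')" if "\<forall>i<d. e i = e' i" for x e e'
    using pc_local[OF assms] that by metis
  fix b k :: nat assume a: "1 \<le> b" "d \<le> k"
  obtain p where p: "okp p" "runs b p (\<lambda>x e. \<forall>i\<ge>k. e i = 0) (\<lambda>x e. e(k := F x e))"
    by (rule pc_prog[OF assms a])
  have "runs b (Seq p (inc b k)) (\<lambda>x e. \<forall>i\<ge>k. e i = 0) (\<lambda>x e. e(k := Suc (F x e)))"
    by (rule runs_conseq[OF runs_seq[OF p(2) runs_inc[OF a(1)]]]) auto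
  then show "\<exists>p. okp p \<and> runs b p (\<lambda>x e. \<forall>i\<ge>k. e i = 0) (\<lambda>x e. e(k := Suc (F x e)))"
    using okp_Seq[OF p(1) okp_inc] by (intro exI conjI)
qed

lemma pc_const: "pc d (\<lambda>x e. c)"
  by (induction c) (auto intro: pc_zero pc_Suc)

text \<open>The arithmetic below rests on this form of primitive recursion. Polynomial time is not
  closed under unrestricted recursion, hence the bound \<open>P\<close> on all intermediate values.
  Register \<open>k\<close> holds the current value, \<open>k + 1\<close> the number of remaining
  rounds and \<open>k + 2\<close> the index; \<open>k + 3\<close> and \<open>k + 4\<close> receive
  the argument and the result of \<open>G\<close>.\<close>

lemma pc_iter:
  assumes A: "pc d A" and B: "pc d B"
    and G: "\<And>k. d \<le> k \<Longrightarrow> pc (k + 2) (\<lambda>x e. G x e (e k) (e (Suc k)))"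
    and L: "\<And>x e e' i v. (\<And>j. j < d \<Longrightarrow> e j = e' j) \<Longrightarrow> G x e i v = G x e' i v"
    and P: "pb P" "\<And>N x e j. bd N x e \<Longrightarrow> j \<le> B x e \<Longrightarrow> rec_nat (A x e) (G x e) j \<le> P N"
  shows "pc d (\<lambda>x e. rec_nat (A x e) (G x e) (B x e))"
  unfolding pc_def
proof (intro conjI allI impI)
  fix x e e' assume e: "\<forall>i<d. e i = (e' i :: nat)"
  have "A x e = A x e'" "B x e = B x e'" using pc_local[OF A] pc_local[OF B] e by metis+
  moreover have "G x e = G x e'" by (intro ext L) (use e in auto)
  ultimately show "rec_nat (A x e) (G x e) (B x e) = rec_nat (A x e') (G x e') (B x e')" by simp
next
  fix b k :: nat assume b: "1 \<le> b" and k: "d \<le> k"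
  obtain pA where pA: "okp pA" "runs b pA (\<lambda>x e. \<forall>i\<ge>k. e i = 0) (\<lambda>x e. e(k := A x e))"
    by (rule pc_prog[OF A b k])
  obtain pB where pB: "okp pB"
    "runs b pB (\<lambda>x e. \<forall>i\<ge>Suc k. e i = 0) (\<lambda>x e. e(Suc k := B x e))"
    by (rule pc_prog[OF B b le_SucI[OF k]])
  obtain pG where pG: "okp pG" "runs b pG (\<lambda>x e. \<forall>i\<ge>k + 4. e i = 0)
      (\<lambda>x e. e(k + 4 := G x e (e (k + 2)) (e (k + 3))))"
    by (rule pc_prog[OF G[of "k + 2"] b, of "k + 4"]) (use k in \<open>simp_all add: eval_nat_numeral\<close>)
  define body where "body = Seq (move b k (k + 3)) (Seq pG (Seq (clear b (k + 3))
     (Seq (move b (k + 4) k) (Seq (inc b (k + 2)) (dec b (Suc k))))))"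
  have GL: "G x (e(i := v)) a c = G x e a c" if "d \<le> i" for x e i v a c
    by (rule L) (use that in auto)
  have body: "runs b body (\<lambda>x e. e (Suc k) \<noteq> 0 \<and> (\<forall>i\<ge>k + 3. e i = 0))
     (\<lambda>x e. e(k := G x e (e (k + 2)) (e k), k + 2 := Suc (e (k + 2)), Suc k := e (Suc k) - 1))"
    unfolding body_def
    by (rule runs_conseq[OF runs_seq[OF runs_move[OF b, of k "k + 3"] runs_seq[OF pG(2)
      runs_seq[OF runs_clear[OF b, of "k + 3"] runs_seq[OF runs_move[OF b, of "k + 4" k]
        runs_seq[OF runs_inc[OF b, of "k + 2"] runs_dec[OF b, of "Suc k"]]]]]]])
      (use k in \<open>auto simp: GL fun_eq_iff\<close>)
  define init where "init x e = e(k := A x e, Suc k := B x e)" for x :: "nat list" and e :: "nat \<Rightarrow> nat"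
  have AB: "A x (e(i := v)) = A x e" "B x (e(i := v)) = B x e" if "d \<le> i" for x e i v
    using pc_upd[OF A that] pc_upd[OF B that] by auto
  have ini: "runs b (Seq pA pB) (\<lambda>x e. \<forall>i\<ge>k. e i = 0) init"
    by (rule runs_conseq[OF runs_seq[OF pA(2) pB(2)]]) (use k in \<open>auto simp: init_def AB\<close>)
  let ?I = "\<lambda>x e'. \<exists>e. (\<forall>i\<ge>k. e i = 0) \<and> e' = init x e"
  let ?st = "\<lambda>x e j. e(k := rec_nat (A x e) (G x e) j, Suc k := B x e - j, k + 2 := j)"
  have loop: "runs b (While (nz b (Suc k)) body) ?I (\<lambda>x e. ?st x e (e (Suc k)))"
  proof (rule runs_While[OF b body])
    show "pb (\<lambda>N. N + P N)" by (intro pb_add pb_id P)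
    fix x e' assume "?I x e'"
    then obtain e where e: "\<forall>i\<ge>k. e i = 0" "e' = init x e" by auto
    have eq: "A x e' = A x e" "B x e' = B x e" "G x e' = G x e"
      using k by (auto simp: e init_def AB GL fun_eq_iff)
    show "?st x e' 0 = e'" unfolding eq using e(1) by (auto simp: e(2) init_def)
    fix j
    show "(?st x e' j (Suc k) \<noteq> 0 \<and> (\<forall>i\<ge>k + 3. ?st x e' j i = 0)) \<and>
        (?st x e' j)(k := G x (?st x e' j) (?st x e' j (k + 2)) (?st x e' j k),
          k + 2 := Suc (?st x e' j (k + 2)), Suc k := ?st x e' j (Suc k) - 1) = ?st x e' (Suc j)"
      if j: "j < e' (Suc k)"
    proof -
      have "j < B x e" using j by (simp add: e init_def)
      then show ?thesis unfolding eq using e(1) k by (auto simp: e(2) init_def GL fun_eq_iff)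
    qed
    show "?st x e' j (Suc k) = e' (Suc k) - j" if "j \<le> e' (Suc k)" unfolding eq by (simp add: e init_def)
    fix N i assume bd: "bd N x e'" and j: "j \<le> e' (Suc k)"
    have j': "j \<le> B x e'" using j unfolding eq by (simp add: e(2) init_def)
    have BN: "B x e' \<le> N" using bd_le[OF bd, of "Suc k"] unfolding eq by (simp add: e(2) init_def)
    have "rec_nat (A x e') (G x e') j \<le> P N" by (rule P(2)[OF bd j'])
    then show "?st x e' j i \<le> N + P N" using j' BN bd_le[OF bd, of i] by auto
  qed
  let ?p = "Seq (Seq pA pB) (Seq (While (nz b (Suc k)) body) (clear b (k + 2)))"
  have "okp ?p" unfolding body_def
    by (intro okp_intros okp_move okp_clear pA pB pG)
  moreover have "runs b ?p (\<lambda>x e. \<forall>i\<ge>k. e i = 0) (\<lambda>x e. e(k := rec_nat (A x e) (G x e) (B x e)))"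
  proof (rule runs_conseq[OF runs_seq[OF ini runs_seq[OF loop runs_clear[OF b]]]])
    fix x e assume e: "\<forall>i\<ge>k. e i = (0::nat)"
    have eq: "A x (init x e) = A x e" "B x (init x e) = B x e" "G x (init x e) = G x e"
      using k by (auto simp: init_def AB GL fun_eq_iff)
    show "(?st x (init x e) (init x e (Suc k)))(k + 2 := 0) = e(k := rec_nat (A x e) (G x e) (B x e))"
      unfolding eq using e by (auto simp: init_def fun_eq_iff)
  qed auto
  ultimately show "\<exists>p. okp p \<and> runs b p (\<lambda>x e. \<forall>i\<ge>k. e i = 0)
      (\<lambda>x e. e(k := rec_nat (A x e) (G x e) (B x e)))" by (intro exI conjI)
qed

text \<open>This is composition: a function treated for arguments in registers may then be applied
  to computed arguments, as in \<open>pc_app1\<close>, \<open>pc_app2\<close> and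
  \<open>pc_app3\<close>.\<close>

lemma pc_let:
  assumes A: "pc d A" and F: "\<And>k. d \<le> k \<Longrightarrow> pc (Suc k) (\<lambda>x e. F x e (e k))"
    and L: "\<And>x e e' i. (\<And>j. j < d \<Longrightarrow> e j = e' j) \<Longrightarrow> F x e i = F x e' i"
  shows "pc d (\<lambda>x e. F x e (A x e))"
  unfolding pc_def
proof (intro conjI allI impI)
  fix x e e' assume e: "\<forall>i<d. e i = (e' i :: nat)"
  have "A x e = A x e'" using pc_local[OF A] e by metis
  moreover have "F x e = F x e'" by (intro ext L) (use e in auto)
  ultimately show "F x e (A x e) = F x e' (A x e')" by simp
next
  fix b k :: nat assume b: "1 \<le> b" and k: "d \<le> k"
  obtain pA where pA: "okp pA" "runs b pA (\<lambda>x e. \<forall>i\<ge>k. e i = 0) (\<lambda>x e. e(k := A x e))"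
    by (rule pc_prog[OF A b k])
  obtain pF where pF: "okp pF" "runs b pF (\<lambda>x e. \<forall>i\<ge>Suc k. e i = 0) (\<lambda>x e. e(Suc k := F x e (e k)))"
    by (rule pc_prog[OF F[OF k] b le_refl])
  have FL: "F x (e(i := v)) a = F x e a" if "d \<le> i" for x e i v a
    by (rule L) (use that in auto)
  let ?p = "Seq pA (Seq pF (Seq (clear b k) (move b (Suc k) k)))"
  have "okp ?p" by (intro okp_intros okp_move okp_clear pA pF)
  moreover have "runs b ?p (\<lambda>x e. \<forall>i\<ge>k. e i = 0) (\<lambda>x e. e(k := F x e (A x e)))"
    by (rule runs_conseq[OF runs_seq[OF pA(2) runs_seq[OF pF(2) runs_seq[OF runs_clear[OF b] runs_move[OF b]]]]])
      (use k in \<open>auto simp: FL fun_eq_iff\<close>)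
  ultimately show "\<exists>p. okp p \<and> runs b p (\<lambda>x e. \<forall>i\<ge>k. e i = 0) (\<lambda>x e. e(k := F x e (A x e)))" by (intro exI conjI)
qed

lemma exec_DoI: "app (d (rd \<sigma>)) \<sigma> = \<sigma>' \<Longrightarrow> exec (Do d) \<sigma> 1 \<sigma>'"
  using exec.Do by blast

lemma exec_cong: "exec p \<sigma> t \<sigma>' \<Longrightarrow> t = t' \<Longrightarrow> \<sigma>' = \<sigma>'' \<Longrightarrow> exec p \<sigma> t' \<sigma>''"
  by simp

definition head :: "head_move \<Rightarrow> nat \<Rightarrow> nat \<Rightarrow> nat \<Rightarrow> prog" where
  "head m b k k' = Do (\<lambda>r i. (r i, if i = 0 then m else if i = b + k then Move_Left
     else if i = b + k' then Move_Right else Stay))"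

lemma exec_head:
  assumes "1 \<le> b" "k \<noteq> k'" "e k \<noteq> 0"
  shows "exec (head m b k k') (lay b x h \<tau> e) 1
    (lay b x (h + shift m) \<tau> (e(k := e k - 1, k' := Suc (e k'))))"
proof -
  have "app (\<lambda>i. (rd (lay b x h \<tau> e) i, if i = 0 then m else if i = b + k then Move_Left
     else if i = b + k' then Move_Right else Stay)) (lay b x h \<tau> e) =
     lay b x (h + shift m) \<tau> (e(k := e k - 1, k' := Suc (e k')))" (is "?l = ?r")
  proof
    fix i
    show "?l i = ?r i" unfolding app_def act_move
      using assms by (auto simp: lay_def cnt_def of_nat_diff)
  qed
  then show ?thesis unfolding head_def by (rule exec_DoI)
qed

lemma exec_head_loop:
  assumes "1 \<le> b" "k \<noteq> k'"
  shows "exec (While (nz b k) (head m b k k')) (lay b x h \<tau> e) (2 * e k + 1)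
    (lay b x (h + int (e k) * shift m) \<tau> (e(k := 0, k' := e k' + e k)))"
proof (induction "e k" arbitrary: e h)
  case 0
  then show ?case using assms by (auto simp: fun_upd_idem intro!: exec.WhileF[simplified])
next
  case (Suc n)
  let ?e = "e(k := e k - 1, k' := Suc (e k'))"
  have ek: "e k \<noteq> 0" using Suc.hyps(2) by simp
  have "exec (While (nz b k) (head m b k k')) (lay b x (h + shift m) \<tau> ?e) (2 * ?e k + 1)
    (lay b x (h + shift m + int (?e k) * shift m) \<tau> (?e(k := 0, k' := ?e k' + ?e k)))"
    by (rule Suc.hyps(1)) (use Suc.hyps(2) assms in auto)
  moreover have "nz b k (rd (lay b x h \<tau> e))" using ek assms by simp
  ultimately show ?case
    by (intro exec_cong[OF exec.WhileT[OF _ exec_head[of b k k' e, OF assms ek]]])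
      (use ek assms in \<open>auto simp: of_nat_diff algebra_simps intro!: arg_cong2[of _ _ _ _ "\<lambda>h e. lay b x h \<tau> e"]\<close>)
qed

fun incs :: "nat \<Rightarrow> nat \<Rightarrow> nat \<Rightarrow> prog" where
  "incs b k 0 = Do idle"
| "incs b k (Suc n) = Seq (incs b k n) (inc b k)"

lemma exec_incs:
  "1 \<le> b \<Longrightarrow> exec (incs b k n) (lay b x h \<tau> e) (Suc n) (lay b x h \<tau> (e(k := e k + n)))"
proof (induction n)
  case 0
  then show ?case using exec_skip by simp
next
  case (Suc n)
  have "(e(k := e k + n))(k := Suc ((e(k := e k + n)) k)) = e(k := e k + Suc n)"
    by (simp add: fun_eq_iff)
  from arg_cong[OF this, of "lay b x h \<tau>"] show ?case unfolding incs.simps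
    by (intro exec_cong[OF exec.Seq[OF Suc.IH[OF Suc.prems] exec_inc[OF Suc.prems, of k]]]) (simp_all only: Suc_eq_plus1)
qed

text \<open>The finite control recognises the symbol by comparing it with \<open>n\<close>,
  \<open>n - 1\<close> and so on, and adds the constant found.\<close>

fun addsym :: "nat \<Rightarrow> nat \<Rightarrow> nat \<Rightarrow> prog" where
  "addsym b k 0 = Do idle"
| "addsym b k (Suc n) = Cond (\<lambda>r. r 0 = Suc n) (incs b k (Suc n)) (addsym b k n)"

lemma exec_addsym:
  assumes "1 \<le> b" "fst (word_tape x) h \<le> n"
  shows "\<exists>t \<le> 2 * n + 2. exec (addsym b k n) (lay b x h \<tau> e) t
    (lay b x h \<tau> (e(k := e k + fst (word_tape x) h)))"
  using assms(2)
proof (induction n)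
  case 0
  then show ?case using exec_skip by (intro exI[of _ 1]) auto
next
  case (Suc n)
  show ?case
  proof (cases "fst (word_tape x) h = Suc n")
    case True
    then show ?thesis using exec.CondT[OF _ exec_incs[OF assms(1)], of "\<lambda>r. r 0 = Suc n" x h \<tau> e k "Suc n"]
      by (intro exI[of _ "Suc (Suc (Suc n))"]) (auto simp: rd_lay fun_upd_def)
  next
    case False
    then have "fst (word_tape x) h \<le> n" using Suc.prems by simp
    from Suc.IH[OF this] obtain t where t: "t \<le> 2 * n + 2" "exec (addsym b k n) (lay b x h \<tau> e) t
      (lay b x h \<tau> (e(k := e k + fst (word_tape x) h)))" by blast
    have "\<not> rd (lay b x h \<tau> e) 0 = Suc n" using False by (simp add: rd_lay)
    then have "exec (addsym b k (Suc n)) (lay b x h \<tau> e) (Suc t)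
      (lay b x h \<tau> (e(k := e k + fst (word_tape x) h)))"
      unfolding addsym.simps using t(2) by (rule exec.CondF)
    moreover have "Suc t \<le> 2 * Suc n + 2" using t(1) by simp
    ultimately show ?thesis by blast
  qed
qed

lemma okp_addsym: "okp (addsym b k n)"
proof (induction n)
  case 0
  then show ?case using okp_skip by simp
next
  case (Suc n)
  have "okp (incs b k m)" for m by (induction m) (auto intro: okp_skip okp_intros)
  moreover have "finc (\<lambda>r. r 0 = Suc n)" unfolding finc_def agree_def by (rule exI[of _ 1]) auto
  ultimately show ?case unfolding addsym.simps using Suc by (intro okp_Cond)
qed

lemma okp_head: "okp (head m b k k')"
  unfolding head_def by (rule okp_Do) (auto simp: plain_def)

definition sym :: "nat list \<Rightarrow> nat \<Rightarrow> nat" where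
  "sym x i = (if i < length x then x ! i else 0)"

text \<open>The head is driven to its position while one register is emptied into the next, and
  driven back while that one is emptied in turn; so it is at cell 0 again, as the notion of a run
  demands.\<close>

lemma pc_sym:
  assumes A: "pc d A"
  shows "pc d (\<lambda>x e. sym x (A x e))"
  unfolding pc_def
proof (intro conjI allI impI)
  fix x e e' assume e: "\<forall>i<d. e i = (e' i :: nat)"
  show "sym x (A x e) = sym x (A x e')" using pc_local[OF A] e by metis
next
  fix b k :: nat assume b: "1 \<le> b" and k: "d \<le> k"
  obtain pA where pA: "okp pA" "runs b pA (\<lambda>x e. \<forall>i\<ge>k. e i = 0) (\<lambda>x e. e(k := A x e))"
    by (rule pc_prog[OF A b k])
  let ?q = "Seq (While (nz b k) (head Move_Right b k (Suc k)))
     (Seq (addsym b k 5) (While (nz b (Suc k)) (head Move_Left b (Suc k) (Suc (Suc k)))))"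
  have q: "runs b ?q (\<lambda>x e. \<forall>i>k. e i = 0) (\<lambda>x e. e(k := sym x (e k), Suc (Suc k) := e k))"
  proof (rule runsI[where P = "\<lambda>N. 4 * N + 14" and Q = "\<lambda>N. N + 5"])
    show "pb (\<lambda>N. 4 * N + 14)" "pb (\<lambda>N. N + 5)" by (intro pb_add pb_mult pb_id pb_const)+
    fix N x e \<tau> assume bd: "bd N x e" and z: "\<forall>i>k. e i = (0::nat)"
    have s: "fst (word_tape x) (int (e k)) = sym x (e k)" by (simp add: word_tape_def sym_def)
    have le: "sym x (e k) \<le> 5" using bd nth_mem by (fastforce simp: bd_def sym_def)
    let ?e1 = "e(k := 0, Suc k := e k)"
    let ?e2 = "e(k := sym x (e k), Suc k := e k)"
    let ?e3 = "e(k := sym x (e k), Suc (Suc k) := e k)"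
    have 1: "exec (While (nz b k) (head Move_Right b k (Suc k))) (lay b x 0 \<tau> e) (2 * e k + 1)
        (lay b x (int (e k)) \<tau> ?e1)"
      using exec_head_loop[OF b, of k "Suc k" Move_Right x 0 \<tau> e] z by simp
    obtain t where t: "t \<le> 12" "exec (addsym b k 5) (lay b x (int (e k)) \<tau> ?e1) t
        (lay b x (int (e k)) \<tau> ?e2)"
      using exec_addsym[OF b, of x "int (e k)" 5 k \<tau> ?e1] le unfolding s
      by (auto simp: fun_upd_twist)
    have "?e2(Suc k := 0, Suc (Suc k) := ?e2 (Suc (Suc k)) + ?e2 (Suc k)) = ?e3"
      using z by (auto simp: fun_eq_iff)
    then have 3: "exec (While (nz b (Suc k)) (head Move_Left b (Suc k) (Suc (Suc k))))
        (lay b x (int (e k)) \<tau> ?e2) (2 * e k + 1) (lay b x 0 \<tau> ?e3)"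
      using exec_head_loop[OF b, of "Suc k" "Suc (Suc k)" Move_Left x "int (e k)" \<tau> ?e2] by simp
    show "\<exists>t\<le>4 * N + 14. exec ?q (lay b x 0 \<tau> e) t (lay b x 0 \<tau> ?e3)"
      using exec.Seq[OF 1 exec.Seq[OF t(2) 3]] t(1) bd_le[OF bd, of k]
      by (intro exI[of _ "2 * e k + 1 + (t + (2 * e k + 1))"]) auto
    show "?e3 i \<le> N + 5" for i using le bd_le[OF bd, of i] bd_le[OF bd, of k] by auto
  qed
  let ?p = "Seq pA (Seq ?q (clear b (Suc (Suc k))))"
  have "okp ?p" by (intro okp_intros okp_clear okp_addsym okp_head pA)
  moreover have "runs b ?p (\<lambda>x e. \<forall>i\<ge>k. e i = 0) (\<lambda>x e. e(k := sym x (A x e)))"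
    by (rule runs_conseq[OF runs_seq[OF pA(2) runs_seq[OF q runs_clear[OF b]]]]) (auto simp: fun_eq_iff)
  ultimately show "\<exists>p. okp p \<and> runs b p (\<lambda>x e. \<forall>i\<ge>k. e i = 0) (\<lambda>x e. e(k := sym x (A x e)))" by (intro exI conjI)
qed

section \<open>Arithmetic, bounded quantifiers and bounded search\<close>

lemma pc_pred:
  assumes "pc d F"
  shows "pc d (\<lambda>x e. F x e - 1)"
proof -
  have r: "rec_nat 0 (\<lambda>i v. i) n = n - (1::nat)" for n by (cases n) auto
  obtain P where P: "pb P" "\<And>N x e. bd N x e \<Longrightarrow> F x e \<le> P N" using pc_bound[OF assms] by auto
  have "pc d (\<lambda>x e. rec_nat 0 (\<lambda>i v. i) (F x e))"
  proof (rule pc_iter[OF pc_zero assms])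
    show "pb P" by fact
    show "rec_nat 0 (\<lambda>i v. i) j \<le> P N" if "bd N x e" "j \<le> F x e" for N x e j
      unfolding r using P(2)[OF that(1)] that(2) by linarith
  qed (auto intro: pc_var)
  then show ?thesis unfolding r .
qed

lemma pc_add:
  assumes "pc d A" "pc d B"
  shows "pc d (\<lambda>x e. A x e + B x e)"
proof -
  have r: "rec_nat a (\<lambda>i v. Suc v) n = a + n" for n a :: nat by (induction n) auto
  obtain P where P: "pb P" "\<And>N x e. bd N x e \<Longrightarrow> A x e \<le> P N" using pc_bound[OF assms(1)] by auto
  obtain Q where Q: "pb Q" "\<And>N x e. bd N x e \<Longrightarrow> B x e \<le> Q N" using pc_bound[OF assms(2)] by auto
  have "pc d (\<lambda>x e. rec_nat (A x e) (\<lambda>i v. Suc v) (B x e))"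
  proof (rule pc_iter[OF assms])
    show "pb (\<lambda>N. P N + Q N)" using P Q by auto
    show "rec_nat (A x e) (\<lambda>i v. Suc v) j \<le> P N + Q N" if "bd N x e" "j \<le> B x e" for N x e j
      unfolding r using P(2)[OF that(1)] Q(2)[OF that(1)] that(2) by linarith
  qed (auto intro: pc_var pc_Suc)
  then show ?thesis unfolding r .
qed

lemma pc_sub:
  assumes "pc d A" "pc d B"
  shows "pc d (\<lambda>x e. A x e - B x e)"
proof -
  have r: "rec_nat a (\<lambda>i v. v - 1) n = a - n" for n a :: nat by (induction n) auto
  obtain P where P: "pb P" "\<And>N x e. bd N x e \<Longrightarrow> A x e \<le> P N" using pc_bound[OF assms(1)] by auto
  have "pc d (\<lambda>x e. rec_nat (A x e) (\<lambda>i v. v - 1) (B x e))"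
  proof (rule pc_iter[OF assms])
    show "pb P" by fact
    show "rec_nat (A x e) (\<lambda>i v. v - 1) j \<le> P N" if "bd N x e" "j \<le> B x e" for N x e j
      unfolding r using P(2)[OF that(1)] by linarith
    show "pc (k + 2) (\<lambda>x e. e (Suc k) - 1)" for k by (intro pc_pred pc_var) simp
  qed auto
  then show ?thesis unfolding r .
qed

lemma pc_sum:
  assumes B: "pc d B" and F: "\<And>k. d \<le> k \<Longrightarrow> pc (Suc k) (\<lambda>x e. F x e (e k))"
    and L: "\<And>x e e' i. (\<And>j. j < d \<Longrightarrow> e j = e' j) \<Longrightarrow> F x e i = F x e' i"
  shows "pc d (\<lambda>x e. \<Sum>i<B x e. F x e i)"
proof -
  have r: "rec_nat 0 (\<lambda>i v. v + f i) n = (\<Sum>i<n. f i)" for n and f :: "nat \<Rightarrow> nat"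
    by (induction n) auto
  obtain P where P: "pb P" "\<And>N x e. bd N x e \<Longrightarrow> F x e (e d) \<le> P N"
    using pc_bound[OF F[OF le_refl]] by auto
  obtain Q where Q: "pb Q" "\<And>N x e. bd N x e \<Longrightarrow> B x e \<le> Q N" using pc_bound[OF B] by auto
  have "pc d (\<lambda>x e. rec_nat 0 (\<lambda>i v. v + F x e i) (B x e))"
  proof (rule pc_iter[OF pc_zero B])
    show "pc (k + 2) (\<lambda>x e. e (Suc k) + F x e (e k))" if "d \<le> k" for k
      by (intro pc_add pc_var pc_mono[OF F[OF that]]) auto
    show "v + F x e i = v + F x e' i" if "\<And>j. j < d \<Longrightarrow> e j = e' j" for x e e' i v
      using L[of e e', OF that] by simp
    show "pb (\<lambda>N. Q N * P (N + Q N))" by (intro pb_mult pb_comp[OF P(1), of "\<lambda>N. N + Q N"] pb_add pb_id Q)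
    fix N x e j assume bd: "bd N x e" and j: "j \<le> B x e"
    have "F x e i \<le> P (N + Q N)" if "i < j" for i
    proof -
      have "bd (N + Q N) x (e(d := i))"
        using bd that j Q(2)[OF bd] by (auto simp: bd_def intro: trans_le_add1)
      from P(2)[OF this] have "F x (e(d := i)) i \<le> P (N + Q N)" by simp
      moreover have "F x (e(d := i)) i = F x e i" by (rule L) auto
      ultimately show ?thesis by simp
    qed
    then have "(\<Sum>i<j. F x e i) \<le> j * P (N + Q N)" using sum_bounded_above[of "{..<j}" "F x e" "P (N + Q N)"] by simp
    also have "\<dots> \<le> Q N * P (N + Q N)" using j Q(2)[OF bd] by (intro mult_le_mono1) linarith
    finally show "rec_nat 0 (\<lambda>i v. v + F x e i) j \<le> Q N * P (N + Q N)" unfolding r .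
  qed
  then show ?thesis unfolding r .
qed

lemma pc_mult:
  assumes "pc d A" "pc d B"
  shows "pc d (\<lambda>x e. A x e * B x e)"
proof -
  have "pc d (\<lambda>x e. \<Sum>i<B x e. A x e)"
    by (rule pc_sum[OF assms(2)]) (auto intro: pc_mono[OF assms(1)] pc_local[OF assms(1)])
  then show ?thesis by (simp add: mult.commute)
qed

definition pcb :: "nat \<Rightarrow> (nat list \<Rightarrow> (nat \<Rightarrow> nat) \<Rightarrow> bool) \<Rightarrow> bool" where
  "pcb d Q \<longleftrightarrow> pc d (\<lambda>x e. of_bool (Q x e))"

lemma pc_of_bool: "pcb d Q \<Longrightarrow> pc d (\<lambda>x e. of_bool (Q x e))"
  by (simp add: pcb_def)

lemma pc_eqI:
  assumes "pc d F" "\<And>x e. F x e = F' x e"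
  shows "pc d F'"
proof -
  have "F = F'" by (intro ext assms(2))
  then show ?thesis using assms(1) by simp
qed

lemma pcb_less:
  assumes "pc d A" "pc d B"
  shows "pcb d (\<lambda>x e. A x e < B x e)"
  unfolding pcb_def
  by (rule pc_eqI[OF pc_sub[OF pc_const[of _ 1] pc_sub[OF pc_const[of _ 1] pc_sub[OF assms(2,1)]]]]) auto

lemma pcb_not:
  assumes "pcb d Q"
  shows "pcb d (\<lambda>x e. \<not> Q x e)"
  unfolding pcb_def by (rule pc_eqI[OF pc_sub[OF pc_const[of _ 1] pc_of_bool[OF assms]]]) auto

lemma pcb_conj:
  assumes "pcb d Q" "pcb d R"
  shows "pcb d (\<lambda>x e. Q x e \<and> R x e)"
  unfolding pcb_def by (rule pc_eqI[OF pc_mult[OF pc_of_bool[OF assms(1)] pc_of_bool[OF assms(2)]]]) auto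

lemma pcb_eqI:
  assumes "pcb d Q" "\<And>x e. Q x e = Q' x e"
  shows "pcb d Q'"
proof -
  have "Q = Q'" by (intro ext assms(2))
  then show ?thesis using assms(1) by simp
qed

lemma pcb_disj:
  assumes "pcb d Q" "pcb d R"
  shows "pcb d (\<lambda>x e. Q x e \<or> R x e)"
  by (rule pcb_eqI[OF pcb_not[OF pcb_conj[OF pcb_not[OF assms(1)] pcb_not[OF assms(2)]]]]) auto

lemma pcb_imp:
  assumes "pcb d Q" "pcb d R"
  shows "pcb d (\<lambda>x e. Q x e \<longrightarrow> R x e)"
  by (rule pcb_eqI[OF pcb_disj[OF pcb_not[OF assms(1)] assms(2)]]) auto

lemma pcb_le:
  assumes "pc d A" "pc d B"
  shows "pcb d (\<lambda>x e. A x e \<le> B x e)"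
  by (rule pcb_eqI[OF pcb_not[OF pcb_less[OF assms(2,1)]]]) auto

lemma pcb_eq:
  assumes "pc d A" "pc d B"
  shows "pcb d (\<lambda>x e. A x e = B x e)"
  by (rule pcb_eqI[OF pcb_conj[OF pcb_le[OF assms] pcb_le[OF assms(2,1)]]]) auto

lemma pcb_ex:
  assumes "pc d B" "\<And>k. d \<le> k \<Longrightarrow> pcb (Suc k) (\<lambda>x e. F x e (e k))"
    "\<And>x e e' i. (\<And>j. j < d \<Longrightarrow> e j = e' j) \<Longrightarrow> F x e i = F x e' i"
  shows "pcb d (\<lambda>x e. \<exists>i<B x e. F x e i)"
proof -
  have s: "pc d (\<lambda>x e. \<Sum>i<B x e. of_bool (F x e i))"
  proof (rule pc_sum[OF assms(1)])
    show "pc (Suc k) (\<lambda>x e. of_bool (F x e (e k)))" if "d \<le> k" for k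
      by (rule pc_of_bool[OF assms(2)[OF that]])
    show "of_bool (F x e i) = (of_bool (F x e' i) :: nat)" if "\<And>j. j < d \<Longrightarrow> e j = e' j" for x e e' i
      using assms(3)[of e e', OF that] by simp
  qed
  have "0 < (\<Sum>i<n. of_bool (Q i) :: nat) \<longleftrightarrow> (\<exists>i<n. Q i)" for n :: nat and Q
    by (subst neq0_conv[symmetric], subst sum_eq_0_iff) auto
  then show ?thesis by (rule pcb_eqI[OF pcb_less[OF pc_const[of _ 0] s]])
qed

lemma pcb_all:
  assumes "pc d B" "\<And>k. d \<le> k \<Longrightarrow> pcb (Suc k) (\<lambda>x e. F x e (e k))"
    "\<And>x e e' i. (\<And>j. j < d \<Longrightarrow> e j = e' j) \<Longrightarrow> F x e i = F x e' i"
  shows "pcb d (\<lambda>x e. \<forall>i<B x e. F x e i)"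
proof -
  have "pcb d (\<lambda>x e. \<exists>i<B x e. \<not> F x e i)"
  proof (rule pcb_ex[OF assms(1)])
    show "pcb (Suc k) (\<lambda>x e. \<not> F x e (e k))" if "d \<le> k" for k
      by (rule pcb_not[OF assms(2)[OF that]])
    show "(\<not> F x e i) = (\<not> F x e' i)" if "\<And>j. j < d \<Longrightarrow> e j = e' j" for x e e' i
      using assms(3)[of e e', OF that] by simp
  qed
  from pcb_not[OF this] show ?thesis by (rule pcb_eqI) simp
qed

lemma pc_if:
  assumes "pcb d Q" "pc d A" "pc d B"
  shows "pc d (\<lambda>x e. if Q x e then A x e else B x e)"
  by (rule pc_eqI[OF pc_add[OF pc_mult[OF pc_of_bool[OF assms(1)] assms(2)]
     pc_mult[OF pc_of_bool[OF pcb_not[OF assms(1)]] assms(3)]]]) auto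

lemma pc_min: "pc d A \<Longrightarrow> pc d B \<Longrightarrow> pc d (\<lambda>x e. min (A x e) (B x e))"
  unfolding min_def by (intro pc_if pcb_le)

lemma pc_app1:
  assumes "\<And>d i. i < d \<Longrightarrow> pc d (\<lambda>x e. f x (e i))" "pc d A"
  shows "pc d (\<lambda>x e. f x (A x e))"
  by (rule pc_let[OF assms(2), where F = "\<lambda>x e. f x"]) (auto intro: assms(1))

lemma pc_app2:
  assumes "\<And>d i j. i < d \<Longrightarrow> j < d \<Longrightarrow> pc d (\<lambda>x e. f x (e i) (e j))" "pc d A" "pc d B"
  shows "pc d (\<lambda>x e. f x (A x e) (B x e))"
proof (rule pc_let[OF assms(2), where F = "\<lambda>x e i. f x i (B x e)"])
  show "pc (Suc k) (\<lambda>x e. f x (e k) (B x e))" if "d \<le> k" for k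
    by (rule pc_let[OF pc_mono[OF assms(3)], where F = "\<lambda>x e. f x (e k)"]) (use that in \<open>auto intro: assms(1)\<close>)
  show "f x i (B x e) = f x i (B x e')" if "\<And>j. j < d \<Longrightarrow> e j = e' j" for x e e' i
    using pc_local[OF assms(3), of e e' x] that by simp
qed

lemma pc_app3:
  assumes "\<And>d i j l. i < d \<Longrightarrow> j < d \<Longrightarrow> l < d \<Longrightarrow> pc d (\<lambda>x e. f x (e i) (e j) (e l))"
    "pc d A" "pc d B" "pc d C"
  shows "pc d (\<lambda>x e. f x (A x e) (B x e) (C x e))"
proof (rule pc_let[OF assms(2), where F = "\<lambda>x e i. f x i (B x e) (C x e)"])
  show "pc (Suc k) (\<lambda>x e. f x (e k) (B x e) (C x e))" if "d \<le> k" for k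
  proof (rule pc_let[OF pc_mono[OF assms(3)], where F = "\<lambda>x e i. f x (e k) i (C x e)"])
    show "d \<le> Suc k" using that by simp
    show "pc (Suc k') (\<lambda>x e. f x (e k) (e k') (C x e))" if k': "Suc k \<le> k'" for k'
      by (rule pc_let[OF pc_mono[OF assms(4)], where F = "\<lambda>x e. f x (e k) (e k')"])
        (use that \<open>d \<le> k\<close> in \<open>auto intro: assms(1)\<close>)
    show "f x (e k) i (C x e) = f x (e' k) i (C x e')" if "\<And>j. j < Suc k \<Longrightarrow> e j = e' j" for x e e' i
      using pc_local[OF assms(4), of e e' x] that \<open>d \<le> k\<close> by simp
  qed
  show "f x i (B x e) (C x e) = f x i (B x e') (C x e')" if "\<And>j. j < d \<Longrightarrow> e j = e' j" for x e e' i
    using pc_local[OF assms(3), of e e' x] pc_local[OF assms(4), of e e' x] that by simp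
qed

text \<open>The quotient counts the positive multiples of the divisor that do not exceed the
  dividend; the guard \<open>0 < e j\<close> makes the count 0 for divisor 0, in agreement with
  \<open>div\<close>.\<close>

lemma pc_div_var:
  assumes "i < d" "j < d"
  shows "pc d (\<lambda>x e. e i div e j)"
proof -
  have "(\<Sum>k<a. of_bool (0 < b \<and> Suc k * b \<le> a)) = a div b" for a b :: nat
  proof (cases "b = 0")
    case False
    have "{k. k < a \<and> Suc k * b \<le> a} = {..<a div b}"
    proof (intro set_eqI iffI)
      fix k assume "k \<in> {..<a div b}"
      then have "Suc k \<le> a div b" by simp
      then have "Suc k * b \<le> a" using False by (simp add: less_eq_div_iff_mult_less_eq)
      moreover from this have "k < a" using False by (cases b) auto
      ultimately show "k \<in> {k. k < a \<and> Suc k * b \<le> a}" by simp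
    qed (use False in \<open>auto simp: less_eq_div_iff_mult_less_eq Suc_le_eq[symmetric]\<close>)
    moreover have "{..<a} \<inter> {k. 0 < b \<and> Suc k * b \<le> a} = {k. k < a \<and> Suc k * b \<le> a}" using False by auto
    ultimately show ?thesis by (simp add: sum_of_bool_eq)
  qed auto
  moreover have "pc d (\<lambda>x e. \<Sum>k<e i. of_bool (0 < e j \<and> Suc k * e j \<le> e i))"
    by (rule pc_sum; (intro pc_of_bool pcb_conj pcb_less pcb_le pc_mult pc_Suc pc_var pc_const)?; use assms in simp)
  ultimately show ?thesis by simp
qed

lemma pc_div: "pc d A \<Longrightarrow> pc d B \<Longrightarrow> pc d (\<lambda>x e. A x e div B x e)"
  by (rule pc_app2[of "\<lambda>x a b. a div b"]) (rule pc_div_var)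

lemma pc_mod:
  assumes "pc d A" "pc d B"
  shows "pc d (\<lambda>x e. A x e mod B x e)"
proof -
  have "a mod b = a - a div b * b" for a b :: nat by (simp add: minus_div_mult_eq_mod)
  then show ?thesis by (intro pc_eqI[OF pc_sub[OF assms(1) pc_mult[OF pc_div[OF assms] assms(2)]]]) simp
qed

text \<open>Bounded search written as a sum: index \<open>i\<close> contributes as long as no
  witness up to \<open>i\<close> has appeared. Without a witness below \<open>n\<close> the result
  is \<open>n\<close>.\<close>

definition first :: "nat \<Rightarrow> (nat \<Rightarrow> bool) \<Rightarrow> nat" where
  "first n Q = (\<Sum>i<n. of_bool (\<forall>j<Suc i. \<not> Q j))"

lemma first_eq:
  assumes "m < n" "Q m"
  shows "first n Q = (LEAST m. Q m)"
proof -
  let ?l = "LEAST m. Q m"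
  have "Q ?l" using assms(2) by (rule LeastI)
  have "?l \<le> m" using assms(2) by (rule Least_le)
  have "{..<n} \<inter> {i. \<forall>j<Suc i. \<not> Q j} = {..<?l}"
  proof (intro set_eqI iffI)
    fix i assume i: "i \<in> {..<n} \<inter> {i. \<forall>j<Suc i. \<not> Q j}"
    have "\<not> ?l < Suc i" using i \<open>Q ?l\<close> by blast
    then show "i \<in> {..<?l}" by simp
  next
    fix i assume i: "i \<in> {..<?l}"
    have "\<not> Q j" if "j < Suc i" for j using i that by (intro not_less_Least) simp
    moreover have "i < n" using i \<open>?l \<le> m\<close> assms(1) by simp
    ultimately show "i \<in> {..<n} \<inter> {i. \<forall>j<Suc i. \<not> Q j}" by blast
  qed
  then show ?thesis unfolding first_def by (simp add: sum_of_bool_eq)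
qed

lemma pc_first:
  assumes "pc d B" "\<And>k. d \<le> k \<Longrightarrow> pcb (Suc k) (\<lambda>x e. F x e (e k))"
    "\<And>x e e' i. (\<And>j. j < d \<Longrightarrow> e j = e' j) \<Longrightarrow> F x e i = F x e' i"
  shows "pc d (\<lambda>x e. first (B x e) (F x e))"
  unfolding first_def
proof (rule pc_sum[OF assms(1)])
  fix k assume k: "d \<le> k"
  show "pc (Suc k) (\<lambda>x e. of_bool (\<forall>j<Suc (e k). \<not> F x e j))"
  proof (intro pc_of_bool pcb_all pc_Suc pc_var pcb_not)
    show "pcb (Suc k') (\<lambda>x e. F x e (e k'))" if "Suc k \<le> k'" for k'
      by (rule assms(2)) (use k that in simp)
    show "(\<not> F x e i) = (\<not> F x e' i)" if "\<And>j. j < Suc k \<Longrightarrow> e j = e' j" for x e e' i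
    proof -
      have "F x e i = F x e' i" by (rule assms(3)) (use k that in simp)
      then show ?thesis by simp
    qed
  qed simp
next
  fix x e e' i assume "\<And>j. j < d \<Longrightarrow> e j = (e' j::nat)"
  then have "F x e = F x e'" using assms(3) by blast
  then show "of_bool (\<forall>j<Suc i. \<not> F x e j) = (of_bool (\<forall>j<Suc i. \<not> F x e' j) :: nat)" by simp
qed

definition ahead :: "nat \<Rightarrow> nat \<Rightarrow> prog" where
  "ahead b k = Do (\<lambda>r i. (r i, if i = 0 \<or> i = b + k \<or> i = b + Suc k then Move_Right else Stay))"

lemma exec_ahead:
  assumes "1 \<le> b"
  shows "exec (ahead b k) (lay b x h \<tau> e) 1 (lay b x (h + 1) \<tau> (e(k := Suc (e k), Suc k := Suc (e (Suc k)))))"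
proof -
  have "app (\<lambda>i. (rd (lay b x h \<tau> e) i, if i = 0 \<or> i = b + k \<or> i = b + Suc k then Move_Right else Stay))
      (lay b x h \<tau> e) = lay b x (h + 1) \<tau> (e(k := Suc (e k), Suc k := Suc (e (Suc k))))" (is "?l = ?r")
  proof
    fix i
    show "?l i = ?r i" unfolding app_def act_move
      using assms by (auto simp: lay_def cnt_def)
  qed
  then show ?thesis unfolding ahead_def by (rule exec_DoI)
qed

lemma exec_ahead_loop:
  assumes "1 \<le> b" "0 \<notin> set x" "h + n = length x"
  shows "exec (While (\<lambda>r. r 0 \<noteq> 0) (ahead b k)) (lay b x (int h) \<tau> e) (2 * n + 1)
    (lay b x (int (length x)) \<tau> (e(k := e k + n, Suc k := e (Suc k) + n)))"
  using assms(3)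
proof (induction n arbitrary: h e)
  case 0
  have "\<not> rd (lay b x (int h) \<tau> e) 0 \<noteq> 0" using 0 by (simp add: rd_lay word_tape_def)
  from exec.WhileF[of "\<lambda>r. r 0 \<noteq> 0", OF this] show ?case using 0 by simp
next
  case (Suc n)
  let ?e = "e(k := Suc (e k), Suc k := Suc (e (Suc k)))"
  have h: "h < length x" using Suc.prems by simp
  have "x ! h \<noteq> 0" using nth_mem[OF h] assms(2) by metis
  then have c: "rd (lay b x (int h) \<tau> e) 0 \<noteq> 0" using h by (simp add: rd_lay word_tape_def)
  have r: "exec (While (\<lambda>r. r 0 \<noteq> 0) (ahead b k)) (lay b x (int h + 1) \<tau> ?e) (2 * n + 1)
    (lay b x (int (length x)) \<tau> (?e(k := ?e k + n, Suc k := ?e (Suc k) + n)))"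
  proof -
    have "int h + 1 = int (Suc h)" by simp
    then show ?thesis using Suc.prems by (simp only:) (rule Suc.IH, simp)
  qed
  have eq: "?e(k := ?e k + n, Suc k := ?e (Suc k) + n) = e(k := e k + Suc n, Suc k := e (Suc k) + Suc n)"
    by auto
  show ?case
    by (rule exec_cong[OF exec.WhileT[of "\<lambda>r. r 0 \<noteq> 0", OF c exec_ahead[OF assms(1)] r]])
      (simp, simp only: eq)
qed

lemma pc_len: "pc d (\<lambda>x e. length x)"
  unfolding pc_def
proof (intro conjI allI impI)
  fix b k :: nat assume b: "1 \<le> b" and k: "d \<le> k"
  let ?q = "Seq (While (\<lambda>r. r 0 \<noteq> 0) (ahead b k)) (While (nz b (Suc k)) (head Move_Left b (Suc k) (Suc (Suc k))))"
  have q: "runs b ?q (\<lambda>x e. \<forall>i\<ge>k. e i = 0) (\<lambda>x e. e(k := length x, Suc (Suc k) := length x))"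
  proof (rule runsI[where P = "\<lambda>N. 4 * N + 2" and Q = "\<lambda>N. N"])
    show "pb (\<lambda>N. 4 * N + 2)" "pb (\<lambda>N. N)" by (intro pb_add pb_mult pb_id pb_const)+
    fix N x e \<tau> assume bd: "bd N x e" and z: "\<forall>i\<ge>k. e i = (0::nat)"
    have nz: "0 \<notin> set x" using bd by (auto simp: bd_def)
    let ?e2 = "e(k := e k + length x, Suc k := e (Suc k) + length x)"
    let ?e3 = "e(k := length x, Suc (Suc k) := length x)"
    have 1: "exec (While (\<lambda>r. r 0 \<noteq> 0) (ahead b k)) (lay b x 0 \<tau> e) (2 * length x + 1)
        (lay b x (int (length x)) \<tau> ?e2)"
      using exec_ahead_loop[OF b nz, of 0 "length x" k \<tau> e] by simp
    have "?e2(Suc k := 0, Suc (Suc k) := ?e2 (Suc (Suc k)) + ?e2 (Suc k)) = ?e3"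
      using z by (auto simp: fun_eq_iff)
    then have 3: "exec (While (nz b (Suc k)) (head Move_Left b (Suc k) (Suc (Suc k))))
        (lay b x (int (length x)) \<tau> ?e2) (2 * length x + 1) (lay b x 0 \<tau> ?e3)"
      using exec_head_loop[OF b, of "Suc k" "Suc (Suc k)" Move_Left x "int (length x)" \<tau> ?e2] z by simp
    have "4 * length x + 2 \<le> 4 * N + 2" using bd by (simp add: bd_def)
    moreover have "exec ?q (lay b x 0 \<tau> e) (4 * length x + 2) (lay b x 0 \<tau> ?e3)"
      by (rule exec_cong[OF exec.Seq[OF 1 3]]) simp_all
    ultimately show "\<exists>t\<le>4 * N + 2. exec ?q (lay b x 0 \<tau> e) t (lay b x 0 \<tau> ?e3)" by blast
    show "?e3 i \<le> N" for i using bd by (auto simp: bd_def)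
  qed
  let ?p = "Seq ?q (clear b (Suc (Suc k)))"
  have "finc (\<lambda>r. r 0 \<noteq> 0)" unfolding finc_def agree_def by (rule exI[of _ 1]) auto
  moreover have "okp (ahead b k)" unfolding ahead_def by (rule okp_Do) (auto simp: plain_def)
  ultimately have "okp ?p" by (intro okp_intros okp_clear okp_head)
  moreover have "runs b ?p (\<lambda>x e. \<forall>i\<ge>k. e i = 0) (\<lambda>x e. e(k := length x))"
    by (rule runs_conseq[OF runs_seq[OF q runs_clear[OF b]]]) (auto simp: fun_eq_iff)
  ultimately show "\<exists>p. okp p \<and> runs b p (\<lambda>x e. \<forall>i\<ge>k. e i = 0) (\<lambda>x e. e(k := length x))"
    by (intro exI conjI)
qed auto

section \<open>Machines for reductions\<close>

definition push :: "nat \<Rightarrow> store \<Rightarrow> store" where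
  "push s \<tau> = \<tau>(1 := act (s, Move_Right) (\<tau> 1))"

definition wr :: "nat list \<Rightarrow> store \<Rightarrow> store" where
  "wr ws \<tau> = fold push ws \<tau>"

lemma wr_simps [simp]: "wr [] \<tau> = \<tau>" "wr (a @ c) \<tau> = wr c (wr a \<tau>)" "wr [s] \<tau> = push s \<tau>"
  by (auto simp: wr_def)

definition put :: "nat \<Rightarrow> prog" where
  "put s = Do (on 1 (\<lambda>_. (s, Move_Right)))"

lemma lay_push:
  "2 \<le> b \<Longrightarrow> (lay b x h \<tau> e)(1 := act (s, Move_Right) (lay b x h \<tau> e 1)) = lay b x h (push s \<tau>) e"
  by (auto simp: lay_def push_def fun_eq_iff)

lemma exec_put: "2 \<le> b \<Longrightarrow> exec (put s) (lay b x h \<tau> e) 1 (lay b x h (push s \<tau>) e)"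
  unfolding put_def by (rule exec_DoI) (simp only: app_on lay_push)

lemma okp_put: "s \<le> 5 \<Longrightarrow> okp (put s)"
  unfolding put_def by (rule okp_Do) (auto simp: plain_def on_def)

text \<open>Emit the symbol \<open>j + v\<close>, where \<open>v\<close> is the content of register \<open>r\<close>; nothing for the blank.\<close>

fun em :: "nat \<Rightarrow> nat \<Rightarrow> nat \<Rightarrow> nat \<Rightarrow> prog" where
  "em b r 0 j = (if j = 0 then Do idle else put j)"
| "em b r (Suc m) j = Cond (nz b r) (Seq (dec b r) (em b r m (Suc j))) (if j = 0 then Do idle else put j)"

definition letter :: "nat \<Rightarrow> nat list" where
  "letter s = (if s = 0 then [] else [s])"

lemma okp_em: "j + m \<le> 5 \<Longrightarrow> okp (em b r m j)"
  by (induction m arbitrary: j) (auto intro!: okp_intros okp_put okp_skip)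

lemma exec_em:
  assumes "2 \<le> b" "e r \<le> m"
  shows "exec (em b r m j) (lay b x h \<tau> e) (if e r = m then 2 * m + 1 else 2 * e r + 2)
    (lay b x h (wr (letter (j + e r)) \<tau>) (e(r := 0)))"
  using assms(2)
proof (induction m arbitrary: j e)
  case 0
  then have "e(r := 0) = e" "e r = 0" by auto
  then show ?case using exec_skip exec_put[OF assms(1)] by (simp add: letter_def)
next
  case (Suc m)
  have b: "1 \<le> b" using assms(1) by simp
  show ?case
  proof (cases "e r = 0")
    case True
    then have "e(r := 0) = e" by auto
    moreover have "exec (if j = 0 then Do idle else put j) (lay b x h \<tau> e) 1 (lay b x h (wr (letter j) \<tau>) e)"
      using exec_skip exec_put[OF assms(1)] by (simp add: letter_def)
    from exec.CondF[of "nz b r", OF _ this]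
    have "exec (em b r (Suc m) j) (lay b x h \<tau> e) (Suc 1) (lay b x h (wr (letter j) \<tau>) e)"
      using b True by simp
    ultimately show ?thesis using True by simp
  next
    case False
    let ?e = "e(r := e r - 1)"
    have "?e r \<le> m" using Suc.prems by simp
    with Suc.IH[where e = ?e and j = "Suc j"]
    have 1: "exec (em b r m (Suc j)) (lay b x h \<tau> ?e) (if ?e r = m then 2 * m + 1 else 2 * ?e r + 2)
      (lay b x h (wr (letter (Suc j + ?e r)) \<tau>) (?e(r := 0)))" by blast
    have 2: "nz b r (rd (lay b x h \<tau> e))" using b False by simp
    have eq: "?e(r := 0) = e(r := 0)" "Suc j + ?e r = j + e r" using False by auto
    show ?thesis unfolding em.simps
    proof (rule exec_cong[OF exec.CondT[of "nz b r", OF 2 exec.Seq[OF exec_dec[where e = e and j = r, OF b False] 1]]])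
      show "Suc (1 + (if ?e r = m then 2 * m + 1 else 2 * ?e r + 2)) =
          (if e r = Suc m then 2 * Suc m + 1 else 2 * e r + 2)"
        using False Suc.prems by auto
    qed (simp only: eq)
  qed
qed

lemma runsg_em:
  assumes "2 \<le> b"
  shows "runsg b (em b r 5 0) (\<lambda>x e. e r \<le> 5) (\<lambda>x e. e(r := 0)) (\<lambda>x e. wr (letter (e r)))"
proof (rule runsI[where P = "\<lambda>_. 12" and Q = "\<lambda>N. N"])
  fix N x \<tau> e assume e: "bd N x e" "e r \<le> (5::nat)"
  from exec_em[where e = e and m = 5 and j = 0 and r = r and x = x and h = 0 and \<tau> = \<tau>, OF assms e(2)] e(2)
  show "\<exists>t\<le>12. exec (em b r 5 0) (lay b x 0 \<tau> e) t (lay b x 0 (wr (letter (e r)) \<tau>) (e(r := 0)))"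
    by (intro exI[of _ "if e r = 5 then 2 * 5 + 1 else 2 * e r + 2"]) (simp split: if_splits)
qed (auto simp: bd_def)

lemma binary_rec: "v \<noteq> 0 \<Longrightarrow> binary v = (1 + v mod 2) # binary (v div 2)" "binary 0 = []"
  by (subst binary.simps; simp)+

lemma length_binary_le: "length (binary v) \<le> v"
proof (induction v rule: less_induct)
  case (less v)
  show ?case
  proof (cases "v = 0")
    case False
    then have "v div 2 < v" by simp
    with less.IH[OF this] False show ?thesis by (simp add: binary_rec(1))
  qed (simp add: binary_rec)
qed

text \<open>This serves twice: it ends the loop that prints the digits, and it reduces the
  comparison of a number with a power of two to counting halvings.\<close>

lemma div_binary: "v div 2 ^ j = 0 \<longleftrightarrow> length (binary v) \<le> j"
proof (induction j arbitrary: v)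
  case 0
  then show ?case by (cases "v = 0") (auto simp: binary_rec)
next
  case (Suc j)
  have "v div 2 ^ Suc j = v div 2 div 2 ^ j" by (simp add: div_mult2_eq)
  then show ?case using Suc.IH[of "v div 2"] by (cases "v = 0") (auto simp: binary_rec)
qed

lemma binary_nth: "j < length (binary v) \<Longrightarrow> binary v ! j = 1 + v div 2 ^ j mod 2"
proof (induction j arbitrary: v)
  case 0
  then show ?case by (cases "v = 0") (auto simp: binary_rec)
next
  case (Suc j)
  then have v: "v \<noteq> 0" by (cases "v = 0") (auto simp: binary_rec)
  then show ?case using Suc.IH[of "v div 2"] Suc.prems by (simp add: binary_rec(1) div_mult2_eq)
qed

lemma binout:
  assumes "2 \<le> b"
  obtains p where "okp p" "runsg b p (\<lambda>x e. \<forall>i>k. e i = 0) (\<lambda>x e. e(k := 0)) (\<lambda>x e. wr (binary (e k)))"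
proof -
  have b: "1 \<le> b" using assms by simp
  have c: "pc (Suc k) (\<lambda>x e. 1 + e k mod 2)" "pc (Suc k) (\<lambda>x e. e k div 2)"
    by (intro pc_add pc_mod pc_div pc_var pc_const; simp)+
  obtain p1 where p1: "okp p1"
      "runs b p1 (\<lambda>x e. \<forall>i\<ge>Suc k. e i = 0) (\<lambda>x e. e(Suc k := 1 + e k mod 2))"
    by (rule pc_prog[OF c(1) b le_refl])
  obtain p2 where p2: "okp p2" "runs b p2 (\<lambda>x e. \<forall>i\<ge>Suc k. e i = 0) (\<lambda>x e. e(Suc k := e k div 2))"
    by (rule pc_prog[OF c(2) b le_refl])
  let ?body = "Seq p1 (Seq (em b (Suc k) 5 0) (Seq p2 (Seq (clear b k) (move b (Suc k) k))))"
  let ?I = "\<lambda>x e. \<forall>i>k. e i = 0"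
  have body: "runsg b ?body ?I (\<lambda>x e. e(k := e k div 2)) (\<lambda>x e. wr [1 + e k mod 2])"
    by (rule runs_conseq_out[OF runs_conseq[OF runsg_seq[OF p1(2) runsg_seq[OF runsg_em[OF assms]
       runsg_seq[OF p2(2) runsg_seq[OF runs_clear[OF b] runs_move[OF b]]]]]]])
      (auto simp: letter_def fun_eq_iff)
  have "runsg b (While (nz b k) ?body) ?I (\<lambda>x e. e(k := e k div 2 ^ length (binary (e k))))
     (\<lambda>x e \<tau>. wr (take (length (binary (e k))) (binary (e k))) \<tau>)"
  proof (rule runsg_While[OF b body, where n = "\<lambda>x e. length (binary (e k))" and Q = "\<lambda>N. N"
        and ts = "\<lambda>x e \<tau> j. wr (take j (binary (e k))) \<tau>" and st = "\<lambda>x e j. e(k := e k div 2 ^ j)"])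
    fix x e j \<tau> assume "?I x e" and j: "j < length (binary (e k))"
    have "take (Suc j) (binary (e k)) = take j (binary (e k)) @ [1 + e k div 2 ^ j mod 2]"
      using j by (simp add: take_Suc_conv_app_nth binary_nth)
    then show "wr [1 + (e(k := e k div 2 ^ j)) k mod 2] (wr (take j (binary (e k))) \<tau>) =
        wr (take (Suc j) (binary (e k))) \<tau>" by simp
  next
    fix N x e j i assume "bd N x e"
    then show "(e(k := e k div 2 ^ j)) i \<le> N"
      by (auto simp: bd_def intro: order_trans[OF div_le_dividend])
  next
    fix N x e assume "bd N x e"
    then show "length (binary (e k)) \<le> N" using order_trans[OF length_binary_le bd_le] by blast
  qed (auto simp: div_binary fun_eq_iff div_mult2_eq[symmetric] mult.commute)
  then have "runsg b (While (nz b k) ?body) ?I (\<lambda>x e. e(k := 0)) (\<lambda>x e. wr (binary (e k)))"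
    using iffD2[OF div_binary order_refl] by simp
  moreover have "okp (While (nz b k) ?body)"
    by (intro okp_intros p1 p2 okp_em okp_clear okp_move) simp
  ultimately show ?thesis using that by blast
qed

text \<open>Every index contributes at most one symbol and then a numeral. Encoded formulas have
  this form: a literal is a sign followed by its variable, and the end of a clause is a symbol
  followed by the empty word \<open>binary 0\<close>.\<close>

definition stream :: "(nat \<Rightarrow> nat) \<Rightarrow> (nat \<Rightarrow> nat) \<Rightarrow> nat \<Rightarrow> nat list" where
  "stream kap num n = concat (map (\<lambda>i. letter (kap i) @ binary (num i)) [0..<n])"

lemma stream_out:
  assumes "2 \<le> b" and I: "pc 0 (\<lambda>x e. I x)"
    and K: "\<And>d i. i < d \<Longrightarrow> pc d (\<lambda>x e. kap x (e i))" and N: "\<And>d i. i < d \<Longrightarrow> pc d (\<lambda>x e. num x (e i))"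
    and le: "\<And>x i. kap x i \<le> 5"
  obtains p where "okp p" "runsg b p (\<lambda>x e. \<forall>i. e i = 0) (\<lambda>x e. e)
    (\<lambda>x e. wr (stream (kap x) (num x) (I x)))"
proof -
  have b: "1 \<le> b" using assms by simp
  obtain pI where pI: "okp pI" "runs b pI (\<lambda>x e. \<forall>i\<ge>0. e i = 0) (\<lambda>x e. e(0 := I x))"
    by (rule pc_prog[OF I b le_refl])
  obtain pK where pK: "okp pK" "runs b pK (\<lambda>x e. \<forall>i\<ge>2. e i = 0) (\<lambda>x e. e(2 := kap x (e 1)))"
    by (rule pc_prog[OF K[of 1 2] b le_refl]) simp
  obtain pN where pN: "okp pN" "runs b pN (\<lambda>x e. \<forall>i\<ge>2. e i = 0) (\<lambda>x e. e(2 := num x (e 1)))"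
    by (rule pc_prog[OF N[of 1 2] b le_refl]) simp
  obtain pB where pB: "okp pB"
    "runsg b pB (\<lambda>x e. \<forall>i>2. e i = 0) (\<lambda>x e. e(2 := 0)) (\<lambda>x e. wr (binary (e 2)))"
    by (rule binout[OF assms(1)])
  let ?body = "Seq pK (Seq (em b 2 5 0) (Seq pN (Seq pB (Seq (inc b 1) (dec b 0)))))"
  have body: "runsg b ?body (\<lambda>x e. e 0 \<noteq> 0 \<and> (\<forall>i\<ge>2. e i = 0)) (\<lambda>x e. e(1 := Suc (e 1), 0 := e 0 - 1))
     (\<lambda>x e. wr (letter (kap x (e 1)) @ binary (num x (e 1))))"
    by (rule runs_conseq_out[OF runs_conseq[OF runsg_seq[OF pK(2) runsg_seq[OF runsg_em[OF assms(1)]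
       runsg_seq[OF pN(2) runsg_seq[OF pB(2) runs_seq[OF runs_inc[OF b] runs_dec[OF b]]]]]]]])
      (use le in \<open>auto simp: fun_eq_iff\<close>)
  have loop: "runsg b (While (nz b 0) ?body) (\<lambda>x e. \<forall>i\<ge>1. e i = 0) (\<lambda>x e. e(1 := e 0, 0 := e 0 - e 0))
     (\<lambda>x e \<tau>. wr (stream (kap x) (num x) (e 0)) \<tau>)"
  proof (rule runsg_While[OF b body, where n = "\<lambda>x e. e 0" and Q = "\<lambda>N. N"
        and ts = "\<lambda>x e \<tau> j. wr (stream (kap x) (num x) j) \<tau>" and st = "\<lambda>x e j. e(1 := j, 0 := e 0 - j)"])
    show "(e(1 := j, 0 := e 0 - j)) i \<le> N" if "bd N x e" "j \<le> e 0" for N x e j i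
      using bd_le[OF that(1), of i] bd_le[OF that(1), of 0] that(2) by auto
    show "e 0 \<le> N" if "bd N x e" for N x e using that by (rule bd_le)
  qed (auto simp: stream_def fun_eq_iff)
  let ?p = "Seq pI (Seq (While (nz b 0) ?body) (clear b 1))"
  have "okp ?p" by (intro okp_intros okp_em okp_clear pI pK pN pB) simp
  moreover have "runsg b ?p (\<lambda>x e. \<forall>i. e i = 0) (\<lambda>x e. e) (\<lambda>x e. wr (stream (kap x) (num x) (I x)))"
    by (rule runs_conseq_out[OF runs_conseq[OF runsg_seq[OF pI(2) runsg_seq[OF loop runs_clear[OF b]]]]])
      (auto simp: fun_eq_iff)
  ultimately show ?thesis using that by blast
qed

lemma read_head_eq: "read_head tp = fst tp (snd tp)"
  by (cases tp) simp

text \<open>Used to bound the length of a written word by the time spent on writing it.\<close>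

lemma exec_head_pos: "exec p \<sigma> t \<sigma>' \<Longrightarrow> \<bar>snd (\<sigma>' i) - snd (\<sigma> i)\<bar> \<le> int t"
proof (induction rule: exec.induct)
  case (Do d \<sigma>)
  have "\<bar>shift m\<bar> \<le> 1" for m by (cases m) auto
  then show ?case by (cases "\<sigma> i"; cases "d (rd \<sigma>) i") (auto simp: app_def)
next
  case (Seq p \<sigma> t \<sigma>1 p' t' \<sigma>2)
  then show ?case by linarith
next
  case (WhileT c \<sigma> p t \<sigma>1 t' \<sigma>2)
  then show ?case by linarith
qed linarith+

section \<open>Simulation of a given machine\<close>

definition valid :: "tm \<Rightarrow> config \<Rightarrow> bool" where
  "valid M c \<longleftrightarrow> fst c < states M \<and> length (snd c) = tapes M \<and>
     (\<forall>tp \<in> set (snd c). \<forall>j. fst tp j < symbols M)"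

text \<open>The tapes of \<open>M\<close> are the tapes from 1 to \<open>tapes M\<close>, and its
  state is a symbol on the next tape. Registers 1 and 2 hold the position of its first head as a
  difference of two naturals; afterwards this brings the head back to the start of the output.
  Readings that no configuration of \<open>M\<close> produces are left unchanged, which keeps the
  action well-formed.\<close>

definition sim :: "tm \<Rightarrow> nat \<Rightarrow> (nat \<Rightarrow> nat) \<Rightarrow> nat \<Rightarrow> nat \<times> head_move" where
  "sim M b r i =
    (if r (Suc (tapes M)) < states M \<and> (\<forall>j<tapes M. r (Suc j) < symbols M) then
       (case trans M (r (Suc (tapes M))) (map (\<lambda>j. r (Suc j)) [0..<tapes M]) of (q', as) \<Rightarrow>
         if 1 \<le> i \<and> i \<le> tapes M then as ! (i - 1)
         else if i = Suc (tapes M) then (q', Stay)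
         else if i = b + 1 then (r i, case snd (as ! 0) of
             Move_Right \<Rightarrow> if r (b + 2) = 1 then Move_Right else Stay
           | Move_Left \<Rightarrow> if r (b + 1) = 1 then Stay else Move_Left | Stay \<Rightarrow> Stay)
         else if i = b + 2 then (r i, case snd (as ! 0) of
             Move_Right \<Rightarrow> if r (b + 2) = 1 then Stay else Move_Left
           | Move_Left \<Rightarrow> if r (b + 1) = 1 then Move_Right else Stay | Stay \<Rightarrow> Stay)
         else (r i, Stay))
     else (r i, Stay))"

lemma turing_trans:
  assumes "turing_machine M" "q < states M" "length ss = tapes M" "\<And>s. s \<in> set ss \<Longrightarrow> s < symbols M"
    "trans M q ss = (q', as)"
  shows "q' < states M" "length as = tapes M" "\<And>a. a \<in> set as \<Longrightarrow> fst a < symbols M"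
proof -
  have H: "\<forall>q < states M. \<forall>ss. length ss = tapes M \<and> set ss \<subseteq> {..<symbols M} \<longrightarrow>
      (case trans M q ss of (q', as) \<Rightarrow>
         q' < states M \<and> length as = tapes M \<and> fst ` set as \<subseteq> {..<symbols M})"
    using assms(1) unfolding turing_machine_def by (elim conjE)
  have "set ss \<subseteq> {..<symbols M}" using assms(4) by auto
  with H[rule_format, OF assms(2), of ss] assms(3,5)
  have R: "q' < states M" "length as = tapes M" "fst ` set as \<subseteq> {..<symbols M}" by auto
  show "q' < states M" "length as = tapes M" by fact+
  show "fst a < symbols M" if "a \<in> set as" for a using R(3) that by auto
qed

lemma wf_sim:
  assumes M: "turing_machine M" and K: "b + 3 \<le> K" "b = tapes M + 2"
    and g: "symbols M \<le> g" "states M \<le> g"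
  shows "wf_prog K g (Do (sim M b))"
  unfolding wf_prog.simps
proof (intro conjI allI impI)
  fix r i assume r: "\<forall>i<K. r i < g" and i: "i < K"
  obtain q' as where tr: "trans M (r (Suc (tapes M))) (map (\<lambda>j. r (Suc j)) [0..<tapes M]) = (q', as)"
    by fastforce
  show "fst (sim M b r i) < g"
  proof (cases "r (Suc (tapes M)) < states M \<and> (\<forall>j<tapes M. r (Suc j) < symbols M)")
    case True
    have "s < symbols M" if "s \<in> set (map (\<lambda>j. r (Suc j)) [0..<tapes M])" for s using that True by auto
    from turing_trans[OF M _ _ this tr] True
    have "q' < states M" "length as = tapes M" "\<And>a. a \<in> set as \<Longrightarrow> fst a < symbols M" by auto
    have X: "fst (as ! (i - 1)) < g" if "1 \<le> i" "i \<le> tapes M"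
    proof -
      have "i - 1 < length as" using that \<open>length as = tapes M\<close> by linarith
      then have "fst (as ! (i - 1)) < symbols M"
        using \<open>\<And>a. a \<in> set as \<Longrightarrow> fst a < symbols M\<close> nth_mem by blast
      then show ?thesis using g by simp
    qed
    have "fst (sim M b r i) =
      (if 1 \<le> i \<and> i \<le> tapes M then fst (as ! (i - 1)) else if i = Suc (tapes M) then q' else r i)"
      using True tr by (simp add: sim_def)
    then show ?thesis using X r i g \<open>q' < states M\<close> by auto
  qed (use r i in \<open>auto simp: sim_def\<close>)
next
  fix r r' i assume a: "agree K r r'" and i: "i < K"
  have E: "r (Suc (tapes M)) = r' (Suc (tapes M))" "r (b + 1) = r' (b + 1)" "r (b + 2) = r' (b + 2)" "r i = r' i"
    using a i K by (auto simp: agree_def)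
  have J: "\<And>j. j < tapes M \<Longrightarrow> r (Suc j) = r' (Suc j)" using a K by (auto simp: agree_def)
  then have mp: "map (\<lambda>j. r (Suc j)) [0..<tapes M] = map (\<lambda>j. r' (Suc j)) [0..<tapes M]" by simp
  have all: "(\<forall>j<tapes M. r (Suc j) < symbols M) = (\<forall>j<tapes M. r' (Suc j) < symbols M)" using J by auto
  show "sim M b r i = sim M b r' i" unfolding sim_def by (simp only: E mp all)
qed

definition tau :: "config \<Rightarrow> store" where
  "tau c i = (if 1 \<le> i \<and> i \<le> length (snd c) then snd c ! (i - 1)
     else (\<lambda>j. if i \<noteq> 0 \<and> j = 0 then fst c else 0, 0))"

lemma sim_step:
  assumes M: "turing_machine M" and b: "b = tapes M + 2" and v: "valid M c" and q: "fst c \<noteq> 1"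
    and p: "int (e 1) - int (e 2) = snd (snd c ! 0)"
  shows "\<exists>e'. exec (Do (sim M b)) (lay b x h (tau c) e) 1 (lay b x h (tau (step M c)) e') \<and>
    valid M (step M c) \<and> int (e' 1) - int (e' 2) = snd (snd (step M c) ! 0) \<and>
    (\<forall>i. i \<noteq> 1 \<and> i \<noteq> 2 \<longrightarrow> e' i = e i) \<and> e' 1 + e' 2 \<le> e 1 + e 2 + 1"
proof -
  obtain s ts where c: "c = (s, ts)" by fastforce
  let ?k = "tapes M" and ?\<sigma> = "lay b x h (tau c) e"
  have k: "1 \<le> ?k" using M by (simp add: turing_machine_def)
  have len: "length ts = ?k" and s: "s < states M" "s \<noteq> 1" and sy: "\<And>tp j. tp \<in> set ts \<Longrightarrow> fst tp j < symbols M"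
    using v q by (auto simp: valid_def c)
  obtain q' as where tr: "trans M s (map read_head ts) = (q', as)" by fastforce
  have rs: "t' < symbols M" if "t' \<in> set (map read_head ts)" for t'
  proof -
    obtain tp where "tp \<in> set ts" "t' = read_head tp" using \<open>t' \<in> set (map read_head ts)\<close> by auto
    then show ?thesis using sy[of tp "snd tp"] by (simp add: read_head_eq)
  qed
  have q': "q' < states M" and las: "length as = ?k" and as: "\<And>a. a \<in> set as \<Longrightarrow> fst a < symbols M"
    using turing_trans[OF M s(1) _ rs tr] len by auto
  have st: "step M c = (q', map2 act as ts)" using s tr by (simp add: step_def c)
  have r1: "rd ?\<sigma> (Suc j) = read_head (ts ! j)" if "j < ?k" for j
    using that b len by (simp add: rd_def lay_def tau_def c)
  have r2: "rd ?\<sigma> (Suc ?k) = s" using b len by (simp add: rd_def lay_def tau_def c)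
  have mp: "map (\<lambda>j. rd ?\<sigma> (Suc j)) [0..<?k] = map read_head ts"
    using r1 len by (auto intro: nth_equalityI)
  have ok: "rd ?\<sigma> (Suc ?k) < states M \<and> (\<forall>j<?k. rd ?\<sigma> (Suc j) < symbols M)"
    using r1 r2 s rs len by auto
  have r3: "rd ?\<sigma> (b + 1) = 1 \<longleftrightarrow> e 1 = 0" "rd ?\<sigma> (b + 2) = 1 \<longleftrightarrow> e 2 = 0"
    using b by (simp_all only: rd_lay(1)) auto
  define e' where "e' = (case snd (as ! 0) of
      Move_Right \<Rightarrow> if e 2 = 0 then e(1 := Suc (e 1)) else e(2 := e 2 - 1)
    | Move_Left \<Rightarrow> if e 1 = 0 then e(2 := Suc (e 2)) else e(1 := e 1 - 1) | Stay \<Rightarrow> e)"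
  have "app (sim M b (rd ?\<sigma>)) ?\<sigma> = lay b x h (tau (step M c)) e'"
  proof
    fix i
    have sim: "sim M b (rd ?\<sigma>) i = (if 1 \<le> i \<and> i \<le> ?k then as ! (i - 1)
         else if i = Suc ?k then (q', Stay)
         else if i = b + 1 then (rd ?\<sigma> i, case snd (as ! 0) of
             Move_Right \<Rightarrow> if e 2 = 0 then Move_Right else Stay
           | Move_Left \<Rightarrow> if e 1 = 0 then Stay else Move_Left | Stay \<Rightarrow> Stay)
         else if i = b + 2 then (rd ?\<sigma> i, case snd (as ! 0) of
             Move_Right \<Rightarrow> if e 2 = 0 then Stay else Move_Left
           | Move_Left \<Rightarrow> if e 1 = 0 then Move_Right else Stay | Stay \<Rightarrow> Stay)
         else (rd ?\<sigma> i, Stay))"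
      unfolding sim_def mp r2[symmetric] if_P[OF ok] r3 unfolding r2 tr by simp
    consider "1 \<le> i \<and> i \<le> ?k" | "i = Suc ?k" | "i = b + 1" | "i = b + 2" |
      "i = 0" | "b \<le> i" "i \<noteq> b + 1" "i \<noteq> b + 2" using b by linarith
    then show "app (sim M b (rd ?\<sigma>)) ?\<sigma> i = lay b x h (tau (step M c)) e' i"
    proof cases
      case 1
      then show ?thesis unfolding app_def sim st using b len las by (auto simp: lay_def tau_def c)
    next
      case 2
      then show ?thesis unfolding app_def sim st using b len las
        by (auto simp: lay_def tau_def c fun_eq_iff)
    next
      case 3
      have "?\<sigma> i = cnt (e 1)" "lay b x h (tau (step M c)) e' i = cnt (e' 1)" using 3 b by (auto simp: lay_def)
      moreover have "sim M b (rd ?\<sigma>) i = (rd ?\<sigma> i, case snd (as ! 0) of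
             Move_Right \<Rightarrow> if e 2 = 0 then Move_Right else Stay
           | Move_Left \<Rightarrow> if e 1 = 0 then Stay else Move_Left | Stay \<Rightarrow> Stay)"
        unfolding sim using 3 b by simp
      moreover from this have "app (sim M b (rd ?\<sigma>)) ?\<sigma> i = (fst (?\<sigma> i), snd (?\<sigma> i) + shift (snd (sim M b (rd ?\<sigma>) i)))"
        unfolding app_def by (simp only: act_move snd_conv)
      ultimately show ?thesis by (auto simp: e'_def cnt_def of_nat_diff split: head_move.splits)
    next
      case 4
      have "?\<sigma> i = cnt (e 2)" "lay b x h (tau (step M c)) e' i = cnt (e' 2)" using 4 b by (auto simp: lay_def)
      moreover have "sim M b (rd ?\<sigma>) i = (rd ?\<sigma> i, case snd (as ! 0) of
             Move_Right \<Rightarrow> if e 2 = 0 then Stay else Move_Left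
           | Move_Left \<Rightarrow> if e 1 = 0 then Move_Right else Stay | Stay \<Rightarrow> Stay)"
        unfolding sim using 4 b by simp
      moreover from this have "app (sim M b (rd ?\<sigma>)) ?\<sigma> i = (fst (?\<sigma> i), snd (?\<sigma> i) + shift (snd (sim M b (rd ?\<sigma>) i)))"
        unfolding app_def by (simp only: act_move snd_conv)
      ultimately show ?thesis by (auto simp: e'_def cnt_def of_nat_diff split: head_move.splits)
    next
      case 5
      then have "sim M b (rd ?\<sigma>) i = (rd ?\<sigma> i, Stay)" unfolding sim using b by simp
      then show ?thesis unfolding app_def using 5 by (simp only: act_move) (simp add: lay_def)
    next
      case 6
      then have "e' (i - b) = e (i - b)" by (auto simp: e'_def split: head_move.splits)
      moreover have "sim M b (rd ?\<sigma>) i = (rd ?\<sigma> i, Stay)" unfolding sim using 6 b by simp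
      ultimately show ?thesis unfolding app_def using 6 b by (simp only: act_move) (simp add: lay_def)
    qed
  qed
  then have "exec (Do (sim M b)) ?\<sigma> 1 (lay b x h (tau (step M c)) e')" by (rule exec_DoI)
  moreover have "valid M (step M c)"
  proof -
    have "fst (act a tp) j < symbols M" if "a \<in> set as" "tp \<in> set ts" for a tp j
      using as[OF that(1)] sy[OF that(2)] by (cases a; cases tp) (auto simp: fun_upd_def)
    then have "\<forall>tp\<in>set (map2 act as ts). \<forall>j. fst tp j < symbols M"
      by (auto simp del: act.simps) (metis set_zip_leftD set_zip_rightD)
    then show ?thesis using q' las len unfolding valid_def st by simp
  qed
  moreover have "int (e' 1) - int (e' 2) = snd (snd (step M c) ! 0)"
  proof -
    have "snd (act a tp) = snd tp + shift (snd a)" for a tp by (cases a; cases tp) simp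
    moreover have "snd (step M c) ! 0 = act (as ! 0) (ts ! 0)" using k las len by (simp add: st)
    ultimately have "snd (snd (step M c) ! 0) = snd (ts ! 0) + shift (snd (as ! 0))" by simp
    then show ?thesis using p by (auto simp: e'_def c of_nat_diff split: head_move.splits)
  qed
  moreover have "\<forall>i. i \<noteq> 1 \<and> i \<noteq> 2 \<longrightarrow> e' i = e i" "e' 1 + e' 2 \<le> e 1 + e 2 + 1"
    by (auto simp: e'_def split: head_move.splits)
  ultimately show ?thesis by blast
qed

text \<open>A simulated step costs one test and one action, and a last test ends the loop. The sum
  of the two position registers grows by at most one per step, so bringing the head back takes time
  linear in \<open>t\<close>.\<close>

lemma sim_run:
  assumes M: "turing_machine M" and b: "b = tapes M + 2"
  shows "valid M c \<Longrightarrow> fst ((step M ^^ t) c) = 1 \<Longrightarrow> int (e 1) - int (e 2) = snd (snd c ! 0) \<Longrightarrow>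
    \<exists>t' e'. t' \<le> 2 * t + 1 \<and>
      exec (While (\<lambda>r. r (Suc (tapes M)) \<noteq> 1) (Do (sim M b))) (lay b x h (tau c) e) t'
        (lay b x h (tau ((step M ^^ t) c)) e') \<and>
      int (e' 1) - int (e' 2) = snd (snd ((step M ^^ t) c) ! 0) \<and> length (snd ((step M ^^ t) c)) = tapes M \<and>
      (\<forall>i. i \<noteq> 1 \<and> i \<noteq> 2 \<longrightarrow> e' i = e i) \<and> e' 1 + e' 2 \<le> e 1 + e 2 + t"
proof (induction t arbitrary: c e)
  case 0
  have "\<not> rd (lay b x h (tau c) e) (Suc (tapes M)) \<noteq> 1"
    using 0 b by (auto simp: rd_def lay_def tau_def valid_def)
  from exec.WhileF[of "\<lambda>r. r (Suc (tapes M)) \<noteq> 1", OF this] 0 show ?case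
    by (intro exI[of _ 1] exI[of _ e]) (auto simp: valid_def)
next
  case (Suc t)
  have rc: "rd (lay b x h (tau c) e) (Suc (tapes M)) = fst c"
    using Suc.prems b by (auto simp: rd_def lay_def tau_def valid_def)
  show ?case
  proof (cases "fst c = 1")
    case True
    then have "step M c = c" by (cases c) (simp add: step_def)
    then have id: "(step M ^^ n) c = c" for n by (induction n) auto
    have "\<not> rd (lay b x h (tau c) e) (Suc (tapes M)) \<noteq> 1" using rc True by simp
    from exec.WhileF[of "\<lambda>r. r (Suc (tapes M)) \<noteq> 1", OF this] Suc.prems show ?thesis unfolding id
      by (intro exI[of _ 1] exI[of _ e]) (auto simp: valid_def)
  next
    case False
    from sim_step[OF M b Suc.prems(1) False Suc.prems(3), of x h] obtain e1 where e1:
      "exec (Do (sim M b)) (lay b x h (tau c) e) 1 (lay b x h (tau (step M c)) e1)"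
      "valid M (step M c)" "int (e1 1) - int (e1 2) = snd (snd (step M c) ! 0)"
      "\<forall>i. i \<noteq> 1 \<and> i \<noteq> 2 \<longrightarrow> e1 i = e i" "e1 1 + e1 2 \<le> e 1 + e 2 + 1" by blast
    have sw: "(step M ^^ Suc t) c = (step M ^^ t) (step M c)" by (simp add: funpow_swap1)
    have "fst ((step M ^^ t) (step M c)) = 1" using Suc.prems(2) unfolding sw .
    from Suc.IH[OF e1(2) this e1(3)] obtain t' e' where IH: "t' \<le> 2 * t + 1"
      "exec (While (\<lambda>r. r (Suc (tapes M)) \<noteq> 1) (Do (sim M b))) (lay b x h (tau (step M c)) e1) t'
        (lay b x h (tau ((step M ^^ t) (step M c))) e')"
      "int (e' 1) - int (e' 2) = snd (snd ((step M ^^ t) (step M c)) ! 0)"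
      "length (snd ((step M ^^ t) (step M c))) = tapes M"
      "\<forall>i. i \<noteq> 1 \<and> i \<noteq> 2 \<longrightarrow> e' i = e1 i" "e' 1 + e' 2 \<le> e1 1 + e1 2 + t" by blast
    have "rd (lay b x h (tau c) e) (Suc (tapes M)) \<noteq> 1" using rc False by simp
    from exec.WhileT[of "\<lambda>r. r (Suc (tapes M)) \<noteq> 1", OF this e1(1) IH(2)] show ?thesis unfolding sw
      by (intro exI[of _ "Suc (1 + t')"] exI[of _ e']) (use IH e1 in auto)
  qed
qed

section \<open>Rewinding heads and comparing a number with the length of the output\<close>

definition drag :: "nat \<Rightarrow> head_move \<Rightarrow> nat \<Rightarrow> prog" where
  "drag b m k = Do (\<lambda>r i. (r i, if i = 1 then m else if i = b + k then Move_Left else Stay))"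

lemma exec_drag:
  assumes "2 \<le> b" "e k \<noteq> 0"
  shows "exec (drag b m k) (lay b x h \<tau> e) 1
    (lay b x h (\<tau>(1 := (fst (\<tau> 1), snd (\<tau> 1) + shift m))) (e(k := e k - 1)))"
proof -
  have "app (\<lambda>i. (rd (lay b x h \<tau> e) i, if i = 1 then m else if i = b + k then Move_Left else Stay)) (lay b x h \<tau> e) =
     lay b x h (\<tau>(1 := (fst (\<tau> 1), snd (\<tau> 1) + shift m))) (e(k := e k - 1))" (is "?l = ?r")
  proof
    fix i
    show "?l i = ?r i" unfolding app_def act_move
      using assms by (auto simp: lay_def cnt_def of_nat_diff)
  qed
  then show ?thesis unfolding drag_def by (rule exec_DoI)
qed

lemma exec_drag_loop:
  assumes "2 \<le> b"
  shows "exec (While (nz b k) (drag b m k)) (lay b x h \<tau> e) (2 * e k + 1)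
    (lay b x h (\<tau>(1 := (fst (\<tau> 1), snd (\<tau> 1) + int (e k) * shift m))) (e(k := 0)))"
proof (induction "e k" arbitrary: e \<tau>)
  case 0
  then show ?case using assms by (auto simp: fun_upd_idem intro!: exec.WhileF[simplified])
next
  case (Suc n)
  let ?e = "e(k := e k - 1)" and ?t = "\<tau>(1 := (fst (\<tau> 1), snd (\<tau> 1) + shift m))"
  have ek: "e k \<noteq> 0" using Suc.hyps(2) by simp
  have "exec (While (nz b k) (drag b m k)) (lay b x h ?t ?e) (2 * ?e k + 1)
    (lay b x h (?t(1 := (fst (?t 1), snd (?t 1) + int (?e k) * shift m))) (?e(k := 0)))"
    by (rule Suc.hyps(1)) (use Suc.hyps(2) in auto)
  moreover have "nz b k (rd (lay b x h \<tau> e))" using ek assms by simp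
  moreover have "?t(1 := (fst (?t 1), snd (?t 1) + int (?e k) * shift m)) =
      \<tau>(1 := (fst (\<tau> 1), snd (\<tau> 1) + int (e k) * shift m))" "?e(k := 0) = e(k := 0)"
    "Suc (1 + (2 * ?e k + 1)) = 2 * e k + 1"
    using ek by (auto simp: of_nat_diff algebra_simps)
  ultimately show ?case
    using exec.WhileT[of "nz b k", OF _ exec_drag[where e = e and k = k, OF assms ek]] by metis
qed

lemma okp_drag: "okp (drag b m k)"
  unfolding drag_def by (rule okp_Do) (auto simp: plain_def)

lemma rd_lay1: "2 \<le> b \<Longrightarrow> rd (lay b x h \<tau> e) (Suc 0) = read_head (\<tau> (Suc 0))"
  by (simp add: rd_def lay_def)

definition glide :: "head_move \<Rightarrow> prog" where
  "glide m = Do (on 1 (\<lambda>s. (s, m)))"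

lemma okp_glide: "okp (glide m)"
  unfolding glide_def by (rule okp_Do) (auto simp: plain_def on_def)

lemma exec_glide:
  assumes "2 \<le> b"
  shows "exec (glide m) (lay b x h \<tau> e) 1 (lay b x h (\<tau>(1 := (fst (\<tau> 1), snd (\<tau> 1) + shift m))) e)"
  unfolding glide_def
proof (rule exec_DoI, rule ext)
  fix i
  show "app (on 1 (\<lambda>s. (s, m)) (rd (lay b x h \<tau> e))) (lay b x h \<tau> e) i =
      lay b x h (\<tau>(1 := (fst (\<tau> 1), snd (\<tau> 1) + shift m))) e i"
    unfolding app_on act_move using assms by (auto simp: lay_def)
qed

lemma rewind_loop:
  assumes "2 \<le> b" "0 \<notin> set w" "n \<le> length w" "\<tau> 1 = (fst (word_tape w), int n - 1)"
  shows "exec (While (\<lambda>r. r 1 \<noteq> 0) (glide Move_Left)) (lay b x h \<tau> e) (2 * n + 1)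
    (lay b x h (\<tau>(1 := (fst (word_tape w), - 1))) e)"
  using assms(3,4)
proof (induction n arbitrary: \<tau>)
  case 0
  have "\<not> rd (lay b x h \<tau> e) 1 \<noteq> 0" using 0 assms(1) by (simp add: rd_lay1 word_tape_def)
  moreover have "\<tau>(1 := (fst (word_tape w), - 1)) = \<tau>" using 0 by (auto simp: fun_eq_iff)
  ultimately show ?case using exec.WhileF[of "\<lambda>r. r 1 \<noteq> 0"] by (metis mult_0_right add_0)
next
  case (Suc n)
  let ?t = "\<tau>(1 := (fst (\<tau> 1), snd (\<tau> 1) + shift Move_Left))"
  have "w ! n \<noteq> 0" using Suc.prems(1) assms(2) nth_mem[of n w] by (metis Suc_le_lessD)
  then have c: "rd (lay b x h \<tau> e) 1 \<noteq> 0" using Suc.prems assms(1) by (simp add: rd_lay1 word_tape_def)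
  have "exec (While (\<lambda>r. r 1 \<noteq> 0) (glide Move_Left)) (lay b x h ?t e) (2 * n + 1)
    (lay b x h (?t(1 := (fst (word_tape w), - 1))) e)"
    by (rule Suc.IH) (use Suc.prems in auto)
  from exec.WhileT[of "\<lambda>r. r 1 \<noteq> 0", OF c exec_glide[OF assms(1)] this] show ?case
    by (rule exec_cong) (simp, simp only: fun_upd_upd)
qed

lemma wr_word:
  assumes "\<tau> 1 = word_tape []"
  shows "wr w \<tau> = \<tau>(1 := (fst (word_tape w), int (length w)))"
proof (induction w rule: rev_induct)
  case Nil
  then show ?case using assms by (auto simp: word_tape_def fun_eq_iff)
next
  case (snoc s w)
  have "(fst (word_tape w))(int (length w) := s) = fst (word_tape (w @ [s]))"
  proof
    fix i
    consider "i = int (length w)" | "i < 0" | "0 \<le> i" "nat i < length w" | "nat i > length w" by linarith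
    then show "((fst (word_tape w))(int (length w) := s)) i = fst (word_tape (w @ [s])) i"
      by cases (auto simp: word_tape_def nth_append)
  qed
  then show ?case using snoc by (simp add: push_def fun_upd_def fun_eq_iff)
qed

lemma halving:
  assumes b2: "2 \<le> b"
  obtains p c where "okp p" "1 \<le> c" "\<And>N x \<tau> e. bd N x e \<Longrightarrow> \<forall>i\<ge>1. e i = 0 \<Longrightarrow>
     \<exists>t \<le> (N + c) ^ c. exec p (lay b x 0 \<tau> e) t (lay b x 0 \<tau> (e(0 := e 0 div 2)))"
proof -
  have b: "1 \<le> b" using b2 by simp
  have c: "pc 1 (\<lambda>x e. e 0 div 2)" by (intro pc_div pc_var pc_const) simp
  obtain p where p: "okp p" "runs b p (\<lambda>x e. \<forall>i\<ge>1. e i = 0) (\<lambda>x e. e(1 := e 0 div 2))"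
    by (rule pc_prog[OF c b le_refl])
  let ?p = "Seq p (Seq (clear b 0) (move b 1 0))"
  have "runs b ?p (\<lambda>x e. \<forall>i\<ge>1. e i = 0) (\<lambda>x e. e(0 := e 0 div 2))"
    by (rule runs_conseq[OF runs_seq[OF p(2) runs_seq[OF runs_clear[OF b] runs_move[OF b]]]])
      (auto simp: fun_eq_iff)
  moreover have "okp ?p" by (intro okp_intros okp_clear okp_move p)
  ultimately show thesis by (elim runsE) (rule that)
qed

text \<open>The loop also stops once the register is 0. The output may be as long as the running
  time of the simulated machine, but in this way the number of passes, each of cost about
  \<open>T\<close>, is at most the initial register.\<close>

lemma compare_loop:
  assumes b: "2 \<le> b" and h: "\<And>\<tau> e. bd N x e \<Longrightarrow> \<forall>i\<ge>1. e i = 0 \<Longrightarrow>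
     \<exists>t \<le> T. exec p (lay b x 0 \<tau> e) t (lay b x 0 \<tau> (e(0 := e 0 div 2)))"
    and bd: "bd N x e" "\<forall>i\<ge>1. e i = 0"
    and out: "0 \<notin> set y" "\<And>i. i < length y \<Longrightarrow> fst (\<tau> 1) (int i) = y ! i" "fst (\<tau> 1) (int (length y)) = 0"
    and j: "snd (\<tau> 1) = int j" "j \<le> length y"
  shows "\<exists>t \<tau>' e'. t \<le> e 0 * (T + 2) + 1 \<and>
    exec (While (\<lambda>r. r 1 \<noteq> 0 \<and> nz b 0 r) (Seq (glide Move_Right) p)) (lay b x 0 \<tau> e) t (lay b x 0 \<tau>' e') \<and>
    (e' 0 = 0 \<longleftrightarrow> e 0 div 2 ^ (length y - j) = 0)"
  using bd out(2,3) j
proof (induction "e 0" arbitrary: e \<tau> j rule: less_induct)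
  case less
  have b1: "1 \<le> b" using b by simp
  have r1: "rd (lay b x 0 \<tau> e) 1 = (if j < length y then y ! j else 0)"
    using less.prems b by (simp add: rd_lay1 read_head_eq)
  show ?case
  proof (cases "j < length y \<and> e 0 \<noteq> 0")
    case False
    then have "\<not> (rd (lay b x 0 \<tau> e) 1 \<noteq> 0 \<and> nz b 0 (rd (lay b x 0 \<tau> e)))"
      using r1 b1 by auto
    from exec.WhileF[of "\<lambda>r. r 1 \<noteq> 0 \<and> nz b 0 r", OF this] show ?thesis
      by (intro exI[of _ 1] exI[of _ \<tau>] exI[of _ e]) (use False less.prems in auto)
  next
    case True
    let ?t = "\<tau>(1 := (fst (\<tau> 1), snd (\<tau> 1) + shift Move_Right))" and ?e = "e(0 := e 0 div 2)"
    have "y ! j \<noteq> 0" using True out(1) nth_mem[of j y] by metis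
    then have c: "rd (lay b x 0 \<tau> e) 1 \<noteq> 0 \<and> nz b 0 (rd (lay b x 0 \<tau> e))"
      using r1 b1 True by simp
    obtain t where t: "t \<le> T" "exec p (lay b x 0 ?t e) t (lay b x 0 ?t ?e)"
      using h[OF less.prems(1,2)] by blast
    have bd': "bd N x ?e" using less.prems(1) by (auto simp: bd_def intro: order_trans[OF div_le_dividend])
    have half: "?e 0 < e 0" using True by simp
    have "\<exists>t' \<tau>' e'. t' \<le> ?e 0 * (T + 2) + 1 \<and>
      exec (While (\<lambda>r. r 1 \<noteq> 0 \<and> nz b 0 r) (Seq (glide Move_Right) p)) (lay b x 0 ?t ?e) t' (lay b x 0 \<tau>' e') \<and>
      (e' 0 = 0 \<longleftrightarrow> ?e 0 div 2 ^ (length y - Suc j) = 0)"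
      by (rule less.hyps[OF half bd']) (use less.prems True in auto)
    then obtain t' \<tau>' e' where IH: "t' \<le> ?e 0 * (T + 2) + 1"
      "exec (While (\<lambda>r. r 1 \<noteq> 0 \<and> nz b 0 r) (Seq (glide Move_Right) p)) (lay b x 0 ?t ?e) t' (lay b x 0 \<tau>' e')"
      "e' 0 = 0 \<longleftrightarrow> ?e 0 div 2 ^ (length y - Suc j) = 0" by (elim exE conjE) (rule that)
    have "length y - j = Suc (length y - Suc j)" using True by (simp add: Suc_diff_Suc)
    then have d: "e 0 div 2 ^ (length y - j) = ?e 0 div 2 ^ (length y - Suc j)" by (simp add: div_mult2_eq)
    have "Suc (?e 0) * (T + 2) \<le> e 0 * (T + 2)" using half by (intro mult_le_mono1) simp
    then have "Suc (1 + t + t') \<le> e 0 * (T + 2) + 1" using IH(1) t(1) by simp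
    moreover have "exec (While (\<lambda>r. r 1 \<noteq> 0 \<and> nz b 0 r) (Seq (glide Move_Right) p)) (lay b x 0 \<tau> e)
        (Suc (1 + t + t')) (lay b x 0 \<tau>' e')"
      by (rule exec.WhileT[of "\<lambda>r. r 1 \<noteq> 0 \<and> nz b 0 r", OF c exec.Seq[OF exec_glide[OF b] t(2)] IH(2)])
    ultimately show ?thesis using IH(3) unfolding d by (intro exI conjI)
  qed
qed

text \<open>The output ends at the first blank: the symbol 2 and a blank form
  \<open>binary 1\<close>, and a blank in cell 0 forms \<open>binary 0\<close>, whatever remains of
  the input behind it.\<close>

definition answer :: "nat \<Rightarrow> prog" where
  "answer b = Cond (nz b 0) (Seq (Do (on 0 (\<lambda>_. (2, Move_Right)))) (Do (on 0 (\<lambda>_. (0, Stay)))))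
     (Do (on 0 (\<lambda>_. (0, Stay))))"

lemma okp_answer: "okp (answer b)"
  unfolding answer_def by (intro okp_intros okp_Do) (auto simp: plain_def on_def)

lemma exec_answer:
  assumes "1 \<le> b"
  shows "\<exists>t \<le> 3. \<exists>\<sigma>. exec (answer b) (lay b x 0 \<tau> e) t \<sigma> \<and> tape_output (\<sigma> 0) (binary (of_bool (e 0 \<noteq> 0)))"
proof (cases "e 0 = 0")
  case True
  then have "\<not> nz b 0 (rd (lay b x 0 \<tau> e))" using assms by simp
  from exec.CondF[of "nz b 0", OF this exec.Do]
  have "exec (answer b) (lay b x 0 \<tau> e) (Suc 1)
    (app (on 0 (\<lambda>_. (0, Stay)) (rd (lay b x 0 \<tau> e))) (lay b x 0 \<tau> e))" unfolding answer_def .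
  moreover have "tape_output (app (on 0 (\<lambda>_. (0, Stay)) (rd (lay b x 0 \<tau> e))) (lay b x 0 \<tau> e) 0) (binary 0)"
    unfolding app_on by (simp add: lay_def tape_output_def binary_rec)
  ultimately show ?thesis using True
    by (intro exI[of _ 2] conjI exI[of _ "app (on 0 (\<lambda>_. (0, Stay)) (rd (lay b x 0 \<tau> e))) (lay b x 0 \<tau> e)"])
      (simp_all add: numeral_2_eq_2)
next
  case False
  then have n: "nz b 0 (rd (lay b x 0 \<tau> e))" using assms by simp
  let ?s = "app (on 0 (\<lambda>_. (2, Move_Right)) (rd (lay b x 0 \<tau> e))) (lay b x 0 \<tau> e)"
  let ?s2 = "app (on 0 (\<lambda>_. (0, Stay)) (rd ?s)) ?s"
  have "exec (answer b) (lay b x 0 \<tau> e) (Suc (1 + 1)) ?s2"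
    unfolding answer_def by (rule exec.CondT[of "nz b 0", OF n exec.Seq[OF exec.Do exec.Do]])
  moreover have "binary 1 = [2]" by (simp add: binary_rec)
  then have "tape_output (?s2 0) (binary 1)"
    unfolding app_on by (simp add: lay_def tape_output_def)
  ultimately show ?thesis using False by (intro exI[of _ 3] conjI exI[of _ ?s2]) (simp_all add: numeral_3_eq_3)
qed

lemma outputs_within_mono:
  assumes "outputs_within M x y t" "t \<le> t'"
  shows "outputs_within M x y t'"
proof -
  obtain q ts where c: "(step M ^^ t) (init_config M x) = (q, ts)" by fastforce
  then have q: "q = 1" using assms(1) by (simp add: outputs_within_def)
  have "(step M ^^ n) (q, ts) = (q, ts)" for n by (induction n) (auto simp: step_def q)
  moreover have "(step M ^^ t') (init_config M x) = (step M ^^ (t' - t)) ((step M ^^ t) (init_config M x))"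
    using assms(2) by (metis comp_apply funpow_add le_add_diff_inverse2)
  ultimately have "(step M ^^ t') (init_config M x) = (step M ^^ t) (init_config M x)" using c by simp
  then show ?thesis using assms(1) by (simp add: outputs_within_def)
qed

text \<open>
  The machine writes the stream on the first tape of \<open>M\<close>, runs \<open>M\<close>, and halves \<open>W\<close> once for each
  symbol of the output: as the gap is large, only the length of the output matters.
\<close>

theorem reduction_machine:
  assumes M: "turing_machine M" and I: "pc 0 (\<lambda>x e. I x)" and W: "pc 0 (\<lambda>x e. W x)"
    and K: "\<And>d i. i < d \<Longrightarrow> pc d (\<lambda>x e. kap x (e i))" and Nu: "\<And>d i. i < d \<Longrightarrow> pc d (\<lambda>x e. num x (e i))"
    and le: "\<And>x i. kap x i \<le> 5"
  shows "\<exists>M' c. turing_machine M' \<and> (\<forall>x y t. set x \<subseteq> {1..5} \<longrightarrow>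
      outputs_within M (stream (kap x) (num x) (I x)) y t \<longrightarrow>
      outputs_within M' x (binary (of_bool (W x div 2 ^ length y \<noteq> 0))) ((length x + c) ^ c + 5 * t))"
proof -
  define b where "b = tapes M + 2"
  have b: "2 \<le> b" "1 \<le> b" by (auto simp: b_def)
  have tapes: "1 \<le> tapes M" "5 < symbols M" "1 < states M" using M by (auto simp: turing_machine_def)
  \<comment> \<open>All work tapes are blank initially, whereas counters need the mark in cell 0; a
    single step supplies it on all of them.\<close>
  define start where "start = Do (\<lambda>r i. if b \<le> i then (1, Stay) else (r i, Stay))"
  obtain pS where pS: "okp pS" "runsg b pS (\<lambda>x e. \<forall>i. e i = 0) (\<lambda>x e. e)
    (\<lambda>x e. wr (stream (kap x) (num x) (I x)))"
    by (rule stream_out[OF b(1) I K Nu le])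
  obtain pW where pW: "okp pW" "runs b pW (\<lambda>x e. \<forall>i\<ge>0. e i = 0) (\<lambda>x e. e(0 := W x))"
    by (rule pc_prog[OF W b(2) le_refl])
  obtain pH ch where pH: "okp pH" "1 \<le> ch" "\<And>N x \<tau> e. bd N x e \<Longrightarrow> \<forall>i\<ge>1. e i = 0 \<Longrightarrow>
     \<exists>t \<le> (N + ch) ^ ch. exec pH (lay b x 0 \<tau> e) t (lay b x 0 \<tau> (e(0 := e 0 div 2)))"
    by (rule halving[OF b(1)], rule that)
  obtain c1 where c1: "1 \<le> c1" "\<And>N x \<tau> e. bd N x e \<Longrightarrow> \<forall>i. e i = 0 \<Longrightarrow>
     \<exists>t \<le> (N + c1) ^ c1. exec (Seq pS pW) (lay b x 0 \<tau> e) t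
       (lay b x 0 (wr (stream (kap x) (num x) (I x)) \<tau>) (e(0 := W x)))"
    "\<And>N x e i. bd N x e \<Longrightarrow> \<forall>i. e i = 0 \<Longrightarrow> (e(0 := W x)) i \<le> (N + c1) ^ c1"
  proof -
    have "runsg b (Seq pS pW) (\<lambda>x e. \<forall>i. e i = 0) (\<lambda>x e. e(0 := W x)) (\<lambda>x e. wr (stream (kap x) (num x) (I x)))"
      by (rule runs_conseq[OF runsg_seq[OF pS(2) pW(2)]]) auto
    then show thesis by (rule runsE) (rule that)
  qed
  let ?rew = "Seq (glide Move_Left) (Seq (While (\<lambda>r. r 1 \<noteq> 0) (glide Move_Left)) (glide Move_Right))"
  let ?run = "While (\<lambda>r. r (Suc (tapes M)) \<noteq> 1) (Do (sim M b))"
  let ?back = "Seq (While (nz b 1) (drag b Move_Left 1)) (While (nz b 2) (drag b Move_Right 2))"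
  let ?cmp = "While (\<lambda>r. r 1 \<noteq> 0 \<and> nz b 0 r) (Seq (glide Move_Right) pH)"
  define A where "A = Seq start (Seq (Seq pS pW) ?rew)"
  define B where "B = Seq ?back (Seq ?cmp (answer b))"
  let ?p = "Seq A (Seq ?run B)"
  have f1: "finc (\<lambda>r. r 1 \<noteq> 0)" unfolding finc_def agree_def by (rule exI[of _ 2]) auto
  have f2: "finc (\<lambda>r. r 1 \<noteq> 0 \<and> nz b 0 r)" unfolding finc_def agree_def nz_def
    by (rule exI[of _ "b + 2"]) auto
  have "okp start" unfolding start_def by (rule okp_Do) (auto simp: plain_def)
  then have okA: "okp A" unfolding A_def by (intro okp_intros pS pW okp_glide f1)
  have okB: "okp B" unfolding B_def by (intro okp_intros okp_drag okp_glide f2 pH okp_answer)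
  obtain K1 where K1: "\<forall>K\<ge>K1. \<forall>g\<ge>6. wf_prog K g A" using okA by (auto simp: okp_def)
  obtain K2 where K2: "\<forall>K\<ge>K2. \<forall>g\<ge>6. wf_prog K g B" using okB by (auto simp: okp_def)
  define Kt where "Kt = K1 + K2 + b + 3"
  define g where "g = 6 + symbols M + states M"
  have "wf_prog Kt g ?p"
  proof -
    have "wf_prog Kt g A" "wf_prog Kt g B" using K1 K2 by (auto simp: Kt_def g_def)
    moreover have "wf_prog Kt g (Do (sim M b))"
      by (rule wf_sim[OF M _ b_def]) (auto simp: Kt_def g_def)
    moreover have "\<forall>r r'. agree Kt r r' \<longrightarrow> (r (Suc (tapes M)) \<noteq> 1) = (r' (Suc (tapes M)) \<noteq> 1)"
      by (auto simp: agree_def Kt_def b_def)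
    ultimately show ?thesis by simp
  qed
  then obtain M' where M': "turing_machine M'"
    "\<And>x t \<sigma>. exec ?p (init_store x) t \<sigma> \<Longrightarrow> (step M' ^^ t) (init_config M' x) = (1, tps Kt \<sigma>)"
    by (rule prog_machine) (auto simp: Kt_def g_def)
  let ?N1 = "\<lambda>n::nat. n + (n + c1) ^ c1"
  let ?time = "\<lambda>n. 1 + (n + c1) ^ c1 + (2 * (n + c1) ^ c1 + 4) + 10 + ?N1 n * ((?N1 n + ch) ^ ch + 2) + 1"
  have "pb ?time" by (intro pb_add pb_mult pb_power pb_id pb_const)
  then obtain c where c: "1 \<le> c" "\<And>n. ?time n \<le> (n + c) ^ c" by (erule pb_E)
  have main: "outputs_within M' x (binary (of_bool (W x div 2 ^ length y \<noteq> 0))) ((length x + c) ^ c + 5 * t)"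
    if x: "set x \<subseteq> {1..5}" and run: "outputs_within M (stream (kap x) (num x) (I x)) y t" for x y t
  proof -
    define n where "n = length x"
    define w where "w = stream (kap x) (num x) (I x)"
    define e0 :: "nat \<Rightarrow> nat" where "e0 = (\<lambda>_. 0)"
    define e1 where "e1 = e0(0 := W x)"
    let ?blank = "\<lambda>i::nat. word_tape []"
    have bd: "bd n x e0" using x by (auto simp: bd_def n_def e0_def)
    have wt: "word_tape [] = (\<lambda>_. 0, 0)" by (auto simp: word_tape_def)
    have "binary v = binary v \<and> set (binary v) \<subseteq> {1..2}" for v
    proof (induction v rule: less_induct)
      case (less v)
      then show ?case using less.IH[of "v div 2"] by (cases "v = 0") (auto simp: binary_rec)
    qed
    then have wset: "set w \<subseteq> {1..5}" using le[of x] unfolding w_def stream_def letter_def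
      by (fastforce simp: Suc_le_eq split: if_splits)
    then have w0: "0 \<notin> set w" by auto
    have 0: "exec start (init_store x) 1 (lay b x 0 ?blank e0)"
      unfolding start_def
      by (rule exec_DoI, rule ext) (use b in \<open>auto simp: app_def init_store_def lay_def e0_def cnt_def wt word_tape_def rd_def fun_eq_iff\<close>)
    obtain t1 where t1: "t1 \<le> (n + c1) ^ c1" "exec (Seq pS pW) (lay b x 0 ?blank e0) t1 (lay b x 0 (wr w ?blank) e1)"
      using c1(2)[OF bd, of ?blank] by (auto simp: e0_def w_def e1_def)
    have ww: "wr w ?blank = ?blank(1 := (fst (word_tape w), int (length w)))" by (rule wr_word) simp
    have lw: "length w \<le> (n + c1) ^ c1"
      using exec_head_pos[OF t1(2)[unfolded ww], of 1] t1(1) b by (simp add: lay_def wt)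
    let ?T1 = "?blank(1 := (fst (word_tape w), int (length w) - 1))"
    let ?T2 = "?blank(1 := (fst (word_tape w), - 1))"
    let ?T3 = "?blank(1 := word_tape w)"
    have r1: "exec (glide Move_Left) (lay b x 0 (wr w ?blank) e1) 1 (lay b x 0 ?T1 e1)"
      using exec_glide[OF b(1), of Move_Left x 0 "wr w ?blank" e1] unfolding ww by simp
    have r2: "exec (While (\<lambda>r. r 1 \<noteq> 0) (glide Move_Left)) (lay b x 0 ?T1 e1) (2 * length w + 1) (lay b x 0 ?T2 e1)"
      using rewind_loop[OF b(1) w0 order_refl, of ?T1 x 0 e1] by simp
    have r3: "exec (glide Move_Right) (lay b x 0 ?T2 e1) 1 (lay b x 0 ?T3 e1)"
      using exec_glide[OF b(1), of Move_Right x 0 ?T2 e1] by (simp add: word_tape_def)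
    have tA: "exec A (init_store x) (1 + (t1 + (1 + (2 * length w + 1 + 1)))) (lay b x 0 ?T3 e1)"
      unfolding A_def by (rule exec.Seq[OF 0 exec.Seq[OF t1(2) exec.Seq[OF r1 exec.Seq[OF r2 r3]]]])
    let ?c0 = "init_config M w"
    obtain q ts where fin: "(step M ^^ t) ?c0 = (q, ts)" by fastforce
    then have q: "q = 1" and out: "tape_output (hd ts) y" using run by (auto simp: outputs_within_def w_def)
    have lay0: "lay b x 0 ?T3 e1 = lay b x 0 (tau ?c0) e1"
      using tapes by (auto simp: lay_def tau_def init_config_def b_def fun_eq_iff wt nth_Cons')
    have v0: "valid M ?c0"
      using tapes wset nth_mem by (fastforce simp: valid_def init_config_def word_tape_def)
    have "fst ((step M ^^ t) ?c0) = 1" using fin q by simp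
    from sim_run[OF M b_def v0 this, of e1 x 0] fin obtain t2 e2 where t2: "t2 \<le> 2 * t + 1"
      "exec ?run (lay b x 0 (tau ?c0) e1) t2 (lay b x 0 (tau (q, ts)) e2)"
      "int (e2 1) - int (e2 2) = snd (ts ! 0)" "length ts = tapes M"
      "\<forall>i. i \<noteq> 1 \<and> i \<noteq> 2 \<longrightarrow> e2 i = e1 i" "e2 1 + e2 2 \<le> t"
      by (auto simp: init_config_def e1_def e0_def word_tape_def)
    let ?ta = "tau (q, ts)"
    \<comment> \<open>The head position is \<open>e2 1 - e2 2\<close>; moving left by the one
      register and right by the other gives 0.\<close>
    let ?ta1 = "?ta(1 := (fst (?ta 1), snd (?ta 1) + int (e2 1) * shift Move_Left))"
    let ?ta2 = "?ta1(1 := (fst (?ta1 1), snd (?ta1 1) + int ((e2(1 := 0)) 2) * shift Move_Right))"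
    have eB: "e2(1 := 0, 2 := 0) = e1" using t2(5) by (auto simp: fun_eq_iff e1_def e0_def)
    have k1: "exec ?back (lay b x 0 ?ta e2) (2 * e2 1 + 1 + (2 * (e2(1 := 0)) 2 + 1)) (lay b x 0 ?ta2 e1)"
      using exec.Seq[OF exec_drag_loop[OF b(1), of 1 Move_Left x 0 ?ta e2]
        exec_drag_loop[OF b(1), of 2 Move_Right x 0 ?ta1 "e2(1 := 0)"]] unfolding eB .
    have ts0: "?ta 1 = hd ts" using t2(4) tapes by (cases ts) (auto simp: tau_def)
    have p0: "snd (?ta2 1) = int 0" "fst (?ta2 1) = fst (hd ts)"
      using t2(3,4) tapes ts0 by (cases ts; auto simp: hd_conv_nth)+
    have bd1: "bd (?N1 n) x e1" using bd c1(3)[OF bd, of 0] by (auto simp: bd_def e1_def e0_def)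
    have e10: "\<forall>i\<ge>1. e1 i = 0" by (simp add: e1_def e0_def)
    have "\<exists>t \<tau>' e'. t \<le> e1 0 * ((?N1 n + ch) ^ ch + 2) + 1 \<and>
      exec ?cmp (lay b x 0 ?ta2 e1) t (lay b x 0 \<tau>' e') \<and> (e' 0 = 0 \<longleftrightarrow> e1 0 div 2 ^ (length y - 0) = 0)"
      by (rule compare_loop[OF b(1) pH(3) bd1 e10]) (use out p0 in \<open>auto simp: tape_output_def\<close>)
    then obtain t3 \<tau>' e3 where t3: "t3 \<le> e1 0 * ((?N1 n + ch) ^ ch + 2) + 1"
      "exec ?cmp (lay b x 0 ?ta2 e1) t3 (lay b x 0 \<tau>' e3)" "e3 0 = 0 \<longleftrightarrow> W x div 2 ^ length y = 0"
      by (auto simp: e1_def)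
    obtain t4 \<sigma> where t4: "t4 \<le> 3" "exec (answer b) (lay b x 0 \<tau>' e3) t4 \<sigma>"
      "tape_output (\<sigma> 0) (binary (of_bool (e3 0 \<noteq> 0)))"
      using exec_answer[OF b(2), of x \<tau>' e3] by blast
    let ?t = "1 + (t1 + (1 + (2 * length w + 1 + 1))) + (t2 + (2 * e2 1 + 1 + (2 * (e2(1 := 0)) 2 + 1) + (t3 + t4)))"
    have "exec ?p (init_store x) ?t \<sigma>"
      unfolding B_def
      by (rule exec.Seq[OF tA[unfolded lay0] exec.Seq[OF t2(2) exec.Seq[OF k1 exec.Seq[OF t3(2) t4(2)]]]])
    from M'(2)[OF this] have "outputs_within M' x (binary (of_bool (W x div 2 ^ length y \<noteq> 0))) ?t"
      using t4(3) t3(3) by (simp add: outputs_within_def tps_def hd_map Kt_def)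
    moreover have "?t \<le> (length x + c) ^ c + 5 * t"
    proof -
      have "e1 0 \<le> ?N1 n" using bd1 by (rule bd_le)
      then have "e1 0 * ((?N1 n + ch) ^ ch + 2) \<le> ?N1 n * ((?N1 n + ch) ^ ch + 2)" by (rule mult_le_mono1)
      moreover have "(e2(1 := 0)) 2 = e2 2" by simp
      ultimately have "?t \<le> ?time n + 5 * t" using t1(1) lw t2(1,6) t3(1) t4(1) by linarith
      then show ?thesis using c(2)[of n] unfolding n_def by linarith
    qed
    ultimately show ?thesis by (rule outputs_within_mono)
  qed
  show ?thesis using M'(1) main by blast
qed

section \<open>Low degree functions on a cube\<close>

text \<open>The field with \<open>q\<close> elements is replaced by integer polynomials modulo
  \<open>q\<close>, because \<open>q\<close> depends on the input and cannot be fixed in a type.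
  Splitting off the linear factor of a root keeps all other roots, since \<open>q\<close> is
  prime.\<close>

lemma poly_roots_mod_prime:
  fixes p :: "int poly"
  assumes "prime q"
  shows "degree p \<le> d \<Longrightarrow> d < card {i. i < q \<and> int q dvd poly p (int i)} \<Longrightarrow> int q dvd coeff p e"
proof (induction d arbitrary: p e)
  case 0
  then obtain i where "int q dvd poly p (int i)" by (metis (mono_tags, lifting) card.empty empty_Collect_eq less_nat_zero_code)
  moreover obtain a where "p = [:a:]" using 0 degree_eq_zeroE by auto
  ultimately show ?case by (cases e) auto
next
  case (Suc d)
  let ?R = "\<lambda>p. {i. i < q \<and> int q dvd poly p (int i)}"
  have "?R p \<noteq> {}" using Suc.prems(2) by fastforce
  then obtain r where r: "r < q" "int q dvd poly p (int r)" by auto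
  define p1 where "p1 = synthetic_div p (int r)"
  have p: "p = [:- int r, 1:] * p1 + [:poly p (int r):]"
    using synthetic_div_correct'[of "int r" p] by (simp add: p1_def)
  have deg: "degree p1 \<le> d" using Suc.prems(1) by (simp add: p1_def degree_synthetic_div)
  have "?R p - {r} \<subseteq> ?R p1"
  proof
    fix i assume "i \<in> ?R p - {r}"
    then have i: "i < q" "int q dvd poly p (int i)" "i \<noteq> r" by auto
    have "poly p (int i) = (int i - int r) * poly p1 (int i) + poly p (int r)"
      by (subst p) (simp add: algebra_simps)
    then have "int q dvd (int i - int r) * poly p1 (int i)" using i(2) r(2)
      by (metis dvd_add_left_iff)
    moreover have "\<not> int q dvd (int i - int r)"
    proof
      assume "int q dvd (int i - int r)"
      then have "[int i = int r] (mod int q)" by (simp add: mod_eq_dvd_iff cong_def)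
      then show False using i r by (simp add: cong_def)
    qed
    moreover have "prime (int q)" using assms by simp
    ultimately have "int q dvd poly p1 (int i)" using prime_dvd_mult_iff by blast
    then show "i \<in> ?R p1" using i by simp
  qed
  then have "card (?R p - {r}) \<le> card (?R p1)" by (intro card_mono) auto
  moreover have "card (?R p - {r}) = card (?R p) - 1" using r by simp
  ultimately have "d < card (?R p1)" using Suc.prems(2) by linarith
  then have c: "int q dvd coeff p1 e'" for e' using Suc.IH[OF deg] by blast
  have "coeff p e = coeff (pCons 0 p1) e - int r * coeff p1 e + coeff [:poly p (int r):] e"
    by (subst p) (cases e; simp add: algebra_simps)
  moreover have "int q dvd coeff (pCons 0 p1) e" using c by (cases e) auto
  moreover have "int q dvd coeff [:poly p (int r):] e" using r by (cases e) auto
  ultimately show ?case using c by (simp add: dvd_add dvd_diff)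
qed

text \<open>Points of the \<open>s\<close>-dimensional cube over \<open>{..<q}\<close> are coded by their base-\<open>q\<close> expansions.\<close>

definition dig :: "nat \<Rightarrow> nat \<Rightarrow> nat \<Rightarrow> nat" where
  "dig q a t = a div q ^ t mod q"

definition undig :: "nat \<Rightarrow> nat \<Rightarrow> (nat \<Rightarrow> nat) \<Rightarrow> nat" where
  "undig q s f = (\<Sum>t<s. f t * q ^ t)"

text \<open>Horner's rule modulo \<open>q\<close>: a number \<open>c\<close> below
  \<open>q ^ s\<close> codes the polynomial of degree below \<open>s\<close> in which digit
  \<open>e\<close> of \<open>c\<close> is the coefficient of \<open>i ^ (s - 1 - e)\<close>.\<close>

definition ev :: "nat \<Rightarrow> nat \<Rightarrow> nat \<Rightarrow> nat \<Rightarrow> nat" where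
  "ev q s c i = rec_nat 0 (\<lambda>e v. (v * i + dig q c e) mod q) s"

lemma undig_less:
  assumes "\<And>t. t < s \<Longrightarrow> f t < q"
  shows "undig q s f < q ^ s"
  using assms
proof (induction s)
  case (Suc s)
  have "undig q s f < q ^ s" using Suc by simp
  moreover have "Suc (f s) \<le> q" using Suc.prems by (simp add: Suc_le_eq)
  then have "Suc (f s) * q ^ s \<le> q * q ^ s" by (rule mult_le_mono1)
  ultimately show ?case by (simp add: undig_def)
qed (simp add: undig_def)

lemma undig_Suc: "undig q (Suc s) f = f 0 + q * undig q s (\<lambda>t. f (Suc t))"
  unfolding undig_def by (subst sum.lessThan_Suc_shift) (simp add: sum_distrib_left algebra_simps)

lemma dig_Suc: "dig q a (Suc t) = dig q (a div q) t"
  by (simp add: dig_def div_mult2_eq)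

lemma dig_undig:
  assumes "\<And>t. t < s \<Longrightarrow> f t < q" "t < s"
  shows "dig q (undig q s f) t = f t"
  using assms
proof (induction s arbitrary: f t)
  case (Suc s)
  have f0: "f 0 < q" using Suc.prems by simp
  show ?case
  proof (cases t)
    case 0
    then show ?thesis using f0 by (simp add: undig_Suc dig_def)
  next
    case (Suc t')
    have "undig q (Suc s) f div q = undig q s (\<lambda>t. f (Suc t))" using f0 by (simp add: undig_Suc)
    then show ?thesis using Suc.IH[of "\<lambda>t. f (Suc t)" t'] Suc.prems Suc by (simp add: dig_Suc)
  qed
qed simp

lemma undig_dig: "a < q ^ s \<Longrightarrow> undig q s (dig q a) = a"
proof (induction s arbitrary: a)
  case (Suc s)
  have "a div q < q ^ s" using Suc.prems by (cases "q = 0") (auto simp: div_less_iff_less_mult mult.commute)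
  from Suc.IH[OF this] show ?case by (simp add: undig_Suc dig_Suc) (simp add: dig_def)
qed (simp add: undig_def)

lemma dig_less: "0 < q \<Longrightarrow> dig q a t < q"
  by (simp add: dig_def)

lemma dig_ext: "a < q ^ s \<Longrightarrow> b < q ^ s \<Longrightarrow> (\<And>t. t < s \<Longrightarrow> dig q a t = dig q b t) \<Longrightarrow> a = b"
  by (metis (no_types, lifting) undig_dig undig_def sum.cong lessThan_iff)

definition up :: "nat \<Rightarrow> nat \<Rightarrow> nat \<Rightarrow> nat \<Rightarrow> nat \<Rightarrow> nat" where
  "up q s a t i = undig q s (\<lambda>e. if e = t then i else dig q a e)"

lemma up_props:
  assumes "0 < q" "i < q"
  shows "up q s a t i < q ^ s" "e < s \<Longrightarrow> dig q (up q s a t i) e = (if e = t then i else dig q a e)"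
proof -
  have F: "\<And>e. e < s \<Longrightarrow> (if e = t then i else dig q a e) < q" using assms dig_less by simp
  show "up q s a t i < q ^ s" unfolding up_def by (rule undig_less) (rule F)
  show "dig q (up q s a t i) e = (if e = t then i else dig q a e)" if "e < s"
    unfolding up_def by (rule dig_undig[OF F that])
qed

definition epoly :: "nat \<Rightarrow> nat \<Rightarrow> nat \<Rightarrow> int poly" where
  "epoly q s c = (\<Sum>e<s. monom (int (dig q c e)) (s - 1 - e))"

lemma ev_epoly: "[int (ev q s c i) = poly (epoly q s c) (int i)] (mod int q)"
proof -
  have "[int (rec_nat 0 (\<lambda>e v. (v * i + dig q c e) mod q) n) =
      (\<Sum>e<n. int (dig q c e) * int i ^ (n - 1 - e))] (mod int q)" for n
  proof (induction n)
    case (Suc n)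
    let ?v = "rec_nat 0 (\<lambda>e v. (v * i + dig q c e) mod q) n"
    have "(\<Sum>e<Suc n. int (dig q c e) * int i ^ (Suc n - 1 - e)) =
        (\<Sum>e<n. int (dig q c e) * int i ^ (n - 1 - e)) * int i + int (dig q c n)"
    proof -
      have "(\<Sum>e<n. int (dig q c e) * int i ^ (n - e)) = (\<Sum>e<n. int (dig q c e) * int i ^ (n - 1 - e) * int i)"
      proof (rule sum.cong)
        fix e assume "e \<in> {..<n}"
        then have "n - e = Suc (n - 1 - e)" by auto
        then show "int (dig q c e) * int i ^ (n - e) = int (dig q c e) * int i ^ (n - 1 - e) * int i" by simp
      qed simp
      then show ?thesis by (simp add: sum_distrib_right)
    qed
    moreover have "[int ((?v * i + dig q c n) mod q) = int ?v * int i + int (dig q c n)] (mod int q)"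
      by (simp add: cong_def zmod_int)
    moreover have "[int ?v * int i + int (dig q c n) =
        (\<Sum>e<n. int (dig q c e) * int i ^ (n - 1 - e)) * int i + int (dig q c n)] (mod int q)"
      using Suc.IH by (intro cong_add cong_mult) auto
    ultimately show ?case using cong_trans by (metis (no_types, lifting) old.nat.simps(7))
  qed simp
  then show ?thesis by (simp add: ev_def epoly_def poly_sum poly_monom)
qed

lemma coeff_epoly: "e < s \<Longrightarrow> coeff (epoly q s c) (s - 1 - e) = int (dig q c e)"
proof -
  assume e: "e < s"
  have "coeff (epoly q s c) (s - 1 - e) = (\<Sum>e'<s. if e' = e then int (dig q c e') else 0)"
    unfolding epoly_def coeff_sum by (rule sum.cong) (use e in auto)
  then show ?thesis using e by simp
qed

lemma degree_epoly: "0 < s \<Longrightarrow> degree (epoly q s c) < s"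
  unfolding epoly_def by (rule degree_sum_less) (auto intro: le_less_trans[OF degree_monom_le])

lemma ev_less: "0 < q \<Longrightarrow> ev q s c i < q"
  by (cases s) (auto simp: ev_def)

text \<open>Distinct codes differ in some digit, hence in some coefficient modulo \<open>q\<close>;
  a nonzero difference of degree below \<open>s\<close> cannot vanish in \<open>s\<close>
  places.\<close>

lemma ev_agree:
  assumes "prime q" "0 < s" "c < q ^ s" "c' < q ^ s" "c \<noteq> c'"
  shows "card {i. i < q \<and> ev q s c i = ev q s c' i} < s"
proof (rule ccontr)
  assume neg: "\<not> ?thesis"
  let ?p = "epoly q s c - epoly q s c'"
  have q: "0 < q" using assms(1) by (simp add: prime_gt_0_nat)
  have "{i. i < q \<and> ev q s c i = ev q s c' i} \<subseteq> {i. i < q \<and> int q dvd poly ?p (int i)}"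
  proof safe
    fix i assume "ev q s c i = ev q s c' i"
    then have "[poly (epoly q s c) (int i) = poly (epoly q s c') (int i)] (mod int q)"
      using ev_epoly[of q s c i] ev_epoly[of q s c' i] by (metis cong_sym cong_trans)
    then show "int q dvd poly ?p (int i)" by (simp add: cong_iff_dvd_diff)
  qed
  then have "card {i. i < q \<and> ev q s c i = ev q s c' i} \<le> card {i. i < q \<and> int q dvd poly ?p (int i)}"
    by (intro card_mono) auto
  then have card: "s - 1 < card {i. i < q \<and> int q dvd poly ?p (int i)}"
    using neg assms(2) by linarith
  have "degree ?p < s" using degree_epoly[OF assms(2)] by (rule degree_diff_less) (rule degree_epoly[OF assms(2)])
  then have deg: "degree ?p \<le> s - 1" by simp
  have "dig q c e = dig q c' e" if "e < s" for e
  proof -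
    have "int q dvd int (dig q c e) - int (dig q c' e)"
      using poly_roots_mod_prime[OF assms(1) deg card, of "s - 1 - e"] that by (simp only: coeff_diff coeff_epoly)
    then have "[int (dig q c e) = int (dig q c' e)] (mod int q)" by (simp add: cong_iff_dvd_diff)
    then have "[dig q c e = dig q c' e] (mod q)" by (simp add: cong_int_iff)
    then show ?thesis using dig_less[OF q] by (simp add: cong_def)
  qed
  then show False using dig_ext[OF assms(3,4)] assms(5) by blast
qed

section \<open>Derivability from a table\<close>

locale tensor =
  fixes q s :: nat
  assumes prime: "prime q" and s0: "0 < s"
begin

abbreviation "B \<equiv> q ^ s"

lemma q0: "0 < q" and B0: "0 < B"
  using prime by (auto simp: prime_gt_0_nat)

text \<open>On the line through \<open>a\<close> in direction \<open>t\<close>, this singles out the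
  point with coordinate \<open>i\<close>. Coordinate \<open>t\<close> of \<open>a\<close> itself
  does not enter, so all points of a line are interchangeable as \<open>a\<close>.\<close>

definition lnk :: "nat \<Rightarrow> nat \<Rightarrow> nat \<Rightarrow> nat \<Rightarrow> bool" where
  "lnk a b t i \<longleftrightarrow> b < B \<and> (\<forall>e<s. dig q b e = (if e = t then i else dig q a e))"

text \<open>The value of variable \<open>j\<close> is stored at the point whose coordinates are the
  base-\<open>s\<close> digits of \<open>j\<close>. Such a point exists as soon as
  \<open>s \<le> q\<close>.\<close>

definition ispt :: "nat \<Rightarrow> nat \<Rightarrow> bool" where
  "ispt j b \<longleftrightarrow> b < B \<and> (\<forall>t<s. dig q b t = j div s ^ t mod s)"

text \<open>
  What can be derived from a set \<open>S\<close> of table entries. \<open>DD S t a v\<close>: value \<open>v\<close> at \<open>a\<close> follows by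
  interpolation along the first \<open>t\<close> coordinates. \<open>LL S t a c i\<close>: the polynomial \<open>c\<close> matches the first
  \<open>i + 1\<close> points of the line through \<open>a\<close> in direction \<open>t\<close>. \<open>RR S t p v b w\<close>: value \<open>v\<close> at \<open>p\<close> leads to
  value \<open>w\<close> at \<open>b\<close> along \<open>t\<close> such lines. \<open>WW\<close>: value \<open>v\<close> at \<open>p\<close> leads to truth value \<open>bt\<close> of variable
  \<open>j\<close> via the point \<open>r\<close>, and \<open>CC\<close>: via all points up to \<open>r\<close>; the detour through a generic point makes
  the truth value unique. \<open>GG\<close>: the first \<open>k\<close> clauses are satisfied from \<open>(p, v)\<close>. \<open>AA\<close>: all points
  up to \<open>p\<close> have a value from which all \<open>m\<close> clauses are satisfied.
\<close>

primrec DD :: "(nat \<times> nat) set \<Rightarrow> nat \<Rightarrow> nat \<Rightarrow> nat \<Rightarrow> bool" where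
  "DD S 0 a v \<longleftrightarrow> (a, v) \<in> S"
| "DD S (Suc t) a v \<longleftrightarrow> (\<exists>c. ev q s c (dig q a t) = v \<and> t < s \<and> c < B \<and>
     (\<forall>i\<le>q - 1. \<exists>b. lnk a b t i \<and> DD S t b (ev q s c i)))"

definition LL :: "(nat \<times> nat) set \<Rightarrow> nat \<Rightarrow> nat \<Rightarrow> nat \<Rightarrow> nat \<Rightarrow> bool" where
  "LL S t a c i \<longleftrightarrow> t < s \<and> c < B \<and> (\<forall>i'\<le>i. \<exists>b. lnk a b t i' \<and> DD S t b (ev q s c i'))"

primrec RR :: "(nat \<times> nat) set \<Rightarrow> nat \<Rightarrow> nat \<Rightarrow> nat \<Rightarrow> nat \<Rightarrow> nat \<Rightarrow> bool" where
  "RR S 0 p v b w \<longleftrightarrow> (p, v) \<in> S \<and> b = p \<and> w = v"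
| "RR S (Suc t) p v b w \<longleftrightarrow> (\<exists>b0 c. RR S t p v b0 (ev q s c (dig q b0 t)) \<and> LL S t b0 c (q - 1) \<and>
     lnk b0 b t (dig q b t) \<and> w = ev q s c (dig q b t))"

definition WW where
  "WW S p v j bt r \<longleftrightarrow> (\<exists>w b. RR S s p v r w \<and> RR S s r w b bt \<and> ispt j b)"

definition CC where
  "CC S p v j bt r \<longleftrightarrow> (\<forall>r'\<le>r. WW S p v j bt r')"

definition GG :: "(nat \<times> nat) set \<Rightarrow> (nat \<Rightarrow> nat \<Rightarrow> nat \<Rightarrow> bool) \<Rightarrow> nat \<Rightarrow> nat \<Rightarrow> nat \<Rightarrow> bool" where
  "GG S cl p v k \<longleftrightarrow> (p, v) \<in> S \<and> (\<forall>k'<k. \<exists>j bt. cl k' j bt \<and> CC S p v j bt (B - 1))"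

definition AA :: "(nat \<times> nat) set \<Rightarrow> (nat \<Rightarrow> nat \<Rightarrow> nat \<Rightarrow> bool) \<Rightarrow> nat \<Rightarrow> nat \<Rightarrow> bool" where
  "AA S cl m p \<longleftrightarrow> (\<forall>p'\<le>p. \<exists>v. GG S cl p' v m)"

lemma DD_Suc: "DD S (Suc t) a v \<longleftrightarrow> (\<exists>c. ev q s c (dig q a t) = v \<and> LL S t a c (q - 1))"
  by (simp add: LL_def)

lemma lnk_up: "t < s \<Longrightarrow> lnk a b t i \<longleftrightarrow> i < q \<and> b = up q s a t i"
proof (intro iffI)
  assume t: "t < s" and l: "lnk a b t i"
  have "dig q b t = i" using l t by (simp add: lnk_def)
  then have i: "i < q" using dig_less[OF q0] by blast
  moreover have "b = up q s a t i"
    by (rule dig_ext[where q = q and s = s]) (use l up_props[OF q0 i] in \<open>auto simp: lnk_def\<close>)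
  ultimately show "i < q \<and> b = up q s a t i" by simp
next
  assume "t < s" "i < q \<and> b = up q s a t i"
  then show "lnk a b t i" using up_props[OF q0] by (auto simp: lnk_def)
qed

lemma LL_cong:
  assumes "\<And>e. e < s \<Longrightarrow> e \<noteq> t \<Longrightarrow> dig q a e = dig q a' e"
  shows "LL S t a c i = LL S t a' c i"
proof -
  have "lnk a b t i' = lnk a' b t i'" for b i' unfolding lnk_def using assms by auto
  then show ?thesis by (simp add: LL_def)
qed

lemma ev_agree': "c < B \<Longrightarrow> c' < B \<Longrightarrow> c \<noteq> c' \<Longrightarrow> card {i. i < q \<and> ev q s c i = ev q s c' i} \<le> s"
  using ev_agree[OF prime s0] by (simp add: less_imp_le)

text \<open>At a coordinate outside this set, the value determines the polynomial among those in
  \<open>C\<close>.\<close>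

definition coll :: "nat set \<Rightarrow> nat set" where
  "coll C = {i. i < q \<and> (\<exists>c\<in>C. \<exists>c'\<in>C. c \<noteq> c' \<and> ev q s c i = ev q s c' i)}"

lemma card_coll:
  assumes "C \<subseteq> {..<B}" "card C \<le> k"
  shows "card (coll C) \<le> k * k * s"
proof -
  have fin: "finite C" using assms(1) finite_subset by blast
  let ?P = "{(c, c'). c \<in> C \<and> c' \<in> C \<and> c \<noteq> c'}"
  have P: "?P \<subseteq> C \<times> C" by auto
  have finP: "finite ?P" by (rule finite_subset[OF P]) (simp add: fin)
  define f where "f x = {i. i < q \<and> ev q s (fst x) i = ev q s (snd x) i}" for x
  have "coll C = \<Union> (f ` ?P)"
  proof (intro set_eqI iffI)
    fix i assume "i \<in> coll C"
    then obtain c c' where "i < q" "c \<in> C" "c' \<in> C" "c \<noteq> c'" "ev q s c i = ev q s c' i"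
      unfolding coll_def by blast
    then have "i \<in> f (c, c')" "(c, c') \<in> ?P" by (simp_all add: f_def)
    then show "i \<in> \<Union> (f ` ?P)" by blast
  next
    fix i assume "i \<in> \<Union> (f ` ?P)"
    then obtain c c' where "(c, c') \<in> ?P" "i \<in> f (c, c')" by blast
    then show "i \<in> coll C" unfolding coll_def f_def by auto
  qed
  also have "card (\<Union> (f ` ?P)) \<le> (\<Sum>x\<in>?P. card (f x))" by (rule card_UN_le[OF finP])
  also have "\<dots> \<le> (\<Sum>x\<in>?P. s)"
  proof (rule sum_mono)
    fix x assume "x \<in> ?P"
    then obtain c c' where x: "x = (c, c')" "c \<in> C" "c' \<in> C" "c \<noteq> c'" by blast
    have "c < B" "c' < B" using x assms(1) by blast+
    from ev_agree'[OF this x(4)] show "card (f x) \<le> s" by (simp add: x(1) f_def)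
  qed
  also have "\<dots> = card ?P * s" by simp
  also have "\<dots> \<le> card (C \<times> C) * s" using P fin by (intro mult_le_mono1 card_mono) auto
  also have "\<dots> \<le> k * k * s" using assms(2) by (intro mult_le_mono1) (simp add: card_cartesian_product mult_le_mono)
  finally show ?thesis .
qed

text \<open>Double counting along the lines in direction \<open>t\<close>: exchanging coordinate
  \<open>t\<close> of \<open>p\<close> with \<open>i\<close> is a bijection on pairs of a point and
  a coordinate. It turns averages over lines into averages over points.\<close>

lemma up_count:
  assumes "t < s"
  shows "(\<Sum>p<B. card {i. i < q \<and> P (up q s p t i)}) = q * card {p. p < B \<and> P p}"
proof -
  let ?X = "{(p, i). p < B \<and> i < q \<and> P (up q s p t i)}" and ?Y = "{(p, i). p < B \<and> i < q \<and> P p}"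
  let ?f = "\<lambda>(p, i). (up q s p t i, dig q p t)"
  have inv: "up q s (up q s p t i) t (dig q p t) = p" if "p < B" "i < q" for p i
    by (rule dig_ext[where q = q and s = s]) (use that up_props[OF q0] dig_less[OF q0] in auto)
  have "bij_betw ?f ?X ?Y"
    by (rule bij_betw_byWitness[where f' = ?f])
      (use inv up_props[OF q0] dig_less[OF q0] assms in \<open>auto simp: split_beta\<close>)
  then have "card ?X = card ?Y" by (rule bij_betw_same_card)
  moreover have "?X = Sigma {..<B} (\<lambda>p. {i. i < q \<and> P (up q s p t i)})" by auto
  moreover have "?Y = {p. p < B \<and> P p} \<times> {..<q}" by auto
  ultimately show ?thesis by (simp add: card_cartesian_product mult.commute)
qed

section \<open>Counting the points whose walk to a fixed target is ambiguous\<close>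

context
  fixes S :: "(nat \<times> nat) set" and a :: nat and g :: nat
  assumes finS: "finite S" and aB: "a < B"
begin

text \<open>The walk from \<open>p\<close> to \<open>a\<close> passes through these hybrids:
  coordinates are replaced by those of \<open>a\<close> one after the other, so it starts with
  \<open>p\<close> for \<open>t = 0\<close> and ends with \<open>a\<close> for
  \<open>t = s\<close>.\<close>

definition pt :: "nat \<Rightarrow> nat \<Rightarrow> nat" where
  "pt t p = undig q s (\<lambda>e. if e < t then dig q a e else dig q p e)"

lemma pt_props: "pt t p < B" "e < s \<Longrightarrow> dig q (pt t p) e = (if e < t then dig q a e else dig q p e)"
proof -
  have F: "\<And>e. e < s \<Longrightarrow> (if e < t then dig q a e else dig q p e) < q" using dig_less[OF q0] by simp
  show "pt t p < B" unfolding pt_def by (rule undig_less) (rule F)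
  show "dig q (pt t p) e = (if e < t then dig q a e else dig q p e)" if "e < s"
    unfolding pt_def by (rule dig_undig[OF F that])
qed

lemma pt_eqI: "b < B \<Longrightarrow> (\<And>e. e < s \<Longrightarrow> dig q b e = (if e < t then dig q a e else dig q p e)) \<Longrightarrow> b = pt t p"
  by (rule dig_ext[where q = q and s = s]) (use pt_props in auto)

text \<open>These are the polynomials supported on a whole line of the walk. They do not depend on
  coordinate \<open>t\<close> of \<open>p\<close>, so the coordinate may be averaged over while the
  list is kept.\<close>

definition lines :: "nat \<Rightarrow> nat \<Rightarrow> nat set" where
  "lines t p = {c. LL S t (pt t p) c (q - 1)}"

lemma lines_sub: "lines t p \<subseteq> {..<B}"
  by (auto simp: lines_def LL_def)

lemma fin_lines: "finite (lines t p)"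
  using lines_sub finite_subset by blast

lemma lines_up: "t < s \<Longrightarrow> i < q \<Longrightarrow> lines t (up q s p t i) = lines t p"
  unfolding lines_def
  by (rule Collect_cong, rule LL_cong) (auto simp: pt_props up_props[OF q0])

definition vals :: "nat \<Rightarrow> nat \<Rightarrow> nat set" where
  "vals t p = {v. DD S t (pt t p) v}"

lemma vals_Suc: "t < s \<Longrightarrow> vals (Suc t) p = (\<lambda>c. ev q s c (dig q a t)) ` lines t p"
proof -
  assume t: "t < s"
  have "LL S t (pt (Suc t) p) c (q - 1) = LL S t (pt t p) c (q - 1)" for c
    by (rule LL_cong) (auto simp: pt_props)
  moreover have "dig q (pt (Suc t) p) t = dig q a t" using t by (simp add: pt_props)
  ultimately show ?thesis unfolding vals_def lines_def DD_Suc by auto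
qed

lemma fin_vals: "t \<le> s \<Longrightarrow> finite (vals t p)"
proof (cases t)
  case 0
  have "vals 0 p \<subseteq> snd ` S" by (force simp: vals_def)
  then show ?thesis using 0 finS finite_subset by blast
qed (simp add: vals_Suc fin_lines)

lemma vals_lines:
  assumes "t < s" "c \<in> lines t p" "i < q"
  shows "ev q s c i \<in> vals t (up q s p t i)"
proof -
  have "i \<le> q - 1" using assms(3) by simp
  then obtain b where b: "lnk (pt t p) b t i" "DD S t b (ev q s c i)" using assms(2) by (auto simp: lines_def LL_def)
  have "b = pt t (up q s p t i)"
    by (rule pt_eqI) (use b(1) assms in \<open>auto simp: lnk_def pt_props up_props[OF q0]\<close>)
  then show ?thesis using b(2) by (simp add: vals_def)
qed

definition bad :: "nat \<Rightarrow> nat" where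
  "bad t = card {p. p < B \<and> g < card (vals t p)}"

definition lam :: "nat \<Rightarrow> nat" where
  "lam t = card {p. p < B \<and> g < card (lines t p)}"

text \<open>At such a point the value does not single out a polynomial along the next line, and the
  walk may branch.\<close>

definition amb :: "nat \<Rightarrow> nat set" where
  "amb t = {p. p < B \<and> dig q p t \<in> coll (lines t p)}"

text \<open>Of \<open>Suc g\<close> polynomials on a line, any two differ at all but at most
  \<open>s\<close> coordinates, so outside \<open>Suc g * Suc g * s\<close> coordinates they produce
  \<open>Suc g\<close> different values. Long lists of polynomials on a line thus force long lists
  of values at most of its points.\<close>

lemma lam_bad:
  assumes t: "t < s"
  shows "(q - Suc g * Suc g * s) * lam t \<le> q * bad t"
proof -
  let ?x = "Suc g * Suc g * s" and ?Q = "\<lambda>p. g < card (vals t p)"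
  have line: "q - ?x \<le> card {i. i < q \<and> ?Q (up q s p t i)}" if p: "g < card (lines t p)" for p
  proof -
    obtain C where C: "C \<subseteq> lines t p" "card C = Suc g" using p by (meson Suc_leI obtain_subset_with_card_n)
    have CB: "C \<subseteq> {..<B}" using C lines_sub by blast
    have "{..<q} - coll C \<subseteq> {i. i < q \<and> ?Q (up q s p t i)}"
    proof
      fix i assume i: "i \<in> {..<q} - coll C"
      then have "inj_on (\<lambda>c. ev q s c i) C" by (auto simp: inj_on_def coll_def)
      then have "card ((\<lambda>c. ev q s c i) ` C) = Suc g" using C by (simp add: card_image)
      moreover have "(\<lambda>c. ev q s c i) ` C \<subseteq> vals t (up q s p t i)" using vals_lines[OF t] C i by auto
      then have "card ((\<lambda>c. ev q s c i) ` C) \<le> card (vals t (up q s p t i))"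
        using fin_vals t by (intro card_mono) auto
      ultimately show "i \<in> {i. i < q \<and> ?Q (up q s p t i)}" using i by auto
    qed
    then have "card ({..<q} - coll C) \<le> card {i. i < q \<and> ?Q (up q s p t i)}" by (intro card_mono) auto
    moreover have "q - card (coll C) \<le> card ({..<q} - coll C)"
      using diff_card_le_card_Diff[of "coll C" "{..<q}"] by (simp add: coll_def)
    moreover have "card (coll C) \<le> ?x" using card_coll[OF CB, of "Suc g"] C by simp
    ultimately show ?thesis by linarith
  qed
  have "(q - ?x) * lam t = (\<Sum>p\<in>{p. p < B \<and> g < card (lines t p)}. q - ?x)" by (simp add: lam_def mult.commute)
  also have "\<dots> \<le> (\<Sum>p\<in>{p. p < B \<and> g < card (lines t p)}. card {i. i < q \<and> ?Q (up q s p t i)})"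
    by (rule sum_mono) (use line in auto)
  also have "\<dots> \<le> (\<Sum>p<B. card {i. i < q \<and> ?Q (up q s p t i)})" by (rule sum_mono2) auto
  also have "\<dots> = q * bad t" unfolding bad_def by (rule up_count[OF t])
  finally show ?thesis .
qed

lemma bad_lam: "t < s \<Longrightarrow> bad (Suc t) \<le> lam t"
  unfolding bad_def lam_def
  by (rule card_mono) (use card_image_le[OF fin_lines] in \<open>auto simp: vals_Suc intro: less_le_trans\<close>)

text \<open>A line with at most \<open>g\<close> polynomials has at most \<open>g * g * s\<close>
  collision coordinates; all points of the remaining lines are counted in
  \<open>lam t\<close>.\<close>

lemma amb_le:
  assumes t: "t < s"
  shows "q * card (amb t) \<le> q * lam t + B * (g * g * s)"
proof -
  let ?Q = "\<lambda>p. card (lines t p) \<le> g \<and> dig q p t \<in> coll (lines t p)"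
  have "card {i. i < q \<and> ?Q (up q s p t i)} \<le> g * g * s" for p
  proof (cases "card (lines t p) \<le> g")
    case True
    have "{i. i < q \<and> ?Q (up q s p t i)} \<subseteq> coll (lines t p)"
      using lines_up[OF t] up_props[OF q0] t by auto
    moreover have "finite (coll (lines t p))" by (simp add: coll_def)
    ultimately have "card {i. i < q \<and> ?Q (up q s p t i)} \<le> card (coll (lines t p))" by (intro card_mono)
    also have "\<dots> \<le> g * g * s" by (rule card_coll[OF lines_sub True])
    finally show ?thesis .
  next
    case False
    then have "{i. i < q \<and> ?Q (up q s p t i)} = {}" using lines_up[OF t] by auto
    then show ?thesis by (simp only: card.empty)
  qed
  then have "(\<Sum>p<B. card {i. i < q \<and> ?Q (up q s p t i)}) \<le> (\<Sum>p<B. g * g * s)" by (rule sum_mono)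
  then have 1: "q * card {p. p < B \<and> ?Q p} \<le> B * (g * g * s)" using up_count[OF t, of ?Q] by simp
  have "amb t \<subseteq> {p. p < B \<and> g < card (lines t p)} \<union> {p. p < B \<and> ?Q p}" by (auto simp: amb_def)
  then have "card (amb t) \<le> card ({p. p < B \<and> g < card (lines t p)} \<union> {p. p < B \<and> ?Q p})" by (intro card_mono) auto
  also have "\<dots> \<le> lam t + card {p. p < B \<and> ?Q p}" unfolding lam_def by (rule card_Un_le)
  finally have "q * card (amb t) \<le> q * (lam t + card {p. p < B \<and> ?Q p})" by (rule mult_le_mono2)
  then show ?thesis using 1 by (simp add: distrib_left)
qed

text \<open>Markov's inequality: for \<open>t = 0\<close> the values at a point are just the entries
  of \<open>S\<close> there.\<close>

lemma bad_0: "Suc g * bad 0 \<le> card S"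
proof -
  let ?A = "{p. p < B \<and> g < card (vals 0 p)}"
  have v: "vals 0 p = {v. (p, v) \<in> S}" if "p < B" for p
  proof -
    have "p = pt 0 p" by (rule pt_eqI[OF that]) simp
    then show ?thesis by (simp add: vals_def)
  qed
  have "Suc g * bad 0 = (\<Sum>p\<in>?A. Suc g)" by (simp add: bad_def)
  also have "\<dots> \<le> (\<Sum>p\<in>?A. card {v. (p, v) \<in> S})" by (rule sum_mono) (use v in auto)
  also have "\<dots> = card (Sigma ?A (\<lambda>p. {v. (p, v) \<in> S}))"
  proof (rule card_SigmaI[symmetric])
    show "\<forall>p\<in>?A. finite {v. (p, v) \<in> S}"
    proof
      fix p
      have "{v. (p, v) \<in> S} \<subseteq> snd ` S" by force
      then show "finite {v. (p, v) \<in> S}" using finS finite_subset by blast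
    qed
  qed simp
  also have "\<dots> \<le> card S" by (rule card_mono[OF finS]) auto
  finally show ?thesis .
qed

lemma RR_digits: "p < B \<Longrightarrow> RR S t p v b w \<Longrightarrow> t \<le> s \<Longrightarrow> b < B \<and> (\<forall>e<s. t \<le> e \<longrightarrow> dig q b e = dig q p e)"
proof (induction t arbitrary: b w)
  case (Suc t)
  then obtain b0 c where b0: "RR S t p v b0 (ev q s c (dig q b0 t))" "lnk b0 b t (dig q b t)" by auto
  then show ?case using Suc.IH[OF Suc.prems(1) b0(1)] Suc.prems(3) by (auto simp: lnk_def)
qed simp

text \<open>By induction the value at \<open>pt t p\<close> is determined by \<open>v\<close>.
  Without a collision at this coordinate the value determines the polynomial along direction
  \<open>t\<close>, and hence the next value.\<close>

lemma RR_unique: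
  assumes p: "p < B" "\<And>t. t < s \<Longrightarrow> p \<notin> amb t"
  shows "t \<le> s \<Longrightarrow> RR S t p v (pt t p) w \<Longrightarrow> RR S t p v (pt t p) w' \<Longrightarrow> w = w'"
proof (induction t arbitrary: w w')
  case (Suc t)
  have t: "t < s" using Suc.prems(1) by simp
  have prev: "b0 = pt t p" if "RR S t p v b0 w0" "lnk b0 (pt (Suc t) p) t i" for b0 w0 i
  proof (rule pt_eqI)
    have d: "b0 < B" "\<forall>e<s. t \<le> e \<longrightarrow> dig q b0 e = dig q p e"
      using RR_digits[OF p(1) that(1)] t by auto
    show "b0 < B" by fact
    fix e assume e: "e < s"
    show "dig q b0 e = (if e < t then dig q a e else dig q p e)"
    proof (cases "e < t")
      case True
      then have "dig q b0 e = dig q (pt (Suc t) p) e" using that(2) e by (auto simp: lnk_def)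
      then show ?thesis using True e by (simp add: pt_props)
    qed (use d e in auto)
  qed
  obtain b0 c where c: "RR S t p v b0 (ev q s c (dig q b0 t))" "LL S t b0 c (q - 1)"
    "lnk b0 (pt (Suc t) p) t (dig q (pt (Suc t) p) t)" "w = ev q s c (dig q (pt (Suc t) p) t)"
    using Suc.prems(2) by auto
  obtain b1 c' where c': "RR S t p v b1 (ev q s c' (dig q b1 t))" "LL S t b1 c' (q - 1)"
    "lnk b1 (pt (Suc t) p) t (dig q (pt (Suc t) p) t)" "w' = ev q s c' (dig q (pt (Suc t) p) t)"
    using Suc.prems(3) by auto
  have b: "b0 = pt t p" "b1 = pt t p" using prev c c' by blast+
  have dp: "dig q (pt t p) t = dig q p t" using t by (simp add: pt_props)
  have "ev q s c (dig q p t) = ev q s c' (dig q p t)"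
    using Suc.IH[of "ev q s c (dig q p t)" "ev q s c' (dig q p t)"] c(1) c'(1) t unfolding b dp by simp
  moreover have "c \<in> lines t p" "c' \<in> lines t p" using c(2) c'(2) by (auto simp: lines_def b)
  ultimately have "c = c'" using p(2)[OF t] p(1) dig_less[OF q0] by (auto simp: amb_def coll_def)
  then show ?case using c(4) c'(4) by simp
qed simp

lemma pt_s: "pt s p = a"
  by (rule pt_eqI[symmetric, OF aB]) simp

definition nonfun :: "nat set" where
  "nonfun = {p. p < B \<and> (\<exists>v w w'. RR S s p v a w \<and> RR S s p v a w' \<and> w \<noteq> w')}"

lemma nonfun_amb: "nonfun \<subseteq> (\<Union>t<s. amb t)"
proof
  fix p assume "p \<in> nonfun"
  then obtain v w w' where p: "p < B" "RR S s p v a w" "RR S s p v a w'" "w \<noteq> w'" by (auto simp: nonfun_def)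
  show "p \<in> (\<Union>t<s. amb t)"
  proof (rule ccontr)
    assume "p \<notin> (\<Union>t<s. amb t)"
    then have "\<And>t. t < s \<Longrightarrow> p \<notin> amb t" by auto
    from RR_unique[OF p(1) this order_refl] p(2-4) show False unfolding pt_s by blast
  qed
qed

text \<open>From one coordinate to the next, the number of points with long lists grows at most by
  the factor \<open>1 / \<rho>\<close>, and \<open>\<rho> ^ s\<close> is at least 1/2. So there are
  never more than \<open>2 * bad 0\<close>, where \<open>bad 0\<close> is at most
  \<open>10 * B / s ^ 2\<close> by the choice \<open>g = s ^ 3\<close>. Summed over \<open>s\<close>
  coordinates, these points contribute at most \<open>B / 5\<close> and the collisions of short
  lists at most \<open>B / 100\<close>.\<close>

lemma card_nonfun:
  assumes s: "100 \<le> s" and q: "s ^ 9 < q" and S: "card S \<le> 10 * s * B" and g: "g = s ^ 3"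
  shows "2 * card nonfun < B"
proof -
  define x where "x = Suc g * Suc g * s"
  define \<rho> where "\<rho> = 1 - real x / real q"
  have sr: "100 \<le> real s" using s by simp
  have qr: "real s ^ 9 < real q" using q by (metis of_nat_less_iff of_nat_power)
  have q0r: "0 < real q" using q0 by simp
  have "Suc g \<le> 2 * s ^ 3" using s by (simp add: g)
  then have "Suc g * Suc g \<le> (2 * s ^ 3) * (2 * s ^ 3)" by (rule mult_le_mono) fact
  then have "x \<le> (2 * s ^ 3) * (2 * s ^ 3) * s" unfolding x_def by (rule mult_le_mono1)
  also have "\<dots> = 4 * s ^ 7" by (simp add: eval_nat_numeral algebra_simps)
  finally have x: "real x \<le> 4 * real s ^ 7" by (metis of_nat_le_iff of_nat_mult of_nat_numeral of_nat_power)
  \<comment> \<open>This is one source of the exponent 9: \<open>x\<close> is at most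
    \<open>4 * s ^ 7\<close>, and the loss \<open>x / q\<close> is incurred once for each of the
    \<open>s\<close> coordinates.\<close>
  have sx: "real s * (real x / real q) \<le> 1 / 2"
  proof -
    have "real s * real x \<le> real s * (4 * real s ^ 7)" using x by (intro mult_left_mono) auto
    also have "\<dots> = 4 * real s ^ 8" by (simp add: eval_nat_numeral)
    also have "\<dots> \<le> (1 / 2) * (real s * real s ^ 8)"
    proof -
      have "0 \<le> real s ^ 8" by simp
      with mult_right_mono[OF sr this] show ?thesis by linarith
    qed
    also have "\<dots> = (1 / 2) * real s ^ 9" by (simp add: eval_nat_numeral)
    also have "\<dots> \<le> (1 / 2) * real q" using qr by simp
    finally show ?thesis using q0r by (simp add: field_simps)
  qed
  have x0: "0 \<le> real x / real q" by simp
  have "real x / real q \<le> real s * (real x / real q)" using mult_right_mono[of 1 "real s" "real x / real q"] sr x0 by simp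
  then have r12: "1 / 2 \<le> \<rho>" "\<rho> \<le> 1" using sx x0 unfolding \<rho>_def by linarith+
  have xq: "x \<le> q" using r12(1) q0r unfolding \<rho>_def by (simp add: field_simps)
  have "1 + real s * (- (real x / real q)) \<le> (1 + - (real x / real q)) ^ s"
  proof (rule Bernoulli_inequality)
    show "- 1 \<le> - (real x / real q)" using r12 unfolding \<rho>_def by linarith
  qed
  then have \<rho>s: "1 / 2 \<le> \<rho> ^ s" using sx unfolding \<rho>_def by simp
  have lam: "\<rho> * real (lam t) \<le> real (bad t)" if "t < s" for t
  proof -
    have "(real q - real x) * real (lam t) \<le> real q * real (bad t)"
      using lam_bad[OF that] xq unfolding x_def[symmetric] by (metis of_nat_diff of_nat_le_iff of_nat_mult)
    then show ?thesis using q0r unfolding \<rho>_def by (simp add: field_simps)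
  qed
  have bad: "\<rho> ^ t * real (bad t) \<le> real (bad 0)" if "t \<le> s" for t
    using that
  proof (induction t)
    case (Suc t)
    have "\<rho> ^ Suc t * real (bad (Suc t)) \<le> \<rho> ^ t * (\<rho> * real (lam t))"
      using bad_lam[of t] Suc.prems r12 by (simp add: mult_left_mono mult.assoc)
    also have "\<dots> \<le> \<rho> ^ t * real (bad t)" using lam[of t] Suc.prems r12 by (intro mult_left_mono) auto
    also have "\<dots> \<le> real (bad 0)" using Suc by simp
    finally show ?case .
  qed simp
  have lam2: "real (lam t) \<le> 2 * real (bad 0)" if t: "t < s" for t
  proof -
    have "1 / 2 \<le> \<rho> ^ Suc t" using power_decreasing[of "Suc t" s \<rho>] \<rho>s r12 t by simp
    then have "1 / 2 * real (lam t) \<le> \<rho> ^ Suc t * real (lam t)" by (intro mult_right_mono) auto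
    also have "\<dots> = \<rho> ^ t * (\<rho> * real (lam t))" by simp
    also have "\<dots> \<le> \<rho> ^ t * real (bad t)" using lam[OF t] r12 by (intro mult_left_mono) auto
    also have "\<dots> \<le> real (bad 0)" using bad[of t] t by simp
    finally show ?thesis by simp
  qed
  have b0: "real (bad 0) * real s ^ 3 \<le> 10 * real s * real B"
  proof -
    have "s ^ 3 * bad 0 \<le> Suc g * bad 0" unfolding g by (rule mult_le_mono1) simp
    then have "s ^ 3 * bad 0 \<le> 10 * s * B" using bad_0 S by linarith
    then have "real (s ^ 3 * bad 0) \<le> real (10 * s * B)" by (simp only: of_nat_le_iff)
    then show ?thesis by (simp add: mult.commute)
  qed
  have b1: "real s * real (bad 0) \<le> real B / 10"
  proof -
    have "real s * (real s * (real s * real (bad 0))) \<le> real s * (10 * real B)"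
      using b0 by (simp add: eval_nat_numeral algebra_simps)
    then have "real s * (real s * real (bad 0)) \<le> 10 * real B" using sr by simp
    moreover have "100 * (real s * real (bad 0)) \<le> real s * (real s * real (bad 0))"
      using sr by (intro mult_right_mono) auto
    ultimately show ?thesis by linarith
  qed
  have amb: "real (card (amb t)) \<le> 2 * real (bad 0) + real B * real s ^ 7 / real q" if t: "t < s" for t
  proof -
    have "g * g * s = s ^ 7" by (simp add: g eval_nat_numeral)
    then have "real q * real (card (amb t)) \<le> real q * real (lam t) + real B * real s ^ 7"
      using amb_le[OF t] by (metis of_nat_add of_nat_le_iff of_nat_mult of_nat_power)
    then have "real (card (amb t)) \<le> real (lam t) + real B * real s ^ 7 / real q"
      using q0r by (simp add: field_simps)
    then show ?thesis using lam2[OF t] by linarith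
  qed
  have "card nonfun \<le> card (\<Union>t<s. amb t)" by (rule card_mono[OF _ nonfun_amb]) (simp add: amb_def)
  also have "\<dots> \<le> (\<Sum>t<s. card (amb t))" by (rule card_UN_le) simp
  finally have "real (card nonfun) \<le> (\<Sum>t<s. real (card (amb t)))" by (metis of_nat_le_iff of_nat_sum)
  also have "\<dots> \<le> (\<Sum>t<s. 2 * real (bad 0) + real B * real s ^ 7 / real q)"
    by (rule sum_mono) (use amb in auto)
  also have "\<dots> = 2 * (real s * real (bad 0)) + real B * (real s * real s ^ 7 / real q)" by (simp add: algebra_simps)
  also have "\<dots> \<le> real B / 5 + real B * (1 / 100)"
  proof -
    have "real s * real s ^ 7 / real q \<le> 1 / 100"
    proof -
      have "100 * (real s * real s ^ 7) \<le> real s * (real s * real s ^ 7)" using sr by (intro mult_right_mono) auto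
      also have "\<dots> = real s ^ 9" by (simp add: eval_nat_numeral)
      finally have "100 * (real s * real s ^ 7) \<le> real q" using qr by linarith
      then show ?thesis using q0r by (simp add: field_simps)
    qed
    then have "real B * (real s * real s ^ 7 / real q) \<le> real B * (1 / 100)" by (intro mult_left_mono) auto
    then show ?thesis using b1 by linarith
  qed
  also have "\<dots> < real B / 2" using B0 by (simp add: field_simps)
  finally have "2 * real (card nonfun) < real B" by simp
  then show ?thesis by (metis of_nat_less_iff of_nat_mult of_nat_numeral)
qed

end

text \<open>By averaging, some \<open>p\<close> has an unambiguous walk to more than half of the
  points. For a variable stored at \<open>a\<close>, more than half of the points have an
  unambiguous walk to \<open>a\<close>; hence some \<open>r\<close> lies in both sets. As
  \<open>CC\<close> demands the same truth value via every \<open>r\<close>, this \<open>r\<close>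
  makes the truth value unique, although the direct walk from \<open>p\<close> to \<open>a\<close>
  may be ambiguous.\<close>

theorem gap_sound:
  assumes A: "AA S cl m (B - 1)" and S: "finite S" "card S \<le> 10 * s * B"
    and s: "100 \<le> s" and q: "s ^ 9 < q"
  shows "\<exists>\<alpha>. \<forall>k<m. \<exists>j bt. cl k j bt \<and> (bt = 1 \<longleftrightarrow> \<alpha> j)"
proof -
  have nf: "2 * card (nonfun S a) < B" if "a < B" for a
    by (rule card_nonfun[OF S(1) that s q S(2) refl])
  have nfB: "nonfun S a \<subseteq> {..<B}" if "a < B" for a by (auto simp: nonfun_def[OF S(1) that])
  have "\<exists>p<B. 2 * card {r. r < B \<and> p \<in> nonfun S r} < B"
  proof (rule ccontr)
    assume no: "\<not> (\<exists>p<B. 2 * card {r. r < B \<and> p \<in> nonfun S r} < B)"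
    have "B \<le> 2 * card {r. r < B \<and> p \<in> nonfun S r}" if "p < B" for p
      using no that by (meson not_less)
    then have "(\<Sum>p<B. B) \<le> (\<Sum>p<B. 2 * card {r. r < B \<and> p \<in> nonfun S r})" by (intro sum_mono) auto
    also have "\<dots> = 2 * (\<Sum>p<B. \<Sum>r<B. of_bool (p \<in> nonfun S r))"
      by (simp add: sum_distrib_left sum_of_bool_eq Int_def lessThan_def)
    also have "(\<Sum>p<B. \<Sum>r<B. of_bool (p \<in> nonfun S r)) = (\<Sum>r<B. \<Sum>p<B. of_bool (p \<in> nonfun S r) :: nat)"
      by (rule sum.swap)
    also have "\<dots> = (\<Sum>r<B. card (nonfun S r))"
    proof (rule sum.cong)
      fix r assume "r \<in> {..<B}"
      then have "{..<B} \<inter> {p. p \<in> nonfun S r} = nonfun S r" using nfB by auto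
      then show "(\<Sum>p<B. of_bool (p \<in> nonfun S r)) = card (nonfun S r)" by (simp add: sum_of_bool_eq)
    qed simp
    also have "2 * (\<Sum>r<B. card (nonfun S r)) = (\<Sum>r<B. 2 * card (nonfun S r))" by (rule sum_distrib_left)
    also have "\<dots> < (\<Sum>r<B. B)"
    proof (rule sum_strict_mono)
      show "{..<B} \<noteq> {}" using B0 by (metis lessThan_iff empty_iff)
    qed (use nf in auto)
    finally show False by simp
  qed
  then obtain p where p: "p < B" "2 * card {r. r < B \<and> p \<in> nonfun S r} < B" by blast
  have "p \<le> B - 1" using p(1) by simp
  with A obtain v where v: "GG S cl p v m" unfolding AA_def by blast
  define \<alpha> where "\<alpha> j = CC S p v j 1 (B - 1)" for j
  have uniq: "bt = bt'" if C: "CC S p v j bt (B - 1)" "CC S p v j bt' (B - 1)" for j bt bt'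
  proof -
    from C(1) obtain a where a: "ispt j a" by (auto simp: CC_def WW_def)
    then have aB: "a < B" by (simp add: ispt_def)
    have pta: "b = a" if "ispt j b" for b
      by (rule dig_ext[where q = q and s = s]) (use that a in \<open>auto simp: ispt_def\<close>)
    have "card (nonfun S a \<union> {r. r < B \<and> p \<in> nonfun S r}) < B"
      using card_Un_le[of "nonfun S a" "{r. r < B \<and> p \<in> nonfun S r}"] nf[OF aB] p(2) by linarith
    moreover have "finite (nonfun S a \<union> {r. r < B \<and> p \<in> nonfun S r})"
      using finite_subset[OF nfB[OF aB]] by simp
    ultimately have "\<not> {..<B} \<subseteq> nonfun S a \<union> {r. r < B \<and> p \<in> nonfun S r}"
      using card_mono[of "nonfun S a \<union> {r. r < B \<and> p \<in> nonfun S r}" "{..<B}"] by auto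
    then obtain r where r: "r < B" "r \<notin> nonfun S a" "p \<notin> nonfun S r" by auto
    have rr: "r \<le> B - 1" using r by simp
    obtain w where w: "RR S s p v r w" "RR S s r w a bt" using C(1) rr pta by (fastforce simp: CC_def WW_def)
    obtain w' where w': "RR S s p v r w'" "RR S s r w' a bt'" using C(2) rr pta by (fastforce simp: CC_def WW_def)
    have "w = w'" using r(3) p(1) w(1) w'(1) by (auto simp: nonfun_def[OF S(1) r(1)])
    then show ?thesis using r(1,2) w(2) w'(2) by (auto simp: nonfun_def[OF S(1) aB])
  qed
  have "\<exists>j bt. cl k j bt \<and> (bt = 1 \<longleftrightarrow> \<alpha> j)" if k: "k < m" for k
  proof -
    obtain j bt where jb: "cl k j bt" "CC S p v j bt (B - 1)" using v k unfolding GG_def by blast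
    have "bt = 1 \<longleftrightarrow> \<alpha> j"
    proof
      show "\<alpha> j" if "bt = 1" using jb(2) that by (simp add: \<alpha>_def)
      show "bt = 1" if "\<alpha> j" by (rule uniq[OF jb(2)]) (use that in \<open>simp add: \<alpha>_def\<close>)
    qed
    then show ?thesis using jb(1) by blast
  qed
  then show ?thesis by blast
qed

end

section \<open>Interpolation and a prime\<close>

lemma dvd_poly: "(\<And>e. d dvd coeff p e) \<Longrightarrow> d dvd poly p (x::int)"
  unfolding poly_altdef by (intro dvd_sum dvd_mult2)

lemma ev_of_poly:
  assumes q: "0 < q" and s: "0 < s" and deg: "degree P < s"
  shows "\<exists>c<q ^ s. \<forall>i. [int (ev q s c i) = poly P (int i)] (mod int q)"
proof -
  define f where "f e = nat (coeff P (s - 1 - e) mod int q)" for e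
  define c where "c = undig q s f"
  have fq: "f e < q" for e using q by (simp add: f_def nat_less_iff)
  have fe: "int (f e) = coeff P (s - 1 - e) mod int q" for e using q by (simp add: f_def)
  have c: "c < q ^ s" unfolding c_def by (rule undig_less) (rule fq)
  have "int q dvd coeff (epoly q s c - P) e" for e
  proof (cases "e < s")
    case True
    have "s - 1 - (s - 1 - e) = e" using True by simp
    then have "coeff (epoly q s c) e = int (f (s - 1 - e))"
      using coeff_epoly[of "s - 1 - e" s q c] dig_undig[of s f q "s - 1 - e"] fq s by (simp add: c_def)
    also have "\<dots> = coeff P e mod int q" using fe[of "s - 1 - e"] \<open>s - 1 - (s - 1 - e) = e\<close> by simp
    finally show ?thesis by (simp add: mod_eq_dvd_iff[symmetric])
  next
    case False
    have "degree (epoly q s c) < s" by (rule degree_epoly[OF s])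
    then have "coeff (epoly q s c) e = 0" "coeff P e = 0" using False deg by (auto intro: coeff_eq_0)
    then show ?thesis by simp
  qed
  then have "int q dvd poly (epoly q s c - P) (int i)" for i by (rule dvd_poly)
  then have "[poly (epoly q s c) (int i) = poly P (int i)] (mod int q)" for i by (simp add: cong_iff_dvd_diff)
  then show ?thesis using c ev_epoly cong_trans by blast
qed

text \<open>The product of the linear factors of the other nodes is normalised by an inverse modulo
  \<open>q\<close>, which exists because \<open>s \<le> q\<close> keeps the nodes distinct modulo
  the prime \<open>q\<close>.\<close>

lemma lagrange:
  assumes q: "prime q" and s: "0 < s" "s \<le> q" and e: "e < s"
  shows "\<exists>P. degree P < s \<and> (\<forall>i<s. [poly P (int i) = of_bool (i = e)] (mod int q))"
proof -
  let ?A = "{..<s} - {e}"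
  define Q where "Q = (\<Prod>e'\<in>?A. [:- int e', 1:])"
  have Qp: "poly Q x = (\<Prod>e'\<in>?A. x - int e')" for x by (simp add: Q_def poly_prod)
  have "degree Q \<le> sum (degree \<circ> (\<lambda>e'. [:- int e', 1:])) ?A" unfolding Q_def by (rule degree_prod_sum_le) simp
  also have "\<dots> = s - 1" using e by simp
  finally have dQ: "degree Q < s" using s by simp
  have "coprime (poly Q (int e)) (int q)" unfolding Qp
  proof (rule prod_coprime_left)
    fix e' assume e': "e' \<in> ?A"
    have "\<not> int q dvd int e - int e'"
    proof
      assume "int q dvd int e - int e'"
      then have "[int e = int e'] (mod int q)" by (simp add: cong_iff_dvd_diff)
      then have "[e = e'] (mod q)" by (simp add: cong_int_iff)
      moreover have "e < q" "e' < q" using e e' s by auto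
      ultimately have "e = e'" by (simp add: cong_less_modulus_unique_nat)
      then show False using e' by simp
    qed
    then show "coprime (int e - int e') (int q)" using q
      by (metis coprime_commute prime_imp_coprime prime_nat_int_transfer)
  qed
  then obtain u where u: "[poly Q (int e) * u = 1] (mod int q)" using cong_solve_coprime_int by blast
  have "[poly (smult u Q) (int i) = of_bool (i = e)] (mod int q)" if "i < s" for i
  proof (cases "i = e")
    case True
    then show ?thesis using u by (simp add: mult.commute)
  next
    case False
    then have "poly Q (int i) = 0" unfolding Qp using that by (intro prod_zero) auto
    then show ?thesis using False by simp
  qed
  moreover have "degree (smult u Q) < s" using dQ degree_smult_le le_less_trans by blast
  ultimately show ?thesis by blast
qed

text \<open>The function is a sum of products of one-dimensional Lagrange polynomials, one factor
  per coordinate. On a line all factors but one are constant, so a polynomial of degree below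
  \<open>s\<close> remains.\<close>

lemma interpolation:
  assumes q: "prime q" and s: "0 < s" "s \<le> q"
  shows "\<exists>F. (\<forall>a. F a < q) \<and>
    (\<forall>a t. t < s \<longrightarrow> (\<exists>c<q ^ s. \<forall>i<q. F (up q s a t i) = ev q s c i)) \<and>
    (\<forall>j b. j < s ^ s \<and> (\<forall>t<s. dig q b t = dig s j t) \<longrightarrow> F b = of_bool (\<alpha> j))"
proof -
  have q0: "0 < q" using q by (simp add: prime_gt_0_nat)
  obtain la where la: "\<And>e. e < s \<Longrightarrow> degree (la e) < s"
    "\<And>e i. e < s \<Longrightarrow> i < s \<Longrightarrow> [poly (la e) (int i) = of_bool (i = e)] (mod int q)"
    using lagrange[OF q s] by metis
  have ds: "dig s j t < s" for j t using dig_less[OF s(1)] .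
  define H where "H a = (\<Sum>j<s ^ s. of_bool (\<alpha> j) * (\<Prod>t<s. poly (la (dig s j t)) (int (dig q a t))))" for a
  define F where "F a = nat (H a mod int q)" for a
  have Fq: "F a < q" for a using q0 by (simp add: F_def nat_less_iff)
  have FH: "int (F a) = H a mod int q" for a using q0 by (simp add: F_def)
  have line: "\<exists>c<q ^ s. \<forall>i<q. F (up q s a t i) = ev q s c i" if t: "t < s" for a t
  proof -
    define k where "k j = of_bool (\<alpha> j) * (\<Prod>t'\<in>{..<s} - {t}. poly (la (dig s j t')) (int (dig q a t')))" for j
    define P where "P = (\<Sum>j<s ^ s. smult (k j) (la (dig s j t)))"
    have deg: "degree P < s" unfolding P_def
      by (rule degree_sum_less) (use la(1) ds s degree_smult_le le_less_trans in \<open>blast+\<close>)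
    have HP: "H (up q s a t i) = poly P (int i)" if i: "i < q" for i
    proof -
      have "(\<Prod>t'<s. poly (la (dig s j t')) (int (dig q (up q s a t i) t'))) =
          poly (la (dig s j t)) (int i) * (\<Prod>t'\<in>{..<s} - {t}. poly (la (dig s j t')) (int (dig q a t')))" for j
      proof -
        have "(\<Prod>t'<s. poly (la (dig s j t')) (int (dig q (up q s a t i) t'))) =
          poly (la (dig s j t)) (int (dig q (up q s a t i) t)) *
          (\<Prod>t'\<in>{..<s} - {t}. poly (la (dig s j t')) (int (dig q (up q s a t i) t')))"
          by (rule prod.remove) (use t in auto)
        also have "(\<Prod>t'\<in>{..<s} - {t}. poly (la (dig s j t')) (int (dig q (up q s a t i) t'))) =
          (\<Prod>t'\<in>{..<s} - {t}. poly (la (dig s j t')) (int (dig q a t')))"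
          by (rule prod.cong) (use up_props(2)[OF q0 i] in auto)
        finally show ?thesis using up_props(2)[OF q0 i, of t s a t] t by simp
      qed
      then show ?thesis by (simp add: H_def P_def k_def poly_sum mult_ac)
    qed
    obtain c where c: "c < q ^ s" "\<And>i. [int (ev q s c i) = poly P (int i)] (mod int q)"
      using ev_of_poly[OF q0 s(1) deg] by blast
    have "F (up q s a t i) = ev q s c i" if i: "i < q" for i
    proof -
      have "int (F (up q s a t i)) = int (ev q s c i) mod int q"
        using FH[of "up q s a t i"] HP[OF i] c(2)[of i] by (simp add: cong_def)
      also have "\<dots> = int (ev q s c i)" using ev_less[OF q0, of s c i] by simp
      finally show ?thesis by simp
    qed
    then show ?thesis using c(1) by blast
  qed
  have pts: "F b = of_bool (\<alpha> j)" if j: "j < s ^ s" and b: "\<forall>t<s. dig q b t = dig s j t" for j b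
  proof -
    have "[H b = (\<Sum>j'<s ^ s. of_bool (\<alpha> j') * of_bool (j' = j))] (mod int q)" unfolding H_def
    proof (intro cong_sum cong_mult cong_refl)
      fix j' assume j': "j' \<in> {..<s ^ s}"
      have "[(\<Prod>t<s. poly (la (dig s j' t)) (int (dig q b t))) = (\<Prod>t<s. of_bool (dig s j t = dig s j' t))] (mod int q)"
        by (rule cong_prod) (use b la(2) ds in auto)
      also have "(\<Prod>t<s. of_bool (dig s j t = dig s j' t)) = (of_bool (j' = j) :: int)"
      proof (cases "j' = j")
        case False
        then obtain t where "t < s" "dig s j t \<noteq> dig s j' t" using dig_ext[of j s s j'] j j' by auto
        then have "(\<Prod>t<s. of_bool (dig s j t = dig s j' t)) = (0 :: int)" by (intro prod_zero) auto
        then show ?thesis using False by simp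
      qed simp
      finally show "[(\<Prod>t<s. poly (la (dig s j' t)) (int (dig q b t))) = of_bool (j' = j)] (mod int q)" .
    qed
    also have "(\<Sum>j'<s ^ s. of_bool (\<alpha> j') * of_bool (j' = j)) = (\<Sum>j'<s ^ s. if j' = j then of_bool (\<alpha> j') else 0 :: int)"
      by (rule sum.cong) auto
    also have "\<dots> = of_bool (\<alpha> j)" using j by simp
    finally have "int (F b) = of_bool (\<alpha> j) mod int q" using FH[of b] by (simp add: cong_def)
    also have "\<dots> = of_bool (\<alpha> j)" using prime_gt_1_nat[OF q] by simp
    finally show ?thesis by (cases "\<alpha> j") auto
  qed
  show ?thesis using Fq line pts by blast
qed

text \<open>The recurrence of Leibniz's harmonic triangle: in the notation of the proof,
  \<open>1 / w = 1 / y - 1 / x\<close>, so that \<open>L / w\<close> is an integer because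
  \<open>L / x\<close> and \<open>L / y\<close> are.\<close>

lemma leibniz_dvd:
  assumes "1 \<le> c" "c \<le> r"
  shows "c * (r choose c) dvd Lcm {1..r}"
  using assms
proof (induction c arbitrary: r rule: nat_induct_at_least)
  case base
  then show ?case by (simp add: dvd_Lcm)
next
  case (Suc c)
  define L where "L = Lcm {1..r}"
  have r: "c \<le> r - 1" "c \<le> r" "1 \<le> r" "Suc (r - 1) = r" using Suc by auto
  have "c * (r choose c) dvd L" unfolding L_def by (rule Suc.IH[OF r(2)])
  then obtain u where u: "L = c * (r choose c) * u" by (auto elim: dvdE)
  have "c * (r - 1 choose c) dvd Lcm {1..r - 1}" by (rule Suc.IH[OF r(1)])
  also have "Lcm {1..r - 1} dvd L" unfolding L_def by (rule Lcm_subset) auto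
  finally obtain v where v: "L = c * (r - 1 choose c) * v" by (auto elim: dvdE)
  define x y w where "x = int (c * (r choose c))" and "y = int (c * (r - 1 choose c))"
    and "w = int (Suc c * (r choose Suc c))"
  have c0: "0 < c" using Suc.hyps by simp
  have "Suc c * (r choose Suc c) = r * (r - 1 choose c)"
    using Suc_times_binomial_eq[of "r - 1" c] r by (simp add: mult.commute)
  then have e1: "w = int r * int (r - 1 choose c)" unfolding w_def by (simp only: of_nat_mult)
  have e2: "(int r - int c) * int (r choose c) = int r * int (r - 1 choose c)"
    using binomial_absorb_comp[of r c] r by (metis of_nat_diff of_nat_mult)
  have "int c * w = int r * y" using e1 by (simp add: y_def)
  moreover have "(int r - int c) * x = int r * y" using e2 by (simp add: x_def y_def algebra_simps)
  ultimately have rel: "w * (x - y) = x * y"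
  proof -
    have "int c * (w * (x - y)) = int r * y * (x - y)"
      unfolding \<open>int c * w = int r * y\<close>[symmetric] by (simp only: mult.assoc)
    also have "\<dots> = y * (int r * x - int r * y)" by (simp add: algebra_simps)
    also have "\<dots> = y * (int c * x)" using \<open>(int r - int c) * x = int r * y\<close> by (simp add: algebra_simps)
    finally have "int c * (w * (x - y)) = int c * (x * y)" by (simp add: algebra_simps)
    then show ?thesis using c0 by simp
  qed
  have xy: "x \<noteq> 0" "y \<noteq> 0" using c0 r by (auto simp: x_def y_def)
  have "int L = x * int u" unfolding x_def u by (rule of_nat_mult)
  have "int L = y * int v" unfolding y_def v by (rule of_nat_mult)
  have "x * y * int L = w * (x - y) * int L" using rel by simp
  also have "\<dots> = w * (x * (y * int v) - y * (x * int u))"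
    using \<open>int L = x * int u\<close> \<open>int L = y * int v\<close> by (metis left_diff_distrib mult.assoc)
  also have "\<dots> = x * y * (w * (int v - int u))" by (simp add: algebra_simps)
  finally have "int L = w * (int v - int u)" using xy by simp
  then have "w dvd int L" by simp
  then show ?case unfolding w_def L_def by (simp only: int_dvd_int_iff)
qed

text \<open>The multiplicity of a prime in a least common multiple is the maximum of its
  multiplicities in the arguments, so the prime power divides a single argument.\<close>

lemma prime_power_dvd_Lcm: "prime p \<Longrightarrow> p ^ k dvd Lcm {1..n::nat} \<Longrightarrow> k = 0 \<or> p ^ k \<le> n"
proof (induction n)
  case 0
  then show ?case by (auto simp: prime_gt_1_nat)
next
  case (Suc n)
  have "Lcm {1..Suc n} = lcm (Suc n) (Lcm {1..n})" by (simp add: atLeastAtMostSuc_conv)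
  then have "p ^ k dvd lcm (Suc n) (Lcm {1..n})" using Suc.prems by simp
  moreover have "Lcm {1..n} \<noteq> 0" by (simp add: Lcm_0_iff)
  ultimately have "k \<le> multiplicity p (lcm (Suc n) (Lcm {1..n}))"
    using Suc.prems(1) by (intro multiplicity_geI) (auto simp: prime_gt_1_nat lcm_eq_0_iff)
  also have "\<dots> = max (multiplicity p (Suc n)) (multiplicity p (Lcm {1..n}))"
    by (rule multiplicity_lcm) (use Suc.prems(1) \<open>Lcm {1..n} \<noteq> 0\<close> in auto)
  finally have "k \<le> multiplicity p (Suc n) \<or> k \<le> multiplicity p (Lcm {1..n})" by linarith
  then show ?case
  proof
    assume "k \<le> multiplicity p (Suc n)"
    then have "p ^ k dvd Suc n" by (rule multiplicity_dvd')
    then show ?thesis by (auto dest: dvd_imp_le)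
  next
    assume "k \<le> multiplicity p (Lcm {1..n})"
    then have "p ^ k dvd Lcm {1..n}" by (rule multiplicity_dvd')
    then show ?thesis using Suc.IH[OF Suc.prems(1)] by auto
  qed
qed

lemma two_power_le_binomial: "2 ^ M \<le> (2 * M choose M)"
proof (induction M)
  case (Suc M)
  have "Suc M * (2 * Suc M choose Suc M) = 2 * (2 * M + 1) * (2 * M choose M)"
    using Suc_times_binomial_eq[of "2 * M + 1" M] Suc_times_binomial_eq[of "2 * M" M]
      binomial_symmetric[of "Suc M" "Suc (2 * M)"] by (simp add: algebra_simps)
  then have "Suc M * (2 * (2 * M choose M)) \<le> Suc M * (2 * Suc M choose Suc M)"
    by (simp add: algebra_simps)
  then have "2 * (2 * M choose M) \<le> (2 * Suc M choose Suc M)" by (simp only: Suc_mult_le_cancel1)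
  then show ?case using Suc by simp
qed simp

text \<open>A Chebyshev-type estimate: without a prime in this range, \<open>Lcm {1..2 * M}\<close>
  has at most \<open>n\<close> prime factors, each with a prime power of at most
  \<open>n ^ 2\<close>. The resulting bound \<open>n ^ (2 * n)\<close> contradicts the lower bound
  \<open>2 ^ M\<close> from the central binomial coefficient.\<close>

lemma prime_between:
  fixes n :: nat
  assumes "64 \<le> n"
  shows "\<exists>p. prime p \<and> n < p \<and> p \<le> n ^ 2"
proof (rule ccontr)
  assume no: "\<not> ?thesis"
  define M where "M = n ^ 2 div 2"
  define L where "L = Lcm {1..2 * M}"
  have M1: "1 \<le> M" "2 * M \<le> n ^ 2"
  proof -
    have "2 \<le> n ^ 2" using assms self_le_power[of n 2] by simp
    then show "1 \<le> M" unfolding M_def by linarith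
    show "2 * M \<le> n ^ 2" unfolding M_def by simp
  qed
  have L0: "L \<noteq> 0" unfolding L_def by (simp add: Lcm_0_iff)
  have "2 ^ M \<le> M * (2 * M choose M)" using two_power_le_binomial[of M] M1
    by (metis le_trans mult_le_mono1 nat_mult_1)
  also have "\<dots> \<le> L"
  proof (rule dvd_imp_le)
    show "M * (2 * M choose M) dvd L" unfolding L_def by (rule leibniz_dvd) (use M1 in auto)
  qed (use L0 in simp)
  also have "L = (\<Prod>p\<in>prime_factors L. p ^ multiplicity p L)" using L0 by (simp add: prime_factorization_nat)
  also have "\<dots> \<le> (\<Prod>p\<in>prime_factors L. n ^ 2)"
  proof (rule prod_mono)
    fix p assume p: "p \<in> prime_factors L"
    then have "p ^ multiplicity p L dvd L" by (simp add: multiplicity_dvd)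
    then have "multiplicity p L = 0 \<or> p ^ multiplicity p L \<le> 2 * M"
      using prime_power_dvd_Lcm p unfolding L_def by blast
    then show "0 \<le> p ^ multiplicity p L \<and> p ^ multiplicity p L \<le> n ^ 2" using M1 by auto
  qed
  also have "\<dots> = (n ^ 2) ^ card (prime_factors L)" by simp
  also have "\<dots> \<le> (n ^ 2) ^ n"
  proof (rule power_increasing)
    have "prime_factors L \<subseteq> {1..n}"
    proof
      fix p assume p: "p \<in> prime_factors L"
      then have pr: "prime p" "p ^ 1 dvd L" by auto
      then have "p \<le> n ^ 2" using prime_power_dvd_Lcm[of p 1 "2 * M"] M1 unfolding L_def by auto
      then show "p \<in> {1..n}" using no pr(1) by (auto simp: prime_ge_1_nat not_less[symmetric])
    qed
    then show "card (prime_factors L) \<le> n" using card_mono[of "{1..n}"] by fastforce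
    show "1 \<le> n ^ 2" using M1 by linarith
  qed
  also have "\<dots> = n ^ (2 * n)" by (simp add: power_mult)
  finally have up: "2 ^ M \<le> n ^ (2 * n)" .
  \<comment> \<open>With \<open>n < 2 ^ k\<close> the upper bound \<open>n ^ (2 * n)\<close> is
    below \<open>2 ^ (2 * k * n)\<close>, and \<open>k \<le> n / 8\<close> makes this exponent at
    most \<open>n ^ 2 / 4\<close>.\<close>
  define k where "k = n div 8"
  have k8: "8 \<le> k" "n < 8 * k + 8" "8 * k \<le> n" using assms unfolding k_def by linarith+
  have "8 * k + 8 \<le> 2 ^ k" using k8(1)
  proof (induction k rule: nat_induct_at_least)
    case (Suc k)
    then show ?case by simp
  qed simp
  then have "n < 2 ^ k" using k8 by linarith
  then have "n ^ (2 * n) < (2 ^ k) ^ (2 * n)" using assms by (intro power_strict_mono) auto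
  also have "\<dots> = 2 ^ (2 * (k * n))" by (simp add: power_mult[symmetric] mult_ac)
  also have "\<dots> \<le> 2 ^ M"
  proof (rule power_increasing)
    have "8 * (k * n) \<le> n * n" using mult_le_mono1[OF k8(3), of n] by simp
    then show "2 * (k * n) \<le> M" unfolding M_def power2_eq_square by linarith
  qed simp
  finally show False using up by simp
qed

section \<open>The Horn rules\<close>

definition mk :: "nat \<Rightarrow> nat list \<Rightarrow> nat" where
  "mk R xs = undig R 8 (\<lambda>i. xs ! i)"

lemma mk_less: "(\<forall>x\<in>set xs. x < R) \<Longrightarrow> length xs = 8 \<Longrightarrow> mk R xs < R ^ 8"
  unfolding mk_def by (rule undig_less) simp

lemma dig_mk:
  assumes "\<forall>x\<in>set [a0, a1, a2, a3, a4, a5, a6, a7]. x < R"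
  shows "dig R (mk R [a0, a1, a2, a3, a4, a5, a6, a7]) 0 = a0"
    "dig R (mk R [a0, a1, a2, a3, a4, a5, a6, a7]) 1 = a1"
    "dig R (mk R [a0, a1, a2, a3, a4, a5, a6, a7]) (Suc 0) = a1"
    "dig R (mk R [a0, a1, a2, a3, a4, a5, a6, a7]) 2 = a2"
    "dig R (mk R [a0, a1, a2, a3, a4, a5, a6, a7]) 3 = a3"
    "dig R (mk R [a0, a1, a2, a3, a4, a5, a6, a7]) 4 = a4"
    "dig R (mk R [a0, a1, a2, a3, a4, a5, a6, a7]) 5 = a5"
    "dig R (mk R [a0, a1, a2, a3, a4, a5, a6, a7]) 6 = a6"
    "dig R (mk R [a0, a1, a2, a3, a4, a5, a6, a7]) 7 = a7"
proof -
  let ?xs = "[a0, a1, a2, a3, a4, a5, a6, a7]"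
  have "?xs ! t < R" if "t < 8" for t
  proof -
    have "?xs ! t \<in> set ?xs" using that by (intro nth_mem) simp
    then show ?thesis using assms by blast
  qed
  then have "dig R (mk R ?xs) t = ?xs ! t" if "t < 8" for t
    unfolding mk_def by (rule dig_undig) (use that in auto)
  from this[of 0] this[of 1] this[of 2] this[of 3] this[of 4] this[of 5] this[of 6] this[of 7]
  show "dig R (mk R ?xs) 0 = a0" "dig R (mk R ?xs) 1 = a1" "dig R (mk R ?xs) (Suc 0) = a1" "dig R (mk R ?xs) 2 = a2"
    "dig R (mk R ?xs) 3 = a3" "dig R (mk R ?xs) 4 = a4" "dig R (mk R ?xs) 5 = a5" "dig R (mk R ?xs) 6 = a6"
    "dig R (mk R ?xs) 7 = a7" by simp_all
qed

locale rules = tensor +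
  fixes R m :: nat and cl :: "nat \<Rightarrow> nat \<Rightarrow> nat \<Rightarrow> bool"
begin

text \<open>
  A variable \<open>w < R\<^sup>8\<close> is an atom: digit 7 of its base-\<open>R\<close> expansion is the kind of the atom, digits 5
  and 6 name the copy it belongs to, and the digits 0 to 4 are its arguments. The variables below
  \<open>R\<^sup>2\<close> are shared by all copies and stand for the entries of the table. The kinds 1 to 7 are the
  predicates \<open>DD\<close>, \<open>LL\<close>, \<open>RR\<close>, \<open>WW\<close>, \<open>CC\<close>, \<open>GG\<close> and \<open>AA\<close>.
\<close>

definition rl :: "nat \<Rightarrow> nat \<Rightarrow> nat \<Rightarrow> bool" where
  "rl a b h \<longleftrightarrow> (let x = dig R a; y = dig R b; z = dig R h in
     (a < R * R \<and> a = b \<and> z 7 = 1 \<and> z 0 = 0 \<and> z 1 = x 0 \<and> z 2 = x 1) \<or>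
     (a < R * R \<and> a = b \<and> z 7 = 3 \<and> z 0 = 0 \<and> z 1 = x 0 \<and> z 2 = x 1 \<and> z 3 = x 0 \<and> z 4 = x 1) \<or>
     (a < R * R \<and> a = b \<and> z 7 = 6 \<and> z 0 = x 0 \<and> z 1 = x 1 \<and> z 2 = 0) \<or>
     (x 5 = z 5 \<and> x 6 = z 6 \<and> y 5 = z 5 \<and> y 6 = z 6 \<and>
      ((a = b \<and> x 7 = 1 \<and> z 7 = 2 \<and> z 0 = x 0 \<and> x 0 < s \<and> z 2 < B \<and> lnk (z 1) (x 1) (x 0) 0 \<and>
          x 2 = ev q s (z 2) 0 \<and> z 3 = 0) \<or>
       (x 7 = 2 \<and> y 7 = 1 \<and> z 7 = 2 \<and> x 0 = z 0 \<and> y 0 = z 0 \<and> x 1 = z 1 \<and> x 2 = z 2 \<and> z 3 = Suc (x 3) \<and>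
          lnk (z 1) (y 1) (z 0) (z 3) \<and> y 2 = ev q s (z 2) (z 3)) \<or>
       (a = b \<and> x 7 = 2 \<and> z 7 = 1 \<and> x 3 = q - 1 \<and> z 0 = Suc (x 0) \<and> z 1 = x 1 \<and>
          z 2 = ev q s (x 2) (dig q (x 1) (x 0))) \<or>
       (x 7 = 3 \<and> y 7 = 2 \<and> z 7 = 3 \<and> y 3 = q - 1 \<and> z 0 = Suc (x 0) \<and> y 0 = x 0 \<and> z 1 = x 1 \<and> z 2 = x 2 \<and>
          y 1 = x 3 \<and> x 4 = ev q s (y 2) (dig q (x 3) (x 0)) \<and> lnk (x 3) (z 3) (x 0) (dig q (z 3) (x 0)) \<and>
          z 4 = ev q s (y 2) (dig q (z 3) (x 0))) \<or>
       (x 7 = 3 \<and> y 7 = 3 \<and> z 7 = 4 \<and> x 0 = s \<and> y 0 = s \<and> z 0 = x 1 \<and> z 1 = x 2 \<and> z 4 = x 3 \<and> y 1 = x 3 \<and>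
          y 2 = x 4 \<and> ispt (z 2) (y 3) \<and> y 4 = z 3) \<or>
       (a = b \<and> x 7 = 4 \<and> z 7 = 5 \<and> x 0 = z 0 \<and> x 1 = z 1 \<and> x 2 = z 2 \<and> x 3 = z 3 \<and> x 4 = 0 \<and> z 4 = 0) \<or>
       (x 7 = 5 \<and> y 7 = 4 \<and> z 7 = 5 \<and> x 0 = z 0 \<and> x 1 = z 1 \<and> x 2 = z 2 \<and> x 3 = z 3 \<and> y 0 = z 0 \<and> y 1 = z 1 \<and>
          y 2 = z 2 \<and> y 3 = z 3 \<and> y 4 = z 4 \<and> z 4 = Suc (x 4)) \<or>
       (x 7 = 6 \<and> y 7 = 5 \<and> z 7 = 6 \<and> x 0 = z 0 \<and> y 0 = z 0 \<and> x 1 = z 1 \<and> y 1 = z 1 \<and> z 2 = Suc (x 2) \<and>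
          y 4 = B - 1 \<and> cl (x 2) (y 2) (y 3)) \<or>
       (a = b \<and> x 7 = 6 \<and> z 7 = 7 \<and> x 0 = 0 \<and> z 0 = 0 \<and> x 2 = m) \<or>
       (x 7 = 7 \<and> y 7 = 6 \<and> z 7 = 7 \<and> z 0 = Suc (x 0) \<and> y 0 = z 0 \<and> y 2 = m))) \<or>
     (a = b \<and> x 7 = 7 \<and> x 0 = B - 1 \<and> h < R * R \<and> z 0 = x 5 \<and> z 1 = x 6))"

text \<open>The rules are separated so that applying one only requires evaluating digits.
  \<open>rl1\<close>, \<open>rl2\<close> and \<open>rl3\<close> bring a table entry into an
  arbitrary copy, where it starts \<open>DD\<close>, \<open>RR\<close> and \<open>GG\<close>;
  \<open>rl14\<close> leads from a completed verification back to the one entry named by the copy;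
  the others work inside a copy.\<close>

lemma rl1: "a < R * R \<Longrightarrow> dig R h 7 = 1 \<Longrightarrow> dig R h 0 = 0 \<Longrightarrow> dig R h 1 = dig R a 0 \<Longrightarrow> dig R h 2 = dig R a 1 \<Longrightarrow> rl a a h"
  unfolding rl_def Let_def by simp

lemma rl2: "a < R * R \<Longrightarrow> dig R h 7 = 3 \<Longrightarrow> dig R h 0 = 0 \<Longrightarrow> dig R h 1 = dig R a 0 \<Longrightarrow> dig R h 2 = dig R a 1 \<Longrightarrow> dig R h 3 = dig R a 0 \<Longrightarrow> dig R h 4 = dig R a 1 \<Longrightarrow> rl a a h"
  unfolding rl_def Let_def by simp

lemma rl3: "a < R * R \<Longrightarrow> dig R h 7 = 6 \<Longrightarrow> dig R h 0 = dig R a 0 \<Longrightarrow> dig R h 1 = dig R a 1 \<Longrightarrow> dig R h 2 = 0 \<Longrightarrow> rl a a h"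
  unfolding rl_def Let_def by simp

lemma rl4: "dig R a 5 = dig R h 5 \<Longrightarrow> dig R a 6 = dig R h 6 \<Longrightarrow> dig R a 7 = 1 \<Longrightarrow> dig R h 7 = 2 \<Longrightarrow> dig R h 0 = dig R a 0 \<Longrightarrow> dig R a 0 < s \<Longrightarrow> dig R h 2 < B \<Longrightarrow> lnk (dig R h 1) (dig R a 1) (dig R a 0) 0 \<Longrightarrow> dig R a 2 = ev q s (dig R h 2) 0 \<Longrightarrow> dig R h 3 = 0 \<Longrightarrow> rl a a h"
  unfolding rl_def Let_def by simp

lemma rl5: "dig R a 5 = dig R h 5 \<Longrightarrow> dig R a 6 = dig R h 6 \<Longrightarrow> dig R b 5 = dig R h 5 \<Longrightarrow> dig R b 6 = dig R h 6 \<Longrightarrow> dig R a 7 = 2 \<Longrightarrow> dig R b 7 = 1 \<Longrightarrow> dig R h 7 = 2 \<Longrightarrow> dig R a 0 = dig R h 0 \<Longrightarrow> dig R b 0 = dig R h 0 \<Longrightarrow> dig R a 1 = dig R h 1 \<Longrightarrow> dig R a 2 = dig R h 2 \<Longrightarrow> dig R h 3 = Suc (dig R a 3) \<Longrightarrow> lnk (dig R h 1) (dig R b 1) (dig R h 0) (dig R h 3) \<Longrightarrow> dig R b 2 = ev q s (dig R h 2) (dig R h 3) \<Longrightarrow> rl a b h"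
  unfolding rl_def Let_def by simp

lemma rl6: "dig R a 5 = dig R h 5 \<Longrightarrow> dig R a 6 = dig R h 6 \<Longrightarrow> dig R a 7 = 2 \<Longrightarrow> dig R h 7 = 1 \<Longrightarrow> dig R a 3 = q - 1 \<Longrightarrow> dig R h 0 = Suc (dig R a 0) \<Longrightarrow> dig R h 1 = dig R a 1 \<Longrightarrow> dig R h 2 = ev q s (dig R a 2) (dig q (dig R a 1) (dig R a 0)) \<Longrightarrow> rl a a h"
  unfolding rl_def Let_def by simp

lemma rl7: "dig R a 5 = dig R h 5 \<Longrightarrow> dig R a 6 = dig R h 6 \<Longrightarrow> dig R b 5 = dig R h 5 \<Longrightarrow> dig R b 6 = dig R h 6 \<Longrightarrow> dig R a 7 = 3 \<Longrightarrow> dig R b 7 = 2 \<Longrightarrow> dig R h 7 = 3 \<Longrightarrow> dig R b 3 = q - 1 \<Longrightarrow> dig R h 0 = Suc (dig R a 0) \<Longrightarrow> dig R b 0 = dig R a 0 \<Longrightarrow> dig R h 1 = dig R a 1 \<Longrightarrow> dig R h 2 = dig R a 2 \<Longrightarrow> dig R b 1 = dig R a 3 \<Longrightarrow> dig R a 4 = ev q s (dig R b 2) (dig q (dig R a 3) (dig R a 0)) \<Longrightarrow> lnk (dig R a 3) (dig R h 3) (dig R a 0) (dig q (dig R h 3) (dig R a 0)) \<Longrightarrow> dig R h 4 = ev q s (dig R b 2) (dig q (dig R h 3) (dig R a 0)) \<Longrightarrow> rl a b h"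
  unfolding rl_def Let_def by simp

lemma rl8: "dig R a 5 = dig R h 5 \<Longrightarrow> dig R a 6 = dig R h 6 \<Longrightarrow> dig R b 5 = dig R h 5 \<Longrightarrow> dig R b 6 = dig R h 6 \<Longrightarrow> dig R a 7 = 3 \<Longrightarrow> dig R b 7 = 3 \<Longrightarrow> dig R h 7 = 4 \<Longrightarrow> dig R a 0 = s \<Longrightarrow> dig R b 0 = s \<Longrightarrow> dig R h 0 = dig R a 1 \<Longrightarrow> dig R h 1 = dig R a 2 \<Longrightarrow> dig R h 4 = dig R a 3 \<Longrightarrow> dig R b 1 = dig R a 3 \<Longrightarrow> dig R b 2 = dig R a 4 \<Longrightarrow> ispt (dig R h 2) (dig R b 3) \<Longrightarrow> dig R b 4 = dig R h 3 \<Longrightarrow> rl a b h"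
  unfolding rl_def Let_def by simp

lemma rl9: "dig R a 5 = dig R h 5 \<Longrightarrow> dig R a 6 = dig R h 6 \<Longrightarrow> dig R a 7 = 4 \<Longrightarrow> dig R h 7 = 5 \<Longrightarrow> dig R a 0 = dig R h 0 \<Longrightarrow> dig R a 1 = dig R h 1 \<Longrightarrow> dig R a 2 = dig R h 2 \<Longrightarrow> dig R a 3 = dig R h 3 \<Longrightarrow> dig R a 4 = 0 \<Longrightarrow> dig R h 4 = 0 \<Longrightarrow> rl a a h"
  unfolding rl_def Let_def by simp

lemma rl10: "dig R a 5 = dig R h 5 \<Longrightarrow> dig R a 6 = dig R h 6 \<Longrightarrow> dig R b 5 = dig R h 5 \<Longrightarrow> dig R b 6 = dig R h 6 \<Longrightarrow> dig R a 7 = 5 \<Longrightarrow> dig R b 7 = 4 \<Longrightarrow> dig R h 7 = 5 \<Longrightarrow> dig R a 0 = dig R h 0 \<Longrightarrow> dig R a 1 = dig R h 1 \<Longrightarrow> dig R a 2 = dig R h 2 \<Longrightarrow> dig R a 3 = dig R h 3 \<Longrightarrow> dig R b 0 = dig R h 0 \<Longrightarrow> dig R b 1 = dig R h 1 \<Longrightarrow> dig R b 2 = dig R h 2 \<Longrightarrow> dig R b 3 = dig R h 3 \<Longrightarrow> dig R b 4 = dig R h 4 \<Longrightarrow> dig R h 4 = Suc (dig R a 4) \<Longrightarrow> rl a b h"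
  unfolding rl_def Let_def by simp

lemma rl11: "dig R a 5 = dig R h 5 \<Longrightarrow> dig R a 6 = dig R h 6 \<Longrightarrow> dig R b 5 = dig R h 5 \<Longrightarrow> dig R b 6 = dig R h 6 \<Longrightarrow> dig R a 7 = 6 \<Longrightarrow> dig R b 7 = 5 \<Longrightarrow> dig R h 7 = 6 \<Longrightarrow> dig R a 0 = dig R h 0 \<Longrightarrow> dig R b 0 = dig R h 0 \<Longrightarrow> dig R a 1 = dig R h 1 \<Longrightarrow> dig R b 1 = dig R h 1 \<Longrightarrow> dig R h 2 = Suc (dig R a 2) \<Longrightarrow> dig R b 4 = B - 1 \<Longrightarrow> cl (dig R a 2) (dig R b 2) (dig R b 3) \<Longrightarrow> rl a b h"
  unfolding rl_def Let_def by simp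

lemma rl12: "dig R a 5 = dig R h 5 \<Longrightarrow> dig R a 6 = dig R h 6 \<Longrightarrow> dig R a 7 = 6 \<Longrightarrow> dig R h 7 = 7 \<Longrightarrow> dig R a 0 = 0 \<Longrightarrow> dig R h 0 = 0 \<Longrightarrow> dig R a 2 = m \<Longrightarrow> rl a a h"
  unfolding rl_def Let_def by simp

lemma rl13: "dig R a 5 = dig R h 5 \<Longrightarrow> dig R a 6 = dig R h 6 \<Longrightarrow> dig R b 5 = dig R h 5 \<Longrightarrow> dig R b 6 = dig R h 6 \<Longrightarrow> dig R a 7 = 7 \<Longrightarrow> dig R b 7 = 6 \<Longrightarrow> dig R h 7 = 7 \<Longrightarrow> dig R h 0 = Suc (dig R a 0) \<Longrightarrow> dig R b 0 = dig R h 0 \<Longrightarrow> dig R b 2 = m \<Longrightarrow> rl a b h"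
  unfolding rl_def Let_def by simp

lemma rl14: "dig R a 7 = 7 \<Longrightarrow> dig R a 0 = B - 1 \<Longrightarrow> h < R * R \<Longrightarrow> dig R h 0 = dig R a 5 \<Longrightarrow> dig R h 1 = dig R a 6 \<Longrightarrow> rl a a h"
  unfolding rl_def Let_def by simp

definition closed :: "nat set \<Rightarrow> bool" where
  "closed X \<longleftrightarrow> (\<forall>a b h. a < R ^ 8 \<longrightarrow> b < R ^ 8 \<longrightarrow> h < R ^ 8 \<longrightarrow> rl a b h \<longrightarrow> a \<in> X \<longrightarrow> b \<in> X \<longrightarrow> h \<in> X)"

lemma closedD: "closed X \<Longrightarrow> rl a b h \<Longrightarrow> a \<in> X \<Longrightarrow> b \<in> X \<Longrightarrow> a < R ^ 8 \<Longrightarrow> b < R ^ 8 \<Longrightarrow> h < R ^ 8 \<Longrightarrow> h \<in> X"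
  unfolding closed_def by blast

definition sem :: "(nat \<times> nat) set \<Rightarrow> nat \<Rightarrow> bool" where
  "sem S w \<longleftrightarrow> (let x = dig R w in
     (x 7 = 1 \<and> DD S (x 0) (x 1) (x 2)) \<or> (x 7 = 2 \<and> LL S (x 0) (x 1) (x 2) (x 3)) \<or>
     (x 7 = 3 \<and> RR S (x 0) (x 1) (x 2) (x 3) (x 4)) \<or> (x 7 = 4 \<and> WW S (x 0) (x 1) (x 2) (x 3) (x 4)) \<or>
     (x 7 = 5 \<and> CC S (x 0) (x 1) (x 2) (x 3) (x 4)) \<or> (x 7 = 6 \<and> GG S cl (x 0) (x 1) (x 2)) \<or>
     (x 7 = 7 \<and> AA S cl m (x 0)))"

lemma small_dig:
  assumes "w < R * R" "2 \<le> t"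
  shows "dig R w t = 0"
proof -
  have "0 < R" using assms(1) by (cases R) auto
  then have "R ^ 2 \<le> R ^ t" using assms(2) by (intro power_increasing) auto
  then have "w < R ^ t" using assms(1) by (simp add: power2_eq_square)
  then show ?thesis by (simp add: dig_def)
qed

text \<open>
  A directly assumed atom of a copy is charged to the single table entry which that copy derives.
\<close>

lemma closed_sem:
  assumes na: "\<not> AA S cl m (B - 1)"
  shows "closed {w. if w < R * R then (dig R w 0, dig R w 1) \<in> S
     else (dig R w 5, dig R w 6) \<in> S \<or> sem S w}" (is "closed ?X")
  unfolding closed_def
proof (intro allI impI)
  fix a b h assume r: "rl a b h" and a: "a \<in> ?X" and b: "b \<in> ?X"
  have big: "\<not> w < R * R" if "0 < dig R w 7" for w using small_dig[of w 7] that by auto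
  define x y z where "x = dig R a" and "y = dig R b" and "z = dig R h"
  note xyz = x_def[symmetric] y_def[symmetric] z_def[symmetric]
  have A: "(x 5, x 6) \<in> S \<or> sem S a" if "0 < x 7" using a big[of a] that by (auto simp: x_def)
  have Bb: "(y 5, y 6) \<in> S \<or> sem S b" if "0 < y 7" using b big[of b] that by (auto simp: y_def)
  have A0: "(x 0, x 1) \<in> S" if "a < R * R" using a that by (auto simp: x_def)
  have H: "h \<in> ?X" if "0 < z 7" "(z 5, z 6) \<in> S \<or> sem S h" using big[of h] that by (auto simp: z_def)
  have q1: "i \<le> q - 1 \<longleftrightarrow> i < q" for i using q0 by auto
  note defs = sem_def Let_def xyz
  \<comment> \<open>Three rules enter a copy and one leaves it. All others stay within one copy, so
    a charged copy remains charged, and otherwise the meaning of the atoms is preserved.\<close>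
  consider (1) "a < R * R" "a = b" "z 7 = 1" "z 0 = 0" "z 1 = x 0" "z 2 = x 1"
    | (2) "a < R * R" "a = b" "z 7 = 3" "z 0 = 0" "z 1 = x 0" "z 2 = x 1" "z 3 = x 0" "z 4 = x 1"
    | (3) "a < R * R" "a = b" "z 7 = 6" "z 0 = x 0" "z 1 = x 1" "z 2 = 0"
    | (4) "a = b" "x 7 = 7" "x 0 = B - 1" "h < R * R" "z 0 = x 5" "z 1 = x 6"
    | (5) "x 5 = z 5" "x 6 = z 6" "y 5 = z 5" "y 6 = z 6" "0 < x 7" "0 < y 7" "0 < z 7"
        "sem S a \<Longrightarrow> sem S b \<Longrightarrow> sem S h"
  proof -
    have LS: "LL S t c i j'" if "LL S t c i j" "lnk c b' t j'" "DD S t b' (ev q s i j')" "j' = Suc j" for t c i j j' b'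
      using that unfolding LL_def by (auto simp: le_Suc_eq)
    have CS: "CC S p v j k r'" if "CC S p v j k r" "WW S p v j k r'" "r' = Suc r" for p v j k r r'
      using that unfolding CC_def by (auto simp: le_Suc_eq)
    have GS: "GG S cl p v k'" if "GG S cl p v k" "cl k j i" "CC S p v j i (B - 1)" "k' = Suc k" for p v k k' j i
      using that unfolding GG_def by (auto simp: less_Suc_eq)
    have xy: "a = b \<Longrightarrow> y = x" by (simp add: x_def y_def)
    from r show thesis unfolding rl_def Let_def xyz
    proof (elim disjE conjE, goal_cases)
      case 1 then show ?case by (rule that(1))
    next
      case 2 then show ?case by (rule that(2))
    next
      case 3 then show ?case by (rule that(3))
    next
      case 4
      then have "y = x" using xy by blast
      with 4 show ?case by (intro that(5)) (auto simp: defs LL_def)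
    next
      case 5
      then show ?case by (intro that(5)) (auto simp: defs intro: LS)
    next
      case 6
      then have "y = x" using xy by blast
      with 6 show ?case by (intro that(5)) (auto simp: defs DD_Suc simp del: DD.simps)
    next
      case 7
      then show ?case by (intro that(5)) (auto simp: defs)
    next
      case 8
      then show ?case by (intro that(5)) (auto simp: defs WW_def)
    next
      case 9
      then have "y = x" using xy by blast
      with 9 show ?case by (intro that(5)) (auto simp: defs CC_def)
    next
      case 10
      then show ?case by (intro that(5)) (auto simp: defs intro: CS)
    next
      case 11
      then show ?case by (intro that(5)) (auto simp: defs intro: GS)
    next
      case 12
      then have "y = x" using xy by blast
      with 12 show ?case by (intro that(5)) (auto simp: defs AA_def)
    next
      case 13
      then show ?case by (intro that(5)) (auto simp: defs AA_def le_Suc_eq)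
    next
      case 14 then show ?case by (intro that(4))
    qed
  qed
  then show "h \<in> ?X"
  proof cases
    case 1
    then show ?thesis using A0 by (intro H) (auto simp: defs)
  next
    case 2
    then show ?thesis using A0 by (intro H) (auto simp: defs)
  next
    case 3
    then show ?thesis using A0 by (intro H) (auto simp: defs GG_def)
  next
    case 4
    \<comment> \<open>The last atom of a verification is false by its meaning, so it can only be
      present because its copy is charged; then the entry it yields already belongs to
      \<open>S\<close>.\<close>
    have "\<not> sem S a" using na 4(2,3) unfolding sem_def Let_def x_def[symmetric] by simp
    then have "(x 5, x 6) \<in> S" using A 4 by simp
    then show ?thesis using 4 by (simp add: z_def)
  next
    case 5
    then show ?thesis using A Bb by (intro H) auto
  qed
qed

text \<open>This is the honest derivation, carried out in the copy that concludes \<open>u\<close>: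
  every atom that speaks of the values of \<open>F\<close> is reached in turn. The slack in
  \<open>B + 10 \<le> R\<close> lets points, codes of polynomials, field elements and kinds all be
  digits in base \<open>R\<close>.\<close>

lemma closed_complete:
  assumes X: "closed X" and RB: "B + 10 \<le> R" "m < R" "s \<le> q"
    and F: "\<And>a. F a < q" "\<And>a t. t < s \<Longrightarrow> \<exists>c<B. \<forall>i<q. F (up q s a t i) = ev q s c i"
      "\<And>j b. j < s ^ s \<Longrightarrow> \<forall>t<s. dig q b t = dig s j t \<Longrightarrow> F b = of_bool (\<alpha> j)"
    and sat: "\<And>k. k < m \<Longrightarrow> \<exists>j<s ^ s. cl k j (of_bool (\<alpha> j))"
    and S: "\<And>a. a < B \<Longrightarrow> a + R * F a \<in> X"
    and u: "u < R * R"
  shows "u \<in> X"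
proof -
  define y1 y2 where "y1 = dig R u 0" and "y2 = dig R u 1"
  have R0: "0 < R" using RB by simp
  have y: "y1 < R" "y2 < R" using dig_less[OF R0] by (auto simp: y1_def y2_def)
  have qB: "q \<le> B" using s0 q0 by (simp add: self_le_power)
  have sB: "s < R" "q < R" "B < R" using RB qB by auto
  define P where "P k x0 x1 x2 x3 x4 \<longleftrightarrow> mk R [x0, x1, x2, x3, x4, y1, y2, k] \<in> X" for k x0 x1 x2 x3 x4
  have G8: "mk R [x0, x1, x2, x3, x4, y1, y2, k] < R ^ 8" if "\<forall>x\<in>set [x0, x1, x2, x3, x4, k]. x < R" for x0 x1 x2 x3 x4 k
    by (rule mk_less) (use that y in auto)
  have R8: "w < R ^ 8" if "w < R * R" for w
  proof -
    have "R ^ 2 \<le> R ^ 8" using R0 by (intro power_increasing) auto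
    then show ?thesis using that by (simp add: power2_eq_square)
  qed
  have ty: "k < R" if "k < 10" for k using that RB by simp
  have FR: "F a < R" for a using F(1)[of a] sB by simp
  have tbl: "a + R * F a < R * R" "dig R (a + R * F a) 0 = a" "dig R (a + R * F a) 1 = F a" if "a < B" for a
  proof -
    have "a < R" "F a < R" using that sB F(1)[of a] by auto
    then have "a + R * F a < R * Suc (F a)" "R * Suc (F a) \<le> R * R" by (simp, intro mult_le_mono2, simp)
    then show "a + R * F a < R * R" by simp
    show "dig R (a + R * F a) 0 = a" "dig R (a + R * F a) 1 = F a" using \<open>a < R\<close> \<open>F a < R\<close> by (auto simp: dig_def)
  qed
  have up1: "P k x0 x1 x2 x3 x4" if "a < B" "rl (a + R * F a) (a + R * F a) (mk R [x0, x1, x2, x3, x4, y1, y2, k])"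
    "\<forall>x\<in>set [x0, x1, x2, x3, x4, k]. x < R" for a k x0 x1 x2 x3 x4
    unfolding P_def by (rule closedD[OF X that(2)]) (use S that tbl(1) R8 G8 in auto)
  have st1: "P k x0 x1 x2 x3 x4" if "P l a0 a1 a2 a3 a4" "\<forall>x\<in>set [x0, x1, x2, x3, x4, k, a0, a1, a2, a3, a4, l]. x < R"
    "rl (mk R [a0, a1, a2, a3, a4, y1, y2, l]) (mk R [a0, a1, a2, a3, a4, y1, y2, l]) (mk R [x0, x1, x2, x3, x4, y1, y2, k])"
    for k x0 x1 x2 x3 x4 l a0 a1 a2 a3 a4
    using that(1) unfolding P_def by (intro closedD[OF X that(3)]) (use that(2) G8 in auto)
  have st2: "P k x0 x1 x2 x3 x4" if "P l a0 a1 a2 a3 a4" "P l' b0 b1 b2 b3 b4"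
    "\<forall>x\<in>set [x0, x1, x2, x3, x4, k, a0, a1, a2, a3, a4, l, b0, b1, b2, b3, b4, l']. x < R"
    "rl (mk R [a0, a1, a2, a3, a4, y1, y2, l]) (mk R [b0, b1, b2, b3, b4, y1, y2, l']) (mk R [x0, x1, x2, x3, x4, y1, y2, k])"
    for k x0 x1 x2 x3 x4 l a0 a1 a2 a3 a4 l' b0 b1 b2 b3 b4
    using that(1,2) unfolding P_def by (intro closedD[OF X that(4)]) (use that(3) G8 in auto)
  have evR: "ev q s c i < R" for c i using ev_less[OF q0, of s c i] sB by simp
  have upR: "up q s a t i < R" "up q s a t i < B" if "i < q" for a t i using up_props(1)[OF q0 that, of s a t] sB by auto
  have up_id: "up q s a t (dig q a t) = a" if "a < B" for a t
    by (rule dig_ext[where q = q and s = s]) (use that up_props[OF q0 dig_less[OF q0, of a t]] in auto)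
  have up_up: "up q s (up q s a t i) t j = up q s a t j" if "i < q" "j < q" for a t i j
    by (rule dig_ext[where q = q and s = s]) (use that up_props[OF q0] in auto)
  note D = dig_mk y ty
  have lines: "P 2 t a c i 0" if DP: "\<And>a. a < B \<Longrightarrow> P 1 t a (F a) 0 0" and t: "t < s" and a: "a < B" and c: "c < B"
    "\<And>i. i < q \<Longrightarrow> F (up q s a t i) = ev q s c i" and i: "i < q" for t a c i
    using i
  proof (induction i)
    case 0
    have "P 1 t (up q s a t 0) (ev q s c 0) 0 0" using DP[OF upR(2)[OF q0, of a t]] c(2)[OF q0] by simp
    then show ?case
      by (rule st1[OF _ _ rl4]) (use upR[OF q0] evR t a c sB ty q0 in \<open>simp_all add: D lnk_up\<close>)
  next
    case (Suc i)
    have 1: "P 1 t (up q s a t (Suc i)) (ev q s c (Suc i)) 0 0" using DP[OF upR(2)[OF Suc.prems, of a t]] c(2)[OF Suc.prems] by simp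
    have 2: "P 2 t a c i 0" using Suc by simp
    show ?case
      by (rule st2[OF 2 1 _ rl5])
        (use upR[OF Suc.prems] evR t a c sB ty Suc.prems in \<open>simp_all add: D lnk_up\<close>)
  qed
  have DP: "P 1 t a (F a) 0 0" if "t \<le> s" "a < B" for t a
    using that
  proof (induction t arbitrary: a)
    case 0
    then show ?case using tbl[OF 0(2)] FR[of a] sB ty
      by (intro up1[OF 0(2) rl1]) (simp_all add: D)
  next
    case (Suc t)
    have t: "t < s" using Suc.prems by simp
    obtain c where c: "c < B" "\<And>i. i < q \<Longrightarrow> F (up q s a t i) = ev q s c i" using F(2)[OF t, of a] by blast
    have 1: "P 2 t a c (q - 1) 0" by (rule lines[OF _ t Suc.prems(2) c]) (use Suc q0 t in auto)
    have "ev q s c (dig q a t) = F a" using c(2)[OF dig_less[OF q0, of a t]] up_id[OF Suc.prems(2), of t] by simp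
    then show ?case
      by (intro st1[OF 1 _ rl6]) (use FR[of a] Suc.prems c sB ty in \<open>simp_all add: D\<close>)
  qed
  have lines': "\<exists>c<B. P 2 t a c (q - 1) 0 \<and> (\<forall>i<q. F (up q s a t i) = ev q s c i)" if t: "t < s" and a: "a < B" for t a
  proof -
    obtain c where c: "c < B" "\<And>i. i < q \<Longrightarrow> F (up q s a t i) = ev q s c i" using F(2)[OF t, of a] by blast
    have "P 2 t a c (q - 1) 0" by (rule lines[OF DP t a c]) (use t q0 in auto)
    then show ?thesis using c by blast
  qed
  have RP: "P 3 t p (F p) b (F b)" if "t \<le> s" "p < B" "b < B" "\<And>e. e < s \<Longrightarrow> t \<le> e \<Longrightarrow> dig q b e = dig q p e" for t p b
    using that
  proof (induction t arbitrary: b)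
    case 0
    have "b = p" by (rule dig_ext[where q = q and s = s]) (use 0 in auto)
    then show ?case using tbl[OF 0(2)] FR[of p] 0 sB ty
      by (intro up1[OF 0(2) rl2]) (simp_all add: D)
  next
    case (Suc t)
    have t: "t < s" using Suc.prems by simp
    have dp: "dig q p t < q" "dig q b t < q" using dig_less[OF q0] by auto
    let ?b = "up q s b t (dig q p t)"
    have bB: "?b < B" using upR[OF dp(1)] by simp
    have db: "dig q ?b t = dig q p t" using up_props(2)[OF q0 dp(1), of t s b t] t by simp
    have 1: "P 3 t p (F p) ?b (F ?b)"
      by (rule Suc.IH[OF _ Suc.prems(2) bB]) (use Suc.prems t up_props(2)[OF q0 dp(1)] in auto)
    obtain c where c: "c < B" "P 2 t ?b c (q - 1) 0" "\<And>i. i < q \<Longrightarrow> F (up q s ?b t i) = ev q s c i"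
      using lines'[OF t bB] by blast
    have 2: "F ?b = ev q s c (dig q ?b t)" using c(3)[OF dp(1)] up_id[OF bB, of t] db by simp
    have b2: "up q s ?b t (dig q b t) = b" using up_up[OF dp] up_id[OF Suc.prems(3)] by simp
    then have 3: "F b = ev q s c (dig q b t)" using c(3)[OF dp(2)] by simp
    have l: "lnk ?b b t (dig q b t)" unfolding lnk_up[OF t] using b2 dp by simp
    have R': "p < R" "F p < R" "?b < R" "F ?b < R" "b < R" "F b < R" "c < R" "t < R" "Suc t < R" "q - 1 < R"
      using Suc.prems bB c(1) F(1)[of p] F(1)[of b] F(1)[of ?b] sB t by auto
    show ?case
      by (rule st2[OF 1 c(2) _ rl7]) (use R' ty l 2 3 t in \<open>simp_all add: D\<close>)
  qed
  have jR: "j < R" if "j < s ^ s" for j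
  proof -
    have "s ^ s \<le> B" using RB(3) by (rule power_mono) simp
    then show ?thesis using that sB by simp
  qed
  have WP: "P 4 p (F p) j (of_bool (\<alpha> j)) r" if "p < B" "r < B" "j < s ^ s" for p j r
  proof -
    define b where "b = undig q s (dig s j)"
    have dj: "dig s j t < q" for t using dig_less[OF s0, of j t] RB(3) by simp
    have b: "b < B" "\<And>t. t < s \<Longrightarrow> dig q b t = dig s j t"
      unfolding b_def by (rule undig_less, rule dj) (rule dig_undig, rule dj)
    have 1: "P 3 s p (F p) r (F r)" "P 3 s r (F r) b (F b)" by (rule RP; use that b in simp)+
    have 2: "F b = of_bool (\<alpha> j)" using F(3)[OF that(3)] b by simp
    have 3: "ispt j b" using b by (simp add: ispt_def dig_def)
    show ?thesis using FR[of p] FR[of r] FR[of b] that b(1) sB ty jR[OF that(3)]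
      by (intro st2[OF 1 _ rl8]) (simp_all add: D 2 3)
  qed
  have bR: "of_bool c < R" for c using RB by (cases c) auto
  have CP: "P 5 p (F p) j (of_bool (\<alpha> j)) r" if "p < B" "r < B" "j < s ^ s" for p j r
    using that(2)
  proof (induction r)
    case 0
    show ?case using FR[of p] that(1) 0 sB ty jR[OF that(3)] bR R0
      by (intro st1[OF WP[OF that(1) 0 that(3)] _ rl9]) (simp_all add: D)
  next
    case (Suc r)
    have 1: "P 5 p (F p) j (of_bool (\<alpha> j)) r" using Suc by simp
    show ?case using FR[of p] that(1) Suc.prems sB ty jR[OF that(3)] bR
      by (intro st2[OF 1 WP[OF that(1) Suc.prems that(3)] _ rl10]) (simp_all add: D)
  qed
  have GP: "P 6 p (F p) k 0 0" if "p < B" "k \<le> m" for p k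
    using that(2)
  proof (induction k)
    case 0
    then show ?case using tbl[OF that(1)] FR[of p] that(1) sB ty
      by (intro up1[OF that(1) rl3]) (simp_all add: D)
  next
    case (Suc k)
    then obtain j where j: "j < s ^ s" "cl k j (of_bool (\<alpha> j))" using sat[of k] by auto
    have 1: "P 6 p (F p) k 0 0" using Suc by simp
    have B1: "B - 1 < B" using B0 by simp
    have 2: "P 5 p (F p) j (of_bool (\<alpha> j)) (B - 1)" by (rule CP[OF that(1) B1 j(1)])
    show ?case using FR[of p] that(1) Suc.prems sB ty jR[OF j(1)] bR j(2) RB(2)
      by (intro st2[OF 1 2 _ rl11]) (simp_all add: D)
  qed
  have AP: "P 7 p 0 0 0 0" if "p < B" for p
    using that
  proof (induction p)
    case 0
    then show ?case using FR[of 0] RB(2) sB ty by (intro st1[OF GP[OF 0 order_refl] _ rl12]) (simp_all add: D)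
  next
    case (Suc p)
    have 1: "P 7 p 0 0 0 0" using Suc by simp
    show ?case using FR[of "Suc p"] RB(2) sB ty Suc.prems
      by (intro st2[OF 1 GP[OF Suc.prems order_refl] _ rl13]) (simp_all add: D)
  qed
  have B1: "B - 1 < B" using B0 by simp
  have "mk R [B - 1, 0, 0, 0, 0, y1, y2, 7] \<in> X" using AP[OF B1] by (simp add: P_def)
  moreover have "mk R [B - 1, 0, 0, 0, 0, y1, y2, 7] < R ^ 8" by (rule G8) (use sB ty in auto)
  moreover have "rl (mk R [B - 1, 0, 0, 0, 0, y1, y2, 7]) (mk R [B - 1, 0, 0, 0, 0, y1, y2, 7]) u"
    using u sB ty y R0 by (intro rl14) (simp_all add: D flip: y1_def y2_def One_nat_def)
  ultimately show ?thesis using closedD[OF X] R8[OF u] by blast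
qed

end

section \<open>The minimisation gap\<close>

text \<open>The clauses with head \<open>G\<close> make every variable below \<open>G\<close> occur,
  as \<open>encodes\<close> demands, whatever the rules are. Triples whose head is in the body are
  tautologies and excluded, since pure Horn clauses contain no complementary pair.\<close>

definition base :: "nat \<Rightarrow> (nat \<Rightarrow> nat \<Rightarrow> nat \<Rightarrow> bool) \<Rightarrow> cnf" where
  "base G r = {{Neg a, Neg b, Pos h} | a b h. a < G \<and> b < G \<and> h < G \<and> h \<noteq> a \<and> h \<noteq> b \<and> r a b h} \<union>
     {{Neg a, Pos G} | a. a < G}"

definition zed :: "nat \<Rightarrow> nat \<Rightarrow> nat set \<Rightarrow> cnf" where
  "zed G t S = {{Neg z, Pos u} | z u. G < z \<and> z \<le> G + t \<and> u \<in> S}"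

definition closedX :: "nat \<Rightarrow> (nat \<Rightarrow> nat \<Rightarrow> nat \<Rightarrow> bool) \<Rightarrow> nat set \<Rightarrow> bool" where
  "closedX G r X \<longleftrightarrow> (\<forall>a b h. a < G \<longrightarrow> b < G \<longrightarrow> h < G \<longrightarrow> r a b h \<longrightarrow> a \<in> X \<longrightarrow> b \<in> X \<longrightarrow> h \<in> X)"

lemma base_sub: "base G r \<subseteq> (\<lambda>(a, b, h). {Neg a, Neg b, Pos h}) ` ({..<G} \<times> {..<G} \<times> {..<G}) \<union>
    (\<lambda>a. {Neg a, Pos G}) ` {..<G}"
  unfolding base_def by force

lemma finite_base: "finite (base G r)"
  by (rule finite_subset[OF base_sub]) simp

lemma card_base: "card (base G r) \<le> G ^ 3 + G"
proof -
  have "card (base G r) \<le> card ((\<lambda>(a, b, h). {Neg a, Neg b, Pos h}) ` ({..<G} \<times> {..<G} \<times> {..<G}) \<union>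
    (\<lambda>a. {Neg a, Pos G}) ` {..<G})" by (rule card_mono[OF _ base_sub]) simp
  also have "\<dots> \<le> card ({..<G} \<times> {..<G} \<times> {..<G}) + card {..<G}"
    by (rule order_trans[OF card_Un_le]) (intro add_mono card_image_le; simp)
  finally show ?thesis by (simp add: card_cartesian_product eval_nat_numeral)
qed

lemma zed_eq: "zed G t S = (\<lambda>(z, u). {Neg z, Pos u}) ` ({G<..G + t} \<times> S)"
  unfolding zed_def by force

lemma card_zed: "finite S \<Longrightarrow> card (zed G t S) \<le> t * card S"
  unfolding zed_eq by (rule order_trans[OF card_image_le]) (auto simp: card_cartesian_product)

lemma horn_form:
  assumes "S \<subseteq> {..<G}"
  shows "pure_horn_3cnf (base G r \<union> zed G t S)"
proof -
  have fin: "finite S" by (rule finite_subset[OF assms]) simp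
  have "pure_horn_clause c \<and> finite c \<and> card c \<le> 3" if cin: "c \<in> base G r \<union> zed G t S" for c
  proof -
    have "(\<exists>a b h. c = {Neg a, Neg b, Pos h} \<and> h \<noteq> a \<and> h \<noteq> b)"
    proof -
      consider a b h where "c = {Neg a, Neg b, Pos h}" "h \<noteq> a" "h \<noteq> b"
        | a where "c = {Neg a, Pos G}" "a < G" | z u where "c = {Neg z, Pos u}" "G < z" "u \<in> S"
        using cin unfolding base_def zed_def by blast
      then show ?thesis
      proof cases
        case 1
        then show ?thesis by blast
      next
        case (2 a)
        then have "c = {Neg a, Neg a, Pos G}" "G \<noteq> a" by auto
        then show ?thesis by blast
      next
        case (3 z u)
        then have "c = {Neg z, Neg z, Pos u}" "u \<noteq> z" using assms by auto
        then show ?thesis by blast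
      qed
    qed
    then obtain a b h where c: "c = {Neg a, Neg b, Pos h}" "h \<noteq> a" "h \<noteq> b" by blast
    have "card c \<le> 3" unfolding c(1) by (rule order_trans[OF card_insert_le_m1]) (auto simp: card_insert_if)
    then show ?thesis using c by (auto simp: pure_horn_clause_def)
  qed
  moreover have "finite (zed G t S)" using fin by (simp add: zed_eq)
  ultimately show ?thesis using finite_base[of G r]
    by (auto simp: pure_horn_3cnf_def pure_horn_cnf_def k_cnf_def is_cnf_def)
qed

lemma vars_base_zed:
  assumes "S \<subseteq> {..<G}" "0 \<in> S"
  shows "vars (base G r \<union> zed G t S) = {..<G + 1 + t}"
proof (intro set_eqI iffI)
  fix v assume "v \<in> vars (base G r \<union> zed G t S)"
  then obtain c l where c: "c \<in> base G r \<union> zed G t S" "l \<in> c" "v = var l" unfolding vars_def by blast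
  consider a b h where "c = {Neg a, Neg b, Pos h}" "a < G" "b < G" "h < G"
    | a where "c = {Neg a, Pos G}" "a < G" | z u where "c = {Neg z, Pos u}" "z \<le> G + t" "u \<in> S"
    using c(1) unfolding base_def zed_def by blast
  then show "v \<in> {..<G + 1 + t}"
  proof cases
    case (1 a b h)
    then have "l = Neg a \<or> l = Neg b \<or> l = Pos h" using c(2) by blast
    then show ?thesis using 1(2-4) c(3) by (elim disjE) simp_all
  next
    case (2 a)
    then have "l = Neg a \<or> l = Pos G" using c(2) by blast
    then show ?thesis using 2(2) c(3) by (elim disjE) simp_all
  next
    case (3 z u)
    then have "l = Neg z \<or> l = Pos u" using c(2) by blast
    moreover have "u < G" using 3(3) assms(1) by blast
    ultimately show ?thesis using 3(2) c(3) by (elim disjE) simp_all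
  qed
next
  fix v assume v: "v \<in> {..<G + 1 + t}"
  have G: "0 < G" using assms by auto
  have "\<exists>c\<in>base G r \<union> zed G t S. \<exists>l\<in>c. v = var l"
  proof -
    consider "v < G" | "v = G" | "G < v" "v \<le> G + t" using v by fastforce
    then show ?thesis
    proof cases
      case 1
      then have "{Neg v, Pos G} \<in> base G r" unfolding base_def by blast
      then show ?thesis by (intro bexI[of _ "{Neg v, Pos G}"] bexI[of _ "Neg v"]) simp_all
    next
      case 2
      then have "{Neg 0, Pos v} \<in> base G r" using G unfolding base_def by blast
      then show ?thesis by (intro bexI[of _ "{Neg 0, Pos v}"] bexI[of _ "Pos v"]) simp_all
    next
      case 3
      then have "{Neg v, Pos 0} \<in> zed G t S" using assms(2) unfolding zed_def by blast
      then show ?thesis by (intro bexI[of _ "{Neg v, Pos 0}"] bexI[of _ "Neg v"]) simp_all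
    qed
  qed
  then show "v \<in> vars (base G r \<union> zed G t S)" unfolding vars_def by blast
qed

lemma models_base_zed:
  assumes "S \<subseteq> {..<G}"
  shows "cnf_fun (base G r \<union> zed G t S) \<alpha> \<longleftrightarrow> closedX G r {v. \<alpha> v} \<and> (\<forall>a<G. \<alpha> a \<longrightarrow> \<alpha> G) \<and>
    (\<forall>z u. G < z \<and> z \<le> G + t \<and> u \<in> S \<and> \<alpha> z \<longrightarrow> \<alpha> u)" (is "?L \<longleftrightarrow> ?R")
proof
  assume L: ?L
  have c: "\<exists>l\<in>c. lit_true \<alpha> l" if "c \<in> base G r \<union> zed G t S" for c using L that by (auto simp: cnf_fun_def)
  have "\<alpha> h" if "a < G" "b < G" "h < G" "r a b h" "\<alpha> a" "\<alpha> b" for a b h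
  proof (cases "h = a \<or> h = b")
    case False
    then have "{Neg a, Neg b, Pos h} \<in> base G r" unfolding base_def using that by blast
    then show ?thesis using c[of "{Neg a, Neg b, Pos h}"] that by auto
  qed (use that in auto)
  moreover have "\<alpha> G" if "a < G" "\<alpha> a" for a
  proof -
    have "{Neg a, Pos G} \<in> base G r" unfolding base_def using that by blast
    then show ?thesis using c[of "{Neg a, Pos G}"] that by auto
  qed
  moreover have "\<alpha> u" if "G < z" "z \<le> G + t" "u \<in> S" "\<alpha> z" for z u
  proof -
    have "{Neg z, Pos u} \<in> zed G t S" unfolding zed_def using that by blast
    then show ?thesis using c[of "{Neg z, Pos u}"] that by auto
  qed
  ultimately show ?R by (auto simp: closedX_def)
next
  assume R: ?R
  then have R1: "closedX G r {v. \<alpha> v}" by (elim conjE)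
  show ?L unfolding cnf_fun_def
  proof
    fix c assume "c \<in> base G r \<union> zed G t S"
    then consider a b h where "c = {Neg a, Neg b, Pos h}" "a < G" "b < G" "h < G" "r a b h"
      | a where "c = {Neg a, Pos G}" "a < G" | z u where "c = {Neg z, Pos u}" "G < z" "z \<le> G + t" "u \<in> S"
      unfolding base_def zed_def by blast
    then show "\<exists>l\<in>c. lit_true \<alpha> l"
    proof cases
      case (1 a b h)
      have "\<forall>a b h. a < G \<longrightarrow> b < G \<longrightarrow> h < G \<longrightarrow> r a b h \<longrightarrow> \<alpha> a \<longrightarrow> \<alpha> b \<longrightarrow> \<alpha> h"
        using R1 unfolding closedX_def mem_Collect_eq .
      then have "\<not> \<alpha> a \<or> \<not> \<alpha> b \<or> \<alpha> h" using 1(2-) by blast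
      then show ?thesis unfolding 1(1) by simp
    next
      case (2 a)
      have "\<not> \<alpha> a \<or> \<alpha> G" using R 2(2) by blast
      then show ?thesis unfolding 2(1) by simp
    next
      case (3 z u)
      have "\<not> \<alpha> z \<or> \<alpha> u" using R 3(2-) by blast
      then show ?thesis unfolding 3(1) by simp
    qed
  qed
qed

text \<open>Once some variable above \<open>G\<close> that heads no clause is true, the true
  variables form a closed set containing \<open>S\<close>, and such a set contains
  \<open>U\<close>.\<close>

lemma same_fun:
  assumes S: "S \<subseteq> U" "U \<subseteq> {..<G}" and gen: "\<And>X. closedX G r X \<Longrightarrow> S \<subseteq> X \<Longrightarrow> U \<subseteq> X"
  shows "cnf_fun (base G r \<union> zed G t S) = cnf_fun (base G r \<union> zed G t U)"
proof
  fix \<alpha>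
  have SG: "S \<subseteq> {..<G}" using S by blast
  show "cnf_fun (base G r \<union> zed G t S) \<alpha> = cnf_fun (base G r \<union> zed G t U) \<alpha>"
    unfolding models_base_zed[OF SG] models_base_zed[OF S(2)]
  proof (intro iffI conjI; elim conjE; assumption?)
    assume c: "closedX G r {v. \<alpha> v}" and z: "\<forall>z u. G < z \<and> z \<le> G + t \<and> u \<in> S \<and> \<alpha> z \<longrightarrow> \<alpha> u"
    show "\<forall>z u. G < z \<and> z \<le> G + t \<and> u \<in> U \<and> \<alpha> z \<longrightarrow> \<alpha> u"
    proof (intro allI impI; elim conjE)
      fix z u assume "G < z" "z \<le> G + t" "u \<in> U" "\<alpha> z"
      then have "S \<subseteq> {v. \<alpha> v}" using z by blast
      then show "\<alpha> u" using gen[OF c] \<open>u \<in> U\<close> by blast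
    qed
  qed (use S in blast)+
qed

text \<open>
  The clauses in which \<open>z\<close> is the only large body variable have at least \<open>K + 1\<close> heads: closing
  their heads under the rules, together with \<open>z\<close>, gives a model.
\<close>

lemma horn_lower:
  assumes U: "U \<subseteq> {..<G}" and \<Psi>: "pure_horn_cnf \<Psi>" "cnf_fun \<Psi> = cnf_fun (base G r \<union> zed G t U)"
    and hard: "\<And>H. H \<subseteq> {..<G} \<Longrightarrow> card H \<le> K \<Longrightarrow> \<exists>X. closedX G r X \<and> H \<subseteq> X \<and> \<not> U \<subseteq> X"
  shows "t * Suc K \<le> card \<Psi>"
proof -
  have fin: "finite \<Psi>" using \<Psi>(1) by (simp add: pure_horn_cnf_def is_cnf_def)
  have ph: "pure_horn_clause c" if "c \<in> \<Psi>" for c using \<Psi>(1) that by (simp add: pure_horn_cnf_def)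
  define C where "C z = {c \<in> \<Psi>. Neg z \<in> c \<and> (\<forall>z'. G < z' \<and> Neg z' \<in> c \<longrightarrow> z' = z)}" for z
  have big: "Suc K \<le> card (C z)" if z: "G < z" "z \<le> G + t" for z
  proof (rule ccontr)
    assume small: "\<not> Suc K \<le> card (C z)"
    define hd where "hd c = (THE v. Pos v \<in> c)" for c
    have hd: "Pos v \<in> c \<longleftrightarrow> v = hd c" if "c \<in> \<Psi>" for c v
      using ph[OF that] unfolding pure_horn_clause_def hd_def by (metis (mono_tags, lifting) the_equality)
    define H where "H = hd ` C z \<inter> {..<G}"
    have fC: "finite (C z)" using fin by (simp add: C_def)
    have "card H \<le> card (hd ` C z)" unfolding H_def using fC by (intro card_mono) auto
    also have "\<dots> \<le> card (C z)" by (rule card_image_le[OF fC])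
    finally have "card H \<le> K" using small by simp
    moreover have "H \<subseteq> {..<G}" by (simp add: H_def)
    ultimately obtain X where X: "closedX G r X" "H \<subseteq> X" "\<not> U \<subseteq> X" using hard by blast
    \<comment> \<open>The variable \<open>G\<close> is included because it follows from every atom,
      and the variables above \<open>G\<close> are dropped, so that all clauses of
      \<open>zed\<close> hold in \<open>Y\<close>.\<close>
    define Y where "Y = (X \<inter> {..<G}) \<union> {G}"
    have cY: "closedX G r Y" using X(1) unfolding closedX_def Y_def by auto
    have cYz: "closedX G r (insert z Y)" using cY z unfolding closedX_def by auto
    have m0: "cnf_fun \<Psi> (\<lambda>v. v \<in> Y)"
      unfolding \<Psi>(2) models_base_zed[OF U]
    proof (intro conjI)
      show "closedX G r {v. v \<in> Y}" using cY by simp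
    qed (auto simp: Y_def)
    have m1: "cnf_fun \<Psi> (\<lambda>v. v \<in> insert z Y)"
      unfolding cnf_fun_def
    proof
      fix c assume c: "c \<in> \<Psi>"
      show "\<exists>l\<in>c. lit_true (\<lambda>v. v \<in> insert z Y) l"
      proof (rule ccontr)
        assume no: "\<not> ?thesis"
        then have body: "v \<in> insert z Y" if "Neg v \<in> c" for v using that by force
        have head: "hd c \<notin> insert z Y" using no hd[OF c, of "hd c"] by force
        obtain l where l: "l \<in> c" "lit_true (\<lambda>v. v \<in> Y) l" using m0 c by (auto simp: cnf_fun_def)
        have Nz: "Neg z \<in> c"
        proof (rule ccontr)
          assume "Neg z \<notin> c"
          then have "v \<in> Y" if "Neg v \<in> c" for v using body[OF that] that by auto
          then show False using l head hd[OF c] by (cases l) auto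
        qed
        have "c \<in> C z" using c Nz body unfolding C_def Y_def by force
        then have notH: "\<not> hd c < G" using head X(2) unfolding H_def Y_def by auto
        then have hG: "G < hd c" using head by (auto simp: Y_def)
        \<comment> \<open>No clause of \<Psi> has a head above \<open>G\<close>: such a variable is
          never a head in the given formula, so falsifying it alone gives a model, in which the
          clause would fail.\<close>
        have "cnf_fun \<Psi> (\<lambda>v. v \<noteq> hd c)"
          unfolding \<Psi>(2) models_base_zed[OF U] using hG U by (auto simp: closedX_def)
        then obtain l where "l \<in> c" "lit_true (\<lambda>v. v \<noteq> hd c) l" using c by (auto simp: cnf_fun_def)
        moreover have "Neg (hd c) \<notin> c" using ph[OF c] hd[OF c] by (auto simp: pure_horn_clause_def)
        ultimately show False using hd[OF c] by (cases l) auto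
      qed
    qed
    obtain u where u: "u \<in> U" "u \<notin> X" using X(3) by blast
    have "\<forall>z' u. G < z' \<and> z' \<le> G + t \<and> u \<in> U \<and> z' \<in> insert z Y \<longrightarrow> u \<in> insert z Y"
      using m1 unfolding \<Psi>(2) models_base_zed[OF U] by blast
    then have "u \<in> insert z Y" using z u by blast
    then show False using u U z by (auto simp: Y_def)
  qed
  have disj: "C z \<inter> C z' = {}" if "G < z" "G < z'" "z \<noteq> z'" for z z'
    using that by (auto simp: C_def)
  have "t * Suc K = (\<Sum>z\<in>{G<..G + t}. Suc K)" by simp
  also have "\<dots> \<le> (\<Sum>z\<in>{G<..G + t}. card (C z))" by (rule sum_mono) (use big in auto)
  also have "\<dots> = card (\<Union>z\<in>{G<..G + t}. C z)"
    by (rule card_UN_disjoint[symmetric]) (use disj fin in \<open>auto simp: C_def\<close>)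
  also have "\<dots> \<le> card \<Psi>" by (rule card_mono[OF fin]) (auto simp: C_def)
  finally show ?thesis .
qed

lemma card_le_literals:
  assumes "pure_horn_cnf \<Psi>"
  shows "card \<Psi> \<le> num_literals \<Psi>"
proof -
  have "1 \<le> card c" if "c \<in> \<Psi>" for c
  proof -
    have "c \<noteq> {}" "finite c" using assms that by (auto simp: pure_horn_cnf_def pure_horn_clause_def is_cnf_def)
    then show ?thesis by (simp add: Suc_le_eq card_gt_0_iff)
  qed
  then have "(\<Sum>c\<in>\<Psi>. 1) \<le> num_literals \<Psi>" unfolding num_literals_def by (intro sum_mono)
  then show ?thesis by simp
qed

text \<open>Clauses and literals can be treated alike: the lower bound carries over because every
  clause has a literal, and in the formula for the upper bound the clauses of \<open>base\<close>
  have at most three literals and those of \<open>zed\<close> at most two.\<close>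

theorem horn_gap:
  assumes U: "U \<subseteq> {..<G}" "0 \<in> U" and P: "P = pure_horn_cnf \<or> P = pure_horn_3cnf"
    and opt: "opt = min_clauses P (G + 1 + t) \<or> opt = min_literals P (G + 1 + t)"
  shows "\<lbrakk>\<And>H. H \<subseteq> {..<G} \<Longrightarrow> card H \<le> K \<Longrightarrow> \<exists>X. closedX G r X \<and> H \<subseteq> X \<and> \<not> U \<subseteq> X\<rbrakk> \<Longrightarrow>
      t * Suc K \<le> opt (cnf_fun (base G r \<union> zed G t U))"
    and "\<lbrakk>S \<subseteq> U; \<And>X. closedX G r X \<Longrightarrow> S \<subseteq> X \<Longrightarrow> U \<subseteq> X\<rbrakk> \<Longrightarrow>
      opt (cnf_fun (base G r \<union> zed G t U)) \<le> 3 * (G ^ 3 + G) + 2 * (t * card S)"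
proof -
  let ?f = "cnf_fun (base G r \<union> zed G t U)" and ?n = "G + 1 + t"
  have Pp: "P \<Psi> \<Longrightarrow> pure_horn_cnf \<Psi>" for \<Psi> using P by (auto simp: pure_horn_3cnf_def)
  have P3: "pure_horn_3cnf \<Psi> \<Longrightarrow> P \<Psi>" for \<Psi> using P by (auto simp: pure_horn_3cnf_def)
  have self: "P (base G r \<union> zed G t U) \<and> represents ?n (base G r \<union> zed G t U) ?f"
    using P3[OF horn_form[OF U(1)]] vars_base_zed[OF U] by (simp add: represents_def)
  {
    assume h: "\<And>H. H \<subseteq> {..<G} \<Longrightarrow> card H \<le> K \<Longrightarrow> \<exists>X. closedX G r X \<and> H \<subseteq> X \<and> \<not> U \<subseteq> X"
    have low: "t * Suc K \<le> card \<Psi> \<and> t * Suc K \<le> num_literals \<Psi>" if "P \<Psi>" "represents ?n \<Psi> ?f" for \<Psi>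
    proof -
      have "t * Suc K \<le> card \<Psi>"
        by (rule horn_lower[OF U(1) Pp[OF that(1)]]) (use that(2) h in \<open>auto simp: represents_def\<close>)
      then show ?thesis using card_le_literals[OF Pp[OF that(1)]] by simp
    qed
    have "\<exists>\<Psi>. P \<Psi> \<and> represents ?n \<Psi> ?f \<and> card \<Psi> = min_clauses P ?n ?f"
      unfolding min_clauses_def by (rule LeastI_ex) (use self in blast)
    moreover have "\<exists>\<Psi>. P \<Psi> \<and> represents ?n \<Psi> ?f \<and> num_literals \<Psi> = min_literals P ?n ?f"
      unfolding min_literals_def by (rule LeastI_ex) (use self in blast)
    ultimately show "t * Suc K \<le> opt ?f" using low opt by metis
  }
  assume S: "S \<subseteq> U" "\<And>X. closedX G r X \<Longrightarrow> S \<subseteq> X \<Longrightarrow> U \<subseteq> X"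
  let ?S = "base G r \<union> zed G t S"
  have SG: "S \<subseteq> {..<G}" using S U by blast
  have fS: "finite S" by (rule finite_subset[OF SG]) simp
  have fz: "finite (zed G t S)" using fS by (simp add: zed_eq)
  have eq: "cnf_fun ?S = ?f" by (rule same_fun[OF S(1) U(1) S(2)])
  have "vars ?S \<subseteq> vars (base G r \<union> zed G t U)" 
  proof -
    have "zed G t S \<subseteq> zed G t U" unfolding zed_eq using S(1) by (intro image_mono) auto
    then show ?thesis unfolding vars_def by (intro image_mono Union_mono) auto
  qed
  then have rep: "P ?S \<and> represents ?n ?S ?f" using P3[OF horn_form[OF SG]] eq vars_base_zed[OF U] by (simp add: represents_def)
  have cards: "card ?S \<le> (G ^ 3 + G) + t * card S"
    by (rule order_trans[OF card_Un_le]) (intro add_mono card_base card_zed fS)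
  have "num_literals ?S \<le> (\<Sum>c\<in>base G r. card c) + (\<Sum>c\<in>zed G t S. card c)"
    unfolding num_literals_def using finite_base fz by (metis (no_types, lifting) le_add1 sum.union_inter)
  also have "\<dots> \<le> (\<Sum>c\<in>base G r. 3) + (\<Sum>c\<in>zed G t S. 2)"
  proof (intro add_mono sum_mono)
    show "card c \<le> 3" if "c \<in> base G r" for c
      using horn_form[OF SG] that by (auto simp: pure_horn_3cnf_def k_cnf_def)
    show "card c \<le> 2" if "c \<in> zed G t S" for c using that by (auto simp: zed_def)
  qed
  also have "\<dots> \<le> 3 * (G ^ 3 + G) + 2 * (t * card S)"
    using card_base[of G r] card_zed[OF fS, of G t] by simp
  finally have lits: "num_literals ?S \<le> 3 * (G ^ 3 + G) + 2 * (t * card S)" .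
  have "min_clauses P ?n ?f \<le> card ?S" unfolding min_clauses_def by (rule Least_le) (use rep in blast)
  moreover have "min_literals P ?n ?f \<le> num_literals ?S" unfolding min_literals_def by (rule Least_le) (use rep in blast)
  ultimately show "opt ?f \<le> 3 * (G ^ 3 + G) + 2 * (t * card S)" using opt cards lits by auto
qed

section \<open>Reading the input formula\<close>

definition cnum :: "nat list \<Rightarrow> nat \<Rightarrow> nat" where
  "cnum x y = (\<Sum>i<y. of_bool (sym x i = 5))"

text \<open>
  The number of clauses of \<open>x\<close> completed before position \<open>y\<close> is \<open>cnum x y\<close>, and \<open>binat x y j\<close> says that the
  maximal binary word of \<open>x\<close> starting at position \<open>y\<close> is that of \<open>j\<close>.
\<close>

definition binat :: "nat list \<Rightarrow> nat \<Rightarrow> nat \<Rightarrow> bool" where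
  "binat x y j \<longleftrightarrow> (\<exists>L<Suc (length x). (\<forall>d<L. j div 2 ^ d \<noteq> 0 \<and> sym x (y + d) = 1 + j div 2 ^ d mod 2) \<and>
     j div 2 ^ L = 0 \<and> \<not> (sym x (y + L) = 1 \<or> sym x (y + L) = 2))"

text \<open>The symbol \<open>4 - bt\<close> is the sign of a positive literal for
  \<open>bt = 1\<close> and of a negative one for \<open>bt = 0\<close>; thus \<open>bt\<close> is
  the truth value of variable \<open>j\<close> that satisfies the literal.\<close>

definition lits :: "nat list \<Rightarrow> nat \<Rightarrow> nat \<Rightarrow> nat \<Rightarrow> bool" where
  "lits x k j bt \<longleftrightarrow> bt \<le> 1 \<and> (\<exists>y<length x. sym x y = 4 - bt \<and> cnum x y = k \<and> binat x (Suc y) j)"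

text \<open>What follows a numeral must not start with a binary digit; otherwise the numeral could
  be cut short and the variable misread.\<close>

definition tail :: "nat list \<Rightarrow> bool" where
  "tail v \<longleftrightarrow> v = [] \<or> 3 \<le> hd v"

text \<open>The same search as in \<open>lits\<close>, but by factorising the word instead of by
  positions; this form suits the induction over the encoding.\<close>

definition occ :: "nat list \<Rightarrow> nat \<Rightarrow> nat \<Rightarrow> nat \<Rightarrow> bool" where
  "occ w k j c \<longleftrightarrow> (\<exists>u v. w = u @ c # binary j @ v \<and> tail v \<and> count_list u 5 = k)"

lemma binary_set: "set (binary v) \<subseteq> {1..2}"
proof (induction v rule: less_induct)
  case (less v)
  show ?case
  proof (cases "v = 0")
    case False
    then have "v div 2 < v" by simp
    from less.IH[OF this] False show ?thesis by (auto simp: binary_rec(1))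
  qed (simp add: binary_rec)
qed

lemma binary_inj: "binary v = binary w \<Longrightarrow> v = w"
proof (induction v arbitrary: w rule: less_induct)
  case (less v)
  show ?case
  proof (cases "v = 0 \<or> w = 0")
    case True
    then show ?thesis using less.prems by (cases "v = 0"; cases "w = 0") (auto simp: binary_rec)
  next
    case False
    then have "v mod 2 = w mod 2" "binary (v div 2) = binary (w div 2)" using less.prems by (auto simp: binary_rec(1))
    moreover have "v div 2 < v" using False by simp
    ultimately have "v mod 2 = w mod 2" "v div 2 = w div 2" using less.IH by auto
    then show ?thesis by (metis div_mult_mod_eq)
  qed
qed

lemma binary_tail:
  assumes "binary n @ w = binary j @ v" "tail w" "tail v"
  shows "n = j"
proof -
  have "takeWhile (\<lambda>s. s < 3) (binary n @ w) = binary n" if "tail w" for n w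
    using that binary_set[of n] by (subst takeWhile_append2) (auto simp: tail_def takeWhile_eq_Nil_iff)
  then show ?thesis using assms binary_inj by metis
qed

text \<open>A sign cannot be one of the binary digits of the first literal, so an occurrence starts
  at the first symbol or lies wholly in the rest of the word.\<close>

lemma occ_lit:
  assumes "c' = 3 \<or> c' = 4" "c = 3 \<or> c = 4" "tail w"
  shows "occ ((c' # binary n) @ w) k j c \<longleftrightarrow> (c' = c \<and> n = j \<and> k = 0) \<or> occ w k j c"
proof
  assume "occ ((c' # binary n) @ w) k j c"
  then obtain u v where uv: "c' # binary n @ w = u @ c # binary j @ v" "tail v" "count_list u 5 = k"
    unfolding occ_def append_Cons by blast
  show "(c' = c \<and> n = j \<and> k = 0) \<or> occ w k j c"
  proof (cases u)
    case Nil
    have "c' # binary n @ w = c # binary j @ v" using uv(1) unfolding Nil append_Nil .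
    then have "c' = c" "binary n @ w = binary j @ v" unfolding list.inject by blast+
    moreover have "k = 0" using uv(3) unfolding Nil by simp
    ultimately show ?thesis using binary_tail[OF _ assms(3) uv(2)] by blast
  next
    case (Cons a u')
    then have eq: "binary n @ w = u' @ c # binary j @ v" using uv by simp
    have "length (binary n) \<le> length u'"
    proof (rule ccontr)
      assume "\<not> ?thesis"
      then have "(binary n @ w) ! length u' = binary n ! length u'" "binary n ! length u' \<in> set (binary n)"
        by (auto simp: nth_append)
      moreover have "(binary n @ w) ! length u' = c" unfolding eq by simp
      ultimately show False using binary_set[of n] assms(2) by auto
    qed
    then obtain u2 where u2: "u' = binary n @ u2" using eq by (metis append_eq_append_conv_if append_take_drop_id)
    then have "w = u2 @ c # binary j @ v" using eq by simp
    moreover have "count_list (binary n) 5 = 0" using binary_set[of n] by (auto simp: count_list_0_iff)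
    then have "count_list u2 5 = k" using uv Cons u2 assms(1) by auto
    ultimately show ?thesis unfolding occ_def using uv(2) by blast
  qed
next
  assume "(c' = c \<and> n = j \<and> k = 0) \<or> occ w k j c"
  then show "occ ((c' # binary n) @ w) k j c"
  proof
    assume a: "c' = c \<and> n = j \<and> k = 0"
    show ?thesis unfolding occ_def
      by (rule exI[of _ "[]"], rule exI[of _ w]) (use a assms(3) in auto)
  next
    assume "occ w k j c"
    then obtain u v where uv: "w = u @ c # binary j @ v" "tail v" "count_list u 5 = k" unfolding occ_def by blast
    have "count_list (binary n) 5 = 0" using binary_set[of n] by (auto simp: count_list_0_iff)
    then show ?thesis unfolding occ_def
      by (intro exI[of _ "c' # binary n @ u"] exI[of _ v]) (use uv assms(1) in auto)
  qed
qed

lemma occ_five: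
  assumes "c = 3 \<or> c = 4"
  shows "occ (5 # w) k j c \<longleftrightarrow> 0 < k \<and> occ w (k - 1) j c"
proof
  assume "occ (5 # w) k j c"
  then obtain u v where uv: "5 # w = u @ c # binary j @ v" "tail v" "count_list u 5 = k" unfolding occ_def by auto
  then obtain u' where "u = 5 # u'" using assms by (cases u) auto
  then have "0 < k" "w = u' @ c # binary j @ v" "count_list u' 5 = k - 1" using uv by auto
  then show "0 < k \<and> occ w (k - 1) j c" using uv(2) unfolding occ_def by blast
next
  assume "0 < k \<and> occ w (k - 1) j c"
  then obtain u v where uv: "0 < k" "w = u @ c # binary j @ v" "tail v" "count_list u 5 = k - 1" unfolding occ_def by auto
  then show "occ (5 # w) k j c" unfolding occ_def by (intro exI[of _ "5 # u"] exI[of _ v]) auto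
qed

definition code_of :: "lit \<Rightarrow> nat" where
  "code_of l = (case l of Pos v \<Rightarrow> 3 | Neg v \<Rightarrow> 4)"

lemma encode_lit_eq: "encode_lit l = code_of l # binary (var l)"
  by (cases l) (auto simp: code_of_def)

lemma occ_clause:
  assumes "c = 3 \<or> c = 4"
  shows "occ (concat (map encode_lit ls) @ 5 # w) k j c \<longleftrightarrow>
    (k = 0 \<and> (\<exists>l\<in>set ls. code_of l = c \<and> var l = j)) \<or> (0 < k \<and> occ w (k - 1) j c)"
proof (induction ls)
  case Nil
  then show ?case using occ_five[OF assms] by auto
next
  case (Cons l ls)
  have t: "tail (concat (map encode_lit ls) @ 5 # w)"
    by (cases ls) (auto simp: tail_def encode_lit_eq code_of_def split: lit.splits)
  have "code_of l = 3 \<or> code_of l = 4" by (cases l) (auto simp: code_of_def)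
  from occ_lit[OF this assms t, of "var l" k j] have "occ (encode_lit l @ concat (map encode_lit ls) @ 5 # w) k j c \<longleftrightarrow>
    (code_of l = c \<and> var l = j \<and> k = 0) \<or> occ (concat (map encode_lit ls) @ 5 # w) k j c"
    unfolding encode_lit_eq[of l] .
  then show ?case unfolding Cons list.map concat.simps append_assoc by auto
qed

lemma occ_cnf:
  assumes "c = 3 \<or> c = 4"
  shows "occ (encode_cnf cs) k j c \<longleftrightarrow> k < length cs \<and> (\<exists>l\<in>set (cs ! k). code_of l = c \<and> var l = j)"
proof (induction cs arbitrary: k)
  case Nil
  then show ?case by (auto simp: occ_def encode_cnf_def)
next
  case (Cons ls cs)
  have "encode_cnf (ls # cs) = concat (map encode_lit ls) @ 5 # encode_cnf cs"
    by (simp add: encode_cnf_def encode_clause_def)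
  then show ?case using occ_clause[OF assms, of ls "encode_cnf cs" k j] Cons[of "k - 1"]
    by (cases k) auto
qed

lemma encode_lit_set:
  assumes "a \<in> set (encode_lit l)"
  shows "1 \<le> a \<and> a \<le> 4"
proof -
  have "a = 3 \<or> a = 4 \<or> a \<in> set (binary (var l))" using assms by (cases l) auto
  then show ?thesis using subsetD[OF binary_set[of "var l"], of a] by auto
qed

lemma encode_cnf_set: "set (encode_cnf cs) \<subseteq> {1..5}"
proof
  fix a assume "a \<in> set (encode_cnf cs)"
  then have "a = 5 \<or> (\<exists>l. a \<in> set (encode_lit l))"
    by (auto simp: encode_cnf_def encode_clause_def split: if_splits)
  then show "a \<in> {1..5}"
  proof
    assume "\<exists>l. a \<in> set (encode_lit l)"
    then obtain l where "a \<in> set (encode_lit l)" by blast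
    from encode_lit_set[OF this] show ?thesis by simp
  qed simp
qed

lemma cnum_count: "y \<le> length x \<Longrightarrow> cnum x y = count_list (take y x) 5"
proof (induction y)
  case (Suc y)
  then have "take (Suc y) x = take y x @ [x ! y]" by (simp add: take_Suc_conv_app_nth)
  then show ?case using Suc by (simp add: cnum_def sym_def)
qed (simp add: cnum_def)

lemma count_encode: "count_list (encode_cnf cs) 5 = length cs"
proof (induction cs)
  case (Cons ls cs)
  have "5 \<notin> set (encode_lit l)" for l using encode_lit_set[of 5 l] by auto
  then have "count_list (concat (map encode_lit ls)) 5 = 0" by (auto simp: count_list_0_iff)
  then show ?case using Cons by (simp add: encode_cnf_def encode_clause_def)
qed (simp add: encode_cnf_def)

lemma binat_drop:
  assumes "set x \<subseteq> {1..5}"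
  shows "binat x y j \<longleftrightarrow> (\<exists>v. drop y x = binary j @ v \<and> tail v)"
proof
  assume "binat x y j"
  then obtain L where L: "\<And>d. d < L \<Longrightarrow> j div 2 ^ d \<noteq> 0 \<and> sym x (y + d) = 1 + j div 2 ^ d mod 2" "j div 2 ^ L = 0"
    "\<not> (sym x (y + L) = 1 \<or> sym x (y + L) = 2)" unfolding binat_def by blast
  have "length (binary j) \<le> L" using L(2) div_binary by simp
  moreover have "L \<le> length (binary j)"
  proof (rule ccontr)
    assume "\<not> ?thesis"
    then have "length (binary j) < L" by simp
    then show False using L(1)[of "length (binary j)"] iffD2[OF div_binary order_refl, of j] by simp
  qed
  ultimately have Lj: "L = length (binary j)" by simp
  have yd: "y + d < length x" if "d < L" for d using L(1)[OF that] by (auto simp: sym_def split: if_splits)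
  have "take L (drop y x) = binary j"
  proof (rule nth_equalityI)
    have "L \<le> length (drop y x)" using yd[of "L - 1"] by (cases L) auto
    then show "length (take L (drop y x)) = length (binary j)" using Lj by simp
    fix d assume "d < length (take L (drop y x))"
    then have d: "d < L" by simp
    then show "take L (drop y x) ! d = binary j ! d"
      using L(1)[OF d] yd[OF d] binary_nth[of d j] Lj by (simp add: sym_def)
  qed
  then have "drop y x = binary j @ drop L (drop y x)" by (metis append_take_drop_id)
  moreover have "tail (drop L (drop y x))"
  proof (cases "y + L < length x")
    case True
    then have "hd (drop L (drop y x)) = x ! (y + L)" by (simp add: hd_drop_conv_nth add.commute)
    moreover have "x ! (y + L) \<in> {1..5}" using assms nth_mem[OF True] by blast
    ultimately show ?thesis using L(3) True by (auto simp: tail_def sym_def)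
  qed (simp add: tail_def)
  ultimately show "\<exists>v. drop y x = binary j @ v \<and> tail v" by blast
next
  assume "\<exists>v. drop y x = binary j @ v \<and> tail v"
  then obtain v where v: "drop y x = binary j @ v" "tail v" by blast
  let ?L = "length (binary j)"
  have len: "length x - y = ?L + length v" using v(1) by (metis length_append length_drop)
  have nth: "x ! (y + d) = (binary j @ v) ! d" if "y + d < length x" for d
    using v(1) that by (metis nth_drop less_imp_le_nat add_leD1)
  have 1: "j div 2 ^ d \<noteq> 0 \<and> sym x (y + d) = 1 + j div 2 ^ d mod 2" if "d < ?L" for d
  proof -
    have "y + d < length x" using len that by linarith
    then show ?thesis using nth[of d] that binary_nth[OF that] div_binary[of j d] by (simp add: sym_def nth_append)
  qed
  have 2: "\<not> (sym x (y + ?L) = 1 \<or> sym x (y + ?L) = 2)"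
  proof (cases "y + ?L < length x")
    case True
    then have "v \<noteq> []" using len by auto
    then have "3 \<le> v ! 0" using v(2) by (simp add: tail_def hd_conv_nth)
    then show ?thesis using nth[OF True] True by (simp add: sym_def nth_append)
  qed (simp add: sym_def)
  show "binat x y j" unfolding binat_def
    by (rule exI[of _ ?L]) (use 1 2 len iffD2[OF div_binary order_refl, of j] in auto)
qed

lemma lits_occ:
  assumes "set x \<subseteq> {1..5}"
  shows "lits x k j bt \<longleftrightarrow> bt \<le> 1 \<and> occ x k j (4 - bt)"
proof -
  have "(\<exists>y<length x. sym x y = 4 - bt \<and> cnum x y = k \<and> binat x (Suc y) j) \<longleftrightarrow> occ x k j (4 - bt)"
  proof
    assume "\<exists>y<length x. sym x y = 4 - bt \<and> cnum x y = k \<and> binat x (Suc y) j"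
    then obtain y v where y: "y < length x" "x ! y = 4 - bt" "count_list (take y x) 5 = k"
      "drop (Suc y) x = binary j @ v" "tail v"
      unfolding binat_drop[OF assms] by (auto simp: sym_def cnum_count)
    then have "x = take y x @ (4 - bt) # binary j @ v" by (metis id_take_nth_drop)
    then show "occ x k j (4 - bt)" unfolding occ_def using y by blast
  next
    assume "occ x k j (4 - bt)"
    then obtain u v where uv: "x = u @ (4 - bt) # binary j @ v" "tail v" "count_list u 5 = k" unfolding occ_def by blast
    then have "length u < length x" "sym x (length u) = 4 - bt" "cnum x (length u) = k"
      by (auto simp: sym_def cnum_count nth_append)
    moreover have "binat x (Suc (length u)) j" unfolding binat_drop[OF assms] using uv by auto
    ultimately show "\<exists>y<length x. sym x y = 4 - bt \<and> cnum x y = k \<and> binat x (Suc y) j" by blast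
  qed
  then show ?thesis by (simp add: lits_def)
qed

lemma lits_encode:
  "lits (encode_cnf cs) k j bt \<longleftrightarrow> bt \<le> 1 \<and> k < length cs \<and> (if bt = 1 then Pos j else Neg j) \<in> set (cs ! k)"
proof -
  have "(\<exists>l\<in>A. code_of l = 4 - bt \<and> var l = j) \<longleftrightarrow> (if bt = 1 then Pos j else Neg j) \<in> A" if "bt \<le> 1" for A
  proof -
    have "code_of l = 4 - bt \<and> var l = j \<longleftrightarrow> l = (if bt = 1 then Pos j else Neg j)" for l
      using that by (cases l) (auto simp: code_of_def)
    then show ?thesis by auto
  qed
  moreover have "4 - bt = 3 \<or> 4 - bt = 4" if "bt \<le> 1" using that by auto
  ultimately show ?thesis unfolding lits_occ[OF encode_cnf_set] using occ_cnf by metis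
qed

lemma sat_lits:
  assumes "lists_cnf cs \<Phi>"
  shows "satisfiable \<Phi> \<longleftrightarrow> (\<exists>\<alpha>. \<forall>k<length cs. \<exists>j bt. lits (encode_cnf cs) k j bt \<and> (bt = 1 \<longleftrightarrow> \<alpha> j))"
proof -
  have "cnf_fun \<Phi> \<alpha> \<longleftrightarrow> (\<forall>k<length cs. \<exists>j bt. lits (encode_cnf cs) k j bt \<and> (bt = 1 \<longleftrightarrow> \<alpha> j))" for \<alpha>
  proof -
    have "cnf_fun \<Phi> \<alpha> \<longleftrightarrow> (\<forall>k<length cs. \<exists>l\<in>set (cs ! k). lit_true \<alpha> l)"
    proof -
      have "\<Phi> = set ` set cs" using assms by (auto simp: lists_cnf_def)
      then have "cnf_fun \<Phi> \<alpha> \<longleftrightarrow> (\<forall>ls\<in>set cs. \<exists>l\<in>set ls. lit_true \<alpha> l)" unfolding cnf_fun_def by blast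
      then show ?thesis unfolding all_set_conv_all_nth .
    qed
    moreover have "(\<exists>l\<in>set (cs ! k). lit_true \<alpha> l) \<longleftrightarrow> (\<exists>j bt. lits (encode_cnf cs) k j bt \<and> (bt = 1 \<longleftrightarrow> \<alpha> j))"
      if k: "k < length cs" for k
    proof
      assume "\<exists>l\<in>set (cs ! k). lit_true \<alpha> l"
      then obtain l where l: "l \<in> set (cs ! k)" "lit_true \<alpha> l" by blast
      show "\<exists>j bt. lits (encode_cnf cs) k j bt \<and> (bt = 1 \<longleftrightarrow> \<alpha> j)"
        by (rule exI[of _ "var l"], rule exI[of _ "of_bool (\<alpha> (var l))"])
          (insert l k, cases l, auto simp: lits_encode)
    next
      assume "\<exists>j bt. lits (encode_cnf cs) k j bt \<and> (bt = 1 \<longleftrightarrow> \<alpha> j)"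
      then obtain j bt where "lits (encode_cnf cs) k j bt" "bt = 1 \<longleftrightarrow> \<alpha> j" by blast
      then show "\<exists>l\<in>set (cs ! k). lit_true \<alpha> l"
        by (intro bexI[of _ "if bt = 1 then Pos j else Neg j"]) (auto simp: lits_encode)
    qed
    ultimately show ?thesis by auto
  qed
  then show ?thesis by (simp add: satisfiable_def)
qed

text \<open>Every variable occurs, so the word is at least as long as their number; this later
  places all variables on the grid. There are at most \<open>(2 * n) ^ 3 + 1\<close> sets of at most
  three literals, the empty clause included, so the length is polynomial in the number of variables
  alone.\<close>

lemma encode_length:
  assumes "k_cnf 3 \<Phi>" "vars \<Phi> = {..<n}" "lists_cnf cs \<Phi>"
  shows "n \<le> length (encode_cnf cs)" "length (encode_cnf cs) \<le> ((2 * n) ^ 3 + 1) * (3 * n + 4)"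
proof -
  have len: "length (encode_lit l) = Suc (length (binary (var l)))" for l by (simp add: encode_lit_eq)
  have Un: "\<Union> \<Phi> = set (concat cs)" using assms(3) by (auto simp: lists_cnf_def)
  have "length (concat cs) \<le> length (encode_cnf cs)"
    by (induction cs) (auto simp: encode_cnf_def encode_clause_def length_concat len sum_list_Suc comp_def)
  moreover have "n \<le> length (concat cs)"
  proof -
    have "{..<n} = var ` set (concat cs)" using assms(2) Un by (simp add: vars_def)
    then have "n = card (var ` set (concat cs))" by (metis card_lessThan)
    also have "\<dots> \<le> length (concat cs)" using card_image_le[of "set (concat cs)" var] card_length[of "concat cs"] by simp
    finally show ?thesis .
  qed
  ultimately show "n \<le> length (encode_cnf cs)" by simp
  let ?Li = "Pos ` {..<n} \<union> Neg ` {..<n}"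
  have Li: "l \<in> ?Li" if "l \<in> \<Union> \<Phi>" for l
  proof -
    have "var l < n" using assms(2) that by (auto simp: vars_def)
    then show ?thesis by (cases l) auto
  qed
  have cLi: "card ?Li \<le> 2 * n"
    by (rule order_trans[OF card_Un_le]) (use card_image_le[of "{..<n}" Pos] card_image_le[of "{..<n}" Neg] in auto)
  have "\<Phi> \<subseteq> insert {} ((\<lambda>(a, b, c). {a, b, c}) ` (?Li \<times> ?Li \<times> ?Li))"
  proof
    fix c assume c: "c \<in> \<Phi>"
    then have f: "finite c" "card c \<le> 3" using assms(1) by (auto simp: k_cnf_def is_cnf_def)
    show "c \<in> insert {} ((\<lambda>(a, b, c). {a, b, c}) ` (?Li \<times> ?Li \<times> ?Li))"
    proof (cases "c = {}")
      case False
      have "\<exists>a b d. c = {a, b, d}"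
      proof -
        consider "card c = 1" | "card c = 2" | "card c = 3" using f False by (metis card_0_eq le_SucE le_zero_eq numeral_3_eq_3 numeral_2_eq_2 One_nat_def)
        then show ?thesis by cases (auto simp: card_1_singleton_iff card_2_iff card_3_iff)
      qed
      then obtain a b d where abd: "c = {a, b, d}" by blast
      then have "a \<in> ?Li" "b \<in> ?Li" "d \<in> ?Li" using Li c by blast+
      then show ?thesis using abd by (auto simp del: Un_iff intro!: image_eqI[of _ _ "(a, b, d)"])
    qed simp
  qed
  then have "card \<Phi> \<le> card (insert {} ((\<lambda>(a, b, c). {a, b, c}) ` (?Li \<times> ?Li \<times> ?Li)))" by (intro card_mono) auto
  also have "\<dots> \<le> Suc (card ((\<lambda>(a, b, c). {a, b, c}) ` (?Li \<times> ?Li \<times> ?Li)))"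
    by (subst card_insert_if) auto
  also have "card ((\<lambda>(a, b, c). {a, b, c}) ` (?Li \<times> ?Li \<times> ?Li)) \<le> card (?Li \<times> ?Li \<times> ?Li)"
    by (rule card_image_le) simp
  also have "card (?Li \<times> ?Li \<times> ?Li) \<le> (2 * n) ^ 3"
    unfolding card_cartesian_product power3_eq_cube using mult_le_mono[OF cLi mult_le_mono[OF cLi cLi]] by (simp add: mult.assoc)
  finally have cP: "card \<Phi> \<le> (2 * n) ^ 3 + 1" by simp
  have "length cs = card \<Phi>" using assms(3) by (metis distinct_card length_map lists_cnf_def)
  have each: "length (encode_clause ls) \<le> 3 * n + 4" if ls: "ls \<in> set cs" for ls
  proof -
    have d: "distinct ls" "set ls \<in> \<Phi>" using assms(3) ls by (auto simp: lists_cnf_def)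
    have l3: "length ls \<le> 3" using d assms(1) distinct_card[OF d(1)] by (fastforce simp: k_cnf_def)
    have "length (encode_lit l) \<le> n + 1" if "l \<in> set ls" for l
    proof -
      have "var l < n" using assms(2) d(2) that by (auto simp: vars_def)
      then show ?thesis using length_binary_le[of "var l"] by (simp add: len)
    qed
    then have "sum_list (map (length \<circ> encode_lit) ls) \<le> sum_list (map (\<lambda>_. n + 1) ls)" by (intro sum_list_mono) auto
    also have "\<dots> = length ls * (n + 1)" by (simp add: sum_list_triv)
    also have "\<dots> \<le> 3 * (n + 1)" using l3 by (rule mult_le_mono1)
    finally show ?thesis by (simp add: encode_clause_def length_concat comp_def)
  qed
  have "length (encode_cnf cs) = sum_list (map (length \<circ> encode_clause) cs)" by (simp add: encode_cnf_def length_concat)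
  also have "\<dots> \<le> sum_list (map (\<lambda>_. 3 * n + 4) cs)" by (rule sum_list_mono) (use each in auto)
  also have "\<dots> = length cs * (3 * n + 4)" by (simp add: sum_list_triv)
  also have "\<dots> \<le> ((2 * n) ^ 3 + 1) * (3 * n + 4)" unfolding \<open>length cs = card \<Phi>\<close> using cP by (rule mult_le_mono1)
  finally show "length (encode_cnf cs) \<le> ((2 * n) ^ 3 + 1) * (3 * n + 4)" .
qed

section \<open>The reduction is computable in polynomial time\<close>

lemma pc_power: "pc d A \<Longrightarrow> pc d (\<lambda>x e. A x e ^ c)"
proof (induction c)
  case 0
  show ?case using pc_const[of d 1] by simp
next
  case (Suc c)
  then show ?case using pc_mult[of d A "\<lambda>x e. A x e ^ c"] by simp
qed

lemma pcb_app3: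
  assumes "\<And>d i j l. i < d \<Longrightarrow> j < d \<Longrightarrow> l < d \<Longrightarrow> pcb d (\<lambda>x e. f x (e i) (e j) (e l))"
    "pc d A" "pc d B" "pc d C"
  shows "pcb d (\<lambda>x e. f x (A x e) (B x e) (C x e))"
  unfolding pcb_def
  by (rule pc_app3[where f = "\<lambda>x a b c. of_bool (f x a b c)", OF _ assms(2-4)]) (rule assms(1)[unfolded pcb_def])

text \<open>The power itself may be exponentially large. Repeated division keeps all intermediate
  values at most the dividend.\<close>

lemma pc_divpow:
  assumes "pc d A" "pc d B" "pc d C"
  shows "pc d (\<lambda>x e. A x e div B x e ^ C x e)"
proof (rule pc_app3[where f = "\<lambda>x a b c. a div b ^ c", OF _ assms])
  fix d i j l :: nat assume ij: "i < d" "j < d" "l < d"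
  have r: "rec_nat a (\<lambda>i v. v div b) t = a div b ^ t" for a b t :: nat
    by (induction t) (auto simp: div_mult2_eq power_Suc2 simp del: power_Suc)
  have "pc d (\<lambda>x e. rec_nat (e i) (\<lambda>i v. v div e j) (e l))"
  proof (rule pc_iter[where G = "\<lambda>x e i v. v div e j" and P = "\<lambda>N. N"])
    show "pc (k + 2) (\<lambda>x e. e (Suc k) div e j)" if "d \<le> k" for k
      by (intro pc_div pc_var) (use that ij in auto)
    show "rec_nat (e i) (\<lambda>i v. v div e j) n \<le> N" if "bd N x e" "n \<le> e l" for N x e n
      unfolding r using bd_le[OF that(1), of i] div_le_dividend[of "e i" "e j ^ n"] by linarith
    show "v div e j = v div e' j" if "\<And>j. j < d \<Longrightarrow> e j = e' j" for x and e e' :: "nat \<Rightarrow> nat" and i v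
      using that[OF ij(2)] by simp
  qed (use ij in \<open>auto intro: pc_var\<close>)
  then show "pc d (\<lambda>x e. e i div e j ^ e l)" unfolding r .
qed

lemma pc_dig: "pc d A \<Longrightarrow> pc d B \<Longrightarrow> pc d C \<Longrightarrow> pc d (\<lambda>x e. dig (A x e) (B x e) (C x e))"
  unfolding dig_def by (intro pc_mod pc_divpow)

text \<open>Powers are capped since intermediate results must stay polynomially bounded.\<close>

definition pwc :: "nat \<Rightarrow> nat \<Rightarrow> nat \<Rightarrow> nat" where
  "pwc a n cap = rec_nat 1 (\<lambda>i v. min (v * a) cap) n"

lemma pwc_eq:
  assumes "1 \<le> a" "1 \<le> n"
  shows "pwc a n cap = min (a ^ n) cap"
  using assms(2)
proof (induction n rule: dec_induct)
  case (step n)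
  have "min (min (a ^ n) cap * a) cap = min (a ^ Suc n) cap"
  proof (cases "a ^ n \<le> cap")
    case False
    have "cap * 1 \<le> cap * a" by (rule mult_le_mono2[OF assms(1)])
    moreover have "1 * a ^ n \<le> a ^ Suc n" unfolding power_Suc by (rule mult_le_mono1[OF assms(1)])
    moreover have "cap < a ^ n" using False by (simp only: not_le)
    ultimately have "cap \<le> cap * a" "cap \<le> a ^ Suc n" "cap \<le> a ^ n" by linarith+
    then show ?thesis by (simp only: min.absorb2)
  qed (simp add: mult.commute)
  then show ?case using step.IH by (simp add: pwc_def)
qed (simp add: pwc_def)

lemma pc_pwc:
  assumes "pc d A" "pc d B" "pc d C"
  shows "pc d (\<lambda>x e. pwc (A x e) (B x e) (C x e))"
proof (rule pc_app3[where f = "\<lambda>x. pwc", OF _ assms])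
  fix d i j l :: nat assume ij: "i < d" "j < d" "l < d"
  show "pc d (\<lambda>x e. pwc (e i) (e j) (e l))" unfolding pwc_def
  \<comment> \<open>The start value 1 is not capped, and the cap may be 0; hence
    \<open>N + 1\<close> instead of \<open>N\<close>.\<close>
  proof (rule pc_iter[where G = "\<lambda>x e i' v. min (v * e i) (e l)" and P = "\<lambda>N. N + 1"])
    show "pc (k + 2) (\<lambda>x e. min (e (Suc k) * e i) (e l))" if "d \<le> k" for k
      by (intro pc_min pc_mult pc_var) (use that ij in auto)
    show "rec_nat 1 (\<lambda>i' v. min (v * e i) (e l)) n \<le> N + 1" if "bd N x e" "n \<le> e j" for N x e n
      using bd_le[OF that(1), of l] by (cases n) auto
    show "min (v * e i) (e l) = min (v * e' i) (e' l)" if "\<And>j. j < d \<Longrightarrow> e j = e' j"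
      for x and e e' :: "nat \<Rightarrow> nat" and i' v
      using that[OF ij(1)] that[OF ij(3)] by simp
  qed (use ij in \<open>auto intro: pc_var pc_const\<close>)
qed

lemma pc_ev:
  assumes Q: "\<And>d. pc d (\<lambda>x e. Q x)" and S: "\<And>d. pc d (\<lambda>x e. S x)" and pos: "\<And>x. 0 < Q x"
    and A: "pc d A" and B: "pc d B"
  shows "pc d (\<lambda>x e. ev (Q x) (S x) (A x e) (B x e))"
proof (rule pc_app2[where f = "\<lambda>x. ev (Q x) (S x)", OF _ A B])
  fix d i j :: nat assume ij: "i < d" "j < d"
  obtain P where P: "pb P" "\<And>N x e. bd N x e \<Longrightarrow> Q x \<le> P N" by (rule pc_bound[OF Q[of 0]]) auto
  show "pc d (\<lambda>x e. ev (Q x) (S x) (e i) (e j))" unfolding ev_def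
  proof (rule pc_iter[where G = "\<lambda>x e f v. (v * e j + dig (Q x) (e i) f) mod Q x", OF _ _ _ _ P(1)])
    show "pc (k + 2) (\<lambda>x e. (e (Suc k) * e j + dig (Q x) (e i) (e k)) mod Q x)" if "d \<le> k" for k
      by (intro pc_mod pc_add pc_mult pc_dig Q pc_var) (use that ij in auto)
    show "rec_nat 0 (\<lambda>f v. (v * e j + dig (Q x) (e i) f) mod Q x) n \<le> P N" if "bd N x e" "n \<le> S x" for N x e n
    proof (cases n)
      case (Suc n')
      have "rec_nat 0 (\<lambda>f v. (v * e j + dig (Q x) (e i) f) mod Q x) n < Q x" using pos by (simp add: Suc)
      then show ?thesis using P(2)[OF that(1)] by simp
    qed simp
    show "(v * e j + dig (Q x) (e i) f) mod Q x = (v * e' j + dig (Q x) (e' i) f) mod Q x"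
      if "\<And>j. j < d \<Longrightarrow> e j = e' j" for x and e e' :: "nat \<Rightarrow> nat" and f v
      using that[OF ij(1)] that[OF ij(2)] by simp
  qed (auto intro: pc_const S)
qed

lemma pcb_lnk:
  assumes Q: "\<And>d. pc d (\<lambda>x e. Q x)" and S: "\<And>d. pc d (\<lambda>x e. S x)" and B: "\<And>d. pc d (\<lambda>x e. Q x ^ S x)"
    and loc: "\<And>x. tensor (Q x) (S x)" and A: "pc d A" "pc d A'" "pc d T" "pc d I"
  shows "pcb d (\<lambda>x e. tensor.lnk (Q x) (S x) (A x e) (A' x e) (T x e) (I x e))"
  unfolding tensor.lnk_def[OF loc]
proof (intro pcb_conj pcb_less A B pcb_all S pcb_eq pc_if pc_dig Q pc_var)
  fix k assume "d \<le> k"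
  then have k: "d \<le> Suc k" by simp
  show "pc (Suc k) A" "pc (Suc k) A'" "pc (Suc k) T" "pc (Suc k) I" by (rule pc_mono[OF _ k], fact A)+
next
  fix x e e' f assume e: "\<And>j. j < d \<Longrightarrow> e j = (e' j :: nat)"
  have "A x e = A x e'" "A' x e = A' x e'" "T x e = T x e'" "I x e = I x e'"
    by (rule pc_local[OF A(1) e], assumption, rule pc_local[OF A(2) e], assumption,
        rule pc_local[OF A(3) e], assumption, rule pc_local[OF A(4) e], assumption)
  then show "(dig (Q x) (A' x e) f = (if f = T x e then I x e else dig (Q x) (A x e) f)) =
    (dig (Q x) (A' x e') f = (if f = T x e' then I x e' else dig (Q x) (A x e') f))" by simp
qed auto

lemma pcb_ispt:
  assumes Q: "\<And>d. pc d (\<lambda>x e. Q x)" and S: "\<And>d. pc d (\<lambda>x e. S x)" and B: "\<And>d. pc d (\<lambda>x e. Q x ^ S x)"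
    and loc: "\<And>x. tensor (Q x) (S x)" and A: "pc d A" "pc d A'"
  shows "pcb d (\<lambda>x e. tensor.ispt (Q x) (S x) (A x e) (A' x e))"
  unfolding tensor.ispt_def[OF loc]
proof (intro pcb_conj pcb_less A B pcb_all S pcb_eq pc_dig Q pc_var pc_mod pc_divpow)
  fix k assume "d \<le> k"
  then have k: "d \<le> Suc k" by simp
  show "pc (Suc k) A" "pc (Suc k) A'" by (rule pc_mono[OF _ k], fact A)+
next
  fix x e e' f assume e: "\<And>j. j < d \<Longrightarrow> e j = (e' j :: nat)"
  have "A x e = A x e'" "A' x e = A' x e'"
    by (rule pc_local[OF A(1) e], assumption, rule pc_local[OF A(2) e], assumption)
  then show "(dig (Q x) (A' x e) f = A x e div S x ^ f mod S x) =
    (dig (Q x) (A' x e') f = A x e' div S x ^ f mod S x)" by simp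
qed auto

lemma pc_cnum:
  assumes "pc d A"
  shows "pc d (\<lambda>x e. cnum x (A x e))"
proof (rule pc_app1[where f = cnum, OF _ assms])
  fix d i :: nat assume i: "i < d"
  show "pc d (\<lambda>x e. cnum x (e i))" unfolding cnum_def
    by (intro pc_sum pc_var pc_of_bool pcb_eq pc_sym pc_const) (use i in auto)
qed

lemma pcb_binat_var:
  assumes "i < d" "j < d"
  shows "pcb d (\<lambda>x e. binat x (e i) (e j))"
proof -
  have "pcb (Suc k) (\<lambda>x e. (\<forall>f<e k. e j div 2 ^ f \<noteq> 0 \<and> sym x (e i + f) = 1 + e j div 2 ^ f mod 2) \<and>
     e j div 2 ^ e k = 0 \<and> \<not> (sym x (e i + e k) = 1 \<or> sym x (e i + e k) = 2))" if "d \<le> k" for k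
    by (intro pcb_conj pcb_not pcb_disj pcb_all pcb_eq pc_sym pc_add pc_mod pc_divpow pc_const pc_var)
      (use assms that in auto)
  then show ?thesis unfolding binat_def
    by (intro pcb_ex[where F = "\<lambda>x e L. (\<forall>f<L. e j div 2 ^ f \<noteq> 0 \<and> sym x (e i + f) = 1 + e j div 2 ^ f mod 2) \<and>
     e j div 2 ^ L = 0 \<and> \<not> (sym x (e i + L) = 1 \<or> sym x (e i + L) = 2)"] pc_Suc pc_len) (use assms in auto)
qed

lemma pcb_binat:
  assumes "pc d A" "pc d B"
  shows "pcb d (\<lambda>x e. binat x (A x e) (B x e))"
  unfolding pcb_def
  by (rule pc_app2[where f = "\<lambda>x a b. of_bool (binat x a b)", OF _ assms]) (rule pcb_binat_var[unfolded pcb_def])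

lemma pcb_lits:
  assumes "pc d A" "pc d B" "pc d C"
  shows "pcb d (\<lambda>x e. lits x (A x e) (B x e) (C x e))"
proof (rule pcb_app3[where f = lits, OF _ assms])
  fix d i j l :: nat assume ij: "i < d" "j < d" "l < d"
  have "pcb d (\<lambda>x e. \<exists>y<length x. sym x y = 4 - e l \<and> cnum x y = e i \<and> binat x (Suc y) (e j))"
  proof (rule pcb_ex[where F = "\<lambda>x e y. sym x y = 4 - e l \<and> cnum x y = e i \<and> binat x (Suc y) (e j)", OF pc_len])
    show "pcb (Suc k) (\<lambda>x e. sym x (e k) = 4 - e l \<and> cnum x (e k) = e i \<and> binat x (Suc (e k)) (e j))" if "d \<le> k" for k
      by (intro pcb_conj pcb_eq pc_sym pc_cnum pcb_binat pc_sub pc_Suc pc_const pc_var) (use ij that in auto)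
  qed (use ij in auto)
  then show "pcb d (\<lambda>x e. lits x (e i) (e j) (e l))" unfolding lits_def
    by (intro pcb_conj pcb_le pc_var pc_const) (use ij in auto)
qed

lemma pcb_rl:
  assumes Q: "\<And>d. pc d (\<lambda>x e. Q x)" and S: "\<And>d. pc d (\<lambda>x e. S x)" and B: "\<And>d. pc d (\<lambda>x e. Q x ^ S x)"
    and R: "\<And>d. pc d (\<lambda>x e. R x)" and M: "\<And>d. pc d (\<lambda>x e. M x)"
    and loc: "\<And>x. tensor (Q x) (S x)" and pos: "\<And>x. 0 < Q x" and A: "pc d A" "pc d A'" "pc d H"
  shows "pcb d (\<lambda>x e. rules.rl (Q x) (S x) (R x) (M x) (lits x) (A x e) (A' x e) (H x e))"
  unfolding rules.rl_def[OF rules.intro[OF loc]] Let_def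
  by (intro pcb_disj pcb_conj pcb_eq pcb_less pc_dig pc_ev[OF Q S pos] pcb_lnk[OF Q S B loc] pcb_ispt[OF Q S B loc] pcb_lits
      pc_mult pc_Suc pc_sub pc_const Q S B R M A)

definition prm :: "nat \<Rightarrow> bool" where
  "prm p \<longleftrightarrow> 1 < p \<and> (\<forall>c<p. 1 < c \<longrightarrow> p mod c \<noteq> 0)"

lemma prm_prime: "prm p \<longleftrightarrow> prime p"
proof
  assume p: "prm p"
  show "prime p" unfolding prime_nat_iff
  proof (intro conjI allI impI)
    show "1 < p" using p by (simp add: prm_def)
    fix c assume "c dvd p"
    then have "c \<le> p" "p mod c = 0" "c \<noteq> 0" using p by (auto simp: prm_def intro: dvd_imp_le)
    then show "c = 1 \<or> c = p" using p unfolding prm_def by (metis le_neq_implies_less less_one linorder_neqE_nat)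
  qed
next
  assume "prime p"
  then show "prm p" unfolding prm_def prime_nat_iff by (metis dvd_eq_mod_eq_0 less_not_refl)
qed

lemma pcb_prm:
  assumes "i < d"
  shows "pcb d (\<lambda>x e. prm (e i))"
  unfolding prm_def by (intro pcb_conj pcb_less pcb_all pcb_imp pcb_not pcb_eq pc_mod pc_const pc_var) (use assms in auto)

section \<open>The parameters of the reduction\<close>

locale enc =
  fixes s0 :: nat
  assumes s0: "100 \<le> s0"
begin

text \<open>Up to the lower bound \<open>s0\<close> this inverts the function \<open>s ^ s\<close>
  at the input length; the capped power decides the inequality without computing
  \<open>s ^ s\<close>. The bound \<open>s0\<close> is fixed at the very end, where it has to beat
  the constant hidden in the approximation factor.\<close>

definition sx :: "nat list \<Rightarrow> nat" where
  "sx x = first (length x + s0 + 1) (\<lambda>s. s0 \<le> s \<and> length x \<le> pwc s s (length x))"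

definition qx :: "nat list \<Rightarrow> nat" where
  "qx x = first (sx x ^ 18 + 1) (\<lambda>p. sx x ^ 9 < p \<and> prm p)"

definition Rx :: "nat list \<Rightarrow> nat" where "Rx x = qx x ^ sx x + 10"
definition Gx :: "nat list \<Rightarrow> nat" where "Gx x = Rx x ^ 8"
text \<open>The fourth power dominates the at most \<open>G ^ 3 + G\<close> clauses of
  \<open>base\<close>, while the number of variables remains polynomial.\<close>

definition tx :: "nat list \<Rightarrow> nat" where "tx x = Gx x ^ 4"
definition nx :: "nat list \<Rightarrow> nat" where "nx x = Gx x + 1 + tx x"
definition mx :: "nat list \<Rightarrow> nat" where "mx x = cnum x (length x)"
text \<open>The threshold between the two cases. The optimum exceeds it for unsatisfiable inputs.
  For satisfiable ones, even \<open>s\<close> times the optimum is at most three tenths of it, which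
  leaves room for rounding up to a power of two.\<close>

definition Wx :: "nat list \<Rightarrow> nat" where "Wx x = 10 * sx x * qx x ^ sx x * tx x"

lemma sx_props: "s0 \<le> sx x" "length x \<le> sx x ^ sx x" "s0 < sx x \<Longrightarrow> (sx x - 1) ^ (sx x - 1) < length x"
proof -
  let ?P = "\<lambda>s. s0 \<le> s \<and> length x \<le> pwc s s (length x)"
  have P: "?P s \<longleftrightarrow> s0 \<le> s \<and> length x \<le> s ^ s" for s using s0 pwc_eq[of s s "length x"] by auto
  have ex: "?P (length x + s0)" unfolding P
  proof
    have "length x + s0 \<le> (length x + s0) ^ (length x + s0)" by (rule self_le_power) (use s0 in auto)
    then show "length x \<le> (length x + s0) ^ (length x + s0)" by linarith
  qed simp
  have eq: "sx x = (LEAST s. ?P s)" unfolding sx_def by (rule first_eq[where Q = ?P, OF _ ex]) simp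
  have "?P (sx x)" unfolding eq using ex by (rule LeastI)
  then show "s0 \<le> sx x" "length x \<le> sx x ^ sx x" unfolding P by auto
  assume "s0 < sx x"
  moreover from this have "\<not> ?P (sx x - 1)" unfolding eq by (intro not_less_Least) simp
  ultimately show "(sx x - 1) ^ (sx x - 1) < length x" unfolding P by auto
qed

lemma qx_props: "prime (qx x)" "sx x ^ 9 < qx x" "qx x \<le> sx x ^ 18"
proof -
  let ?P = "\<lambda>p. sx x ^ 9 < p \<and> prm p"
  have "(2::nat) ^ 9 \<le> sx x ^ 9" by (rule power_mono) (use sx_props(1)[of x] s0 in auto)
  then have "64 \<le> sx x ^ 9" by simp
  from prime_between[OF this] obtain p where p: "?P p" "p \<le> sx x ^ 18"
    unfolding prm_prime by (auto simp flip: power_mult)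
  have eq: "qx x = (LEAST p. ?P p)" unfolding qx_def by (rule first_eq[where Q = ?P, OF _ p(1)]) (use p in simp)
  have "?P (qx x)" unfolding eq using p(1) by (rule LeastI)
  then show "prime (qx x)" "sx x ^ 9 < qx x" unfolding prm_prime by auto
  have "qx x \<le> p" unfolding eq using p(1) by (rule Least_le)
  then show "qx x \<le> sx x ^ 18" using p(2) by simp
qed

lemma sx_qx: "0 < sx x" "0 < qx x" "sx x \<le> qx x"
proof -
  show "0 < sx x" using sx_props(1)[of x] s0 by simp
  then have "sx x \<le> sx x ^ 9" by (intro self_le_power) auto
  then show "sx x \<le> qx x" "0 < qx x" using qx_props(2)[of x] by auto
qed

lemma tensor_x: "tensor (qx x) (sx x)"
  by unfold_locales (use qx_props sx_qx in auto)

text \<open>If \<open>s\<close> exceeds \<open>s0\<close>, minimality gives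
  \<open>r ^ r < length x\<close> for \<open>r = s - 1\<close>, and \<open>s ^ (18 * s)\<close> is
  at most \<open>(r ^ r) ^ 72\<close> because \<open>s \<le> r * r\<close> and
  \<open>s \<le> 2 * r\<close>. Otherwise \<open>s = s0\<close>, and the bound is a
  constant.\<close>

lemma B_bound: "qx x ^ sx x \<le> (length x + s0 ^ (18 * s0)) ^ 72"
proof -
  let ?s = "sx x"
  have "qx x ^ ?s \<le> (?s ^ 18) ^ ?s" by (rule power_mono[OF qx_props(3)]) simp
  then have le: "qx x ^ ?s \<le> ?s ^ (18 * ?s)" by (simp add: power_mult)
  show ?thesis
  proof (cases "?s = s0")
    case True
    have "qx x ^ ?s \<le> length x + s0 ^ (18 * s0)" using le unfolding True by linarith
    also have "1 \<le> s0 ^ (18 * s0)" using s0 by simp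
    then have "length x + s0 ^ (18 * s0) \<le> (length x + s0 ^ (18 * s0)) ^ 72" by (intro self_le_power) linarith+
    finally show ?thesis .
  next
    case False
    then have gt: "s0 < ?s" using sx_props(1)[of x] by simp
    define r where "r = ?s - 1"
    have r: "?s = Suc r" "1 < r" using gt s0 by (auto simp: r_def)
    have lt: "r ^ r < length x" using sx_props(3)[OF gt] by (simp add: r_def)
    have "2 * r \<le> r * r" by (rule mult_le_mono1) (use r(2) in simp)
    then have "Suc r \<le> r * r" using r(2) by linarith
    then have "Suc r ^ (18 * Suc r) \<le> (r * r) ^ (18 * Suc r)" by (rule power_mono) simp
    also have "\<dots> = r ^ (36 * Suc r)" by (simp add: power_mult flip: power2_eq_square) (simp flip: power_mult)
    also have "\<dots> \<le> r ^ (72 * r)" by (rule power_increasing) (use r(2) in auto)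
    also have "\<dots> = (r ^ r) ^ 72" by (simp add: mult.commute flip: power_mult)
    also have "\<dots> \<le> (length x + s0 ^ (18 * s0)) ^ 72" by (rule power_mono) (use lt in auto)
    finally show ?thesis using le unfolding r(1) by linarith
  qed
qed

lemma pc_sx: "pc d (\<lambda>x e. sx x)"
  unfolding sx_def
  by (intro pc_first[where F = "\<lambda>x e s. s0 \<le> s \<and> length x \<le> pwc s s (length x)"] pc_add pc_len pc_const pcb_conj pcb_le pc_pwc pc_var) auto

lemma pc_qx: "pc d (\<lambda>x e. qx x)"
  unfolding qx_def
  by (intro pc_first[where F = "\<lambda>x e p. sx x ^ 9 < p \<and> prm p"] pc_add pc_power pc_sx pc_const pcb_conj pcb_less pcb_prm pc_var) auto

text \<open>The polynomial bound just obtained serves as the cap, so capping does not change the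
  value.\<close>

lemma pc_Bx: "pc d (\<lambda>x e. qx x ^ sx x)"
proof (rule pc_eqI)
  show "pc d (\<lambda>x e. pwc (qx x) (sx x) ((length x + s0 ^ (18 * s0)) ^ 72))"
    by (intro pc_pwc pc_qx pc_sx pc_power pc_add pc_len pc_const)
  show "pwc (qx x) (sx x) ((length x + s0 ^ (18 * s0)) ^ 72) = qx x ^ sx x" for x and e :: "nat \<Rightarrow> nat"
    using pwc_eq[of "qx x" "sx x"] sx_qx[of x] B_bound[of x] by (simp add: Suc_le_eq)
qed

lemma pc_Rx: "pc d (\<lambda>x e. Rx x)" unfolding Rx_def by (intro pc_add pc_Bx pc_const)
lemma pc_Gx: "pc d (\<lambda>x e. Gx x)" unfolding Gx_def by (intro pc_power pc_Rx)
lemma pc_tx: "pc d (\<lambda>x e. tx x)" unfolding tx_def by (intro pc_power pc_Gx)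
lemma pc_nx: "pc d (\<lambda>x e. nx x)" unfolding nx_def by (intro pc_add pc_Gx pc_tx pc_const)
lemma pc_mx: "pc d (\<lambda>x e. mx x)" unfolding mx_def by (intro pc_cnum pc_len)
lemma pc_Wx: "pc d (\<lambda>x e. Wx x)" unfolding Wx_def by (intro pc_mult pc_sx pc_Bx pc_tx pc_const)

text \<open>Symmetric in the two body variables, so that every clause can be listed with its body in
  nondecreasing order and thus exactly once.\<close>

definition rr :: "nat list \<Rightarrow> nat \<Rightarrow> nat \<Rightarrow> nat \<Rightarrow> bool" where
  "rr x a b h \<longleftrightarrow> rules.rl (qx x) (sx x) (Rx x) (mx x) (lits x) a b h \<or>
     rules.rl (qx x) (sx x) (Rx x) (mx x) (lits x) b a h"

definition cq :: "nat list \<Rightarrow> nat \<Rightarrow> nat \<Rightarrow> nat \<Rightarrow> bool" where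
  "cq x a b h \<longleftrightarrow> a \<le> b \<and> h \<noteq> a \<and> h \<noteq> b \<and> ((b < Gx x \<and> h < Gx x \<and> rr x a b h) \<or>
     (a = b \<and> a < Gx x \<and> h = Gx x) \<or> (a = b \<and> Gx x < a \<and> a \<le> Gx x + tx x \<and> h < Rx x * Rx x))"

lemma pcb_cq:
  assumes "pc d A" "pc d B" "pc d C"
  shows "pcb d (\<lambda>x e. cq x (A x e) (B x e) (C x e))"
  unfolding cq_def rr_def
  by (intro pcb_conj pcb_disj pcb_not pcb_le pcb_less pcb_eq pcb_rl pc_qx pc_sx pc_Bx pc_Rx pc_mx tensor_x sx_qx
      pc_Gx pc_tx pc_add pc_mult assms)

end

section \<open>Listing the clauses\<close>

definition ia :: "nat \<Rightarrow> nat \<Rightarrow> nat" where "ia n i = i div n div n"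
definition ib :: "nat \<Rightarrow> nat \<Rightarrow> nat" where "ib n i = i div n mod n"
definition ih :: "nat \<Rightarrow> nat \<Rightarrow> nat" where "ih n i = i mod n"

text \<open>
  The index \<open>i div 4\<close> runs through all triples \<open>(a, b, h)\<close> below \<open>n\<close>; for those with \<open>Q a b h\<close>, the four
  indices \<open>i\<close> belonging to it produce the literals of \<open>a, b \<longrightarrow> h\<close> and the end of the clause. The second
  literal is omitted if \<open>a = b\<close>.
\<close>

definition kapg :: "nat \<Rightarrow> (nat \<Rightarrow> nat \<Rightarrow> nat \<Rightarrow> bool) \<Rightarrow> nat \<Rightarrow> nat" where
  "kapg n Q i = (if Q (ia n (i div 4)) (ib n (i div 4)) (ih n (i div 4)) then
     (if i mod 4 = 0 then 4 else if i mod 4 = 1 then if ia n (i div 4) < ib n (i div 4) then 4 else 0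
      else if i mod 4 = 2 then 3 else 5) else 0)"

definition numg :: "nat \<Rightarrow> (nat \<Rightarrow> nat \<Rightarrow> nat \<Rightarrow> bool) \<Rightarrow> nat \<Rightarrow> nat" where
  "numg n Q i = (if Q (ia n (i div 4)) (ib n (i div 4)) (ih n (i div 4)) then
     (if i mod 4 = 0 then ia n (i div 4) else if i mod 4 = 1 then
        if ia n (i div 4) < ib n (i div 4) then ib n (i div 4) else 0
      else if i mod 4 = 2 then ih n (i div 4) else 0) else 0)"

definition cll :: "nat \<Rightarrow> nat \<Rightarrow> lit list" where
  "cll n i = (if ia n i < ib n i then [Neg (ia n i), Neg (ib n i), Pos (ih n i)] else [Neg (ia n i), Pos (ih n i)])"

lemma stream_clauses:
  "stream (kapg n Q) (numg n Q) (4 * N) =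
    encode_cnf (map (cll n) (filter (\<lambda>i. Q (ia n i) (ib n i) (ih n i)) [0..<N]))"
proof (induction N)
  case 0
  show ?case by (simp add: stream_def encode_cnf_def)
next
  case (Suc N)
  have u: "[0..<4 * Suc N] = [0..<4 * N] @ [4 * N, Suc (4 * N), Suc (Suc (4 * N)), Suc (Suc (Suc (4 * N)))]"
  proof -
    have "4 * Suc N = Suc (Suc (Suc (Suc (4 * N))))" by simp
    then show ?thesis by (simp only: upt_Suc) simp
  qed
  have d: "4 * N div 4 = N" "Suc (4 * N) div 4 = N" "Suc (Suc (4 * N)) div 4 = N" "Suc (Suc (Suc (4 * N))) div 4 = N"
    "4 * N mod 4 = 0" "Suc (4 * N) mod 4 = 1" "Suc (Suc (4 * N)) mod 4 = 2" "Suc (Suc (Suc (4 * N))) mod 4 = 3"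
    by presburger+
  have b0: "binary 0 = []" by (simp add: binary.simps)
  have "stream (kapg n Q) (numg n Q) (4 * Suc N) = stream (kapg n Q) (numg n Q) (4 * N) @
    (if Q (ia n N) (ib n N) (ih n N) then encode_clause (cll n N) else [])"
    unfolding stream_def u map_append concat_append list.map concat.simps
    by (simp add: kapg_def numg_def d letter_def encode_clause_def cll_def b0)
  then show ?case unfolding Suc by (simp add: encode_cnf_def)
qed

lemma index_triple:
  assumes "a < n" "b < n" "h < (n::nat)"
  shows "\<exists>i<n ^ 3. ia n i = a \<and> ib n i = b \<and> ih n i = h"
proof -
  let ?i = "(a * n + b) * n + h"
  have m: "x * n + y < z * n" if "x < z" "y < n" for x y z :: nat
  proof -
    have "Suc x * n \<le> z * n" by (rule mult_le_mono1) (use that in simp)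
    then show ?thesis using that(2) unfolding mult_Suc by linarith
  qed
  have "?i < n * n * n" by (intro m assms)
  then have "?i < n ^ 3" by (simp add: power3_eq_cube)
  moreover have "?i div n = a * n + b" "?i mod n = h" using assms(3) by simp_all
  moreover have "(a * n + b) div n = a" "(a * n + b) mod n = b" using assms(2) by simp_all
  ultimately show ?thesis unfolding ia_def ib_def ih_def by (intro exI[of _ ?i]) simp
qed

lemma index_inj:
  assumes "ia n i = ia n j" "ib n i = ib n j" "ih n i = ih n j"
  shows "i = j"
  using assms unfolding ia_def ib_def ih_def by (metis div_mult_mod_eq)

lemma clause_inj:
  assumes "{Neg a, Neg b, Pos h} = {Neg a', Neg b', Pos h'}" "a \<le> b" "a' \<le> (b'::nat)"
  shows "a = a' \<and> b = b' \<and> h = h'"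
proof -
  have "Pos v \<in> {Neg a, Neg b, Pos h} \<longleftrightarrow> v = h" "Pos v \<in> {Neg a', Neg b', Pos h'} \<longleftrightarrow> v = h'"
    "Neg v \<in> {Neg a, Neg b, Pos h} \<longleftrightarrow> v = a \<or> v = b" "Neg v \<in> {Neg a', Neg b', Pos h'} \<longleftrightarrow> v = a' \<or> v = b'" for v by auto
  then have "v = h \<longleftrightarrow> v = h'" "v = a \<or> v = b \<longleftrightarrow> v = a' \<or> v = b'" for v using assms(1) by simp_all
  then have "h = h'" "a = a' \<or> a = b'" "b = a' \<or> b = b'" "a' = a \<or> a' = b" "b' = a \<or> b' = b" by blast+
  then show ?thesis using assms(2,3) by auto
qed

lemma clauses_list:
  assumes Q: "\<And>a b h. Q a b h \<Longrightarrow> a \<le> b \<and> a < n \<and> b < n \<and> h < n"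
  shows "lists_cnf (map (cll n) (filter (\<lambda>i. Q (ia n i) (ib n i) (ih n i)) [0..<n ^ 3])) {{Neg a, Neg b, Pos h} | a b h. Q a b h}"
proof -
  let ?F = "filter (\<lambda>i. Q (ia n i) (ib n i) (ih n i)) [0..<n ^ 3]"
  have st: "set (cll n i) = {Neg (ia n i), Neg (ib n i), Pos (ih n i)}" if "i \<in> set ?F" for i
  proof -
    have "ia n i \<le> ib n i" using that Q by auto
    then show ?thesis by (auto simp: cll_def)
  qed
  have "distinct (cll n i)" for i by (simp add: cll_def)
  moreover have "inj_on (\<lambda>i. set (cll n i)) (set ?F)"
  proof (rule inj_onI)
    fix i j assume ij: "i \<in> set ?F" "j \<in> set ?F" "set (cll n i) = set (cll n j)"
    have "ia n i \<le> ib n i" "ia n j \<le> ib n j" using ij(1,2) Q by auto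
    from clause_inj[OF ij(3)[unfolded st[OF ij(1)] st[OF ij(2)]] this] have "ia n i = ia n j" "ib n i = ib n j" "ih n i = ih n j" by blast+
    then show "i = j" by (rule index_inj)
  qed
  then have "distinct (map set (map (cll n) ?F))" by (simp add: distinct_map comp_def)
  moreover have "set (map set (map (cll n) ?F)) = {{Neg a, Neg b, Pos h} | a b h. Q a b h}"
  proof (intro set_eqI iffI)
    fix c assume "c \<in> set (map set (map (cll n) ?F))"
    then obtain i where i: "i \<in> set ?F" "c = set (cll n i)" by auto
    then show "c \<in> {{Neg a, Neg b, Pos h} | a b h. Q a b h}" using st[OF i(1)] by auto
  next
    fix c assume "c \<in> {{Neg a, Neg b, Pos h} | a b h. Q a b h}"
    then obtain a b h where c: "c = {Neg a, Neg b, Pos h}" "Q a b h" by blast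
    obtain i where i: "i < n ^ 3" "ia n i = a" "ib n i = b" "ih n i = h"
      using index_triple[of a n b h] Q[OF c(2)] by blast
    then have "i \<in> set ?F" using c by simp
    moreover from st[OF this] have "c = set (cll n i)" using c i by simp
    ultimately show "c \<in> set (map set (map (cll n) ?F))" by (simp only: set_map image_image) blast
  qed
  ultimately show ?thesis unfolding lists_cnf_def by (auto simp del: map_map)
qed

lemma base_zed_sorted:
  assumes sy: "\<And>a b h. r a b h \<Longrightarrow> r b a h" and U: "U \<subseteq> {..<G}"
  shows "base G r \<union> zed G t U = {{Neg a, Neg b, Pos h} | a b h. a \<le> b \<and> h \<noteq> a \<and> h \<noteq> b \<and>
    ((b < G \<and> h < G \<and> r a b h) \<or> (a = b \<and> a < G \<and> h = G) \<or> (a = b \<and> G < a \<and> a \<le> G + t \<and> h \<in> U))}" (is "_ = ?R")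
proof (intro set_eqI iffI)
  fix c assume "c \<in> base G r \<union> zed G t U"
  then consider a b h where "c = {Neg a, Neg b, Pos h}" "a < G" "b < G" "h < G" "h \<noteq> a" "h \<noteq> b" "r a b h"
    | a where "c = {Neg a, Pos G}" "a < G" | z u where "c = {Neg z, Pos u}" "G < z" "z \<le> G + t" "u \<in> U"
    unfolding base_def zed_def by blast
  then show "c \<in> ?R"
  proof cases
    case (1 a b h)
    show ?thesis
    proof (cases "a \<le> b")
      case True
      with 1 show ?thesis by blast
    next
      case False
      have "c = {Neg b, Neg a, Pos h}" using 1(1) by blast
      moreover have "b \<le> a" using False by simp
      ultimately show ?thesis using 1 sy by blast
    qed
  next
    case (2 a)
    have "c = {Neg a, Neg a, Pos G}" using 2(1) by blast
    with 2 show ?thesis by blast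
  next
    case (3 z u)
    have "c = {Neg z, Neg z, Pos u}" using 3(1) by blast
    moreover have "u \<noteq> z" using 3 U by auto
    ultimately show ?thesis using 3 by blast
  qed
next
  fix c assume "c \<in> ?R"
  then obtain a b h where c: "c = {Neg a, Neg b, Pos h}" "a \<le> b" "h \<noteq> a" "h \<noteq> b"
    and d: "(b < G \<and> h < G \<and> r a b h) \<or> (a = b \<and> a < G \<and> h = G) \<or> (a = b \<and> G < a \<and> a \<le> G + t \<and> h \<in> U)" by blast
  from d show "c \<in> base G r \<union> zed G t U"
  proof (elim disjE conjE)
    assume *: "b < G" "h < G" "r a b h"
    then have "a < G" using c by simp
    then show ?thesis using * c unfolding base_def by blast
  next
    assume *: "a = b" "a < G" "h = G"
    then have "c = {Neg a, Pos G}" using c by blast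
    then show ?thesis using * unfolding base_def by blast
  next
    assume *: "a = b" "G < a" "a \<le> G + t" "h \<in> U"
    then have "c = {Neg a, Pos h}" using c by blast
    then show ?thesis using * unfolding zed_def by blast
  qed
qed

section \<open>Correctness of the reduction\<close>

context enc
begin

abbreviation Ux :: "nat list \<Rightarrow> nat set" where "Ux x \<equiv> {..<Rx x * Rx x}"
abbreviation hx :: "nat list \<Rightarrow> cnf" where "hx x \<equiv> base (Gx x) (rr x) \<union> zed (Gx x) (tx x) (Ux x)"

lemma Rx_props: "10 \<le> Rx x" "qx x ^ sx x < Rx x" "qx x \<le> qx x ^ sx x" "Rx x * Rx x \<le> Gx x" "10 \<le> Gx x"
proof -
  show R: "10 \<le> Rx x" "qx x ^ sx x < Rx x" by (simp_all add: Rx_def)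
  show "qx x \<le> qx x ^ sx x" using sx_qx[of x] by (intro self_le_power) auto
  have "Rx x ^ 2 \<le> Rx x ^ 8" by (rule power_increasing) (use R in auto)
  then show "Rx x * Rx x \<le> Gx x" by (simp add: Gx_def power2_eq_square)
  moreover have "10 * 1 \<le> Rx x * Rx x" by (rule mult_le_mono) (use R in auto)
  ultimately show "10 \<le> Gx x" by linarith
qed

lemma Ux_props: "Ux x \<subseteq> {..<Gx x}" "0 \<in> Ux x"
proof -
  show "Ux x \<subseteq> {..<Gx x}" using Rx_props(4)[of x] by auto
  have "0 < Rx x" using Rx_props(1)[of x] by simp
  then show "0 \<in> Ux x" by simp
qed

lemma closedX_closed:
  "closedX (Gx x) (rr x) X \<longleftrightarrow> rules.closed (qx x) (sx x) (Rx x) (mx x) (lits x) X"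
proof -
  interpret rules "qx x" "sx x" "Rx x" "mx x" "lits x" by (rule rules.intro[OF tensor_x])
  show ?thesis unfolding closedX_def closed_def rr_def Gx_def by blast
qed

lemma encodes_hx: "encodes (stream (kapg (nx x) (cq x)) (numg (nx x) (cq x)) (4 * nx x ^ 3)) (nx x) (hx x)"
proof -
  have "lists_cnf (map (cll (nx x)) (filter (\<lambda>i. cq x (ia (nx x) i) (ib (nx x) i) (ih (nx x) i)) [0..<nx x ^ 3]))
    {{Neg a, Neg b, Pos h} | a b h. cq x a b h}"
    by (rule clauses_list) (use Rx_props(4)[of x] in \<open>auto simp: cq_def nx_def\<close>)
  moreover have "hx x = {{Neg a, Neg b, Pos h} | a b h. cq x a b h}"
    unfolding cq_def by (subst base_zed_sorted[OF _ Ux_props(1)]) (auto simp: rr_def)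
  moreover have "vars (hx x) = {..<nx x}" unfolding nx_def by (rule vars_base_zed[OF Ux_props])
  ultimately show ?thesis unfolding encodes_def stream_clauses by auto
qed

text \<open>There are at most \<open>3 * G ^ 6\<close> clauses and more than \<open>G ^ 4\<close>
  variables, whence the exponent \<open>1 + 1 / 2\<close>.\<close>

lemma horn_inputs_hx: "horn_inputs 3 (1 / 2) (nx x) (hx x)"
proof -
  let ?G = "Gx x"
  have "card (hx x) \<le> card (base ?G (rr x)) + card (zed ?G (tx x) (Ux x))" by (rule card_Un_le)
  also have "\<dots> \<le> (?G ^ 3 + ?G) + tx x * (Rx x * Rx x)"
    using card_base[of ?G "rr x"] card_zed[of "Ux x" ?G "tx x"] by simp
  also have "tx x * (Rx x * Rx x) \<le> ?G ^ 4 * ?G" unfolding tx_def by (rule mult_le_mono2[OF Rx_props(4)])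
  finally have 1: "card (hx x) \<le> ?G ^ 3 + ?G + ?G ^ 5" by (simp add: eval_nat_numeral)
  have G1: "1 \<le> ?G" using Rx_props(5)[of x] by simp
  have "?G ^ 3 \<le> ?G ^ 6" "?G ^ 1 \<le> ?G ^ 6" "?G ^ 5 \<le> ?G ^ 6" by (rule power_increasing; use G1 in simp)+
  then have "card (hx x) \<le> 3 * ?G ^ 6" using 1 by simp
  then have "real (card (hx x)) \<le> real (3 * ?G ^ 6)" by (simp only: of_nat_le_iff)
  then have 2: "real (card (hx x)) \<le> 3 * real ?G ^ 6" by simp
  have g0: "0 < real ?G" using G1 by simp
  have "real ?G ^ 6 = (real ?G powr 4) powr (3 / 2)"
    unfolding powr_powr using powr_realpow[OF g0, of 6] by simp
  also have "\<dots> = (real ?G ^ 4) powr (3 / 2)" using powr_realpow[OF g0, of 4] by simp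
  also have "\<dots> \<le> real (nx x) powr (3 / 2)" by (rule powr_mono2) (auto simp: nx_def tx_def)
  finally have "real (card (hx x)) \<le> 3 * real (nx x) powr (1 + 1 / 2)" using 2 by simp
  then show ?thesis unfolding horn_inputs_def using horn_form[OF Ux_props(1)] by blast
qed

text \<open>The table of the interpolating function, one entry for each of the \<open>B\<close>
  points, generates all table variables. Its clauses cost at most \<open>2 * t * B\<close> literals,
  and all others together at most \<open>t * B\<close>, because \<open>t = G ^ 4\<close>.\<close>

lemma hx_sat:
  assumes \<Phi>: "k_cnf 3 \<Phi>" "vars \<Phi> = {..<N}" "lists_cnf cs \<Phi>" and x: "x = encode_cnf cs" and sat: "satisfiable \<Phi>"
    and P: "P = pure_horn_cnf \<or> P = pure_horn_3cnf" "opt = min_clauses P \<or> opt = min_literals P"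
  shows "opt (nx x) (cnf_fun (hx x)) \<le> 3 * (tx x * qx x ^ sx x)"
proof -
  interpret rules "qx x" "sx x" "Rx x" "mx x" "lits x" by (rule rules.intro[OF tensor_x])
  let ?B = "qx x ^ sx x" and ?R = "Rx x" and ?G = "Gx x"
  obtain \<alpha> where \<alpha>: "\<And>k. k < length cs \<Longrightarrow> \<exists>j bt. lits x k j bt \<and> (bt = 1 \<longleftrightarrow> \<alpha> j)"
    using sat unfolding sat_lits[OF \<Phi>(3)] x by blast
  have "sx x ^ sx x \<le> ?B" by (rule power_mono[OF sx_qx(3)]) simp
  then have lenR: "length x \<le> ?B" using sx_props(2)[of x] by simp
  have m: "mx x = length cs" unfolding mx_def cnum_count[OF order_refl] using count_encode[of cs] x by simp
  have "length cs \<le> length x" using count_le_length[of x 5] count_encode[of cs] x by simp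
  then have mR: "mx x < ?R" using lenR Rx_props(2)[of x] m by simp
  obtain F where F: "\<And>a. F a < qx x" "\<And>a t. t < sx x \<Longrightarrow> \<exists>c<?B. \<forall>i<qx x. F (up (qx x) (sx x) a t i) = ev (qx x) (sx x) c i"
    "\<And>j b. j < sx x ^ sx x \<Longrightarrow> \<forall>t<sx x. dig (qx x) b t = dig (sx x) j t \<Longrightarrow> F b = of_bool (\<alpha> j)"
    using interpolation[OF qx_props(1) sx_qx(1) sx_qx(3), of x \<alpha>] by blast
  have cl: "\<exists>j<sx x ^ sx x. lits x k j (of_bool (\<alpha> j))" if k: "k < mx x" for k
  proof -
    obtain j bt where j: "lits x k j bt" "bt = 1 \<longleftrightarrow> \<alpha> j" using \<alpha>[of k] k m by auto
    have bt: "bt \<le> 1" "(if bt = 1 then Pos j else Neg j) \<in> set (cs ! k)" using j(1) unfolding x lits_encode by auto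
    have "set (cs ! k) \<in> \<Phi>" using \<Phi>(3) k m by (auto simp: lists_cnf_def)
    then have "var (if bt = 1 then Pos j else Neg j) \<in> vars \<Phi>" using bt(2) unfolding vars_def by blast
    then have "j < N" using \<Phi>(2) by (auto split: if_splits)
    moreover have "N \<le> length x" using encode_length(1)[OF \<Phi>] x by simp
    ultimately have "j < sx x ^ sx x" using sx_props(2)[of x] by linarith
    moreover have "bt = of_bool (\<alpha> j)" using bt(1) j(2) by (cases "\<alpha> j") auto
    ultimately show ?thesis using j(1) by blast
  qed
  let ?S = "(\<lambda>a. a + ?R * F a) ` {..<?B}"
  have S: "?S \<subseteq> Ux x"
  proof
    fix u assume "u \<in> ?S"
    then obtain a where a: "a < ?B" "u = a + ?R * F a" by auto
    have "Suc (F a) \<le> ?R" using F(1)[of a] Rx_props(2,3)[of x] by linarith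
    then have "?R * Suc (F a) \<le> ?R * ?R" by (rule mult_le_mono2)
    then show "u \<in> Ux x" using a Rx_props(2)[of x] by simp
  qed
  have gen: "Ux x \<subseteq> X" if X: "closedX ?G (rr x) X" "?S \<subseteq> X" for X
  proof
    fix u assume "u \<in> Ux x"
    then have u: "u < ?R * ?R" by simp
    show "u \<in> X"
      by (rule closed_complete[OF X(1)[unfolded closedX_closed] _ mR sx_qx(3) F cl _ u])
        (use X(2) in \<open>auto simp: Rx_def\<close>)
  qed
  have "opt (nx x) = min_clauses P (?G + 1 + tx x) \<or> opt (nx x) = min_literals P (?G + 1 + tx x)"
    using P(2) by (auto simp: nx_def)
  from horn_gap(2)[OF Ux_props P(1) this S gen]
  have "opt (nx x) (cnf_fun (hx x)) \<le> 3 * (?G ^ 3 + ?G) + 2 * (tx x * card ?S)" by simp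
  also have "card ?S \<le> ?B" using card_image_le[of "{..<?B}" "\<lambda>a. a + ?R * F a"] by simp
  also have "3 * (?G ^ 3 + ?G) \<le> tx x * ?B"
  proof -
    have "?G ^ 1 \<le> ?G ^ 3" by (rule power_increasing) (use Rx_props(5)[of x] in auto)
    then have "3 * (?G ^ 3 + ?G) \<le> 10 * ?G ^ 3" by simp
    also have "\<dots> \<le> ?G * ?G ^ 3" by (rule mult_le_mono1[OF Rx_props(5)])
    also have "\<dots> = tx x * 1" by (simp add: tx_def eval_nat_numeral)
    also have "\<dots> \<le> tx x * ?B" by (rule mult_le_mono2) (use sx_qx[of x] in auto)
    finally show ?thesis .
  qed
  finally show ?thesis by simp
qed

text \<open>Each atom of \<open>H\<close> yields one entry of the set \<open>?S\<close>: itself if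
  it belongs to the table, and otherwise the entry that its copy concludes. Being small, this set
  cannot pass the verification, so \<open>closed_sem\<close> gives a closed set whose table part is
  \<open>?S\<close>; it misses an entry because there are \<open>R * R\<close> of them.\<close>

lemma hx_unsat:
  assumes \<Phi>: "lists_cnf cs \<Phi>" and x: "x = encode_cnf cs" and unsat: "\<not> satisfiable \<Phi>"
    and P: "P = pure_horn_cnf \<or> P = pure_horn_3cnf" "opt = min_clauses P \<or> opt = min_literals P"
  shows "tx x * Suc (10 * sx x * qx x ^ sx x) \<le> opt (nx x) (cnf_fun (hx x))"
proof -
  have s100: "100 \<le> sx x" using s0 sx_props(1)[of x] by simp
  interpret rules "qx x" "sx x" "Rx x" "mx x" "lits x" by (rule rules.intro[OF tensor_x])
  let ?B = "qx x ^ sx x" and ?R = "Rx x" and ?G = "Gx x"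
  have m: "mx x = length cs" unfolding mx_def cnum_count[OF order_refl] using count_encode[of cs] x by simp
  have KR: "10 * sx x * ?B < ?R * ?R"
  proof -
    have "10 * sx x \<le> sx x * sx x" using s100 by (intro mult_le_mono1) simp
    also have "\<dots> = sx x ^ 2" by (simp add: power2_eq_square)
    also have "\<dots> \<le> sx x ^ 9" by (rule power_increasing) (use s100 in auto)
    finally have "10 * sx x \<le> ?R" using qx_props(2)[of x] Rx_props(2,3)[of x] by linarith
    then have "10 * sx x * ?B \<le> ?R * ?B" by (rule mult_le_mono1)
    also have "\<dots> < ?R * ?R" using Rx_props(1,2)[of x] by (intro mult_strict_left_mono) auto
    finally show ?thesis .
  qed
  have hard: "\<exists>X. closedX ?G (rr x) X \<and> H \<subseteq> X \<and> \<not> Ux x \<subseteq> X" if H: "H \<subseteq> {..<?G}" "card H \<le> 10 * sx x * ?B" for H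
  proof -
    let ?f = "\<lambda>w. if w < ?R * ?R then (dig ?R w 0, dig ?R w 1) else (dig ?R w 5, dig ?R w 6)"
    let ?S = "?f ` H"
    have fH: "finite H" by (rule finite_subset[OF H(1)]) simp
    have cS: "card ?S \<le> 10 * sx x * ?B" using card_image_le[OF fH, of ?f] H(2) by linarith
    have "\<not> AA ?S (lits x) (mx x) (?B - 1)"
    proof
      assume "AA ?S (lits x) (mx x) (?B - 1)"
      from gap_sound[OF this finite_imageI[OF fH] cS s100 qx_props(2)] have "satisfiable \<Phi>"
        unfolding sat_lits[OF \<Phi>] m unfolding x by blast
      then show False using unsat by contradiction
    qed
    from closed_sem[OF this] have X: "closed {w. if w < ?R * ?R then (dig ?R w 0, dig ?R w 1) \<in> ?S
     else (dig ?R w 5, dig ?R w 6) \<in> ?S \<or> sem ?S w}" (is "closed ?X") .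
    have "H \<subseteq> ?X"
    proof
      fix w assume "w \<in> H"
      then have "?f w \<in> ?S" by (rule imageI)
      then show "w \<in> ?X" by (cases "w < ?R * ?R") (simp_all only: if_True if_False mem_Collect_eq simp_thms)
    qed
    moreover have "\<not> Ux x \<subseteq> ?X"
    proof
      assume U: "Ux x \<subseteq> ?X"
      have in_S: "(\<lambda>w. (dig ?R w 0, dig ?R w 1)) ` Ux x \<subseteq> ?S"
      proof
        fix p assume "p \<in> (\<lambda>w. (dig ?R w 0, dig ?R w 1)) ` Ux x"
        then obtain w where w: "w < ?R * ?R" "p = (dig ?R w 0, dig ?R w 1)" by auto
        then have "w \<in> ?X" using U by (meson lessThan_iff subsetD)
        then show "p \<in> ?S" unfolding w(2) mem_Collect_eq if_P[OF w(1)] .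
      qed
      have "inj_on (\<lambda>w. (dig ?R w 0, dig ?R w 1)) (Ux x)"
      proof (rule inj_onI)
        fix w w' assume w: "w \<in> Ux x" "w' \<in> Ux x" "(dig ?R w 0, dig ?R w 1) = (dig ?R w' 0, dig ?R w' 1)"
        have "w div ?R < ?R" "w' div ?R < ?R" using w(1,2) by (auto simp: less_mult_imp_div_less)
        then have "w mod ?R = w' mod ?R" "w div ?R = w' div ?R" using w(3) by (auto simp: dig_def)
        then show "w = w'" by (metis div_mult_mod_eq)
      qed
      then have "?R * ?R = card ((\<lambda>w. (dig ?R w 0, dig ?R w 1)) ` Ux x)" by (simp add: card_image)
      also have "\<dots> \<le> card ?S" by (rule card_mono[OF finite_imageI[OF fH] in_S])
      finally show False using cS KR by linarith
    qed
    ultimately show ?thesis using X[folded closedX_closed] by blast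
  qed
  have "opt (nx x) = min_clauses P (?G + 1 + tx x) \<or> opt (nx x) = min_literals P (?G + 1 + tx x)"
    using P(2) by (auto simp: nx_def)
  from horn_gap(1)[OF Ux_props P(1) this hard] show ?thesis .
qed

section \<open>From an approximate optimum to satisfiability\<close>

lemma length_binary_power:
  "v < 2 ^ length (binary v)" "v \<noteq> 0 \<Longrightarrow> 2 ^ length (binary v) \<le> 2 * v"
proof -
  let ?L = "length (binary v)"
  have "v div 2 ^ ?L = 0" using div_binary by simp
  then show "v < 2 ^ ?L" by (simp add: div_eq_0_iff)
  assume v: "v \<noteq> 0"
  then have L: "?L \<noteq> 0" by (simp add: binary.simps)
  then have "v div 2 ^ (?L - 1) \<noteq> 0" unfolding div_binary using L by linarith
  then have "2 ^ (?L - 1) \<le> v" by (simp add: div_eq_0_iff)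
  moreover have "(2::nat) ^ ?L = 2 * 2 ^ (?L - 1)" using L by (simp flip: power_Suc)
  ultimately show "2 ^ ?L \<le> 2 * v" by simp
qed

text \<open>The power \<open>2 ^ length (binary v)\<close> exceeds \<open>v\<close>, but not
  \<open>2 * v\<close> unless \<open>v = 0\<close>. With \<open>B\<close> for \<open>q ^ s\<close>,
  satisfiable inputs have \<open>v \<le> 3 * s * t * B\<close>, and twice this is below the
  threshold \<open>10 * s * t * B\<close>; for unsatisfiable inputs the optimum, and hence
  \<open>v\<close>, is already above the threshold.\<close>

lemma decide:
  assumes \<Phi>: "k_cnf 3 \<Phi>" "encodes x N \<Phi>"
    and P: "P = pure_horn_cnf \<or> P = pure_horn_3cnf" "opt = min_clauses P \<or> opt = min_literals P"
    and f: "f (nx x) \<le> real (sx x)"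
    and v: "opt (nx x) (cnf_fun (hx x)) \<le> v" "real v \<le> f (nx x) * real (opt (nx x) (cnf_fun (hx x)))"
  shows "Wx x div 2 ^ length (binary v) \<noteq> 0 \<longleftrightarrow> satisfiable \<Phi>"
proof -
  obtain cs where cs: "vars \<Phi> = {..<N}" "lists_cnf cs \<Phi>" "x = encode_cnf cs" using \<Phi>(2) unfolding encodes_def by blast
  let ?B = "qx x ^ sx x" and ?o = "opt (nx x) (cnf_fun (hx x))"
  have t0: "0 < tx x" using Rx_props(5)[of x] by (simp add: tx_def)
  have B0: "0 < ?B" using sx_qx[of x] by simp
  show ?thesis
  proof (cases "satisfiable \<Phi>")
    case True
    have o: "?o \<le> 3 * (tx x * ?B)" by (rule hx_sat[OF \<Phi>(1) cs True P])
    have "real v \<le> real (sx x) * real ?o" using v(2) mult_right_mono[OF f, of "real ?o"] by simp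
    also have "\<dots> = real (sx x * ?o)" by simp
    finally have "v \<le> sx x * ?o" by (simp only: of_nat_le_iff)
    also have "\<dots> \<le> sx x * (3 * (tx x * ?B))" by (rule mult_le_mono2[OF o])
    finally have vle: "v \<le> 3 * (sx x * ?B * tx x)" by (simp add: algebra_simps)
    have W: "Wx x = 10 * (sx x * ?B * tx x)" by (simp add: Wx_def)
    have W1: "1 \<le> Wx x" unfolding W using t0 B0 sx_qx(1)[of x] by simp
    have "2 ^ length (binary v) \<le> Wx x"
    proof (cases "v = 0")
      case True
      then show ?thesis using W1 by (simp add: binary.simps)
    next
      case False
      then show ?thesis using length_binary_power(2)[OF False] vle W by linarith
    qed
    then show ?thesis using True by (simp add: div_eq_0_iff not_less)
  next
    case False
    have "Wx x < tx x * Suc (10 * sx x * ?B)" using t0 by (simp add: Wx_def algebra_simps)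
    also have "\<dots> \<le> ?o" by (rule hx_unsat[OF cs(2,3) False P])
    also have "\<dots> \<le> v" by (rule v(1))
    also have "\<dots> < 2 ^ length (binary v)" by (rule length_binary_power(1))
    finally show ?thesis using False by simp
  qed
qed

lemma pcb_kap: "i < d \<Longrightarrow> pc d (\<lambda>x e. kapg (nx x) (cq x) (e i))"
  unfolding kapg_def ia_def ib_def ih_def
  by (intro pc_if pcb_cq pcb_eq pcb_less pc_div pc_mod pc_nx pc_const pc_var) auto

lemma pcb_num: "i < d \<Longrightarrow> pc d (\<lambda>x e. numg (nx x) (cq x) (e i))"
  unfolding numg_def ia_def ib_def ih_def
  by (intro pc_if pcb_cq pcb_eq pcb_less pc_div pc_mod pc_nx pc_const pc_var) auto

lemma sat_machine:
  assumes M: "turing_machine M" and P: "P = pure_horn_cnf \<or> P = pure_horn_3cnf" "opt = min_clauses P \<or> opt = min_literals P"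
    and f: "\<And>x. f (nx x) \<le> real (sx x)"
    and appr: "\<And>n \<Phi> x. horn_inputs 3 (1 / 2) n \<Phi> \<Longrightarrow> encodes x n \<Phi> \<Longrightarrow>
      \<exists>v. opt n (cnf_fun \<Phi>) \<le> v \<and> real v \<le> f n * real (opt n (cnf_fun \<Phi>)) \<and> outputs_within M x (binary v) (T n)"
  shows "\<exists>M' c. turing_machine M' \<and> (\<forall>\<Phi> N x. k_cnf 3 \<Phi> \<longrightarrow> encodes x N \<Phi> \<longrightarrow>
    outputs_within M' x (binary (of_bool (satisfiable \<Phi>))) ((length x + c) ^ c + 5 * T (nx x)))"
proof -
  have le: "kapg (nx x) (cq x) i \<le> 5" for x i by (simp add: kapg_def)
  obtain M' c where M': "turing_machine M'" and run: "\<And>x y t. set x \<subseteq> {1..5} \<Longrightarrow>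
      outputs_within M (stream (kapg (nx x) (cq x)) (numg (nx x) (cq x)) (4 * nx x ^ 3)) y t \<Longrightarrow>
      outputs_within M' x (binary (of_bool (Wx x div 2 ^ length y \<noteq> 0))) ((length x + c) ^ c + 5 * t)"
    using reduction_machine[where kap = "\<lambda>x. kapg (nx x) (cq x)" and num = "\<lambda>x. numg (nx x) (cq x)",
        OF M pc_mult[OF pc_const[of _ 4] pc_power[OF pc_nx, of _ 3]] pc_Wx pcb_kap pcb_num le] by blast
  have "outputs_within M' x (binary (of_bool (satisfiable \<Phi>))) ((length x + c) ^ c + 5 * T (nx x))"
    if \<Phi>: "k_cnf 3 \<Phi>" "encodes x N \<Phi>" for \<Phi> N x
  proof -
    obtain v where v: "opt (nx x) (cnf_fun (hx x)) \<le> v" "real v \<le> f (nx x) * real (opt (nx x) (cnf_fun (hx x)))"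
      "outputs_within M (stream (kapg (nx x) (cq x)) (numg (nx x) (cq x)) (4 * nx x ^ 3)) (binary v) (T (nx x))"
      using appr[OF horn_inputs_hx encodes_hx] by blast
    have "set x \<subseteq> {1..5}" using \<Phi>(2) encode_cnf_set unfolding encodes_def by blast
    from run[OF this v(3)] show ?thesis unfolding decide[where f = f, OF \<Phi> P f v(1,2)] .
  qed
  then show ?thesis using M' by blast
qed

end

section \<open>Running times\<close>

text \<open>For every \<open>b > 0\<close> one has \<open>y \<le> b * (y * y) + 1 / b\<close>, since
  a square is nonnegative; thus a square root is negligible against any linear function.\<close>

lemma exp_sqrt_growth:
  fixes E d :: real
  assumes "0 < d" "0 \<le> E"
  shows "(\<lambda>n::nat. exp (sqrt (real n + E))) \<in> O(\<lambda>n. 2 powr (d * real n))"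
proof -
  define b where "b = d * ln 2"
  have b: "0 < b" using assms by (simp add: b_def)
  have "exp (sqrt (real n + E)) \<le> exp (b * E + 1 / b) * 2 powr (d * real n)" for n
  proof -
    define y where "y = sqrt (real n + E)"
    have y: "y * y = real n + E" using assms(2) by (simp add: y_def)
    have "0 \<le> (b * y - 1) * (b * y - 1) + b * y" using b assms(2) by (simp add: y_def)
    then have "b * y \<le> b * (b * (y * y) + 1 / b)" using b by (simp add: algebra_simps)
    then have "y \<le> b * (y * y) + 1 / b" using b by (simp only: mult_le_cancel_left_pos)
    then have "exp y \<le> exp (b * E + 1 / b + b * real n)" unfolding y by (simp add: algebra_simps)
    also have "\<dots> = exp (b * E + 1 / b) * 2 powr (d * real n)"
      unfolding exp_add[of "b * E + 1 / b"] by (simp add: powr_def b_def mult.commute mult.left_commute)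
    finally show ?thesis by (simp add: y_def)
  qed
  then show ?thesis by (intro bigoI[where c = "exp (b * E + 1 / b)"] always_eventually allI) simp
qed

text \<open>Obtained from \<open>z \<le> exp z\<close> for \<open>z = b * (n + E) / k\<close> by
  raising both sides to the power \<open>k\<close>.\<close>

lemma power_growth:
  fixes E d :: real
  assumes "0 < d" "0 \<le> E"
  shows "(\<lambda>n::nat. (real n + E) ^ k) \<in> O(\<lambda>n. 2 powr (d * real n))"
proof (cases "k = 0")
  case True
  have "1 \<le> 2 powr (d * real n)" for n using assms(1) by (simp add: ge_one_powr_ge_zero)
  then show ?thesis using True by (intro bigoI[where c = 1] always_eventually allI) simp
next
  case False
  define b where "b = d * ln 2"
  have b: "0 < b" using assms by (simp add: b_def)
  have "(real n + E) ^ k \<le> (k / b) ^ k * exp (b * E) * 2 powr (d * real n)" for n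
  proof -
    let ?z = "b * (real n + E) / k"
    have zk: "?z ^ k \<le> exp ?z ^ k"
    proof (rule power_mono)
      show "?z \<le> exp ?z" using exp_ge_add_one_self[of ?z] by linarith
      show "0 \<le> ?z" using b assms(2) by simp
    qed
    have "real k * ?z = b * (real n + E)" using False by simp
    then have kz: "real k * ?z = b * E + b * real n" by (simp only: distrib_left add.commute)
    have "exp ?z ^ k = exp (real k * ?z)" by (rule exp_of_nat_mult[symmetric])
    also have "\<dots> = exp (b * E) * exp (b * real n)" unfolding kz exp_add ..
    also have "exp (b * real n) = 2 powr (d * real n)" by (simp add: powr_def b_def mult.commute mult.left_commute)
    finally have ez: "exp ?z ^ k = exp (b * E) * 2 powr (d * real n)" .
    have "real n + E = k / b * ?z" using b False by simp
    from arg_cong[OF this, of "\<lambda>y. y ^ k"] have "(real n + E) ^ k = (k / b) ^ k * ?z ^ k"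
      unfolding power_mult_distrib[of "k / b" ?z] .
    also have "\<dots> \<le> (k / b) ^ k * exp ?z ^ k" by (rule mult_left_mono[OF zk]) (use b in simp)
    finally show ?thesis unfolding ez by (simp only: mult.assoc)
  qed
  then show ?thesis using assms(2) by (intro bigoI[where c = "(k / b) ^ k * exp (b * E)"] always_eventually allI) simp
qed



lemma pow_add_le:
  assumes "1 \<le> n"
  shows "a ^ n + c \<le> (a + c :: nat) ^ n"
  using assms
proof (induction n rule: dec_induct)
  case (step n)
  have "c \<le> c * (a + c) ^ n" by (cases "c = 0") auto
  moreover have "a ^ n \<le> (a + c) ^ n" by (rule power_mono) auto
  then have "a * a ^ n \<le> a * (a + c) ^ n" by (rule mult_le_mono2)
  ultimately have "a * a ^ n + c \<le> a * (a + c) ^ n + c * (a + c) ^ n" by linarith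
  then show ?case by (simp only: power_Suc distrib_right)
qed simp

text \<open>The product \<open>6 * 72 * 33\<close>: the input length is at most
  \<open>(N + 10) ^ 6\<close>, \<open>R\<close> is bounded by the power 72 of the length plus a
  constant, and the number of variables of the Horn formula is at most
  \<open>R ^ 33\<close>.\<close>

definition size_exp :: nat where "size_exp = 14256"

context enc
begin

lemma nx_le_R: "nx x \<le> Rx x ^ 33"
proof -
  let ?G = "Gx x"
  have G1: "1 \<le> ?G" using Rx_props(5)[of x] by simp
  have "?G ^ 1 \<le> ?G ^ 4" "?G ^ 0 \<le> ?G ^ 4" by (rule power_increasing; use G1 in simp)+
  then have "nx x \<le> 3 * ?G ^ 4" by (simp add: nx_def tx_def)
  also have "\<dots> \<le> Rx x * ?G ^ 4" by (rule mult_le_mono1) (use Rx_props(1)[of x] in simp)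
  also have "\<dots> = Rx x ^ 33" unfolding Gx_def by (simp flip: power_mult power_Suc)
  finally show ?thesis .
qed

lemma size_bounds:
  assumes "k_cnf 3 \<Phi>" "encodes x N \<Phi>"
  shows "length x \<le> (N + 10) ^ 6" "nx x \<le> (N + (20 + s0 ^ (18 * s0))) ^ size_exp"
proof -
  let ?D = "s0 ^ (18 * s0)"
  obtain cs where cs: "vars \<Phi> = {..<N}" "lists_cnf cs \<Phi>" "x = encode_cnf cs" using assms(2) unfolding encodes_def by blast
  have "length x \<le> ((2 * N) ^ 3 + 1) * (3 * N + 4)" using encode_length(2)[OF assms(1) cs(1,2)] cs(3) by simp
  also have "\<dots> \<le> (N + 10) ^ 4 * (N + 10) ^ 2"
  proof (rule mult_le_mono)
    have "10 * (N ^ 3 + 10) \<le> (N + 10) * (N + 10) ^ 3" by (rule mult_le_mono) (use pow_add_le[of 3 N 10] in auto)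
    also have "\<dots> = (N + 10) ^ 4" by (simp flip: power_Suc)
    finally show "(2 * N) ^ 3 + 1 \<le> (N + 10) ^ 4" by (simp add: power_mult_distrib)
    have "3 * N + 4 \<le> 10 * (N + 10)" by simp
    also have "\<dots> \<le> (N + 10) * (N + 10)" by (rule mult_le_mono1) simp
    finally show "3 * N + 4 \<le> (N + 10) ^ 2" unfolding power2_eq_square .
  qed
  also have "\<dots> = (N + 10) ^ 6" by (simp flip: power_add)
  finally show len: "length x \<le> (N + 10) ^ 6" .
  have "Rx x \<le> (length x + ?D) ^ 72 + 10" using B_bound[of x] by (simp add: Rx_def)
  also have "\<dots> \<le> (length x + ?D + 10) ^ 72" by (rule pow_add_le) simp
  also have "\<dots> \<le> ((N + (20 + ?D)) ^ 6) ^ 72"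
  proof (rule power_mono)
    have "length x + ?D + 10 \<le> (N + 10) ^ 6 + (10 + ?D)" using len by linarith
    also have "\<dots> \<le> (N + 10 + (10 + ?D)) ^ 6" by (rule pow_add_le) simp
    also have "N + 10 + (10 + ?D) = N + (20 + ?D)" by linarith
    finally show "length x + ?D + 10 \<le> (N + (20 + ?D)) ^ 6" .
  qed simp
  finally have "Rx x ^ 33 \<le> (((N + (20 + ?D)) ^ 6) ^ 72) ^ 33" by (rule power_mono) simp
  also have "\<dots> = (N + (20 + ?D)) ^ (6 * 72 * 33)" by (simp only: power_mult)
  also have "6 * 72 * 33 = size_exp" by (simp add: size_exp_def)
  finally show "nx x \<le> (N + (20 + ?D)) ^ size_exp" using nx_le_R[of x] by linarith
qed

lemma sx_le_nx: "sx x \<le> nx x"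
proof -
  have "Rx x * 1 \<le> Rx x * Rx x" by (rule mult_le_mono2) (use Rx_props(1)[of x] in simp)
  then show ?thesis using sx_qx(3)[of x] Rx_props(2,3,4)[of x] unfolding nx_def by linarith
qed

text \<open>Here \<open>627 = 33 * 19\<close>: the number of variables is at most
  \<open>R ^ 33\<close>, \<open>R\<close> is at most \<open>s ^ (18 * s + 1)\<close>, and
  \<open>ln s\<close> is estimated by \<open>s\<close>.\<close>

lemma ln_nx: "ln (real (nx x)) \<le> 627 * (real (sx x))\<^sup>2"
proof -
  let ?s = "sx x"
  have s: "100 \<le> ?s" using sx_props(1)[of x] s0 by simp
  have "qx x ^ ?s \<le> (?s ^ 18) ^ ?s" by (rule power_mono[OF qx_props(3)]) simp
  then have "qx x ^ ?s \<le> ?s ^ (18 * ?s)" by (simp add: power_mult)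
  moreover have "1 \<le> ?s ^ (18 * ?s)" using s by simp
  ultimately have "Rx x \<le> 100 * ?s ^ (18 * ?s)" unfolding Rx_def by linarith
  also have "\<dots> \<le> ?s * ?s ^ (18 * ?s)" by (rule mult_le_mono1[OF s])
  finally have "Rx x \<le> ?s ^ Suc (18 * ?s)" by simp
  then have "Rx x ^ 33 \<le> (?s ^ Suc (18 * ?s)) ^ 33" by (rule power_mono) simp
  then have "nx x \<le> ?s ^ (Suc (18 * ?s) * 33)" unfolding power_mult using nx_le_R[of x] by linarith
  then have "real (nx x) \<le> real (?s ^ (Suc (18 * ?s) * 33))" by (simp only: of_nat_le_iff)
  moreover have "0 < nx x" by (simp add: nx_def)
  ultimately have "ln (real (nx x)) \<le> ln (real ?s ^ (Suc (18 * ?s) * 33))" by (subst ln_le_cancel_iff) (use s in auto)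
  also have "\<dots> = real (Suc (18 * ?s) * 33) * ln (real ?s)" by (rule ln_realpow)
  also have "\<dots> \<le> (19 * real ?s * 33) * real ?s"
  proof (rule mult_mono)
    show "ln (real ?s) \<le> real ?s" using ln_le_minus_one[of "real ?s"] s by simp
    show "0 \<le> ln (real ?s)" using s by simp
  qed (use s in auto)
  finally show ?thesis by (simp add: power2_eq_square)
qed

text \<open>Since \<open>ln n\<close> is at most \<open>627 * s ^ 2\<close>, its fourth root is at
  most \<open>627 * sqrt s\<close>; the factor \<open>c\<close> is compensated by the second
  \<open>sqrt s\<close>, which is at least \<open>627 * c\<close> by the choice of
  \<open>s0\<close>.\<close>

lemma factor_le:
  assumes "0 < c" "\<And>n. s0 \<le> n \<Longrightarrow> f n \<le> c * ln (real n) powr (1 / 4)" "(627 * c)\<^sup>2 \<le> real s0"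
  shows "f (nx x) \<le> real (sx x)"
proof -
  let ?s = "real (sx x)"
  define y where "y = sqrt ?s"
  have s: "100 \<le> sx x" using sx_props(1)[of x] s0 by simp
  have y: "y * y = ?s" "0 < y" using s by (auto simp: y_def)
  have n: "100 \<le> nx x" "s0 \<le> nx x" using sx_le_nx[of x] sx_props(1)[of x] s by auto
  have "f (nx x) \<le> c * ln (real (nx x)) powr (1 / 4)" by (rule assms(2)[OF n(2)])
  also have "\<dots> \<le> c * (627 * y)"
  proof (rule mult_left_mono)
    have "?s\<^sup>2 = y ^ 4" unfolding y(1)[symmetric] by (simp add: eval_nat_numeral)
    then have "627 * ?s\<^sup>2 \<le> (627 * y) ^ 4" by (simp add: power_mult_distrib)
    then have "ln (real (nx x)) \<le> (627 * y) ^ 4" using ln_nx[of x] by linarith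
    then have "ln (real (nx x)) powr (1 / 4) \<le> ((627 * y) ^ 4) powr (1 / 4)" using n by (intro powr_mono2) auto
    also have "(627 * y) ^ 4 = (627 * y) powr 4" using powr_realpow[of "627 * y" 4] y(2) by simp
    also have "((627 * y) powr 4) powr (1 / 4) = 627 * y" unfolding powr_powr using y(2) by simp
    finally show "ln (real (nx x)) powr (1 / 4) \<le> 627 * y" .
  qed (use assms(1) in simp)
  also have "\<dots> = (627 * c) * y" by simp
  also have "\<dots> \<le> y * y"
  proof (rule mult_right_mono)
    have "real s0 \<le> ?s" using sx_props(1)[of x] by simp
    then show "627 * c \<le> y" unfolding y_def by (intro real_le_rsqrt) (use assms(3) in linarith)
  qed (use y in simp)
  finally show ?thesis using y(1) by simp
qed

end

text \<open>The finitely many exceptions can be absorbed in the constant because \<open>g\<close> is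
  at least 1. A bound without exceptions is what passes to a maximum over an initial
  segment.\<close>

lemma bigo_explicit_bound:
  fixes T :: "nat \<Rightarrow> nat" and g :: "nat \<Rightarrow> real"
  assumes "(\<lambda>n. real (T n)) \<in> O(g)" "\<And>n. 1 \<le> g n"
  obtains A where "0 \<le> A" "\<And>n. real (T n) \<le> A * g n"
proof -
  obtain c where c: "0 < c" "eventually (\<lambda>n. norm (real (T n)) \<le> c * norm (g n)) at_top"
    using assms(1) by (rule landau_o.bigE)
  obtain m where m: "\<And>n. m \<le> n \<Longrightarrow> real (T n) \<le> c * \<bar>g n\<bar>" using c(2) unfolding eventually_at_top_linorder by auto
  let ?A = "c + (\<Sum>n<m. real (T n))"
  have sn: "0 \<le> (\<Sum>n<m. real (T n))" by (intro sum_nonneg) simp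
  have "real (T n) \<le> ?A * g n" for n
  proof (cases "n < m")
    case True
    have "real (T n) \<le> (\<Sum>n<m. real (T n))" by (rule member_le_sum) (use True in auto)
    also have "\<dots> \<le> ?A * 1" using c(1) by simp
    also have "\<dots> \<le> ?A * g n" by (rule mult_left_mono[OF assms(2)]) (use c(1) sn in linarith)
    finally show ?thesis .
  next
    case False
    then have "real (T n) \<le> c * g n" using m[of n] assms(2)[of n] by simp
    also have "\<dots> \<le> ?A * g n" by (rule mult_right_mono) (use sn assms(2)[of n] in auto)
    finally show ?thesis .
  qed
  then show ?thesis using c(1) sn by (intro that[of ?A]) auto
qed

text \<open>This determines \<delta>: the exponent \<open>1 / (2 * size_exp)\<close> turns the
  polynomial number of variables of the Horn formula into a square root of the original number, up
  to the additive constant \<open>E\<close>.\<close>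

lemma max_time_bound:
  fixes T :: "nat \<Rightarrow> nat"
  assumes A: "0 \<le> A" "\<And>n. real (T n) \<le> A * exp (real n powr (1 / (2 * real size_exp)))"
  shows "real (Max (T ` {..(N + E) ^ size_exp})) \<le> A * exp (sqrt (real N + real E))"
proof -
  have k: "0 < real size_exp" by (simp add: size_exp_def)
  have "Max (T ` {..(N + E) ^ size_exp}) \<in> T ` {..(N + E) ^ size_exp}" by (rule Max_in) auto
  then obtain n where n: "n \<le> (N + E) ^ size_exp" "Max (T ` {..(N + E) ^ size_exp}) = T n" by blast
  have "real n powr (1 / (2 * real size_exp)) \<le> sqrt (real (N + E))"
  proof (cases "N + E = 0")
    case True
    then have "n = 0" using n(1) by (simp add: size_exp_def)
    then show ?thesis using True by simp
  next
    case False
    then have p: "0 < real (N + E)" by (simp only: of_nat_0_less_iff)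
    have "real n \<le> real ((N + E) ^ size_exp)" using n(1) by (simp only: of_nat_le_iff)
    then have "real n powr (1 / (2 * real size_exp)) \<le> (real (N + E) ^ size_exp) powr (1 / (2 * real size_exp))"
      unfolding of_nat_power by (intro powr_mono2) auto
    also have "\<dots> = real (N + E) powr (real size_exp * (1 / (2 * real size_exp)))"
      unfolding powr_realpow[OF p, symmetric] powr_powr ..
    also have "real size_exp * (1 / (2 * real size_exp)) = 1 / 2" using k by simp
    also have "real (N + E) powr (1 / 2) = sqrt (real (N + E))" using p by (simp add: powr_half_sqrt)
    finally show ?thesis .
  qed
  then have "exp (real n powr (1 / (2 * real size_exp))) \<le> exp (sqrt (real N + real E))" by simp
  then have "A * exp (real n powr (1 / (2 * real size_exp))) \<le> A * exp (sqrt (real N + real E))"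
    by (rule mult_left_mono[OF _ A(1)])
  then show ?thesis unfolding n(2) using A(2)[of n] by linarith
qed

lemma not_approximable:
  assumes eth: ETH and f: "f \<in> O(\<lambda>n. ln (real n) powr (1 / 4))"
    and P: "P = pure_horn_cnf \<or> P = pure_horn_3cnf" "opt = min_clauses P \<or> opt = min_literals P"
  shows "\<not> approximable opt (horn_inputs 3 (1 / 2)) f (\<lambda>n. exp (real n powr (1 / (2 * real size_exp))))"
proof
  assume "approximable opt (horn_inputs 3 (1 / 2)) f (\<lambda>n. exp (real n powr (1 / (2 * real size_exp))))"
  then obtain M T where M: "turing_machine M"
    and T: "(\<lambda>n. real (T n)) \<in> O(\<lambda>n. exp (real n powr (1 / (2 * real size_exp))))"
    and appr: "\<And>n \<Phi> x. horn_inputs 3 (1 / 2) n \<Phi> \<Longrightarrow> encodes x n \<Phi> \<Longrightarrow>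
      \<exists>v. opt n (cnf_fun \<Phi>) \<le> v \<and> real v \<le> f n * real (opt n (cnf_fun \<Phi>)) \<and> outputs_within M x (binary v) (T n)"
    unfolding approximable_def by blast
  obtain A where A: "0 \<le> A" "\<And>n. real (T n) \<le> A * exp (real n powr (1 / (2 * real size_exp)))"
    by (rule bigo_explicit_bound[OF T]) (simp, blast)
  obtain cf where cf: "0 < cf" "eventually (\<lambda>n. norm (f n) \<le> cf * norm (ln (real n) powr (1 / 4))) at_top"
    using f by (rule landau_o.bigE)
  obtain n0 where n0: "\<And>n. n0 \<le> n \<Longrightarrow> norm (f n) \<le> cf * norm (ln (real n) powr (1 / 4))"
    using cf(2) unfolding eventually_at_top_linorder by blast
  \<comment> \<open>The counting argument requires 100, the estimate of \<open>f\<close> holds from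
    \<open>n0\<close> on, and the last term is what \<open>factor_le\<close> requires of the
    constant \<open>cf\<close>.\<close>
  define s0 where "s0 = 100 + n0 + nat \<lceil>(627 * cf)\<^sup>2\<rceil>"
  interpret enc s0 by unfold_locales (simp add: s0_def)
  have "f (nx x) \<le> real (sx x)" for x
  proof (rule factor_le[OF cf(1)])
    show "f n \<le> cf * ln (real n) powr (1 / 4)" if "s0 \<le> n" for n
    proof -
      have "n0 \<le> n" using that by (simp add: s0_def)
      from n0[OF this] show ?thesis by simp
    qed
    show "(627 * cf)\<^sup>2 \<le> real s0" unfolding s0_def by linarith
  qed
  from sat_machine[where f = f, OF M P this appr] obtain M' c where M': "turing_machine M'"
    and run: "\<And>\<Phi> N x. k_cnf 3 \<Phi> \<Longrightarrow> encodes x N \<Phi> \<Longrightarrow>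
      outputs_within M' x (binary (of_bool (satisfiable \<Phi>))) ((length x + c) ^ c + 5 * T (nx x))" by blast
  define E where "E = 20 + s0 ^ (18 * s0)"
  \<comment> \<open>The time bound may depend only on the number \<open>N\<close> of variables, but
    \<open>nx x\<close> depends on the formula and \<open>T\<close> need not be monotone; hence the
    maximum over all possible sizes.\<close>
  define T' where "T' N = ((N + 10) ^ 6 + c) ^ c + 5 * Max (T ` {..(N + E) ^ size_exp})" for N
  have run': "outputs_within M' x (binary (of_bool (satisfiable \<Phi>))) (T' N)" if \<Phi>: "k_cnf 3 \<Phi>" "encodes x N \<Phi>" for \<Phi> N x
  proof (rule outputs_within_mono[OF run[OF \<Phi>]])
    have "(length x + c) ^ c \<le> ((N + 10) ^ 6 + c) ^ c" by (rule power_mono) (use size_bounds(1)[OF \<Phi>] in auto)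
    moreover have "T (nx x) \<le> Max (T ` {..(N + E) ^ size_exp})"
      by (rule Max_ge) (use size_bounds(2)[OF \<Phi>] in \<open>auto simp: E_def\<close>)
    ultimately show "(length x + c) ^ c + 5 * T (nx x) \<le> T' N" unfolding T'_def by linarith
  qed
  have fast: "k_sat_in_time 3 (\<lambda>n. 2 powr (d * real n))" if d: "0 < d" for d
  proof -
    have le: "real (T' N) \<le> (real N + real (10 + c)) ^ (6 * c) + 5 * A * exp (sqrt (real N + real E))" for N
    proof -
      have "((N + 10) ^ 6 + c) ^ c \<le> ((N + 10 + c) ^ 6) ^ c" by (rule power_mono[OF pow_add_le]) auto
      then have "real (((N + 10) ^ 6 + c) ^ c) \<le> real ((N + 10 + c) ^ (6 * c))" unfolding power_mult by (simp only: of_nat_le_iff)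
      also have "\<dots> = (real N + real (10 + c)) ^ (6 * c)" by (simp add: add.assoc)
      finally have 1: "real (((N + 10) ^ 6 + c) ^ c) \<le> (real N + real (10 + c)) ^ (6 * c)" .
      have "real (T' N) = real (((N + 10) ^ 6 + c) ^ c) + 5 * real (Max (T ` {..(N + E) ^ size_exp}))"
        unfolding T'_def by (simp only: of_nat_add of_nat_mult of_nat_numeral)
      then show ?thesis using 1 max_time_bound[OF A, of N E] by linarith
    qed
    have "(\<lambda>N. (real N + real (10 + c)) ^ (6 * c) + 5 * A * exp (sqrt (real N + real E))) \<in> O(\<lambda>n. 2 powr (d * real n))"
    proof (rule sum_in_bigo(1))
      show "(\<lambda>N. (real N + real (10 + c)) ^ (6 * c)) \<in> O(\<lambda>n. 2 powr (d * real n))" by (rule power_growth[OF d]) simp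
      have "(\<lambda>N. exp (sqrt (real N + real E))) \<in> O(\<lambda>n. 2 powr (d * real n))" by (rule exp_sqrt_growth[OF d]) simp
      then show "(\<lambda>N. 5 * A * exp (sqrt (real N + real E))) \<in> O(\<lambda>n. 2 powr (d * real n))" by simp
    qed
    moreover have "(\<lambda>N. real (T' N)) \<in> O(\<lambda>N. (real N + real (10 + c)) ^ (6 * c) + 5 * A * exp (sqrt (real N + real E)))"
    proof (intro bigoI[where c = 1] always_eventually allI)
      fix N
      show "norm (real (T' N)) \<le> 1 * norm ((real N + real (10 + c)) ^ (6 * c) + 5 * A * exp (sqrt (real N + real E)))"
        using order_trans[OF le[of N] abs_ge_self] by simp
    qed
    ultimately have "(\<lambda>N. real (T' N)) \<in> O(\<lambda>n. 2 powr (d * real n))" by (rule landau_o.big_trans[rotated])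
    then show ?thesis unfolding k_sat_in_time_def using M' run' by blast
  qed
  have le: "sat_exponent 3 \<le> d" if d: "0 < d" for d
    unfolding sat_exponent_def
  proof (rule cInf_lower)
    show "d \<in> {\<delta>. 0 \<le> \<delta> \<and> k_sat_in_time 3 (\<lambda>n. 2 powr (\<delta> * real n))}" using d fast by simp
    show "bdd_below {\<delta>. 0 \<le> \<delta> \<and> k_sat_in_time 3 (\<lambda>n. 2 powr (\<delta> * real n))}" by (rule bdd_belowI[of _ 0]) simp
  qed
  have pos: "0 < sat_exponent 3" using eth by (simp add: ETH_def)
  have "sat_exponent 3 \<le> sat_exponent 3 / 2" by (rule le) (use pos in simp)
  with pos show False by simp
qed

theorem theorem5:
  assumes "ETH"
  shows "\<exists>\<delta> \<theta> \<epsilon> C :: real.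
    0 < \<delta> \<and> \<delta> < 1 \<and> 0 < \<theta> \<and> 0 < \<epsilon> \<and> \<epsilon> < 1 \<and> 0 < C \<and>
    (\<forall>f :: nat \<Rightarrow> real. (\<forall>n. 1 \<le> f n) \<and> f \<in> O(\<lambda>n. ln (real n) powr \<theta>) \<longrightarrow>
      (\<forall>P \<in> {pure_horn_cnf, pure_horn_3cnf}.
        \<not> approximable (min_clauses P) (horn_inputs C \<epsilon>) f (\<lambda>n. exp (real n powr \<delta>)) \<and>
        \<not> approximable (min_literals P) (horn_inputs C \<epsilon>) f (\<lambda>n. exp (real n powr \<delta>))))"
proof (rule exI[of _ "1 / (2 * real size_exp)"], rule exI[of _ "1 / 4"], rule exI[of _ "1 / 2"], rule exI[of _ 3],
    intro conjI allI impI ballI)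
  fix f :: "nat \<Rightarrow> real" and P
  assume "(\<forall>n. 1 \<le> f n) \<and> f \<in> O(\<lambda>n. ln (real n) powr (1 / 4))" and "P \<in> {pure_horn_cnf, pure_horn_3cnf}"
  then have f: "f \<in> O(\<lambda>n. ln (real n) powr (1 / 4))" and P: "P = pure_horn_cnf \<or> P = pure_horn_3cnf" by blast+
  show "\<not> approximable (min_clauses P) (horn_inputs 3 (1 / 2)) f (\<lambda>n. exp (real n powr (1 / (2 * real size_exp))))"
    by (rule not_approximable[OF assms f P]) simp
  show "\<not> approximable (min_literals P) (horn_inputs 3 (1 / 2)) f (\<lambda>n. exp (real n powr (1 / (2 * real size_exp))))"
    by (rule not_approximable[OF assms f P]) simp
qed (simp_all add: size_exp_def)

end
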